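(* Let $U:D\to\mathbb{R}^k$, $D\subset\mathbb{R}^d$, be a solution of the vectorial Bernoulli problem, and for $j\in\{1,\dots,d\}$ let $$\mathcal S_j=\Big\{x_0\in\Omega_U^{(1)}\cap\partial\Omega_U\cap D\ :\ \text{every blow-up limit } U_0 \text{ of } U \text{ at } x_0 \text{ is linear and has rank } j\Big\}.$$ If $j=d$, then $\mathcal S_d$ is a discrete subset of $D$; more precisely, each point of $\mathcal S_d$ is isolated in $\partial\Omega_U$. If $1\le j<d$, then $\mathcal S_j$ is a set of Hausdorff dimension $\dim_{\mathcal H}\mathcal S_j\le d-j$.
   Context: Setting: $D\subset\mathbb{R}^d$ is a smooth open set of finite measure, $\Lambda>0$, $k\ge1$, $\Phi\in H^{1/2}(\partial D;\mathbb{R}^k)$. A solution of the vectorial Bernoulli problem is a minimizer $U=(u_1,\dots,u_k)$ of $\int_D|\nabla U|^2\,dx+\Lambda|\Omega_U|$ among all $U\in H^1(D;\mathbb{R}^k)$ with $U=\Phi$ on $\partial D$ (in the sense of traces), where $|\nabla U|^2=\sum_i|\nabla u_i|^2$, $|U|=\sqrt{\sum_i u_i^2}$ and $\Omega_U=\{|U|>0\}$. Solutions are locally Lipschitz in $D$ and are identified with their continuous representative, so $\Omega_U$ is open. $\Omega_U^{(1)}$ is the set of points $x_0$ with $\lim_{r\to0}|\Omega_U\cap B_r(x_0)|/|B_r|=1$. A blow-up limit of $U$ at $x_0\in\partial\Omega_U\cap D$ is a function $U_0:\mathbb{R}^d\to\mathbb{R}^k$ that is the locally uniform limit of $U_{r_n,x_0}(y)=\frac1{r_n}U(x_0+r_ny)$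 for some sequence $r_n\to0^+$. It is linear if $U_0(x)=Ax$ for a real $k\times d$ matrix $A$; its rank is then the rank of $A$. *)

theory Defs
  imports "HOL-Analysis.Analysis"
begin

section \<open>Smooth functions, test functions and smooth open sets\<close>

text \<open>The predicate below is meant for open sets \<open>S\<close>.\<close>

primrec Ck_on :: "nat \<Rightarrow> (real^'d) set \<Rightarrow> (real^'d \<Rightarrow> real) \<Rightarrow> bool" where
  "Ck_on 0 S f \<longleftrightarrow> continuous_on S f"
| "Ck_on (Suc n) S f \<longleftrightarrow> (\<forall>x\<in>S. f differentiable (at x)) \<and>
     (\<forall>i. Ck_on n S (\<lambda>x. frechet_derivative f (at x) (axis i 1)))"

definition smooth_on :: "(real^'d) set \<Rightarrow> (real^'d \<Rightarrow> real) \<Rightarrow> bool" where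
  "smooth_on S f \<longleftrightarrow> (\<forall>n. Ck_on n S f)"

definition test_functions :: "(real^'d) set \<Rightarrow> (real^'d \<Rightarrow> real) set" where
  "test_functions D = {\<phi>. smooth_on UNIV \<phi> \<and>
     compact (closure {x. \<phi> x \<noteq> 0}) \<and> closure {x. \<phi> x \<noteq> 0} \<subseteq> D}"

text \<open>
  Near each boundary point \<open>D\<close> is the negativity set of a smooth function without critical
  points; \<open>D\<close> may be unbounded, and it lies on one side of its boundary.
\<close>

definition smooth_open_set :: "(real^'d) set \<Rightarrow> bool" where
  "smooth_open_set D \<longleftrightarrow> open D \<and>
     (\<forall>x0 \<in> frontier D. \<exists>V \<rho>. open V \<and> x0 \<in> V \<and> smooth_on V \<rho> \<and>
        (\<forall>x\<in>V. frechet_derivative \<rho> (at x) \<noteq> (\<lambda>h. 0)) \<and> D \<inter> V = {x \<in> V. \<rho> x < 0})"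

section \<open>Hausdorff measure and dimension\<close>

text \<open>
  The case distinction makes the \<open>0\<close>-dimensional measure the counting measure, since
  \<open>0 powr 0 = 0\<close> in the library. Covering sets are required to be bounded because the
  library's \<open>diameter\<close> is meaningless for unbounded sets. No dimensional normalising constant
  is used: it affects neither dimensions nor the function spaces and traces below.
\<close>

definition diam_pow :: "real \<Rightarrow> 'a::metric_space set \<Rightarrow> ennreal" where
  "diam_pow s E = (if E = {} then 0 else if s = 0 then 1 else ennreal (diameter E powr s))"

definition hausdorff_outer :: "real \<Rightarrow> 'a::metric_space set \<Rightarrow> ennreal" where
  "hausdorff_outer s A =
     (SUP \<delta> \<in> {0<..}. INF E \<in> {E :: nat \<Rightarrow> 'a set.
          A \<subseteq> (\<Union>i. E i) \<and> (\<forall>i. bounded (E i) \<and> diameter (E i) \<le> \<delta>)}. (\<Sum>i. diam_pow s (E i)))"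

definition hausdorff_measure :: "real \<Rightarrow> 'a::metric_space measure" where
  "hausdorff_measure s = measure_of UNIV (sets borel) (hausdorff_outer s)"

definition hausdorff_dim :: "'a::metric_space set \<Rightarrow> ereal" where
  "hausdorff_dim A = Inf {ereal s | s. 0 \<le> s \<and> hausdorff_outer s A = 0}"

definition surface_measure :: "(real^'d) set \<Rightarrow> (real^'d) measure" where
  "surface_measure D =
     completion (restrict_space (hausdorff_measure (real CARD('d) - 1)) (frontier D))"

section \<open>Sobolev spaces and traces\<close>

definition is_weak_gradient ::
    "(real^'d) set \<Rightarrow> (real^'d \<Rightarrow> real) \<Rightarrow> (real^'d \<Rightarrow> real^'d) \<Rightarrow> bool" where
  "is_weak_gradient D u G \<longleftrightarrow>
     (\<forall>K. compact K \<and> K \<subseteq> D \<longrightarrow> u absolutely_integrable_on K \<and> G absolutely_integrable_on K) \<and>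
     (\<forall>\<phi> \<in> test_functions D. \<forall>i.
        (\<integral>x. u x * frechet_derivative \<phi> (at x) (axis i 1) \<partial>lebesgue_on D) =
        - (\<integral>x. G x $ i * \<phi> x \<partial>lebesgue_on D))"

definition weak_grad :: "(real^'d) set \<Rightarrow> (real^'d \<Rightarrow> real) \<Rightarrow> real^'d \<Rightarrow> real^'d" where
  "weak_grad D u = (SOME G. is_weak_gradient D u G)"

definition L2 :: "'a measure \<Rightarrow> ('a \<Rightarrow> 'b::euclidean_space) set" where
  "L2 M = {f. f \<in> borel_measurable M \<and> integrable M (\<lambda>x. (norm (f x))\<^sup>2)}"

definition H1 :: "(real^'d) set \<Rightarrow> (real^'d \<Rightarrow> real) set" where
  "H1 D = {u. u \<in> L2 (lebesgue_on D) \<and> (\<exists>G. is_weak_gradient D u G \<and> G \<in> L2 (lebesgue_on D))}"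

definition H1_norm_sq :: "(real^'d) set \<Rightarrow> (real^'d \<Rightarrow> real) \<Rightarrow> ennreal" where
  "H1_norm_sq D u =
     (\<integral>\<^sup>+x. ennreal ((u x)\<^sup>2 + (norm (weak_grad D u x))\<^sup>2) \<partial>lebesgue_on D)"

text \<open>
  The Sobolev--Slobodeckij space of order one half on the boundary, which has dimension
  \<open>d - 1\<close>, whence the exponent \<open>(d - 1) + 2 * (1/2) = d\<close>.
\<close>

definition H_half :: "(real^'d) set \<Rightarrow> (real^'d \<Rightarrow> real) set" where
  "H_half D = {\<phi>. \<phi> \<in> L2 (surface_measure D) \<and>
     (\<integral>\<^sup>+x. (\<integral>\<^sup>+y. ennreal ((\<phi> x - \<phi> y)\<^sup>2 / dist x y ^ CARD('d))
        \<partial>surface_measure D) \<partial>surface_measure D) < \<infinity>}"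

text \<open>
  The trace operator is the continuous extension of the restriction \<open>f \<mapsto> f|\<^bsub>\<partial>D\<^esub>\<close> from
  test functions on the whole space to \<open>H\<^sup>1\<close>. As \<open>D\<close> may be unbounded, convergence on
  the boundary is taken in local \<open>L\<^sup>2\<close>.
\<close>

definition has_trace :: "(real^'d) set \<Rightarrow> (real^'d \<Rightarrow> real) \<Rightarrow> (real^'d \<Rightarrow> real) \<Rightarrow> bool" where
  "has_trace D u \<phi> \<longleftrightarrow> u \<in> H1 D \<and> \<phi> \<in> borel_measurable (surface_measure D) \<and>
     (\<exists>f. (\<forall>n::nat. f n \<in> test_functions UNIV) \<and>
        (\<lambda>n. H1_norm_sq D (\<lambda>x. f n x - u x)) \<longlonglongrightarrow> 0 \<and>
        (\<forall>K. compact K \<longrightarrow>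
           (\<lambda>n. \<integral>\<^sup>+x. ennreal ((f n x - \<phi> x)\<^sup>2) * indicator K x \<partial>surface_measure D) \<longlonglongrightarrow> 0))"

definition H1_vec :: "(real^'d) set \<Rightarrow> (real^'d \<Rightarrow> real^'k) set" where
  "H1_vec D = {U. \<forall>i. (\<lambda>x. U x $ i) \<in> H1 D}"

definition H_half_vec :: "(real^'d) set \<Rightarrow> (real^'d \<Rightarrow> real^'k) set" where
  "H_half_vec D = {\<Phi>. \<forall>i. (\<lambda>x. \<Phi> x $ i) \<in> H_half D}"

definition has_trace_vec :: "(real^'d) set \<Rightarrow> (real^'d \<Rightarrow> real^'k) \<Rightarrow> (real^'d \<Rightarrow> real^'k) \<Rightarrow> bool" where
  "has_trace_vec D U \<Phi> \<longleftrightarrow> (\<forall>i. has_trace D (\<lambda>x. U x $ i) (\<lambda>x. \<Phi> x $ i))"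

section \<open>The vectorial Bernoulli problem\<close>

definition pos_set :: "(real^'d) set \<Rightarrow> (real^'d \<Rightarrow> real^'k) \<Rightarrow> (real^'d) set" where
  "pos_set D U = {x \<in> D. norm (U x) > 0}"

definition bernoulli_energy :: "(real^'d) set \<Rightarrow> real \<Rightarrow> (real^'d \<Rightarrow> real^'k) \<Rightarrow> real" where
  "bernoulli_energy D \<Lambda> U =
     (\<integral>x. (\<Sum>i\<in>UNIV. (norm (weak_grad D (\<lambda>y. U y $ i) x))\<^sup>2) \<partial>lebesgue_on D)
     + \<Lambda> * measure lebesgue (pos_set D U)"

text \<open>
  Solutions are identified with their continuous representative, which is the reason for the
  continuity requirement; the competitors \<open>V\<close> need not be continuous.
\<close>

definition bernoulli_solution ::
    "(real^'d) set \<Rightarrow> real \<Rightarrow> (real^'d \<Rightarrow> real^'k) \<Rightarrow> (real^'d \<Rightarrow> real^'k) \<Rightarrow> bool" where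
  "bernoulli_solution D \<Lambda> \<Phi> U \<longleftrightarrow>
     U \<in> H1_vec D \<and> has_trace_vec D U \<Phi> \<and> continuous_on D U \<and>
     (\<forall>V \<in> H1_vec D. has_trace_vec D V \<Phi> \<longrightarrow> bernoulli_energy D \<Lambda> U \<le> bernoulli_energy D \<Lambda> V)"

definition density_one_points :: "(real^'d) set \<Rightarrow> (real^'d) set" where
  "density_one_points A = {x0.
     ((\<lambda>r. measure lebesgue (A \<inter> ball x0 r) / measure lebesgue (ball x0 r)) \<longlongrightarrow> 1) (at_right 0)}"

text \<open>
  For a compact set \<open>K\<close> and \<open>x0\<close> in the open domain of \<open>U\<close>, the rescalings only evaluate \<open>U\<close>
  inside its domain once \<open>n\<close> is large, so values of \<open>U\<close> outside the domain play no role.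
\<close>

definition is_blowup_limit ::
    "(real^'d \<Rightarrow> real^'k) \<Rightarrow> real^'d \<Rightarrow> (real^'d \<Rightarrow> real^'k) \<Rightarrow> bool" where
  "is_blowup_limit U x0 U0 \<longleftrightarrow>
     (\<exists>r. (\<forall>n::nat. r n > 0) \<and> r \<longlonglongrightarrow> 0 \<and>
        (\<forall>K. compact K \<longrightarrow>
           uniform_limit K (\<lambda>n y. (1 / r n) *\<^sub>R U (x0 + r n *\<^sub>R y)) U0 sequentially))"

definition linear_of_rank :: "nat \<Rightarrow> (real^'d \<Rightarrow> real^'k) \<Rightarrow> bool" where
  "linear_of_rank j U0 \<longleftrightarrow> (\<exists>A :: real^'d^'k. (\<forall>x. U0 x = A *v x) \<and> rank A = j)"

definition stratum :: "(real^'d) set \<Rightarrow> (real^'d \<Rightarrow> real^'k) \<Rightarrow> nat \<Rightarrow> (real^'d) set" where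
  "stratum D U j =
     {x0 \<in> density_one_points (pos_set D U) \<inter> frontier (pos_set D U) \<inter> D.
        \<forall>U0. is_blowup_limit U x0 U0 \<longrightarrow> linear_of_rank j U0}"

end

(* A variation U + t phi e_i is admissible and enlarges the positivity set at most by the part of the
   zero set Z inside the support of phi, so minimality gives
     (int u_i Lap phi)^2 <= Lambda |Z cap supp phi| int |grad phi|^2.
   Hence averages of u = u_i against a radial kernel vary little from scale to scale, with an error
   controlled by the density of Z, and the L^2 excess of u over affine functions decays up to that
   error. Conversely the gradient vanishes almost everywhere on Z, so Z is thin wherever u is close to
   a steep affine function. The two effects together keep the slopes of the approximating affine
   functions bounded, which makes U locally Lipschitz.

   By Lipschitz continuity every sequence of rescalings at a point of the zero set has a blow-up limit
   along a subsequence. If all of these are linear of rank j, then by compactness Z lies, at every small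
   scale r, within epsilon r of the kernel of some linear map of rank j, a subspace of dimension d - j.
   For j = d this isolates the point in the free boundary; for j < d the stratum can be covered, from
   each scale r to the scale 4 epsilon r, by about C epsilon^(j-d) balls, and iterating this shows that
   its Hausdorff measures of dimension greater than d - j vanish. *)
theory Submission
  imports Defs "HOL-Complex_Analysis.Great_Picard" "HOL-Library.Diagonal_Subsequence"
begin

section \<open>Smooth functions\<close>

text \<open>The obstacle is scaling. Passing from u to u(a + r y) / r leaves \<Lambda> unchanged, so
  the error caused by the zero set does not shrink with the scale. Excess decay alone would let the
  slope of the approximating affine function drift by a bounded amount at every scale, which gives a
  modulus of order r log(1/r) and no Lipschitz bound. Drift does harm only when the slope is already
  large, and then the measure of Z at the next scale is at most the excess plus the old measure,
  divided by the square of the slope. A weighted sum of excess and error therefore contracts, and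
  the drifts above a threshold slope form a convergent geometric series.

  Each component is treated as a scalar function with its own variational inequality; the components
  are coupled only through the common set Z.

  Blow-up limits may depend on the sequence of radii. For this reason the approximating kernel is
  allowed to change from one radius to the next, and the covering argument asks for no relation
  between the subspaces at different radii.\<close>

abbreviation pd :: "'d \<Rightarrow> (real^'d \<Rightarrow> real) \<Rightarrow> real^'d \<Rightarrow> real" where
  "pd i f x \<equiv> frechet_derivative f (at x) (axis i 1)"

definition grad :: "(real^'d \<Rightarrow> real) \<Rightarrow> real^'d \<Rightarrow> real^'d" where
  "grad f x = (\<chi> i. pd i f x)"

definition lap :: "(real^'d \<Rightarrow> real) \<Rightarrow> real^'d \<Rightarrow> real" where
  "lap f x = (\<Sum>i\<in>UNIV. pd i (pd i f) x)"

abbreviation smooth :: "(real^'d \<Rightarrow> real) \<Rightarrow> bool" where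
  "smooth f \<equiv> smooth_on UNIV f"

lemma grad_nth [simp]: "grad f x $ i = pd i f x"
  by (simp add: grad_def)

lemma smooth_differentiable: "smooth f \<Longrightarrow> f differentiable (at x)"
proof -
  assume "smooth f"
  then have "Ck_on (Suc 0) UNIV f" unfolding smooth_on_def by blast
  then show ?thesis by simp
qed

lemma smooth_pd: "smooth f \<Longrightarrow> smooth (pd i f)"
proof -
  assume "smooth f"
  then have "Ck_on (Suc n) UNIV f" for n unfolding smooth_on_def by blast
  then show ?thesis unfolding smooth_on_def by simp
qed

lemma smooth_continuous: "smooth f \<Longrightarrow> continuous_on UNIV f"
  unfolding smooth_on_def by (metis Ck_on.simps(1))

text \<open>\<open>Ck_on\<close> at order n + 1 asks for order n of every partial derivative, so the
  induction on the order has to run over a whole family at once. A family of differentiable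
  functions closed under partial derivatives then serves as a certificate of smoothness, and no
  order has to be tracked afterwards.\<close>

lemma smooth_coinduct:
  assumes F: "\<And>f. f \<in> F \<Longrightarrow> (\<forall>x. f differentiable (at x)) \<and> (\<forall>i. pd i f \<in> F)"
    and f: "f \<in> F"
  shows "smooth f"
proof -
  have "f \<in> F \<Longrightarrow> Ck_on n UNIV f" for n f
  proof (induction n arbitrary: f)
    case 0
    then show ?case using F
      by (auto intro!: continuous_at_imp_continuous_on differentiable_imp_continuous_within)
  next
    case (Suc n)
    then show ?case using F by simp
  qed
  with f show ?thesis unfolding smooth_on_def by blast
qed

section \<open>Rules for partial derivatives\<close>

lemma pd_eqI: "(f has_derivative f') (at x) \<Longrightarrow> pd i f x = f' (axis i 1)"
  by (metis frechet_derivative_at)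

lemma linear_axis_expand:
  fixes F :: "real^'d \<Rightarrow> real"
  assumes "linear F"
  shows "F h = (\<Sum>i\<in>UNIV. F (axis i 1) * h $ i)"
proof -
  have "F h = F (\<Sum>i\<in>UNIV. h $ i *\<^sub>R axis i 1)"
    by (simp add: basis_expansion flip: scalar_mult_eq_scaleR)
  also have "\<dots> = (\<Sum>i\<in>UNIV. h $ i * F (axis i 1))"
    using assms by (simp add: linear_sum linear_cmul)
  finally show ?thesis by (simp add: mult.commute)
qed

lemma has_derivative_grad:
  fixes f :: "real^'d \<Rightarrow> real"
  assumes "f differentiable (at x)"
  shows "(f has_derivative (\<lambda>h. grad f x \<bullet> h)) (at x)"
proof -
  have d: "(f has_derivative frechet_derivative f (at x)) (at x)"
    using assms frechet_derivative_works by blast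
  have "frechet_derivative f (at x) h = grad f x \<bullet> h" for h
    using linear_axis_expand[OF linear_frechet_derivative[OF assms], of h]
    by (simp add: inner_vec_def)
  then have "frechet_derivative f (at x) = (\<lambda>h. grad f x \<bullet> h)" by auto
  with d show ?thesis by simp
qed

lemma has_derivative_grad_smooth:
  "smooth f \<Longrightarrow> (f has_derivative (\<lambda>h. grad f x \<bullet> h)) (at x)"
  by (rule has_derivative_grad) (rule smooth_differentiable)

lemma pd_const [simp]: "pd i (\<lambda>x. c) = (\<lambda>x. 0)"
  by (rule ext, rule pd_eqI[where f' = "\<lambda>h. 0", simplified]) simp

lemma pd_add: "f differentiable (at x) \<Longrightarrow> g differentiable (at x) \<Longrightarrow>
    pd i (\<lambda>x. f x + g x) x = pd i f x + pd i g x"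
  by (subst pd_eqI[OF has_derivative_add[OF has_derivative_grad has_derivative_grad]])
     (simp_all add: inner_axis)

lemma pd_mult: "f differentiable (at x) \<Longrightarrow> g differentiable (at x) \<Longrightarrow>
    pd i (\<lambda>x. f x * g x) x = pd i f x * g x + f x * pd i g x"
  by (subst pd_eqI[OF has_derivative_mult[OF has_derivative_grad has_derivative_grad]])
     (simp_all add: inner_axis)

lemma pd_cmult: "f differentiable (at x) \<Longrightarrow> pd i (\<lambda>x. c * f x) x = c * pd i f x"
  by (subst pd_mult) simp_all

lemma pd_comp:
  assumes "f differentiable (at x)" "(h has_real_derivative D) (at (f x))"
  shows "pd i (\<lambda>x. h (f x)) x = D * pd i f x"
proof -
  have "((\<lambda>x. h (f x)) has_derivative (\<lambda>v. D * (grad f x \<bullet> v))) (at x)"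
    using has_derivative_compose[OF has_derivative_grad[OF assms(1)]
        assms(2)[unfolded has_field_derivative_def]] by simp
  from pd_eqI[OF this] show ?thesis by (simp add: inner_axis)
qed

lemma pd_affine:
  assumes f: "f differentiable (at (s *\<^sub>R x + a))"
  shows "pd i (\<lambda>x. f (s *\<^sub>R x + a)) x = s * pd i f (s *\<^sub>R x + a)"
    and "(\<lambda>x. f (s *\<^sub>R x + a)) differentiable (at x)"
proof -
  have 1: "((\<lambda>x. s *\<^sub>R x + a) has_derivative (\<lambda>h. s *\<^sub>R h)) (at x)"
    by (auto intro!: derivative_eq_intros)
  have 2: "((\<lambda>x. f (s *\<^sub>R x + a)) has_derivative (\<lambda>h. grad f (s *\<^sub>R x + a) \<bullet> (s *\<^sub>R h))) (at x)"
    using has_derivative_compose[OF 1 has_derivative_grad[OF f]] by simp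
  from pd_eqI[OF 2]
  show "pd i (\<lambda>x. f (s *\<^sub>R x + a)) x = s * pd i f (s *\<^sub>R x + a)" by (simp add: inner_axis)
  show "(\<lambda>x. f (s *\<^sub>R x + a)) differentiable (at x)" using 2 unfolding differentiable_def by blast
qed

text \<open>The functions \<open>p(1/t) exp(-1/t)\<close> are closed under differentiation across \<open>t = 0\<close>.\<close>

definition flat :: "real poly \<Rightarrow> real \<Rightarrow> real" where
  "flat p t = (if t > 0 then poly p (1/t) * exp (-(1/t)) else 0)"

lemma poly_exp_tendsto_0: "((\<lambda>y. poly p y * exp (-y)) \<longlongrightarrow> (0::real)) at_top"
proof -
  have "((\<lambda>y. \<Sum>i\<le>degree p. coeff p i * (y ^ i / exp y)) \<longlongrightarrow> (\<Sum>i\<le>degree p. coeff p i * 0)) at_top"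
    by (intro tendsto_sum tendsto_mult tendsto_const tendsto_power_div_exp_0)
  then show ?thesis
    by (simp add: poly_altdef exp_minus sum_distrib_right divide_inverse mult.assoc)
qed

text \<open>With y = 1/t, differentiating p(y) exp(-y) in t gives y^2 (p - p')(y) exp(-y); the
  polynomial \<open>[:0,0,1:]\<close> is the factor y^2. At t = 0 the difference quotient from the
  right is again of the form q(y) exp(-y), with q(y) = y p(y), and exponential decay beats the
  polynomial.\<close>

lemma flat_has_derivative:
  "(flat p has_real_derivative flat ([:0,0,1:] * (p - pderiv p)) t) (at t)"
proof (cases t "0::real" rule: linorder_cases)
  case less
  have "((\<lambda>t. 0) has_real_derivative 0) (at t)" by simp
  moreover have "\<forall>\<^sub>F s in nhds t. 0 = flat p s"
    using less eventually_nhds_in_open[of "{..<0}" t] by (auto simp: flat_def elim!: eventually_mono)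
  ultimately show ?thesis using less DERIV_cong_ev[OF refl, of "\<lambda>t. 0" "flat p" t 0 0]
    by (simp add: flat_def)
next
  case greater
  have "((\<lambda>t. poly p (1/t) * exp (-(1/t))) has_real_derivative
     poly ([:0,0,1:] * (p - pderiv p)) (1/t) * exp (-(1/t))) (at t)"
    using greater
    by (auto intro!: derivative_eq_intros simp: field_simps power2_eq_square)
  moreover have "\<forall>\<^sub>F s in nhds t. poly p (1/s) * exp (-(1/s)) = flat p s"
    using greater eventually_nhds_in_open[of "{0<..}" t] by (auto simp: flat_def elim!: eventually_mono)
  ultimately show ?thesis using greater
     DERIV_cong_ev[OF refl, of "\<lambda>t. poly p (1/t) * exp (-(1/t))" "flat p" t]
    by (simp add: flat_def)
next
  case equal
  have "((\<lambda>s. (flat p s - flat p 0) / (s - 0)) \<longlongrightarrow> 0) (at 0)"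
  proof (rule filterlim_split_at)
    show "((\<lambda>s. (flat p s - flat p 0) / (s - 0)) \<longlongrightarrow> 0) (at_left 0)"
      by (rule tendsto_eventually)
         (auto simp: flat_def eventually_at_filter intro!: always_eventually)
    have "((\<lambda>s. poly ([:0,1:] * p) (inverse s) * exp (- inverse s)) \<longlongrightarrow> 0) (at_right (0::real))"
      using filterlim_compose[OF poly_exp_tendsto_0 filterlim_inverse_at_top_right] by blast
    then show "((\<lambda>s. (flat p s - flat p 0) / (s - 0)) \<longlongrightarrow> 0) (at_right 0)"
      by (rule Lim_transform_eventually)
         (auto simp: flat_def eventually_at_filter field_simps intro!: always_eventually)
  qed
  then show ?thesis using equal
    by (simp add: has_field_derivative_iff flat_def)
qed

text \<open>Every construction needed later is a constructor, and the smooth functions themselves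
  enter through \<open>base\<close>. One rule induction shows the set closed under partial
  derivatives, so it consists of smooth functions, and each introduction rule turns into a closure
  property of smoothness.\<close>

inductive_set smooth_gen :: "(real^'d \<Rightarrow> real) set" where
  base: "smooth f \<Longrightarrow> f \<in> smooth_gen"
| const: "(\<lambda>x. c) \<in> smooth_gen"
| coord: "(\<lambda>x. x $ i) \<in> smooth_gen"
| add: "f \<in> smooth_gen \<Longrightarrow> g \<in> smooth_gen \<Longrightarrow> (\<lambda>x. f x + g x) \<in> smooth_gen"
| mult: "f \<in> smooth_gen \<Longrightarrow> g \<in> smooth_gen \<Longrightarrow> (\<lambda>x. f x * g x) \<in> smooth_gen"
| flat: "f \<in> smooth_gen \<Longrightarrow> (\<lambda>x. flat p (f x)) \<in> smooth_gen"
| affine: "f \<in> smooth_gen \<Longrightarrow> (\<lambda>x. f (s *\<^sub>R x + a)) \<in> smooth_gen"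

lemma smooth_gen_closed:
  fixes f :: "real^'d \<Rightarrow> real"
  shows "f \<in> smooth_gen \<Longrightarrow> (\<forall>x. f differentiable (at x)) \<and> (\<forall>i. pd i f \<in> smooth_gen)"
proof (induction rule: smooth_gen.induct)
  case (base f)
  then show ?case by (auto intro: smooth_gen.base smooth_pd smooth_differentiable)
next
  case (const c)
  then show ?case by (auto intro: smooth_gen.const)
next
  case (coord i)
  have d: "((\<lambda>x. x $ i) has_derivative (\<lambda>x. x $ i)) (at x)" for x :: "real^'d"
    by (rule bounded_linear_imp_has_derivative) (rule bounded_linear_vec_nth)
  have "pd k (\<lambda>x. x $ i) = (\<lambda>x. (axis k 1 :: real^'d) $ i)" for k
    by (rule ext) (rule pd_eqI[OF d])
  then show ?case using d by (auto simp: differentiable_def intro: smooth_gen.const)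
next
  case (add f g)
  have "pd i (\<lambda>x. f x + g x) = (\<lambda>x. pd i f x + pd i g x)" for i
    using add by (auto simp: pd_add)
  moreover have "(\<lambda>x. pd i f x + pd i g x) \<in> smooth_gen" for i
    using add by (intro smooth_gen.add) auto
  ultimately show ?case using add by simp
next
  case (mult f g)
  have "pd i (\<lambda>x. f x * g x) = (\<lambda>x. pd i f x * g x + f x * pd i g x)" for i
    using mult by (auto simp: pd_mult)
  moreover have "(\<lambda>x. pd i f x * g x + f x * pd i g x) \<in> smooth_gen" for i
    using mult by (intro smooth_gen.add smooth_gen.mult) auto
  ultimately show ?case using mult by simp
next
  case (flat f p)
  have "pd i (\<lambda>x. flat p (f x)) = (\<lambda>x. flat ([:0,0,1:] * (p - pderiv p)) (f x) * pd i f x)" for i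
    using flat by (intro ext pd_comp flat_has_derivative) auto
  moreover have "(\<lambda>x. flat p (f x)) differentiable (at x)" for x
    using flat has_derivative_compose[OF has_derivative_grad
        flat_has_derivative[unfolded has_field_derivative_def]]
    unfolding differentiable_def by blast
  moreover have "(\<lambda>x. flat ([:0,0,1:] * (p - pderiv p)) (f x) * pd i f x) \<in> smooth_gen" for i
    using flat by (intro smooth_gen.mult smooth_gen.flat) auto
  ultimately show ?case by simp
next
  case (affine f s a)
  then have "pd i (\<lambda>x. f (s *\<^sub>R x + a)) = (\<lambda>x. s * pd i f (s *\<^sub>R x + a))" for i
    by (auto simp: pd_affine)
  moreover have "(\<lambda>x. s * pd i f (s *\<^sub>R x + a)) \<in> smooth_gen" for i
    using affine by (intro smooth_gen.mult smooth_gen.const smooth_gen.affine) auto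
  moreover have "(\<lambda>x. f (s *\<^sub>R x + a)) differentiable (at x)" for x
    using affine by (intro pd_affine(2)) auto
  ultimately show ?case by simp
qed

lemma smooth_gen_iff: "f \<in> smooth_gen \<longleftrightarrow> smooth f"
  using smooth_coinduct[OF smooth_gen_closed] smooth_gen.base by blast

lemmas smooth_const [simp] = smooth_gen.const[unfolded smooth_gen_iff]
lemmas smooth_coord [simp] = smooth_gen.coord[unfolded smooth_gen_iff]
lemmas smooth_add = smooth_gen.add[unfolded smooth_gen_iff]
lemmas smooth_mult = smooth_gen.mult[unfolded smooth_gen_iff]
lemmas smooth_flat = smooth_gen.flat[unfolded smooth_gen_iff]
lemmas smooth_affine = smooth_gen.affine[unfolded smooth_gen_iff]

lemma smooth_cmult: "smooth f \<Longrightarrow> smooth (\<lambda>x. c * f x)"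
  by (intro smooth_mult) auto

lemma smooth_minus: "smooth f \<Longrightarrow> smooth (\<lambda>x. - f x)"
  using smooth_cmult[of f "-1"] by simp

lemma smooth_diff: "smooth f \<Longrightarrow> smooth g \<Longrightarrow> smooth (\<lambda>x. f x - g x)"
  using smooth_add[OF _ smooth_minus, of f g] by simp

lemma smooth_sum: "(\<And>i. i \<in> I \<Longrightarrow> smooth (f i)) \<Longrightarrow> smooth (\<lambda>x. \<Sum>i\<in>I. f i x)"
  by (induction I rule: infinite_finite_induct) (auto intro!: smooth_add)

lemma smooth_power2: "smooth f \<Longrightarrow> smooth (\<lambda>x. (f x)\<^sup>2)"
  unfolding power2_eq_square by (intro smooth_mult)

lemma smooth_inner: "smooth (\<lambda>x. q \<bullet> x)"
  unfolding inner_vec_def by (intro smooth_sum) (auto intro: smooth_cmult)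

lemma smooth_norm_sq: "smooth (\<lambda>x::real^'d. (norm x)\<^sup>2)"
  unfolding power2_norm_eq_inner inner_vec_def by (intro smooth_sum) (auto intro!: smooth_mult)

lemma smooth_lap: "smooth f \<Longrightarrow> smooth (lap f)"
  unfolding lap_def[abs_def] by (intro smooth_sum smooth_pd)

lemma continuous_grad: "smooth f \<Longrightarrow> continuous_on UNIV (grad f)"
  unfolding grad_def[abs_def] by (intro continuous_on_vec_lambda smooth_continuous smooth_pd)

section \<open>Derivatives off the support\<close>

lemma pd_outside:
  assumes "closed S" "\<And>y. y \<notin> S \<Longrightarrow> f y = 0" "x \<notin> S"
  shows "pd i f x = 0"
proof -
  have "((\<lambda>x. 0) has_derivative (\<lambda>h. 0)) (at x)" by simp
  then have "(f has_derivative (\<lambda>h. 0)) (at x)"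
    by (rule has_derivative_transform_within_open[of _ _ _ _ "- S"]) (use assms in auto)
  from pd_eqI[OF this] show ?thesis .
qed

lemma grad_outside:
  assumes "closed S" "\<And>y. y \<notin> S \<Longrightarrow> f y = 0" "x \<notin> S"
  shows "grad f x = 0"
  using pd_outside[OF assms] by (simp add: vec_eq_iff)

lemma lap_outside:
  assumes "closed S" "\<And>y. y \<notin> S \<Longrightarrow> f y = 0" "x \<notin> S"
  shows "lap f x = 0"
proof -
  have "pd i f y = 0" if "y \<notin> S" for i y by (rule pd_outside[OF assms(1,2) that])
  then have "pd i (pd i f) x = 0" for i by (rule pd_outside[OF assms(1) _ assms(3)])
  then show ?thesis by (simp add: lap_def)
qed

section \<open>Integrals of compactly supported functions\<close>

lemma integrable_compact_support:
  fixes f :: "'a::euclidean_space \<Rightarrow> 'b::euclidean_space"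
  assumes f: "continuous_on S f" and S: "compact S" and 0: "\<And>x. x \<notin> S \<Longrightarrow> f x = 0"
  shows "integrable lborel f"
proof -
  have "(\<lambda>x. indicator S x *\<^sub>R f x) = f" using 0 by (auto simp: indicator_def fun_eq_iff)
  with borel_integrable_compact[OF S f] show ?thesis by simp
qed

lemma lborel_integral_affine:
  fixes f :: "'a::euclidean_space \<Rightarrow> real"
  assumes c: "c \<noteq> 0" and f: "f \<in> borel_measurable borel"
  shows "integral\<^sup>L lborel f = \<bar>c\<bar> ^ DIM('a) * (LINT x|lborel. f (t + c *\<^sub>R x))"
proof -
  have "integral\<^sup>L lborel f =
     integral\<^sup>L (density (distr lborel borel (\<lambda>x. t + c *\<^sub>R x)) (\<lambda>_. ennreal (\<bar>c\<bar> ^ DIM('a)))) f"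
    using lborel_affine[OF c, of t] by simp
  also have "\<dots> = (LINT x|distr lborel borel (\<lambda>x. t + c *\<^sub>R x). \<bar>c\<bar> ^ DIM('a) * f x)"
    using f by (subst integral_density) auto
  also have "\<dots> = (LINT x|lborel. \<bar>c\<bar> ^ DIM('a) * f (t + c *\<^sub>R x))"
    using f by (subst integral_distr) auto
  finally show ?thesis by simp
qed

lemma bounded_compact_support:
  fixes f :: "'a::euclidean_space \<Rightarrow> 'b::euclidean_space"
  assumes "continuous_on UNIV f" "compact S" "\<And>x. x \<notin> S \<Longrightarrow> f x = 0"
  obtains B where "B \<ge> 0" "\<And>x. norm (f x) \<le> B"
proof -
  have "compact (f ` S)"
    using assms by (meson compact_continuous_image continuous_on_subset subset_UNIV)
  then obtain B where "\<And>x. x \<in> S \<Longrightarrow> norm (f x) \<le> B" "B > 0"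
    by (metis compact_imp_bounded bounded_pos imageI)
  then show ?thesis using that[of B] assms(3)
    by (metis less_eq_real_def norm_zero)
qed

lemma has_real_derivative_line:
  fixes g :: "real^'d \<Rightarrow> real"
  assumes "g differentiable (at (x + t *\<^sub>R v))"
  shows "((\<lambda>t. g (x + t *\<^sub>R v)) has_real_derivative (grad g (x + t *\<^sub>R v) \<bullet> v)) (at t)"
proof -
  have 1: "((\<lambda>t. x + t *\<^sub>R v) has_derivative (\<lambda>h. h *\<^sub>R v)) (at t)"
    by (auto intro!: derivative_eq_intros)
  have "((\<lambda>t. g (x + t *\<^sub>R v)) has_derivative (\<lambda>h. grad g (x + t *\<^sub>R v) \<bullet> (h *\<^sub>R v))) (at t)"
    using has_derivative_compose[OF 1 has_derivative_grad[OF assms]] by simp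
  moreover have "(\<lambda>h. grad g (x + t *\<^sub>R v) \<bullet> (h *\<^sub>R v)) = (*) (grad g (x + t *\<^sub>R v) \<bullet> v)"
    by (auto simp: mult.commute)
  ultimately show ?thesis unfolding has_field_derivative_def by simp
qed

lemma mvt_grad:
  fixes g :: "real^'d \<Rightarrow> real"
  assumes "\<And>x. g differentiable (at x)"
  obtains \<theta> where "0 < \<theta>" "\<theta> < 1" "g (x + v) - g x = grad g (x + \<theta> *\<^sub>R v) \<bullet> v"
proof -
  have "\<exists>z>0. z < 1 \<and> g (x + 1 *\<^sub>R v) - g (x + 0 *\<^sub>R v) = (1 - 0) * (grad g (x + z *\<^sub>R v) \<bullet> v)"
    by (rule MVT2) (auto intro: has_real_derivative_line assms)
  then show ?thesis using that by auto
qed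

text \<open>Translation invariance makes the integral of every difference quotient zero. The mean
  value theorem bounds the quotients by the maximum of the derivative, and for step sizes at most
  one they all vanish outside one ball, so dominated convergence passes to the derivative.\<close>

lemma integral_pd_eq_0:
  fixes g :: "real^'d \<Rightarrow> real"
  assumes d: "\<And>x. g differentiable (at x)" and c: "continuous_on UNIV (pd i g)"
    and S: "compact S" and 0: "\<And>x. x \<notin> S \<Longrightarrow> g x = 0"
  shows "(LINT x|lborel. pd i g x) = 0"
proof -
  define e where "e = (axis i 1 :: real^'d)"
  have gc: "continuous_on UNIV g"
    using d by (auto intro!: continuous_at_imp_continuous_on differentiable_imp_continuous_within)
  have gb: "g \<in> borel_measurable borel" using gc by (rule borel_measurable_continuous_onI)
  have gi: "integrable lborel g"
    using integrable_compact_support[OF continuous_on_subset[OF gc] S 0] by auto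
  have p0: "pd i g x = 0" if "x \<notin> S" for x
    by (rule pd_outside[OF compact_imp_closed[OF S] 0 that])
  obtain B where B: "B \<ge> 0" "\<And>x. norm (pd i g x) \<le> B"
    using bounded_compact_support[OF c S p0] by blast
  obtain R where "\<forall>x\<in>S. norm x \<le> R" using compact_imp_bounded[OF S] bounded_iff by blast
  then have R: "S \<subseteq> cball 0 R" by auto
  have gt: "integrable lborel (\<lambda>x. g (x + a))" "(LINT x|lborel. g (x + a)) = integral\<^sup>L lborel g" for a
  proof -
    have "compact ((+) (-a) ` S)" by (rule compact_translation[OF S])
    moreover have "g (x + a) = 0" if "x \<notin> (+) (-a) ` S" for x
      using that image_eqI[of x "(+) (-a)" "x + a" S] by (intro 0) auto
    ultimately show "integrable lborel (\<lambda>x. g (x + a))"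
      by (intro integrable_compact_support[where S = "(+) (-a) ` S"])
         (auto intro!: continuous_on_compose2[OF gc] continuous_intros)
    show "(LINT x|lborel. g (x + a)) = integral\<^sup>L lborel g"
      using lborel_integral_affine[OF _ gb, of 1 a] by (simp add: add.commute)
  qed
  define h where "h n = inverse (real (Suc n))" for n
  have h: "h n > 0" "h n \<le> 1" for n by (auto simp: h_def inverse_le_1_iff)
  define s where "s n x = (g (x + h n *\<^sub>R e) - g x) / h n" for n x
  have s0: "integral\<^sup>L lborel (s n) = 0" for n
    unfolding s_def using gt(1)[of "h n *\<^sub>R e"] gi gt(2)[of "h n *\<^sub>R e"] by simp
  have lim: "(\<lambda>n. s n x) \<longlonglongrightarrow> pd i g x" for x
  proof -
    have "((\<lambda>t. g (x + t *\<^sub>R e)) has_real_derivative (grad g (x + 0 *\<^sub>R e) \<bullet> e)) (at 0)"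
      by (rule has_real_derivative_line[OF d])
    then have "((\<lambda>t. (g (x + t *\<^sub>R e) - g x) / t) \<longlongrightarrow> pd i g x) (at 0)"
      by (simp add: has_field_derivative_iff e_def inner_axis)
    moreover have "filterlim h (at 0) sequentially"
      unfolding filterlim_at using h LIMSEQ_inverse_real_of_nat
      by (auto simp: h_def[abs_def])
    ultimately show ?thesis unfolding s_def by (rule filterlim_compose)
  qed
  have bd: "norm (s n x) \<le> B * indicator (cball 0 (R + 1)) x" for n x
  proof (cases "x \<in> cball 0 (R + 1)")
    case True
    obtain \<theta> where "g (x + h n *\<^sub>R e) - g x = grad g (x + \<theta> *\<^sub>R (h n *\<^sub>R e)) \<bullet> (h n *\<^sub>R e)"
      using mvt_grad[OF d] by blast
    then have "s n x = pd i g (x + \<theta> *\<^sub>R (h n *\<^sub>R e))"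
      using h[of n] by (simp add: s_def e_def inner_axis)
    then show ?thesis using B True by simp
  next
    case False
    have "norm (h n *\<^sub>R e) \<le> 1" using h[of n] by (simp add: e_def)
    then have "norm x \<le> norm (x + h n *\<^sub>R e) + 1"
      by (smt (verit, best) add_diff_cancel_right' norm_triangle_ineq4)
    then have "x \<notin> S" "x + h n *\<^sub>R e \<notin> S" using False R by (auto simp: subset_iff)
    then show ?thesis using False by (simp add: s_def 0)
  qed
  have "(\<lambda>n. integral\<^sup>L lborel (s n)) \<longlonglongrightarrow> (LINT x|lborel. pd i g x)"
  proof (rule integral_dominated_convergence[where w = "\<lambda>x. B * indicator (cball 0 (R + 1)) x"])
    show "pd i g \<in> borel_measurable lborel" using c by (simp add: borel_measurable_continuous_onI)
    show "s n \<in> borel_measurable lborel" for n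
      unfolding s_def using gb gt(1)[of "h n *\<^sub>R e"] by auto
    show "integrable lborel (\<lambda>x. B * indicator (cball 0 (R + 1)) x)"
      using emeasure_lborel_cball_finite by (intro integrable_mult_right integrable_real_indicator) auto
  qed (use lim bd in auto)
  then show ?thesis using s0 LIMSEQ_unique[of "\<lambda>n. 0"] by auto
qed

text \<open>The product rule combined with \<open>integral_pd_eq_0\<close>. Compact support is asked
  of \<open>g\<close> alone, and differentiable factors with a continuous partial derivative
  suffice; this admits truncations such as \<open>t * arctan (f / t)\<close> without any discussion
  of their higher derivatives.\<close>

lemma integral_by_parts:
  fixes f g :: "real^'d \<Rightarrow> real"
  assumes f: "\<And>x. f differentiable (at x)" "continuous_on UNIV (pd i f)"
    and g: "\<And>x. g differentiable (at x)" "continuous_on UNIV (pd i g)"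
    and S: "compact S" and 0: "\<And>x. x \<notin> S \<Longrightarrow> g x = 0"
  shows "(LINT x|lborel. f x * pd i g x) = - (LINT x|lborel. pd i f x * g x)"
proof -
  have fc: "continuous_on UNIV f" and gc: "continuous_on UNIV g"
    using f g by (auto intro!: continuous_at_imp_continuous_on differentiable_imp_continuous_within)
  have p: "pd i (\<lambda>x. f x * g x) = (\<lambda>x. pd i f x * g x + f x * pd i g x)"
    by (rule ext, rule pd_mult[OF f(1) g(1)])
  have p0: "pd i g x = 0" if "x \<notin> S" for x
    by (rule pd_outside[OF compact_imp_closed[OF S] 0 that])
  have i: "integrable lborel (\<lambda>x. f x * pd i g x)" "integrable lborel (\<lambda>x. pd i f x * g x)"
    by (rule integrable_compact_support[OF continuous_on_subset[OF _ subset_UNIV] S];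
        use fc gc f g 0 p0 in \<open>auto intro!: continuous_intros\<close>)+
  have "(LINT x|lborel. pd i (\<lambda>x. f x * g x) x) = 0"
  proof (rule integral_pd_eq_0[OF _ _ S])
    show "(\<lambda>x. f x * g x) differentiable at x" for x using f g by simp
    show "continuous_on UNIV (pd i (\<lambda>x. f x * g x))"
      unfolding p using fc gc f g by (intro continuous_intros)
  qed (use 0 in auto)
  then show ?thesis unfolding p using i by simp
qed

lemma Fubini_compact_support:
  fixes F :: "'a::euclidean_space \<Rightarrow> 'b::euclidean_space \<Rightarrow> real"
  assumes c: "continuous_on UNIV (\<lambda>(x,y). F x y)" and S: "compact S" and T: "compact T"
    and 0: "\<And>x y. x \<notin> S \<or> y \<notin> T \<Longrightarrow> F x y = 0"
  shows "(LINT x|lborel. LINT y|lborel. F x y) = (LINT y|lborel. LINT x|lborel. F x y)"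
proof -
  have "integrable lborel (\<lambda>(x,y). F x y)"
    by (rule integrable_compact_support[OF continuous_on_subset[OF c subset_UNIV] compact_Times[OF S T]])
       (use 0 in auto)
  then have "integrable (lborel \<Otimes>\<^sub>M lborel) (\<lambda>(x,y). F x y)" unfolding lborel_prod .
  from lborel_pair.Fubini_integral[OF this] show ?thesis by simp
qed

lemma smooth_lipschitz:
  fixes \<rho> :: "real^'d \<Rightarrow> real"
  assumes \<rho>: "smooth \<rho>" and S: "compact S" and 0: "\<And>x. x \<notin> S \<Longrightarrow> \<rho> x = 0"
  obtains L where "L \<ge> 0" "\<And>x y. \<bar>\<rho> x - \<rho> y\<bar> \<le> L * norm (x - y)"
proof -
  obtain B where B: "B \<ge> 0" "\<And>x. norm (grad \<rho> x) \<le> B"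
    using bounded_compact_support[OF continuous_grad[OF \<rho>] S grad_outside[OF compact_imp_closed[OF S] 0]]
    by metis
  have "\<bar>\<rho> x - \<rho> y\<bar> \<le> B * norm (x - y)" for x y
  proof -
    obtain \<theta> where "\<rho> (y + (x - y)) - \<rho> y = grad \<rho> (y + \<theta> *\<^sub>R (x - y)) \<bullet> (x - y)"
      using mvt_grad[OF smooth_differentiable[OF \<rho>]] by blast
    then have "\<bar>\<rho> x - \<rho> y\<bar> \<le> norm (grad \<rho> (y + \<theta> *\<^sub>R (x - y))) * norm (x - y)"
      by (metis Cauchy_Schwarz_ineq2 add.commute diff_add_cancel)
    also have "\<dots> \<le> B * norm (x - y)" using B by (intro mult_right_mono) auto
    finally show ?thesis .
  qed
  with B that show ?thesis by blast
qed

text \<open>Compact support makes the gradient globally Lipschitz, and the mean value theorem turns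
  this into a remainder bound with one constant for all base points. Uniformity in \<open>x\<close>
  is what survives integration against another function in a convolution.\<close>

lemma smooth_taylor2:
  fixes \<rho> :: "real^'d \<Rightarrow> real"
  assumes \<rho>: "smooth \<rho>" and S: "compact S" and 0: "\<And>x. x \<notin> S \<Longrightarrow> \<rho> x = 0"
  obtains C where "C \<ge> 0" "\<And>x v. \<bar>\<rho> (x + v) - \<rho> x - grad \<rho> x \<bullet> v\<bar> \<le> C * (norm v)\<^sup>2"
proof -
  have "\<exists>L\<ge>0. \<forall>x y. \<bar>pd i \<rho> x - pd i \<rho> y\<bar> \<le> L * norm (x - y)" for i
    using smooth_lipschitz[OF smooth_pd[OF \<rho>] S pd_outside[OF compact_imp_closed[OF S] 0]] by metis
  then obtain L where L: "\<And>i. L i \<ge> 0" "\<And>i x y. \<bar>pd i \<rho> x - pd i \<rho> y\<bar> \<le> L i * norm (x - y)"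
    by metis
  define C where "C = (\<Sum>i\<in>UNIV. L i)"
  have C0: "C \<ge> 0" unfolding C_def using L by (intro sum_nonneg) auto
  have C: "norm (grad \<rho> x - grad \<rho> y) \<le> C * norm (x - y)" for x y
  proof -
    have "norm (grad \<rho> x - grad \<rho> y) \<le> (\<Sum>i\<in>UNIV. \<bar>(grad \<rho> x - grad \<rho> y) $ i\<bar>)"
      by (rule norm_le_l1_cart)
    also have "\<dots> \<le> (\<Sum>i\<in>UNIV. L i * norm (x - y))" using L by (intro sum_mono) simp
    finally show ?thesis by (simp add: C_def sum_distrib_right)
  qed
  have "\<bar>\<rho> (x + v) - \<rho> x - grad \<rho> x \<bullet> v\<bar> \<le> C * (norm v)\<^sup>2" for x v
  proof -
    obtain \<theta> where \<theta>: "0 < \<theta>" "\<theta> < 1" "\<rho> (x + v) - \<rho> x = grad \<rho> (x + \<theta> *\<^sub>R v) \<bullet> v"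
      using mvt_grad[OF smooth_differentiable[OF \<rho>]] by blast
    have "\<bar>\<rho> (x + v) - \<rho> x - grad \<rho> x \<bullet> v\<bar> = \<bar>(grad \<rho> (x + \<theta> *\<^sub>R v) - grad \<rho> x) \<bullet> v\<bar>"
      by (simp add: \<theta> inner_diff_left)
    also have "\<dots> \<le> norm (grad \<rho> (x + \<theta> *\<^sub>R v) - grad \<rho> x) * norm v" by (rule Cauchy_Schwarz_ineq2)
    also have "\<dots> \<le> (C * norm (\<theta> *\<^sub>R v)) * norm v"
      using C[of "x + \<theta> *\<^sub>R v" x] by (intro mult_right_mono) auto
    also have "\<dots> \<le> (C * norm v) * norm v"
      using \<theta> C0 by (intro mult_right_mono mult_left_mono) (auto simp: mult_left_le_one_le)
    finally show ?thesis by (simp add: power2_eq_square mult.assoc)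
  qed
  with C0 that show ?thesis by blast
qed

section \<open>Convolution with a smooth kernel\<close>

definition conv :: "(real^'d \<Rightarrow> real) \<Rightarrow> (real^'d \<Rightarrow> real) \<Rightarrow> real^'d \<Rightarrow> real" where
  "conv u \<rho> x = (LINT y|lborel. u y * \<rho> (x - y))"

lemma conv_integrable:
  fixes u \<rho> :: "real^'d \<Rightarrow> real"
  assumes u: "continuous_on UNIV u" and \<rho>: "continuous_on UNIV \<rho>"
    and 0: "\<And>z. z \<notin> cball 0 r \<Longrightarrow> \<rho> z = 0"
  shows "integrable lborel (\<lambda>y. u y * \<rho> (x - y))"
proof (rule integrable_compact_support[where S = "cball x r"])
  show "continuous_on (cball x r) (\<lambda>y. u y * \<rho> (x - y))"
    by (intro continuous_intros continuous_on_compose2[OF \<rho>] continuous_on_subset[OF u]) auto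
  show "u y * \<rho> (x - y) = 0" if "y \<notin> cball x r" for y
    using that 0[of "x - y"] unfolding mem_cball_0 by (simp add: dist_norm)
qed auto

text \<open>The Taylor remainder of the kernel is integrated against \<open>u\<close>. The integral
  of the absolute value of \<open>u\<close> over a ball stays explicit in the bound: besides
  differentiability of the convolution, it later yields the quadratic remainder of an averaged
  function in terms of its excess.\<close>

lemma conv_taylor:
  fixes u \<rho> :: "real^'d \<Rightarrow> real"
  assumes u: "continuous_on UNIV u" and \<rho>: "smooth \<rho>" and 0: "\<And>z. z \<notin> cball 0 r \<Longrightarrow> \<rho> z = 0"
    and C: "C \<ge> 0" "\<And>x v. \<bar>\<rho> (x + v) - \<rho> x - grad \<rho> x \<bullet> v\<bar> \<le> C * (norm v)\<^sup>2"
    and h: "norm h \<le> t"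
  shows "\<bar>conv u \<rho> (x + h) - conv u \<rho> x - (\<Sum>i\<in>UNIV. conv u (pd i \<rho>) x * h $ i)\<bar> \<le>
     C * (norm h)\<^sup>2 * (LINT y|lborel. indicator (cball x (r + t)) y * \<bar>u y\<bar>)"
proof -
  have p0: "pd i \<rho> z = 0" if "z \<notin> cball 0 r" for z i
    by (rule pd_outside[OF closed_cball 0 that])
  note i1 = conv_integrable[OF u smooth_continuous[OF \<rho>] 0]
  note i2 = conv_integrable[OF u smooth_continuous[OF smooth_pd[OF \<rho>]] p0]
  have iM: "integrable lborel (\<lambda>y. indicator (cball x (r + t)) y *\<^sub>R \<bar>u y\<bar>)"
    by (intro borel_integrable_compact continuous_intros continuous_on_subset[OF u]) auto
  have e: "u y * \<rho> (x + h - y) - u y * \<rho> (x - y) - (\<Sum>i\<in>UNIV. u y * pd i \<rho> (x - y) * h $ i) =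
     u y * (\<rho> ((x - y) + h) - \<rho> (x - y) - grad \<rho> (x - y) \<bullet> h)" for y
    by (simp add: inner_vec_def right_diff_distrib sum_distrib_left mult.assoc algebra_simps)
  have "conv u \<rho> (x + h) - conv u \<rho> x - (\<Sum>i\<in>UNIV. conv u (pd i \<rho>) x * h $ i) =
    (LINT y|lborel. u y * \<rho> (x + h - y) - u y * \<rho> (x - y) - (\<Sum>i\<in>UNIV. u y * pd i \<rho> (x - y) * h $ i))"
    unfolding conv_def using i1 i2 by simp
  also have "norm \<dots> \<le> (LINT y|lborel. C * (norm h)\<^sup>2 * (indicator (cball x (r + t)) y *\<^sub>R \<bar>u y\<bar>))"
  proof (rule Bochner_Integration.integral_norm_bound_integral)
    show "integrable lborel (\<lambda>y. u y * \<rho> (x + h - y) - u y * \<rho> (x - y) -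
        (\<Sum>i\<in>UNIV. u y * pd i \<rho> (x - y) * h $ i))"
      using i1 i2 by simp
    show "integrable lborel (\<lambda>y. C * (norm h)\<^sup>2 * (indicator (cball x (r + t)) y *\<^sub>R \<bar>u y\<bar>))"
      using iM by simp
    fix y :: "real^'d"
    show "norm (u y * \<rho> (x + h - y) - u y * \<rho> (x - y) - (\<Sum>i\<in>UNIV. u y * pd i \<rho> (x - y) * h $ i))
       \<le> C * (norm h)\<^sup>2 * (indicator (cball x (r + t)) y *\<^sub>R \<bar>u y\<bar>)"
    proof (cases "y \<in> cball x (r + t)")
      case True
      then show ?thesis unfolding e using C(2)[of "x - y" h]
        by (simp add: abs_mult mult.commute[of "\<bar>u y\<bar>"] mult_right_mono)
    next
      \<comment> \<open>Off the larger ball neither \<open>x - y\<close> nor its shift by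
        \<open>h\<close> meets the support of the kernel, so the whole remainder is zero.\<close>
      case False
      then have "x - y \<notin> cball 0 r" "(x - y) + h \<notin> cball 0 r"
        using h order_trans[OF norm_ge_zero h] norm_triangle_ineq4[of "(x - y) + h" h]
        unfolding mem_cball_0 by (auto simp: dist_norm)
      then have "\<rho> (x - y) = 0" "\<rho> ((x - y) + h) = 0" "grad \<rho> (x - y) = 0"
        using 0 p0 by (auto simp: vec_eq_iff)
      then show ?thesis unfolding e using C by simp
    qed
  qed
  also have "\<dots> = C * (norm h)\<^sup>2 * (LINT y|lborel. indicator (cball x (r + t)) y * \<bar>u y\<bar>)" by simp
  finally show ?thesis by simp
qed

lemma conv_has_derivative:
  fixes u \<rho> :: "real^'d \<Rightarrow> real"
  assumes u: "continuous_on UNIV u" and \<rho>: "smooth \<rho>" and 0: "\<And>z. z \<notin> cball 0 r \<Longrightarrow> \<rho> z = 0"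
  shows "(conv u \<rho> has_derivative (\<lambda>h. \<Sum>i\<in>UNIV. conv u (pd i \<rho>) x * h $ i)) (at x)"
proof -
  obtain C where C: "C \<ge> 0" "\<And>x v. \<bar>\<rho> (x + v) - \<rho> x - grad \<rho> x \<bullet> v\<bar> \<le> C * (norm v)\<^sup>2"
    using smooth_taylor2[OF \<rho> compact_cball 0] by metis
  let ?D = "\<lambda>h::real^'d. \<Sum>i\<in>UNIV. conv u (pd i \<rho>) x * h $ i"
  have D: "bounded_linear ?D"
    by (intro bounded_linear_sum bounded_linear_const_mult bounded_linear_vec_nth)
  define M where "M = (LINT y|lborel. indicator (cball x (r + 1)) y * \<bar>u y\<bar>)"
  have est: "norm (conv u \<rho> (x + h) - conv u \<rho> x - ?D h) \<le> C * M * (norm h)\<^sup>2" if "norm h \<le> 1" for h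
    using conv_taylor[where x = x and r = r, OF u \<rho> 0 C that] by (simp add: M_def ac_simps)
  have "((\<lambda>h. norm (conv u \<rho> (x + h) - conv u \<rho> x - ?D h) / norm h) \<longlongrightarrow> 0) (at 0)"
  proof (rule Lim_null_comparison)
    show "\<forall>\<^sub>F h in at 0. norm (norm (conv u \<rho> (x + h) - conv u \<rho> x - ?D h) / norm h) \<le> C * M * norm h"
      unfolding eventually_at
    proof (intro exI[of _ 1] conjI ballI impI)
      fix h :: "real^'d" assume h: "h \<noteq> 0 \<and> dist h 0 < 1"
      then have "norm (conv u \<rho> (x + h) - conv u \<rho> x - ?D h) / norm h \<le> C * M * (norm h)\<^sup>2 / norm h"
        by (intro divide_right_mono est) auto
      then show "norm (norm (conv u \<rho> (x + h) - conv u \<rho> x - ?D h) / norm h) \<le> C * M * norm h"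
        using h by (simp add: power2_eq_square)
    qed simp
    show "((\<lambda>h. C * M * norm h) \<longlongrightarrow> 0) (at 0)"
      by (intro tendsto_mult_right_zero tendsto_norm_zero tendsto_ident_at)
  qed
  with D show ?thesis unfolding has_derivative_at by blast
qed

lemma pd_conv:
  assumes "continuous_on UNIV u" "smooth \<rho>" "\<And>z. z \<notin> cball 0 r \<Longrightarrow> \<rho> z = 0"
  shows "pd i (conv u \<rho>) = conv u (pd i \<rho>)"
  by (rule ext) (subst pd_eqI[OF conv_has_derivative[OF assms]], auto simp: axis_def if_distrib cong: if_cong)

text \<open>All derivatives fall on the kernel, so the convolutions of the fixed \<open>u\<close>
  with smooth kernels supported in one ball form a family closed under partial derivatives.\<close>

lemma smooth_conv:
  assumes u: "continuous_on UNIV u" and \<rho>: "smooth \<rho>" "\<And>z. z \<notin> cball 0 r \<Longrightarrow> \<rho> z = 0"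
  shows "smooth (conv u \<rho>)"
proof (rule smooth_coinduct)
  let ?F = "{conv u \<rho> | \<rho>. smooth \<rho> \<and> (\<forall>z. z \<notin> cball 0 r \<longrightarrow> \<rho> z = 0)}"
  show "conv u \<rho> \<in> ?F" using \<rho> by blast
  fix f assume "f \<in> ?F"
  then obtain \<rho> where \<rho>: "f = conv u \<rho>" "smooth \<rho>" "\<And>z. z \<notin> cball 0 r \<Longrightarrow> \<rho> z = 0" by blast
  have "f differentiable (at x)" for x
    using conv_has_derivative[OF u \<rho>(2,3)] unfolding \<rho>(1) differentiable_def by blast
  moreover have "pd i f \<in> ?F" for i
  proof -
    have "pd i \<rho> z = 0" if "z \<notin> cball 0 r" for z by (rule pd_outside[OF closed_cball \<rho>(3) that])
    moreover have "pd i f = conv u (pd i \<rho>)" unfolding \<rho>(1) by (rule pd_conv[OF u \<rho>(2,3)])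
    ultimately show ?thesis using smooth_pd[OF \<rho>(2)] by blast
  qed
  ultimately show "(\<forall>x. f differentiable (at x)) \<and> (\<forall>i. pd i f \<in> ?F)" by blast
qed

section \<open>The radial kernel and its potential\<close>

lemma grad_affine:
  assumes "smooth f"
  shows "grad (\<lambda>x. f (s *\<^sub>R x + a)) x = s *\<^sub>R grad f (s *\<^sub>R x + a)"
  by (simp add: vec_eq_iff pd_affine smooth_differentiable assms)

lemma lap_affine:
  assumes "smooth f"
  shows "lap (\<lambda>x. f (s *\<^sub>R x + a)) x = s\<^sup>2 * lap f (s *\<^sub>R x + a)"
proof -
  have "pd i (\<lambda>x. f (s *\<^sub>R x + a)) = (\<lambda>x. s * pd i f (s *\<^sub>R x + a))" for i
    by (rule ext) (simp add: pd_affine smooth_differentiable assms)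
  moreover have "pd i (\<lambda>x. s * pd i f (s *\<^sub>R x + a)) x = s * (s * pd i (pd i f) (s *\<^sub>R x + a))" for i
    by (subst pd_cmult[OF smooth_differentiable[OF smooth_affine[OF smooth_pd[OF assms]]]])
       (simp only: pd_affine(1)[OF smooth_differentiable[OF smooth_pd[OF assms]]])
  ultimately show ?thesis
    by (simp add: lap_def sum_distrib_left power2_eq_square mult.assoc)
qed

lemma pd_norm_sq: "pd i (\<lambda>x::real^'d. (norm x)\<^sup>2) x = 2 * x $ i"
proof -
  have "((\<lambda>x::real^'d. x \<bullet> x) has_derivative (\<lambda>h. x \<bullet> h + h \<bullet> x)) (at x)"
    by (auto intro!: derivative_eq_intros)
  from pd_eqI[OF this] show ?thesis
    by (simp add: power2_norm_eq_inner inner_axis inner_commute[of "axis i 1"])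
qed

lemma flat_ge_0: "flat 1 t \<ge> 0" "flat [:0,0,1:] t \<ge> 0" and flat_le_1: "flat 1 t \<le> 1"
  by (auto simp: flat_def)

lemma flat_nonpos: "t \<le> 0 \<Longrightarrow> flat p t = 0"
  by (simp add: flat_def)

text \<open>
  Since the derivative of \<open>exp(-1/t)\<close> is \<open>t\<^sup>-\<^sup>2 exp(-1/t)\<close>, the gradient of \<open>pot\<close> at \<open>y\<close> is
  \<open>- kap y\<close> times \<open>y\<close>. This makes the derivative in \<open>s\<close> of the rescaled kernel \<open>ker s\<close> a rescaled
  Laplacian of \<open>pot\<close>, so that averages against \<open>ker s\<close> vary little for nearly harmonic functions.
\<close>

definition bump :: "real^'d \<Rightarrow> real" where
  "bump y = flat 1 (1 - (norm y)\<^sup>2)"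

definition kap0 :: "real^'d \<Rightarrow> real" where
  "kap0 y = flat [:0,0,1:] (1 - (norm y)\<^sup>2)"

definition kap :: "real^'d \<Rightarrow> real" where
  "kap y = kap0 y / integral\<^sup>L lborel (kap0 :: real^'d \<Rightarrow> real)"

text \<open>The factor 2 cancels the one from differentiating the squared norm, and the integral is
  the constant that gives \<open>kap\<close> mass one.\<close>

definition pot :: "real^'d \<Rightarrow> real" where
  "pot y = bump y / (2 * integral\<^sup>L lborel (kap0 :: real^'d \<Rightarrow> real))"

lemma smooth_bump: "smooth bump"
  unfolding bump_def[abs_def] by (intro smooth_flat smooth_diff smooth_const smooth_norm_sq)

lemma smooth_kap0: "smooth kap0"
  unfolding kap0_def[abs_def] by (intro smooth_flat smooth_diff smooth_const smooth_norm_sq)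

lemma smooth_kap: "smooth kap"
  unfolding kap_def[abs_def] divide_inverse mult.commute[of _ "inverse _"]
  by (intro smooth_cmult smooth_kap0)

lemma smooth_pot: "smooth pot"
  unfolding pot_def[abs_def] divide_inverse mult.commute[of _ "inverse _"]
  by (intro smooth_cmult smooth_bump)

lemma one_le_norm_sq: "norm y \<ge> 1 \<Longrightarrow> 1 - (norm y)\<^sup>2 \<le> 0"
proof -
  assume "norm y \<ge> 1"
  then have "1 \<le> (norm y)\<^sup>2" by (rule one_le_power)
  then show ?thesis by linarith
qed

lemma bump_outside: "norm y \<ge> 1 \<Longrightarrow> bump y = 0"
  and kap0_outside: "norm y \<ge> 1 \<Longrightarrow> kap0 y = 0"
  unfolding bump_def kap0_def by (rule flat_nonpos[OF one_le_norm_sq], assumption)+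

lemma kap_outside: "norm y \<ge> 1 \<Longrightarrow> kap y = 0" and pot_outside: "norm y \<ge> 1 \<Longrightarrow> pot y = 0"
  by (simp_all add: kap_def pot_def kap0_outside bump_outside)

lemma bump_bounds: "0 \<le> bump y" "bump y \<le> 1"
  by (auto simp: bump_def flat_ge_0 flat_le_1)

lemma bump_lower: "norm y \<le> 1/2 \<Longrightarrow> exp (-2) \<le> bump y"
proof -
  assume "norm y \<le> 1/2"
  then have "(norm y)\<^sup>2 \<le> (1/2)\<^sup>2" by (intro power_mono) auto
  then have "1 - (norm y)\<^sup>2 \<ge> 1/2" by (simp add: power2_eq_square)
  then show ?thesis by (auto simp: bump_def flat_def field_simps)
qed

text \<open>On the ball of radius 1/2 the argument t = 1 - |y|^2 lies between 1/2 and 1, where the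
  profile t^(-2) exp(-1/t) is at least exp(-2).\<close>

lemma kap0_integral_pos: "integral\<^sup>L lborel (kap0 :: real^'d \<Rightarrow> real) > 0"
proof -
  let ?k = "kap0 :: real^'d \<Rightarrow> real"
  have i: "integrable lborel ?k"
    by (rule integrable_compact_support[OF continuous_on_subset[OF smooth_continuous[OF smooth_kap0] subset_UNIV]
          compact_cball[of 0 1]]) (auto intro!: kap0_outside)
  have nn: "kap0 y \<ge> 0" for y :: "real^'d" by (simp add: kap0_def flat_ge_0)
  have lb: "exp (-2) * indicator (cball 0 (1/2)) y \<le> ?k y" for y
  proof (cases "norm y \<le> 1/2")
    case True
    then have "(norm y)\<^sup>2 \<le> (1/2)\<^sup>2" by (intro power_mono) auto
    then have a: "1 - (norm y)\<^sup>2 \<ge> 1/2" "1 - (norm y)\<^sup>2 \<le> 1" by (auto simp: power2_eq_square)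
    define t where "t = 1 - (norm y)\<^sup>2"
    have t: "1/2 \<le> t" "t \<le> 1" using a by (auto simp: t_def)
    have "exp (-2) \<le> exp (- (1/t))" using t by (auto simp: field_simps)
    moreover have "1 \<le> (1/t) * (1/t)" using t mult_mono[of 1 "1/t" 1 "1/t"] by (auto simp: field_simps)
    ultimately have "1 * exp (-2) \<le> (1/t) * (1/t) * exp (- (1/t))" by (intro mult_mono) auto
    then show ?thesis using True t by (simp add: kap0_def flat_def t_def[symmetric])
  next
    case False
    then show ?thesis using nn by simp
  qed
  have "0 < exp (-2) * measure lborel (cball (0::real^'d) (1/2))"
    using content_cball_pos[of "1/2" "0::real^'d"] by simp
  also have "\<dots> = (LINT y|lborel. exp (-2) * indicator (cball (0::real^'d) (1/2)) y)" by simp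
  also have "\<dots> \<le> integral\<^sup>L lborel ?k"
    using emeasure_lborel_cball_finite
    by (intro integral_mono i lb integrable_mult_right integrable_real_indicator) auto
  finally show ?thesis .
qed

lemma kap_nonneg: "kap y \<ge> 0"
  using kap0_integral_pos by (simp add: kap_def kap0_def flat_ge_0 less_imp_le)

lemma kap_even: "kap (- y) = kap y"
  by (simp add: kap_def kap0_def)

lemma integral_kap: "integral\<^sup>L lborel (kap :: real^'d \<Rightarrow> real) = 1"
proof -
  have "integral\<^sup>L lborel (kap :: real^'d \<Rightarrow> real) = (LINT y|lborel. kap0 (y::real^'d) / integral\<^sup>L lborel (kap0 :: real^'d \<Rightarrow> real))"
    by (simp only: kap_def[abs_def])
  also have "\<dots> = 1" using kap0_integral_pos[where 'd = 'd] by simp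
  finally show ?thesis .
qed

lemma flat_1_deriv: "(flat 1 has_real_derivative flat [:0,0,1:] t) (at t)"
  using flat_has_derivative[of 1 t] by simp

lemma pd_pot: "pd i pot (y::real^'d) = - (y $ i * kap y)"
proof -
  have "pd i (\<lambda>y::real^'d. 1 - (norm y)\<^sup>2) y = - (2 * y $ i)"
  proof -
    have "pd i (\<lambda>y::real^'d. 1 + (-1) * (norm y)\<^sup>2) y = - (2 * y $ i)"
      by (simp only: pd_add[OF smooth_differentiable[OF smooth_const]
            smooth_differentiable[OF smooth_cmult[OF smooth_norm_sq]]]
            pd_cmult[OF smooth_differentiable[OF smooth_norm_sq]] pd_norm_sq fun_cong[OF pd_const])
    then show ?thesis by simp
  qed
  then have "pd i bump y = - (2 * y $ i * kap0 y)"
    unfolding bump_def[abs_def] kap0_def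
    by (subst pd_comp[OF _ flat_1_deriv]) (auto simp: smooth_differentiable smooth_norm_sq)
  then show ?thesis
    unfolding pot_def[abs_def] divide_inverse mult.commute[of _ "inverse _"]
    using kap0_integral_pos[where 'd = 'd]
    by (subst pd_cmult) (auto simp: smooth_differentiable smooth_bump kap_def field_simps)
qed

text \<open>The gradient of \<open>pot\<close> at y is \<open>- kap y\<close> times y, so its
  Laplacian is minus the divergence of the field \<open>kap y\<close> times y. This is the
  expression that arises on differentiating a mass-preserving rescaling of \<open>kap\<close> in the
  scale.\<close>

lemma lap_pot: "lap pot (y::real^'d) = - (real CARD('d) * kap y + grad kap y \<bullet> y)"
proof -
  have "pd i (pd i pot) y = - kap y - y $ i * pd i kap y" for i
  proof -
    have "pd i (\<lambda>y. y $ i) y = 1"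
      using pd_eqI[OF bounded_linear_imp_has_derivative[OF bounded_linear_vec_nth], of i y i] by simp
    moreover have "pd i pot = (\<lambda>y. (-1) * (y $ i * kap y))" by (rule ext) (simp add: pd_pot)
    moreover have "pd i (\<lambda>y. (-1) * (y $ i * kap y)) y = (-1) * (pd i (\<lambda>y. y $ i) y * kap y + y $ i * pd i kap y)"
      by (subst pd_cmult[OF smooth_differentiable[OF smooth_mult[OF smooth_coord smooth_kap]]])
         (simp only: pd_mult[OF smooth_differentiable[OF smooth_coord] smooth_differentiable[OF smooth_kap]])
    ultimately show ?thesis by simp
  qed
  then show ?thesis
    by (simp add: lap_def sum_subtractf inner_vec_def mult.commute)
qed

text \<open>The scaling keeps the mass equal to one and puts the support in the ball of radius
  \<open>s\<close>, so \<open>conv u (ker s) x\<close> is a radial average of \<open>u\<close>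
  around \<open>x\<close> at scale \<open>s\<close>.\<close>

definition ker :: "real \<Rightarrow> real^'d \<Rightarrow> real" where
  "ker s z = inverse s ^ CARD('d) * kap (inverse s *\<^sub>R z)"

lemma smooth_ker: "smooth (ker s)"
  using smooth_cmult[OF smooth_affine[OF smooth_kap, of "inverse s" 0]]
  unfolding ker_def[abs_def] by simp

lemma ker_nonneg: "s > 0 \<Longrightarrow> ker s z \<ge> 0"
  by (simp add: ker_def kap_nonneg)

lemma ker_even: "ker s (- z) = ker s z"
  by (simp add: ker_def kap_even)

lemma ker_even_diff: "ker s (x - y) = ker s (y - x)"
  using ker_even[of s "y - x"] by simp

lemma ker_outside: "s > 0 \<Longrightarrow> z \<notin> cball 0 s \<Longrightarrow> ker s z = 0"
  by (simp add: ker_def kap_outside divide_simps)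

lemma ker_outside_diff: "s > 0 \<Longrightarrow> y \<notin> cball x s \<Longrightarrow> ker s (x - y) = 0"
  by (rule ker_outside) (simp_all add: dist_norm del: mem_cball add: mem_cball_0, simp add: dist_norm)

lemma integral_ker:
  assumes "s > 0"
  shows "(LINT z|lborel. ker s (z - x)) = 1"
proof -
  have "(LINT z|lborel. ker s (z - x)) = \<bar>s\<bar> ^ DIM(real^'a) * (LINT z|lborel. ker s ((x + s *\<^sub>R z) - x))"
    using assms
    by (intro lborel_integral_affine borel_measurable_continuous_onI
         continuous_on_compose2[OF smooth_continuous[OF smooth_ker]] continuous_intros) auto
  also have "\<dots> = (LINT z|lborel. kap (z :: real^'a))"
    using assms by (simp add: ker_def power_inverse)
  finally show ?thesis by (simp add: integral_kap)
qed

lemma integral_ker': "s > 0 \<Longrightarrow> (LINT z|lborel. ker s (x - z)) = 1"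
  unfolding ker_even_diff[of s x] by (rule integral_ker)

section \<open>Weak near-harmonicity\<close>

text \<open>
  For a component \<open>u\<close> of a solution with zero set \<open>Z\<close>, comparing with the competitors obtained by
  adding \<open>t \<phi>\<close> to that component and optimising in \<open>t\<close> yields the following inequality.
\<close>

definition nearly_harmonic ::
  "real \<Rightarrow> real^'d \<Rightarrow> real \<Rightarrow> (real^'d \<Rightarrow> real) \<Rightarrow> (real^'d) set \<Rightarrow> bool" where
  "nearly_harmonic \<Lambda> x0 R u Z \<longleftrightarrow> continuous_on UNIV u \<and> compact Z \<and> (\<forall>x\<in>Z. u x = 0) \<and> \<Lambda> \<ge> 0 \<and>
     (\<forall>\<phi> x r. smooth \<phi> \<longrightarrow> (\<forall>y. y \<notin> cball x r \<longrightarrow> \<phi> y = 0) \<longrightarrow> cball x r \<subseteq> cball x0 R \<longrightarrow>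
        (LINT y|lborel. u y * lap \<phi> y)\<^sup>2 \<le>
        \<Lambda> * measure lborel (Z \<inter> cball x r) * (LINT y|lborel. (norm (grad \<phi> y))\<^sup>2))"

lemma
  assumes "nearly_harmonic \<Lambda> x0 R u Z"
  shows nh_cont: "continuous_on UNIV u" and nh_compact: "compact Z" and nh_zero: "x \<in> Z \<Longrightarrow> u x = 0"
    and nh_Lam: "\<Lambda> \<ge> 0"
    and nh_test: "\<And>\<phi> x r. smooth \<phi> \<Longrightarrow> (\<And>y. y \<notin> cball x r \<Longrightarrow> \<phi> y = 0) \<Longrightarrow> cball x r \<subseteq> cball x0 R \<Longrightarrow>
        (LINT y|lborel. u y * lap \<phi> y)\<^sup>2 \<le>
        \<Lambda> * measure lborel (Z \<inter> cball x r) * (LINT y|lborel. (norm (grad \<phi> y))\<^sup>2)"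
  using assms unfolding nearly_harmonic_def by blast+

section \<open>Invariance under rescaling\<close>

lemma measure_affine_vimage:
  fixes S :: "(real^'d) set"
  assumes "S \<in> sets borel" "r > 0"
  shows "measure lborel S = r ^ CARD('d) * measure lborel {y. x + r *\<^sub>R y \<in> S}"
proof -
  have "measure lborel S = (LINT y|lborel. indicator S y)" by simp
  also have "\<dots> = r ^ CARD('d) * (LINT y|lborel. indicator S (x + r *\<^sub>R y))"
    using assms by (subst lborel_integral_affine[of r _ x]) auto
  also have "(\<lambda>y. indicator S (x + r *\<^sub>R y) :: real) = indicator {y. x + r *\<^sub>R y \<in> S}"
    by (auto simp: indicator_def)
  finally show ?thesis by simp
qed

text \<open>Test functions are transported by the affine change of variables. The pairing with the
  function scales like r^(d-1), the measure of the zero set like r^d and the Dirichlet energy like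
  r^(d-2), so both sides of the inequality pick up r^(2d-2) and \<Lambda> is unchanged. The later
  one-step estimates can therefore be proved on the unit ball.\<close>

lemma nearly_harmonic_rescale:
  fixes u :: "real^'d \<Rightarrow> real"
  assumes w: "nearly_harmonic \<Lambda> x0 R u Z" and r: "r > 0" and sub: "cball a r \<subseteq> cball x0 R"
  shows "nearly_harmonic \<Lambda> 0 1 (\<lambda>y. u (a + r *\<^sub>R y) / r) {y. a + r *\<^sub>R y \<in> Z}"
  unfolding nearly_harmonic_def
proof (intro conjI allI impI ballI)
  note uc = nh_cont[OF w]
  show "continuous_on UNIV (\<lambda>y. u (a + r *\<^sub>R y) / r)"
    using r by (intro continuous_intros continuous_on_compose2[OF uc]) auto
  have "{y. a + r *\<^sub>R y \<in> Z} = (\<lambda>z. inverse r *\<^sub>R (z - a)) ` Z"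
    using r by (force simp: image_iff)
  moreover have "compact ((\<lambda>z. inverse r *\<^sub>R (z - a)) ` Z)"
    by (intro compact_continuous_image continuous_intros nh_compact[OF w])
  ultimately show "compact {y. a + r *\<^sub>R y \<in> Z}" by simp
  show "u (a + r *\<^sub>R x) / r = 0" if "x \<in> {y. a + r *\<^sub>R y \<in> Z}" for x
    using that nh_zero[OF w] by simp
  show "\<Lambda> \<ge> 0" by (rule nh_Lam[OF w])
next
  fix \<phi> :: "real^'d \<Rightarrow> real" and x :: "real^'d" and t
  assume \<phi>: "smooth \<phi>" and 0: "\<forall>y. y \<notin> cball x t \<longrightarrow> \<phi> y = 0" and s: "cball x t \<subseteq> cball 0 1"
  note uc = nh_cont[OF w]
  define \<phi>' where "\<phi>' y = \<phi> (inverse r *\<^sub>R y + (- inverse r *\<^sub>R a))" for y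
  have \<phi>': "smooth \<phi>'" unfolding \<phi>'_def[abs_def] by (rule smooth_affine[OF \<phi>])
  have inv: "inverse r *\<^sub>R (a + r *\<^sub>R y) + (- inverse r *\<^sub>R a) = y" for y
    using r by (simp add: scaleR_add_right)
  have l: "lap \<phi>' (a + r *\<^sub>R y) = (inverse r)\<^sup>2 * lap \<phi> y" for y
    unfolding \<phi>'_def[abs_def] lap_affine[OF \<phi>] inv ..
  have g: "grad \<phi>' (a + r *\<^sub>R y) = inverse r *\<^sub>R grad \<phi> y" for y
    unfolding \<phi>'_def[abs_def] grad_affine[OF \<phi>] inv ..
  define X where "X = (LINT y|lborel. u y * lap \<phi>' y)"
  define V where "V = (LINT y|lborel. u (a + r *\<^sub>R y) / r * lap \<phi> y)"
  define G' where "G' = (LINT y|lborel. (norm (grad \<phi>' y))\<^sup>2)"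
  define G where "G = (LINT y|lborel. (norm (grad \<phi> y))\<^sup>2)"
  define M where "M = measure lborel ({y. a + r *\<^sub>R y \<in> Z} \<inter> cball x t)"
  define M' where "M' = measure lborel (Z \<inter> cball (a + r *\<^sub>R x) (r * t))"
  have "X = r ^ CARD('d) * (LINT y|lborel. u (a + r *\<^sub>R y) * ((inverse r)\<^sup>2 * lap \<phi> y))"
    unfolding X_def using r
    by (subst lborel_integral_affine[of r _ a])
       (auto intro!: borel_measurable_continuous_onI continuous_intros uc smooth_continuous[OF smooth_lap[OF \<phi>']]
         simp: l)
  also have "(\<lambda>y. u (a + r *\<^sub>R y) * ((inverse r)\<^sup>2 * lap \<phi> y)) = (\<lambda>y. inverse r * (u (a + r *\<^sub>R y) / r * lap \<phi> y))"
    by (auto simp: power2_eq_square divide_inverse)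
  finally have X: "r * X = r ^ CARD('d) * V" using r by (simp add: V_def field_simps)
  have "G' = r ^ CARD('d) * (LINT y|lborel. (inverse r)\<^sup>2 * (norm (grad \<phi> y))\<^sup>2)"
    unfolding G'_def using r
    by (subst lborel_integral_affine[of r _ a])
       (auto intro!: borel_measurable_continuous_onI continuous_intros continuous_grad[OF \<phi>']
         simp: g power_mult_distrib)
  then have G: "r\<^sup>2 * G' = r ^ CARD('d) * G" using r by (simp add: G_def field_simps power2_eq_square)
  have M: "M' = r ^ CARD('d) * M"
  proof -
    have "{y. a + r *\<^sub>R y \<in> Z \<inter> cball (a + r *\<^sub>R x) (r * t)} = {y. a + r *\<^sub>R y \<in> Z} \<inter> cball x t"
      using r by (auto simp: dist_norm simp flip: scaleR_diff_right)
    then show ?thesis unfolding M'_def M_def using r nh_compact[OF w]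
      by (subst measure_affine_vimage[of _ r a]) (auto intro!: borel_compact compact_Int_closed)
  qed
  have "X\<^sup>2 \<le> \<Lambda> * M' * G'"
    unfolding X_def M'_def G'_def
  proof (rule nh_test[OF w \<phi>'])
    show "\<phi>' y = 0" if y: "y \<notin> cball (a + r *\<^sub>R x) (r * t)" for y
    proof -
      define z where "z = inverse r *\<^sub>R y + (- inverse r *\<^sub>R a)"
      have "y = a + r *\<^sub>R z" using r by (simp add: z_def scaleR_add_right scaleR_diff_right)
      then have "z \<notin> cball x t" using y r by (auto simp: dist_norm simp flip: scaleR_diff_right)
      then show ?thesis using 0 by (simp add: \<phi>'_def z_def)
    qed
    show "cball (a + r *\<^sub>R x) (r * t) \<subseteq> cball x0 R"
    proof
      fix y assume y: "y \<in> cball (a + r *\<^sub>R x) (r * t)"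
      define z where "z = inverse r *\<^sub>R y + (- inverse r *\<^sub>R a)"
      have yz: "y = a + r *\<^sub>R z" using r by (simp add: z_def scaleR_add_right scaleR_diff_right)
      then have "z \<in> cball x t" using y r by (auto simp: dist_norm simp flip: scaleR_diff_right)
      then have "norm z \<le> 1" using s by auto
      then have "y \<in> cball a r" using r by (simp add: yz dist_norm)
      then show "y \<in> cball x0 R" using sub by blast
    qed
  qed
  \<comment> \<open>The extra factor r^2 clears negative powers of r, so that exponents stay natural
    numbers also in dimension one.\<close>
  then have "r\<^sup>2 * X\<^sup>2 \<le> r\<^sup>2 * (\<Lambda> * M' * G')" using r by (intro mult_left_mono) auto
  also have "\<dots> = \<Lambda> * M' * (r\<^sup>2 * G')" by simp
  also have "\<dots> = (r ^ CARD('d))\<^sup>2 * (\<Lambda> * M * G)" unfolding G M by (simp add: power2_eq_square)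
  also have "r\<^sup>2 * X\<^sup>2 = (r ^ CARD('d))\<^sup>2 * V\<^sup>2" using X by (metis power_mult_distrib)
  finally have "V\<^sup>2 \<le> \<Lambda> * M * G" using r by simp
  then show "(LINT y|lborel. u (a + r *\<^sub>R y) / r * lap \<phi> y)\<^sup>2 \<le>
     \<Lambda> * measure lborel ({y. a + r *\<^sub>R y \<in> Z} \<inter> cball x t) * (LINT y|lborel. (norm (grad \<phi> y))\<^sup>2)"
    by (simp add: V_def M_def G_def)
qed

section \<open>Mollified test functions\<close>

lemma conv_pd:
  fixes \<phi> :: "real^'d \<Rightarrow> real"
  assumes \<phi>: "smooth \<phi>" and s: "s > 0"
  shows "pd i (conv \<phi> (ker s)) = conv (pd i \<phi>) (ker s)"
proof
  fix x :: "real^'d"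
  have p: "pd i (\<lambda>y. ker s (x - y)) y = - pd i (ker s) (x - y)" for y
  proof -
    have "pd i (\<lambda>y. ker s ((-1) *\<^sub>R y + x)) y = (-1) * pd i (ker s) ((-1) *\<^sub>R y + x)"
      by (rule pd_affine(1)[OF smooth_differentiable[OF smooth_ker]])
    then show ?thesis by simp
  qed
  have sm: "smooth (\<lambda>y. ker s (x - y))" using smooth_affine[OF smooth_ker, of s "-1" x] by simp
  have "pd i (conv \<phi> (ker s)) x = conv \<phi> (pd i (ker s)) x"
    by (rule fun_cong[OF pd_conv[OF smooth_continuous[OF \<phi>] smooth_ker ker_outside[OF s]]])
  also have "\<dots> = - (LINT y|lborel. \<phi> y * pd i (\<lambda>y. ker s (x - y)) y)"
    by (simp add: conv_def p)
  also have "\<dots> = (LINT y|lborel. pd i \<phi> y * ker s (x - y))"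
    using ker_outside_diff[OF s]
    by (subst integral_by_parts[OF smooth_differentiable[OF \<phi>] smooth_continuous[OF smooth_pd[OF \<phi>]]
           smooth_differentiable[OF sm] smooth_continuous[OF smooth_pd[OF sm]] compact_cball[of x s]])
       auto
  finally show "pd i (conv \<phi> (ker s)) x = conv (pd i \<phi>) (ker s) x" by (simp add: conv_def)
qed

lemma conv_ker_integrable:
  assumes "continuous_on UNIV u" "s > 0"
  shows "integrable lborel (\<lambda>y. u y * ker s (x - y))"
  by (rule conv_integrable[OF assms(1) smooth_continuous[OF smooth_ker] ker_outside[OF assms(2)]])

text \<open>Jensen's inequality for the probability density \<open>ker s (x - y)\<close>: the
  variance of \<open>g\<close> around its mean \<open>m\<close> is nonnegative.\<close>

lemma conv_sq_le:
  fixes g :: "real^'d \<Rightarrow> real"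
  assumes g: "continuous_on UNIV g" and s: "s > 0"
  shows "(conv g (ker s) x)\<^sup>2 \<le> conv (\<lambda>y. (g y)\<^sup>2) (ker s) x"
proof -
  define m where "m = conv g (ker s) x"
  note i = conv_ker_integrable[OF _ s]
  have i1: "integrable lborel (\<lambda>y. g y * ker s (x - y))" by (rule i[OF g])
  have i2: "integrable lborel (\<lambda>y. (g y)\<^sup>2 * ker s (x - y))" by (rule i) (intro continuous_intros g)
  have i3: "integrable lborel (\<lambda>y. ker s (x - y))" using i[OF continuous_on_const, of 1 x] by simp
  have "0 \<le> (LINT y|lborel. (g y - m)\<^sup>2 * ker s (x - y))"
    using ker_nonneg[OF s] by (intro integral_nonneg_AE AE_I2 mult_nonneg_nonneg) auto
  also have "\<dots> = (LINT y|lborel. (g y)\<^sup>2 * ker s (x - y) - 2 * m * (g y * ker s (x - y)) + m\<^sup>2 * ker s (x - y))"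
    by (simp add: power2_diff algebra_simps)
  also have "\<dots> = conv (\<lambda>y. (g y)\<^sup>2) (ker s) x - 2 * m * m + m\<^sup>2 * 1"
    using i1 i2 i3 integral_ker'[OF s, of x] by (simp add: conv_def m_def)
  finally show ?thesis by (simp add: m_def power2_eq_square)
qed

lemma conv_outside:
  assumes "\<And>y. y \<notin> cball a r \<Longrightarrow> g y = 0" "s > 0" "x \<notin> cball a (r + s)"
  shows "conv g (ker s) x = 0"
proof -
  have "g y * ker s (x - y) = 0" for y
  proof (cases "y \<in> cball a r")
    case True
    then have "x - y \<notin> cball 0 s" using assms(3) dist_triangle[of a x y]
      unfolding mem_cball_0 by (auto simp: dist_norm norm_minus_commute)
    then have "ker s (x - y) = 0" by (rule ker_outside[OF assms(2)])
    then show ?thesis by simp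
  qed (use assms in auto)
  then have "(\<lambda>y. g y * ker s (x - y)) = (\<lambda>y. 0)" by (rule ext)
  then show ?thesis by (simp only: conv_def) simp
qed

text \<open>Evenness of the kernel makes convolution with it self-adjoint.\<close>

lemma integral_conv_swap:
  fixes f g :: "real^'d \<Rightarrow> real"
  assumes f: "continuous_on UNIV f" and g: "continuous_on UNIV g" and s: "s > 0"
    and 0: "\<And>y. y \<notin> cball a r \<Longrightarrow> g y = 0"
  shows "(LINT x|lborel. conv f (ker s) x * g x) = (LINT y|lborel. f y * conv g (ker s) y)"
proof -
  have k: "continuous_on UNIV (ker s)" by (rule smooth_continuous[OF smooth_ker])
  have "(LINT x|lborel. conv f (ker s) x * g x) = (LINT x|lborel. LINT y|lborel. f y * ker s (x - y) * g x)"
    by (simp add: conv_def)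
  also have "\<dots> = (LINT y|lborel. LINT x|lborel. f y * ker s (x - y) * g x)"
  proof (rule Fubini_compact_support[OF _ compact_cball[of a r] compact_cball[of a "r + s"]])
    show "continuous_on UNIV (\<lambda>(x, y). f y * ker s (x - y) * g x)"
      unfolding case_prod_beta
      by (intro continuous_intros continuous_on_compose2[OF k] continuous_on_compose2[OF f]
          continuous_on_compose2[OF g]) auto
    show "f y * ker s (x - y) * g x = 0" if h: "x \<notin> cball a r \<or> y \<notin> cball a (r + s)" for x y
    proof (cases "x \<in> cball a r")
      case True
      then have "x - y \<notin> cball 0 s" using h dist_triangle[of a y x]
        unfolding mem_cball_0 by (auto simp: dist_norm norm_minus_commute)
      then have "ker s (x - y) = 0" by (rule ker_outside[OF s])
      then show ?thesis by simp
    qed (use 0 in auto)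
  qed
  also have "(\<lambda>y. LINT x|lborel. f y * ker s (x - y) * g x) = (\<lambda>y. LINT x|lborel. f y * (g x * ker s (y - x)))"
    by (subst ker_even_diff) (simp add: ac_simps)
  finally show ?thesis by (simp add: conv_def)
qed

text \<open>Convolution being self-adjoint, testing the mollified function with \<phi> amounts to
  testing \<open>u\<close> with the mollified \<phi>, whose Laplacian is the mollified Laplacian and
  whose Dirichlet energy is no larger by Jensen's inequality. The price is that the support, and
  with it the part of \<open>Z\<close> that counts, grows by \<open>s\<close>. In return, energy
  estimates can be carried out on a smooth function.\<close>

lemma mollified_test:
  fixes u :: "real^'d \<Rightarrow> real"
  assumes w: "nearly_harmonic \<Lambda> x0 R u Z" and s: "s > 0" and \<phi>: "smooth \<phi>"
    and 0: "\<And>y. y \<notin> cball x r \<Longrightarrow> \<phi> y = 0" and sub: "cball x (r + s) \<subseteq> cball x0 R"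
  shows "(LINT y|lborel. conv u (ker s) y * lap \<phi> y)\<^sup>2 \<le>
        \<Lambda> * measure lborel (Z \<inter> cball x (r + s)) * (LINT y|lborel. (norm (grad \<phi> y))\<^sup>2)"
proof -
  let ?\<psi> = "conv \<phi> (ker s)"
  have \<psi>: "smooth ?\<psi>" by (rule smooth_conv[OF smooth_continuous[OF \<phi>] smooth_ker ker_outside[OF s]])
  have p0: "pd i \<phi> y = 0" if "y \<notin> cball x r" for y i by (rule pd_outside[OF closed_cball 0 that])
  have l0: "lap \<phi> y = 0" if "y \<notin> cball x r" for y by (rule lap_outside[OF closed_cball 0 that])
  have pc: "continuous_on UNIV (pd i \<phi>)" for i by (rule smooth_continuous[OF smooth_pd[OF \<phi>]])
  have pc2: "continuous_on UNIV (\<lambda>y. (pd i \<phi> y)\<^sup>2)" for i by (intro continuous_intros pc)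
  have i2: "integrable lborel (\<lambda>y. pd i (pd i \<phi>) y * ker s (z - y))" for i z
    by (rule conv_ker_integrable[OF smooth_continuous[OF smooth_pd[OF smooth_pd[OF \<phi>]]] s])
  have "lap ?\<psi> = conv (lap \<phi>) (ker s)"
    by (rule ext)
       (simp add: lap_def conv_pd[OF \<phi> s] fun_cong[OF conv_pd[OF smooth_pd[OF \<phi>] s]] conv_def sum_distrib_right i2)
  then have "(LINT y|lborel. conv u (ker s) y * lap \<phi> y) = (LINT y|lborel. u y * lap ?\<psi> y)"
    using integral_conv_swap[OF nh_cont[OF w] smooth_continuous[OF smooth_lap[OF \<phi>]] s l0] by simp
  then have "(LINT y|lborel. conv u (ker s) y * lap \<phi> y)\<^sup>2 \<le>
      \<Lambda> * measure lborel (Z \<inter> cball x (r + s)) * (LINT y|lborel. (norm (grad ?\<psi> y))\<^sup>2)"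
    using nh_test[OF w \<psi> conv_outside[OF 0 s] sub] by simp
  also have "\<dots> \<le> \<Lambda> * measure lborel (Z \<inter> cball x (r + s)) * (LINT y|lborel. (norm (grad \<phi> y))\<^sup>2)"
  proof (rule mult_left_mono)
    have n: "(norm (grad f y))\<^sup>2 = (\<Sum>i\<in>UNIV. (pd i f y)\<^sup>2)" for f and y :: "real^'d"
      unfolding power2_norm_eq_inner inner_vec_def by (simp add: power2_eq_square)
    have sm2: "smooth (conv (\<lambda>y. (pd i \<phi> y)\<^sup>2) (ker s))" for i
      by (rule smooth_conv[OF pc2 smooth_ker ker_outside[OF s]])
    have ii: "integrable lborel (conv (\<lambda>y. (pd i \<phi> y)\<^sup>2) (ker s))" for i
      by (rule integrable_compact_support[OF continuous_on_subset[OF smooth_continuous[OF sm2] subset_UNIV]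
           compact_cball[of x "r + s"]]) (rule conv_outside[OF _ s], use p0 in auto)
    have g0: "grad ?\<psi> y = 0" if "y \<notin> cball x (r + s)" for y
      by (rule grad_outside[OF closed_cball conv_outside[OF 0 s] that])
    have "(LINT y|lborel. (norm (grad ?\<psi> y))\<^sup>2) \<le> (LINT y|lborel. (\<Sum>i\<in>UNIV. conv (\<lambda>y. (pd i \<phi> y)\<^sup>2) (ker s) y))"
    proof (rule integral_mono)
      show "integrable lborel (\<lambda>y. (norm (grad ?\<psi> y))\<^sup>2)"
        by (rule integrable_compact_support[OF _ compact_cball[of x "r + s"]])
           (auto intro!: continuous_intros continuous_on_subset[OF continuous_grad[OF \<psi>]]
             simp: g0)
      show "integrable lborel (\<lambda>y. \<Sum>i\<in>UNIV. conv (\<lambda>y. (pd i \<phi> y)\<^sup>2) (ker s) y)"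
        using ii by simp
      show "(norm (grad ?\<psi> y))\<^sup>2 \<le> (\<Sum>i\<in>UNIV. conv (\<lambda>y. (pd i \<phi> y)\<^sup>2) (ker s) y)" for y
        unfolding n fun_cong[OF conv_pd[OF \<phi> s]] by (intro sum_mono conv_sq_le pc s)
    qed
    also have "\<dots> = (\<Sum>i\<in>UNIV. LINT y|lborel. conv (\<lambda>y. (pd i \<phi> y)\<^sup>2) (ker s) y)"
      using ii by simp
    also have "\<dots> = (\<Sum>i\<in>UNIV. LINT y|lborel. (pd i \<phi> y)\<^sup>2)"
    proof (rule sum.cong[OF refl])
      fix i
      \<comment> \<open>Moving the convolution onto the constant 1, which the kernel preserves,
        shows that mollification keeps the total integral.\<close>
      have "(LINT y|lborel. 1 * conv (\<lambda>y. (pd i \<phi> y)\<^sup>2) (ker s) y) =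
          (LINT y|lborel. conv (\<lambda>y. 1) (ker s) y * (pd i \<phi> y)\<^sup>2)"
        by (rule integral_conv_swap[symmetric, OF continuous_on_const pc2 s]) (use p0 in auto)
      then show "(LINT y|lborel. conv (\<lambda>y. (pd i \<phi> y)\<^sup>2) (ker s) y) = (LINT y|lborel. (pd i \<phi> y)\<^sup>2)"
        by (simp add: conv_def integral_ker'[OF s])
    qed
    also have "\<dots> = (LINT y|lborel. (norm (grad \<phi> y))\<^sup>2)"
    proof -
      have "integrable lborel (\<lambda>y. (pd i \<phi> y)\<^sup>2)" for i
        by (rule integrable_compact_support[OF continuous_on_subset[OF pc2 subset_UNIV] compact_cball[of x r]])
           (use p0 in auto)
      then show ?thesis unfolding n by simp
    qed
    finally show "(LINT y|lborel. (norm (grad ?\<psi> y))\<^sup>2) \<le> (LINT y|lborel. (norm (grad \<phi> y))\<^sup>2)" .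
  qed (use nh_Lam[OF w] in simp)
  finally show ?thesis .
qed

section \<open>Energy estimates\<close>

lemma green:
  fixes g \<phi> :: "real^'d \<Rightarrow> real"
  assumes g: "smooth g" and \<phi>: "smooth \<phi>" and 0: "\<And>y. y \<notin> cball a r \<Longrightarrow> \<phi> y = 0"
  shows "(LINT y|lborel. g y * lap \<phi> y) = - (LINT y|lborel. grad g y \<bullet> grad \<phi> y)"
proof -
  have p0: "pd i \<phi> y = 0" if "y \<notin> cball a r" for i y by (rule pd_outside[OF closed_cball 0 that])
  have p1: "pd i (pd i \<phi>) y = 0" if "y \<notin> cball a r" for i y by (rule pd_outside[OF closed_cball p0 that])
  note c = smooth_continuous continuous_on_subset[OF smooth_continuous subset_UNIV]
  have i1: "integrable lborel (\<lambda>y. g y * pd i (pd i \<phi>) y)" for i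
    by (rule integrable_compact_support[OF _ compact_cball[of a r]])
       (auto intro!: c smooth_mult g \<phi> smooth_pd simp: p1)
  have i2: "integrable lborel (\<lambda>y. pd i g y * pd i \<phi> y)" for i
    by (rule integrable_compact_support[OF _ compact_cball[of a r]])
       (auto intro!: c smooth_mult g \<phi> smooth_pd simp: p0)
  have "(LINT y|lborel. g y * lap \<phi> y) = (\<Sum>i\<in>UNIV. LINT y|lborel. g y * pd i (pd i \<phi>) y)"
    using i1 by (simp add: lap_def sum_distrib_left)
  also have "\<dots> = (\<Sum>i\<in>UNIV. - (LINT y|lborel. pd i g y * pd i \<phi> y))"
    by (intro sum.cong refl integral_by_parts[OF smooth_differentiable[OF g] smooth_continuous[OF smooth_pd[OF g]]
         smooth_differentiable[OF smooth_pd[OF \<phi>]] smooth_continuous[OF smooth_pd[OF smooth_pd[OF \<phi>]]]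
         compact_cball p0])
  also have "\<dots> = - (LINT y|lborel. grad g y \<bullet> grad \<phi> y)"
    using i2 by (simp add: inner_vec_def sum_negf)
  finally show ?thesis .
qed

lemma grad_diff_affine:
  fixes f :: "real^'d \<Rightarrow> real"
  assumes f: "smooth f"
  shows "smooth (\<lambda>x. f x - (b + q \<bullet> x))" "grad (\<lambda>x. f x - (b + q \<bullet> x)) x = grad f x - q"
proof -
  show "smooth (\<lambda>x. f x - (b + q \<bullet> x))"
    by (intro smooth_diff smooth_add f smooth_const smooth_inner)
  have "((\<lambda>x. f x - (b + q \<bullet> x)) has_derivative (\<lambda>h. grad f x \<bullet> h - (0 + q \<bullet> h))) (at x)"
    by (intro has_derivative_diff has_derivative_add has_derivative_const has_derivative_grad_smooth[OF f]
         has_derivative_inner_right has_derivative_ident)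
  from pd_eqI[OF this] show "grad (\<lambda>x. f x - (b + q \<bullet> x)) x = grad f x - q"
    by (simp add: vec_eq_iff inner_axis)
qed

text \<open>The test function is f minus the affine function, times \<eta>^2, as for harmonic
  functions. The right-hand side contains the energy G of the test function itself, which is at most
  2 X + 8 Y, with X the weighted energy and Y the cut-off term. The weight 1/8 in front of G brings
  back only X/4, which is absorbed by the X/2 on the left.\<close>

lemma caccioppoli:
  fixes f \<eta> :: "real^'d \<Rightarrow> real"
  assumes f: "smooth f" and \<eta>: "smooth \<eta>" "\<And>y. 0 \<le> \<eta> y" "\<And>y. \<eta> y \<le> 1"
    and 0: "\<And>y. y \<notin> cball a r \<Longrightarrow> \<eta> y = 0"
    and A: "\<And>\<phi>. smooth \<phi> \<Longrightarrow> (\<And>y. y \<notin> cball a r \<Longrightarrow> \<phi> y = 0) \<Longrightarrow>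
      (LINT y|lborel. f y * lap \<phi> y)\<^sup>2 \<le> A * (LINT y|lborel. (norm (grad \<phi> y))\<^sup>2)" "A \<ge> 0"
  shows "(LINT y|lborel. (\<eta> y)\<^sup>2 * (norm (grad f y - q))\<^sup>2) \<le>
     12 * (LINT y|lborel. (f y - (b + q \<bullet> y))\<^sup>2 * (norm (grad \<eta> y))\<^sup>2) + 8 * A"
proof -
  define w where "w x = f x - (b + q \<bullet> x)" for x
  have w: "smooth w" and gw: "grad w x = grad f x - q" for x
    unfolding w_def[abs_def] by (rule grad_diff_affine[OF f])+
  define \<phi> where "\<phi> x = w x * (\<eta> x)\<^sup>2" for x
  have \<phi>: "smooth \<phi>" unfolding \<phi>_def[abs_def] by (intro smooth_mult smooth_power2 w \<eta>)
  have \<phi>0: "\<phi> y = 0" if "y \<notin> cball a r" for y using 0 that by (simp add: \<phi>_def)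
  have g\<phi>: "grad \<phi> y = (\<eta> y)\<^sup>2 *\<^sub>R grad w y + (2 * w y * \<eta> y) *\<^sub>R grad \<eta> y" for y
  proof -
    have 1: "pd i (\<lambda>y. \<eta> y * \<eta> y) y = pd i \<eta> y * \<eta> y + \<eta> y * pd i \<eta> y" for i
      by (rule pd_mult) (intro smooth_differentiable \<eta>)+
    have 2: "pd i (\<lambda>y. w y * (\<eta> y * \<eta> y)) y = pd i w y * (\<eta> y * \<eta> y) + w y * pd i (\<lambda>y. \<eta> y * \<eta> y) y" for i
      by (rule pd_mult) (intro smooth_differentiable smooth_mult \<eta> w)+
    have "\<phi> = (\<lambda>y. w y * (\<eta> y * \<eta> y))" by (auto simp: \<phi>_def power2_eq_square)
    then have "pd i \<phi> y = pd i w y * (\<eta> y * \<eta> y) + w y * (pd i \<eta> y * \<eta> y + \<eta> y * pd i \<eta> y)" for i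
      by (simp only: 1 2)
    then show ?thesis
      unfolding vec_eq_iff power2_eq_square by (simp add: algebra_simps)
  qed
  note c = continuous_on_subset[OF smooth_continuous subset_UNIV] continuous_on_subset[OF continuous_grad subset_UNIV]
  have cc: "continuous_on S w" "continuous_on S \<eta>" "continuous_on S (grad w)" "continuous_on S (grad \<eta>)"
     "continuous_on S (grad \<phi>)" for S
    by (intro c w \<eta> \<phi>)+
  have g\<eta>0: "grad \<eta> y = 0" if "y \<notin> cball a r" for y by (rule grad_outside[OF closed_cball 0 that])
  have g\<phi>0: "grad \<phi> y = 0" if "y \<notin> cball a r" for y by (rule grad_outside[OF closed_cball \<phi>0 that])
  have iX: "integrable lborel (\<lambda>y. (\<eta> y)\<^sup>2 * (norm (grad w y))\<^sup>2)"
    by (rule integrable_compact_support[OF _ compact_cball[of a r]])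
       (auto intro!: continuous_intros cc simp: 0)
  have iY: "integrable lborel (\<lambda>y. (w y)\<^sup>2 * (norm (grad \<eta> y))\<^sup>2)"
    by (rule integrable_compact_support[OF _ compact_cball[of a r]])
       (auto intro!: continuous_intros cc simp: g\<eta>0)
  have iG: "integrable lborel (\<lambda>y. (norm (grad \<phi> y))\<^sup>2)" "integrable lborel (\<lambda>y. grad w y \<bullet> grad \<phi> y)"
    by (rule integrable_compact_support[OF _ compact_cball[of a r]];
        auto intro!: continuous_intros cc simp: g\<phi>0)+
  define X where "X = (LINT y|lborel. (\<eta> y)\<^sup>2 * (norm (grad w y))\<^sup>2)"
  define Y where "Y = (LINT y|lborel. (w y)\<^sup>2 * (norm (grad \<eta> y))\<^sup>2)"
  define G where "G = (LINT y|lborel. (norm (grad \<phi> y))\<^sup>2)"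
  \<comment> \<open>An affine function does not contribute: after one integration by parts its
    pairing with the Laplacian of \<phi> is a combination of integrals of partial derivatives of
    \<phi>, all of them zero.\<close>
  have fl: "(LINT y|lborel. f y * lap \<phi> y) = (LINT y|lborel. w y * lap \<phi> y)"
  proof -
    have l: "smooth (\<lambda>x. b + q \<bullet> x)" by (intro smooth_add smooth_const smooth_inner)
    have gl: "grad (\<lambda>x. b + q \<bullet> x) y = q" for y
    proof -
      have "((\<lambda>x. b + q \<bullet> x) has_derivative (\<lambda>h. 0 + q \<bullet> h)) (at y)"
        by (intro has_derivative_add has_derivative_const has_derivative_inner_right has_derivative_ident)
      from pd_eqI[OF this] show ?thesis by (simp add: vec_eq_iff inner_axis)
    qed
    have lap0: "lap \<phi> y = 0" if "y \<notin> cball a r" for y by (rule lap_outside[OF closed_cball \<phi>0 that])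
    have p0: "pd i \<phi> y = 0" if "y \<notin> cball a r" for y i by (rule pd_outside[OF closed_cball \<phi>0 that])
    have "(LINT y|lborel. (b + q \<bullet> y) * lap \<phi> y) = - (LINT y|lborel. q \<bullet> grad \<phi> y)"
      using green[OF l \<phi> \<phi>0] by (simp add: gl)
    also have "(LINT y|lborel. q \<bullet> grad \<phi> y) = (\<Sum>i\<in>UNIV. q $ i * (LINT y|lborel. pd i \<phi> y))"
    proof -
      have "integrable lborel (\<lambda>y. q $ i * pd i \<phi> y)" for i
        by (rule integrable_compact_support[OF _ compact_cball[of a r]])
           (auto intro!: c smooth_cmult smooth_pd \<phi> simp: p0)
      then show ?thesis by (simp add: inner_vec_def)
    qed
    also have "\<dots> = 0"
    proof -
      have "(LINT y|lborel. pd i \<phi> y) = 0" for i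
        by (rule integral_pd_eq_0[OF smooth_differentiable[OF \<phi>] smooth_continuous[OF smooth_pd[OF \<phi>]] compact_cball \<phi>0])
      then show ?thesis by simp
    qed
    finally have z: "(LINT y|lborel. (b + q \<bullet> y) * lap \<phi> y) = 0" by simp
    have i1: "integrable lborel (\<lambda>y. f y * lap \<phi> y)" "integrable lborel (\<lambda>y. (b + q \<bullet> y) * lap \<phi> y)"
      by (rule integrable_compact_support[OF _ compact_cball[of a r]];
          auto intro!: c smooth_mult smooth_add smooth_const smooth_inner smooth_lap f \<phi> simp: lap0)+
    have "(LINT y|lborel. w y * lap \<phi> y) = (LINT y|lborel. f y * lap \<phi> y - (b + q \<bullet> y) * lap \<phi> y)"
      by (simp add: w_def left_diff_distrib)
    also have "\<dots> = (LINT y|lborel. f y * lap \<phi> y)" using i1 z by simp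
    finally show ?thesis ..
  qed
  have cs: "2 * \<bar>(w y * \<eta> y) * (grad w y \<bullet> grad \<eta> y)\<bar> \<le>
      1/2 * ((\<eta> y)\<^sup>2 * (norm (grad w y))\<^sup>2) + 2 * ((w y)\<^sup>2 * (norm (grad \<eta> y))\<^sup>2)" for y
  proof -
    have "\<bar>(w y * \<eta> y) * (grad w y \<bullet> grad \<eta> y)\<bar> \<le> \<bar>w y * \<eta> y\<bar> * (norm (grad w y) * norm (grad \<eta> y))"
      unfolding abs_mult by (intro mult_left_mono Cauchy_Schwarz_ineq2) auto
    also have "\<dots> = (\<bar>\<eta> y\<bar> * norm (grad w y)) * (\<bar>w y\<bar> * norm (grad \<eta> y))" by (simp add: abs_mult)
    finally have 1: "\<bar>(w y * \<eta> y) * (grad w y \<bullet> grad \<eta> y)\<bar> \<le> (\<bar>\<eta> y\<bar> * norm (grad w y)) * (\<bar>w y\<bar> * norm (grad \<eta> y))" .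
    have "0 \<le> ((\<bar>\<eta> y\<bar> * norm (grad w y)) - 2 * (\<bar>w y\<bar> * norm (grad \<eta> y)))\<^sup>2" by simp
    then have "4 * ((\<bar>\<eta> y\<bar> * norm (grad w y)) * (\<bar>w y\<bar> * norm (grad \<eta> y))) \<le>
       (\<bar>\<eta> y\<bar> * norm (grad w y))\<^sup>2 + 4 * (\<bar>w y\<bar> * norm (grad \<eta> y))\<^sup>2"
      by (simp add: power2_diff power_mult_distrib)
    with 1 show ?thesis by (simp add: power_mult_distrib)
  qed
  have "1/2 * X - 2 * Y = (LINT y|lborel. 1/2 * ((\<eta> y)\<^sup>2 * (norm (grad w y))\<^sup>2) - 2 * ((w y)\<^sup>2 * (norm (grad \<eta> y))\<^sup>2))"
    using iX iY by (simp add: X_def Y_def)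
  also have "\<dots> \<le> (LINT y|lborel. grad w y \<bullet> grad \<phi> y)"
  proof (rule integral_mono)
    fix y
    have "grad w y \<bullet> grad \<phi> y = (\<eta> y)\<^sup>2 * (norm (grad w y))\<^sup>2 + 2 * ((w y * \<eta> y) * (grad w y \<bullet> grad \<eta> y))"
      by (simp add: g\<phi> inner_add_right power2_norm_eq_inner)
    then show "1/2 * ((\<eta> y)\<^sup>2 * (norm (grad w y))\<^sup>2) - 2 * ((w y)\<^sup>2 * (norm (grad \<eta> y))\<^sup>2) \<le> grad w y \<bullet> grad \<phi> y"
      using cs[of y] by linarith
  qed (use iX iY iG in auto)
  also have "\<dots> = - (LINT y|lborel. f y * lap \<phi> y)" unfolding fl using green[OF w \<phi> \<phi>0] by simp
  also have "\<dots> \<le> \<bar>LINT y|lborel. f y * lap \<phi> y\<bar>" by simp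
  \<comment> \<open>The square root of A G is at most the arithmetic mean of 4 A and G/4, because (2
    A + G/8)^2 = (2 A - G/8)^2 + A G.\<close>
  also have "\<dots> \<le> 2 * A + G / 8"
  proof (rule abs_le_square_iff[THEN iffD2, THEN order_trans])
    have G0: "G \<ge> 0" unfolding G_def by (intro integral_nonneg_AE) auto
    have "0 \<le> (2 * A - G / 8)\<^sup>2" by simp
    then have "A * G \<le> (2 * A + G / 8)\<^sup>2" by (simp add: power2_eq_square field_simps)
    then show "(LINT y|lborel. f y * lap \<phi> y)\<^sup>2 \<le> (2 * A + G / 8)\<^sup>2"
      using A(1)[OF \<phi> \<phi>0] by (simp add: G_def)
    show "\<bar>2 * A + G / 8\<bar> \<le> 2 * A + G / 8" using G0 A by simp
  qed
  finally have 1: "1/2 * X - 2 * Y \<le> 2 * A + G / 8" .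
  have "G \<le> (LINT y|lborel. 2 * ((\<eta> y)\<^sup>2 * (norm (grad w y))\<^sup>2) + 8 * ((w y)\<^sup>2 * (norm (grad \<eta> y))\<^sup>2))"
    unfolding G_def
  proof (rule integral_mono)
    fix y
    have e1: "\<eta> y * \<eta> y \<le> 1" using \<eta>(2,3)[of y] by (simp add: mult_le_one)
    define p where "p = (\<eta> y)\<^sup>2 *\<^sub>R grad w y"
    define s where "s = (2 * w y * \<eta> y) *\<^sub>R grad \<eta> y"
    have "(norm (p + s))\<^sup>2 \<le> 2 * (norm p)\<^sup>2 + 2 * (norm s)\<^sup>2"
    proof -
      have "0 \<le> (norm (p - s))\<^sup>2" by simp
      then show ?thesis by (simp add: power2_norm_eq_inner inner_add inner_diff inner_commute)
    qed
    moreover have "(norm p)\<^sup>2 \<le> (\<eta> y)\<^sup>2 * (norm (grad w y))\<^sup>2"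
    proof -
      have "(norm p)\<^sup>2 = (\<eta> y * \<eta> y) * ((\<eta> y)\<^sup>2 * (norm (grad w y))\<^sup>2)"
        by (simp add: p_def power_mult_distrib power2_eq_square)
      also have "\<dots> \<le> 1 * ((\<eta> y)\<^sup>2 * (norm (grad w y))\<^sup>2)" by (intro mult_right_mono e1) auto
      finally show ?thesis by simp
    qed
    moreover have "(norm s)\<^sup>2 \<le> 4 * ((w y)\<^sup>2 * (norm (grad \<eta> y))\<^sup>2)"
    proof -
      have "(norm s)\<^sup>2 = (\<eta> y * \<eta> y) * (4 * ((w y)\<^sup>2 * (norm (grad \<eta> y))\<^sup>2))"
        by (simp add: s_def power_mult_distrib power2_eq_square)
      also have "\<dots> \<le> 1 * (4 * ((w y)\<^sup>2 * (norm (grad \<eta> y))\<^sup>2))" by (intro mult_right_mono e1) auto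
      finally show ?thesis by simp
    qed
    ultimately show "(norm (grad \<phi> y))\<^sup>2 \<le> 2 * ((\<eta> y)\<^sup>2 * (norm (grad w y))\<^sup>2) + 8 * ((w y)\<^sup>2 * (norm (grad \<eta> y))\<^sup>2)"
      unfolding g\<phi> p_def[symmetric] s_def[symmetric] by linarith
  qed (use iX iY iG in auto)
  also have "\<dots> = 2 * X + 8 * Y" using iX iY by (simp add: X_def Y_def)
  finally have "X \<le> 12 * Y + 8 * A" using 1 by linarith
  then show ?thesis by (simp add: X_def Y_def gw w_def)
qed

text \<open>
  Testing the gradient with \<open>arctan(f/t)\<close>, whose derivative concentrates on the zero set of \<open>f\<close>
  as \<open>t\<close> tends to 0, expresses that the gradient vanishes almost everywhere on that set.
\<close>

lemma zero_set_energy: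
  fixes f \<zeta> :: "real^'d \<Rightarrow> real"
  assumes f: "smooth f" and \<zeta>: "smooth \<zeta>" "\<And>y. 0 \<le> \<zeta> y" and 0: "\<And>y. y \<notin> cball a r \<Longrightarrow> \<zeta> y = 0"
    and t: "t > 0"
  shows "(norm q)\<^sup>2 * (LINT y|lborel. \<zeta> y / (1 + (f y / t)\<^sup>2)) \<le>
     (LINT y|lborel. \<zeta> y * (norm (grad f y - q))\<^sup>2) + 4 * t * norm q * (LINT y|lborel. norm (grad \<zeta> y))"
proof -
  \<comment> \<open>\<open>T\<close> is bounded by a multiple of \<open>t\<close>, while the factor
    \<open>T'\<close> of its gradient equals one where \<open>f\<close> vanishes. Moving the
    derivative from \<open>T\<close> to \<zeta> therefore costs only an error of order
    \<open>t\<close>.\<close>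
  define T where "T y = t * arctan (f y / t)" for y
  define T' where "T' y = 1 / (1 + (f y / t)\<^sup>2)" for y
  have den: "1 + (f y / t)\<^sup>2 \<noteq> 0" for y using sum_power2_gt_zero_iff[of 1 "f y / t"] by simp
  have T'0: "0 \<le> T' y" "T' y \<le> 1" for y
  proof -
    have "1 / (1 + z) \<le> 1" if "z \<ge> 0" for z :: real using that by (simp add: divide_le_eq_1)
    from this[OF zero_le_power2] show "T' y \<le> 1" by (simp only: T'_def)
  qed (simp add: T'_def)
  have Td: "((\<lambda>s. t * arctan (s / t)) has_real_derivative T' y) (at (f y))" for y
  proof -
    have "((\<lambda>s. t * arctan (s / t)) has_real_derivative t * (inverse (1 + (f y / t)\<^sup>2) * (1 / t))) (at (f y))"
      by (intro DERIV_cmult DERIV_chain2[OF DERIV_arctan] DERIV_cdivide DERIV_ident)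
    moreover have "t * (inverse (1 + (f y / t)\<^sup>2) * (1 / t)) = T' y"
      using t by (simp add: T'_def inverse_eq_divide)
    ultimately show ?thesis by simp
  qed
  have Tdiff: "T differentiable (at y)" for y
    unfolding T_def[abs_def] differentiable_def
    using has_derivative_compose[OF has_derivative_grad_smooth[OF f] Td[unfolded has_field_derivative_def]] by blast
  have pT: "pd i T = (\<lambda>y. T' y * pd i f y)" for i
    unfolding T_def[abs_def] by (rule ext, rule pd_comp[OF smooth_differentiable[OF f] Td])
  note c = continuous_on_subset[OF smooth_continuous subset_UNIV] continuous_on_subset[OF continuous_grad subset_UNIV]
  have cT': "continuous_on S T'" for S
    unfolding T'_def[abs_def] using t den by (intro continuous_intros c f) auto
  have cT: "continuous_on S T" for S
    unfolding T_def[abs_def] using t by (intro continuous_intros c f) auto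
  have p0: "pd i \<zeta> y = 0" if "y \<notin> cball a r" for y i by (rule pd_outside[OF closed_cball 0 that])
  have g0: "grad \<zeta> y = 0" if "y \<notin> cball a r" for y by (rule grad_outside[OF closed_cball 0 that])
  have cp: "continuous_on UNIV (pd i T)" for i
    unfolding pT by (intro continuous_intros cT' c smooth_pd f)
  have ibp: "(LINT y|lborel. T y * pd i \<zeta> y) = - (LINT y|lborel. T' y * pd i f y * \<zeta> y)" for i
  proof -
    have "(LINT y|lborel. T y * pd i \<zeta> y) = - (LINT y|lborel. pd i T y * \<zeta> y)"
      by (rule integral_by_parts[OF Tdiff cp smooth_differentiable[OF \<zeta>(1)]
            smooth_continuous[OF smooth_pd[OF \<zeta>(1)]] compact_cball 0])
    then show ?thesis by (simp only: fun_cong[OF pT])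
  qed
  note I = integrable_compact_support[OF _ compact_cball[of a r]]
  have cc: "continuous_on S f" "continuous_on S \<zeta>" "continuous_on S (grad f)" "continuous_on S (grad \<zeta>)"
     "continuous_on S (pd i f)" "continuous_on S (pd i \<zeta>)" for S i
    by (intro c f \<zeta> smooth_pd)+
  have i1: "integrable lborel (\<lambda>y. T y * pd i \<zeta> y)" "integrable lborel (\<lambda>y. T' y * pd i f y * \<zeta> y)" for i
    by (rule I; auto intro!: continuous_intros cT cT' cc simp: p0 0)+
  have i2: "integrable lborel (\<lambda>y. T y * (q \<bullet> grad \<zeta> y))" "integrable lborel (\<lambda>y. T' y * (q \<bullet> grad f y) * \<zeta> y)"
    by (rule I; auto intro!: continuous_intros cT cT' cc simp: g0 0)+
  have i3: "integrable lborel (\<lambda>y. \<zeta> y * T' y)" "integrable lborel (\<lambda>y. \<zeta> y * (norm (grad f y - q))\<^sup>2)"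
     "integrable lborel (\<lambda>y. norm (grad \<zeta> y))"
    by (rule I; auto intro!: continuous_intros cT cT' cc simp: g0 0)+
  have "(LINT y|lborel. T y * (q \<bullet> grad \<zeta> y)) = (\<Sum>i\<in>UNIV. q $ i * (LINT y|lborel. T y * pd i \<zeta> y))"
  proof -
    have "(\<lambda>y. T y * (q \<bullet> grad \<zeta> y)) = (\<lambda>y. \<Sum>i\<in>UNIV. q $ i * (T y * pd i \<zeta> y))"
      by (auto simp: inner_vec_def sum_distrib_left ac_simps)
    then show ?thesis using i1 by simp
  qed
  also have "\<dots> = - (\<Sum>i\<in>UNIV. q $ i * (LINT y|lborel. T' y * pd i f y * \<zeta> y))"
    by (simp add: ibp sum_negf)
  also have "(\<Sum>i\<in>UNIV. q $ i * (LINT y|lborel. T' y * pd i f y * \<zeta> y)) = (LINT y|lborel. T' y * (q \<bullet> grad f y) * \<zeta> y)"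
  proof -
    have "(\<lambda>y. T' y * (q \<bullet> grad f y) * \<zeta> y) = (\<lambda>y. \<Sum>i\<in>UNIV. q $ i * (T' y * pd i f y * \<zeta> y))"
      by (auto simp: inner_vec_def sum_distrib_left sum_distrib_right ac_simps)
    then show ?thesis using i1 by simp
  qed
  finally have e: "(LINT y|lborel. T' y * (q \<bullet> grad f y) * \<zeta> y) = - (LINT y|lborel. T y * (q \<bullet> grad \<zeta> y))" by simp
  have "1/2 * (norm q)\<^sup>2 * (LINT y|lborel. \<zeta> y * T' y) - 1/2 * (LINT y|lborel. \<zeta> y * (norm (grad f y - q))\<^sup>2) =
     (LINT y|lborel. 1/2 * (norm q)\<^sup>2 * (\<zeta> y * T' y) - 1/2 * (\<zeta> y * (norm (grad f y - q))\<^sup>2))"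
    using i3 by simp
  also have "\<dots> \<le> (LINT y|lborel. T' y * (q \<bullet> grad f y) * \<zeta> y)"
  proof (rule integral_mono)
    fix y
    have 0: "\<zeta> y * T' y * (norm (grad f y - q))\<^sup>2 \<le> \<zeta> y * 1 * (norm (grad f y - q))\<^sup>2"
      using \<zeta>(2) T'0 by (intro mult_right_mono mult_left_mono) auto
    \<comment> \<open>Dropping the square of the gradient leaves the term that is linear in it;
      together with the weight \<open>T'\<close> this is a derivative of \<open>T\<close> and can be
      integrated by parts.\<close>
    have "1/2 * (norm q)\<^sup>2 - 1/2 * (norm (grad f y - q))\<^sup>2 = q \<bullet> grad f y - 1/2 * (norm (grad f y))\<^sup>2"
      by (simp add: power2_norm_eq_inner inner_diff inner_commute field_simps)
    then have "1/2 * (norm q)\<^sup>2 - 1/2 * (norm (grad f y - q))\<^sup>2 \<le> q \<bullet> grad f y"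
      using zero_le_power2[of "norm (grad f y)"] by linarith
    then have "(\<zeta> y * T' y) * (1/2 * (norm q)\<^sup>2 - 1/2 * (norm (grad f y - q))\<^sup>2) \<le> (\<zeta> y * T' y) * (q \<bullet> grad f y)"
      using \<zeta>(2) T'0 by (intro mult_left_mono) auto
    with 0 show "1/2 * (norm q)\<^sup>2 * (\<zeta> y * T' y) - 1/2 * (\<zeta> y * (norm (grad f y - q))\<^sup>2) \<le> T' y * (q \<bullet> grad f y) * \<zeta> y"
      by (simp add: algebra_simps)
  qed (use i2 i3 in auto)
  also have "\<dots> \<le> norm (LINT y|lborel. T y * (q \<bullet> grad \<zeta> y))" unfolding e by simp
  also have "\<dots> \<le> (LINT y|lborel. 2 * t * norm q * norm (grad \<zeta> y))"
  proof (rule Bochner_Integration.integral_norm_bound_integral)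
    fix y
    have "\<bar>arctan (f y / t)\<bar> \<le> 2" using arctan_bounded[of "f y / t"] pi_less_4 by linarith
    then have "\<bar>T y\<bar> \<le> t * 2" using t by (simp add: T_def abs_mult)
    moreover have "\<bar>q \<bullet> grad \<zeta> y\<bar> \<le> norm q * norm (grad \<zeta> y)" by (rule Cauchy_Schwarz_ineq2)
    ultimately have "\<bar>T y\<bar> * \<bar>q \<bullet> grad \<zeta> y\<bar> \<le> (t * 2) * (norm q * norm (grad \<zeta> y))"
      using t by (intro mult_mono) auto
    then show "norm (T y * (q \<bullet> grad \<zeta> y)) \<le> 2 * t * norm q * norm (grad \<zeta> y)"
      by (simp add: abs_mult mult.assoc mult.left_commute)
  qed (use i2 i3 in auto)
  also have "\<dots> = 2 * t * norm q * (LINT y|lborel. norm (grad \<zeta> y))" by simp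
  finally show ?thesis by (simp add: T'_def)
qed

text \<open>Uniform continuity of \<open>u\<close> on a ball slightly larger than \<open>K\<close>;
  restricting to scales below one keeps all averages inside that ball.\<close>

lemma conv_uniform:
  fixes u :: "real^'d \<Rightarrow> real"
  assumes u: "continuous_on UNIV u" and K: "compact K" and e: "e > 0"
  obtains s0 where "s0 > 0" "\<And>s x. 0 < s \<Longrightarrow> s < s0 \<Longrightarrow> x \<in> K \<Longrightarrow> \<bar>conv u (ker s) x - u x\<bar> \<le> e"
proof -
  obtain M where M: "\<And>x. x \<in> K \<Longrightarrow> norm x \<le> M" using compact_imp_bounded[OF K] bounded_iff by metis
  have "uniformly_continuous_on (cball 0 (M + 1)) u"
    by (intro compact_uniformly_continuous continuous_on_subset[OF u]) auto
  then obtain d where d: "d > 0" "\<And>x y. x \<in> cball 0 (M + 1) \<Longrightarrow> y \<in> cball 0 (M + 1) \<Longrightarrow> dist y x < d \<Longrightarrow> dist (u y) (u x) < e"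
    unfolding uniformly_continuous_on_def using e by metis
  show ?thesis
  proof (rule that[of "min d 1"])
    show "min d 1 > 0" using d by simp
    fix s x assume s: "0 < s" "s < min d 1" and x: "x \<in> K"
    have i: "integrable lborel (\<lambda>y. u y * ker s (x - y))" by (rule conv_ker_integrable[OF u s(1)])
    have i': "integrable lborel (\<lambda>y. ker s (x - y))"
      using conv_ker_integrable[OF continuous_on_const s(1), of 1 x] by simp
    have "conv u (ker s) x - u x = (LINT y|lborel. u y * ker s (x - y) - u x * ker s (x - y))"
      using i i' integral_ker'[OF s(1), of x] by (simp add: conv_def)
    also have "norm \<dots> \<le> (LINT y|lborel. e * ker s (x - y))"
    proof (rule Bochner_Integration.integral_norm_bound_integral)
      fix y
      show "norm (u y * ker s (x - y) - u x * ker s (x - y)) \<le> e * ker s (x - y)"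
      proof (cases "y \<in> cball x s")
        case True
        then have "dist y x < d" using s by (simp add: dist_commute)
        moreover have "norm x \<le> M" by (rule M[OF x])
        moreover have "norm y \<le> M + 1"
          using True M[OF x] s norm_triangle_ineq2[of y x] by (simp add: dist_norm norm_minus_commute)
        ultimately have "\<bar>u y - u x\<bar> \<le> e" using d(2)[of x y] by (simp add: dist_norm)
        then have "\<bar>u y - u x\<bar> * ker s (x - y) \<le> e * ker s (x - y)"
          by (intro mult_right_mono ker_nonneg s)
        then show ?thesis using ker_nonneg[OF s(1), of "x - y"] by (simp add: abs_mult flip: left_diff_distrib)
      next
        case False
        have "ker s (x - y) = 0" by (rule ker_outside_diff[OF s(1) False])
        then show ?thesis by simp
      qed
    qed (use i i' in auto)
    also have "\<dots> = e" using integral_ker'[OF s(1), of x] by simp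
    finally show "\<bar>conv u (ker s) x - u x\<bar> \<le> e" by simp
  qed
qed

section \<open>Approximate mean value property\<close>

text \<open>The scale derivative of s^(-d) kap(z/s) is -s^(-d-1) times d kap + y . grad kap,
  evaluated at y = z/s, which \<open>lap_pot\<close> identifies as a Laplacian.\<close>

lemma ker_has_derivative:
  fixes z :: "real^'d"
  assumes "\<sigma> > 0"
  shows "((\<lambda>\<sigma>. ker \<sigma> z) has_real_derivative inverse \<sigma> ^ Suc CARD('d) * lap pot (inverse \<sigma> *\<^sub>R z)) (at \<sigma>)"
proof -
  define n where "n = CARD('d)"
  have n: "n > 0" by (simp add: n_def)
  have i: "(inverse has_real_derivative - (inverse \<sigma> ^ 2)) (at \<sigma>)"
    using DERIV_inverse[of \<sigma>] assms by (simp add: power2_eq_square)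
  have k: "((\<lambda>t. kap (0 + t *\<^sub>R z)) has_real_derivative (grad kap (0 + inverse \<sigma> *\<^sub>R z) \<bullet> z)) (at (inverse \<sigma>))"
    by (rule has_real_derivative_line[OF smooth_differentiable[OF smooth_kap]])
  have "((\<lambda>\<sigma>. inverse \<sigma> ^ n * kap (0 + inverse \<sigma> *\<^sub>R z)) has_real_derivative
     (of_nat n * (- (inverse \<sigma> ^ 2) * inverse \<sigma> ^ (n - Suc 0))) * kap (0 + inverse \<sigma> *\<^sub>R z) +
     (grad kap (0 + inverse \<sigma> *\<^sub>R z) \<bullet> z) * (- (inverse \<sigma> ^ 2)) * inverse \<sigma> ^ n) (at \<sigma>)"
    by (intro DERIV_mult DERIV_power i DERIV_chain2[OF k i])
  moreover have "(of_nat n * (- (inverse \<sigma> ^ 2) * inverse \<sigma> ^ (n - Suc 0))) * kap (0 + inverse \<sigma> *\<^sub>R z) +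
     (grad kap (0 + inverse \<sigma> *\<^sub>R z) \<bullet> z) * (- (inverse \<sigma> ^ 2)) * inverse \<sigma> ^ n =
     inverse \<sigma> ^ Suc n * lap pot (inverse \<sigma> *\<^sub>R z)"
  proof -
    have "inverse \<sigma> ^ 2 * inverse \<sigma> ^ (n - Suc 0) = inverse \<sigma> ^ Suc n"
      using n by (simp flip: power_add)
    then have e: "- (inverse \<sigma> ^ 2) * inverse \<sigma> ^ (n - Suc 0) = - (inverse \<sigma> ^ Suc n)" by simp
    show ?thesis
      unfolding e by (simp add: lap_pot n_def[symmetric] algebra_simps power2_eq_square)
  qed
  ultimately show ?thesis by (simp add: ker_def n_def)
qed

lemma integral_cbox_eq_lborel:
  fixes f :: "'a::euclidean_space \<Rightarrow> real"
  assumes "integrable lborel f" "\<And>y. y \<notin> cbox a b \<Longrightarrow> f y = 0"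
  shows "integral (cbox a b) f = integral\<^sup>L lborel f"
proof -
  have "(\<lambda>x. if x \<in> cbox a b then f x else 0) = f" using assms(2) by auto
  then have "(f has_integral integral\<^sup>L lborel f) (cbox a b)"
    using has_integral_integral_lborel[OF assms(1)] has_integral_restrict_UNIV[of "cbox a b" f] by simp
  then show ?thesis by (rule integral_unique)
qed

lemma lap_pot_outside: "x \<notin> cball 0 1 \<Longrightarrow> lap pot x = 0"
  by (rule lap_outside[OF closed_cball[of 0 1]]) (auto intro!: pot_outside)

lemma conv_ker_has_derivative:
  fixes u :: "real^'d \<Rightarrow> real"
  assumes u: "continuous_on UNIV u" and \<sigma>: "\<sigma> > 0"
  shows "((\<lambda>\<sigma>. conv u (ker \<sigma>) x) has_real_derivative
     (LINT y|lborel. u y * (inverse \<sigma> ^ Suc CARD('d) * lap pot (inverse \<sigma> *\<^sub>R (x - y))))) (at \<sigma>)"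
proof -
  \<comment> \<open>For scales in this interval all kernels live in the ball of radius 2 \<sigma>
    around \<open>x\<close>. One box \<open>cbox a b\<close> thus carries every integral, and
    differentiation under the integral sign applies on it.\<close>
  define U where "U = {0<..<2*\<sigma>}"
  obtain a b where ab: "cball x (2 * \<sigma>) \<subseteq> cbox a b"
    using bounded_subset_cbox_symmetric[OF bounded_cball] by metis
  have c: "continuous_on S u" for S by (rule continuous_on_subset[OF u]) simp
  have lc: "continuous_on UNIV (lap pot :: real^'d \<Rightarrow> real)" by (rule smooth_continuous[OF smooth_lap[OF smooth_pot]])
  have kc: "continuous_on UNIV (ker s :: real^'d \<Rightarrow> real)" for s by (rule smooth_continuous[OF smooth_ker])
  have zero1: "u y * ker s (x - y) = 0" if "s \<in> U" "y \<notin> cbox a b" for s y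
  proof -
    have "y \<notin> cball x s" using that ab subset_cball[of s "2 * \<sigma>" x] by (auto simp: U_def)
    then have "ker s (x - y) = 0" using that by (intro ker_outside_diff) (auto simp: U_def)
    then show ?thesis by simp
  qed
  have zero2: "lap pot (inverse \<sigma> *\<^sub>R (x - y)) = 0" if "y \<notin> cball x \<sigma>" for y
  proof (rule lap_pot_outside)
    show "inverse \<sigma> *\<^sub>R (x - y) \<notin> cball 0 1"
      unfolding mem_cball_0 using that \<sigma> by (simp add: dist_norm divide_simps)
  qed
  have "((\<lambda>s. integral (cbox a b) (\<lambda>y. u y * ker s (x - y))) has_field_derivative
     integral (cbox a b) (\<lambda>y. u y * (inverse \<sigma> ^ Suc CARD('d) * lap pot (inverse \<sigma> *\<^sub>R (x - y))))) (at \<sigma> within U)"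
  proof (rule leibniz_rule_field_derivative)
    show "((\<lambda>s. u y * ker s (x - y)) has_field_derivative
        u y * (inverse s ^ Suc CARD('d) * lap pot (inverse s *\<^sub>R (x - y)))) (at s within U)" if "s \<in> U" for s y
      by (rule has_field_derivative_at_within, rule DERIV_cmult, rule ker_has_derivative)
         (use that in \<open>auto simp: U_def\<close>)
    show "(\<lambda>y. u y * ker s (x - y)) integrable_on cbox a b" for s
      by (intro integrable_continuous continuous_intros c continuous_on_compose2[OF kc]) auto
    show "continuous_on (U \<times> cbox a b)
       (\<lambda>(s, y). u y * (inverse s ^ Suc CARD('d) * lap pot (inverse s *\<^sub>R (x - y))))"
      unfolding case_prod_beta
      by (intro continuous_intros continuous_on_compose2[OF u] continuous_on_compose2[OF lc]) (auto simp: U_def)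
    show "\<sigma> \<in> U" "convex U" using \<sigma> by (auto simp: U_def)
  qed
  moreover have "integral (cbox a b) (\<lambda>y. u y * (inverse \<sigma> ^ Suc CARD('d) * lap pot (inverse \<sigma> *\<^sub>R (x - y)))) =
     (LINT y|lborel. u y * (inverse \<sigma> ^ Suc CARD('d) * lap pot (inverse \<sigma> *\<^sub>R (x - y))))"
  proof (rule integral_cbox_eq_lborel)
    show "integrable lborel (\<lambda>y. u y * (inverse \<sigma> ^ Suc CARD('d) * lap pot (inverse \<sigma> *\<^sub>R (x - y))))"
      by (rule integrable_compact_support[OF _ compact_cball[of x \<sigma>]])
         (auto intro!: continuous_intros c continuous_on_compose2[OF lc] simp: zero2)
    show "u y * (inverse \<sigma> ^ Suc CARD('d) * lap pot (inverse \<sigma> *\<^sub>R (x - y))) = 0" if "y \<notin> cbox a b" for y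
    proof -
      have "y \<notin> cball x \<sigma>" using that ab subset_cball[of \<sigma> "2 * \<sigma>" x] \<sigma> by auto
      then show ?thesis by (simp add: zero2)
    qed
  qed
  moreover have "integral (cbox a b) (\<lambda>y. u y * ker s (x - y)) = conv u (ker s) x" if "s \<in> U" for s
    unfolding conv_def
    by (rule integral_cbox_eq_lborel) (use that conv_ker_integrable[OF u, of s x] zero1 in \<open>auto simp: U_def\<close>)
  ultimately have d: "((\<lambda>s. integral (cbox a b) (\<lambda>y. u y * ker s (x - y))) has_field_derivative
     (LINT y|lborel. u y * (inverse \<sigma> ^ Suc CARD('d) * lap pot (inverse \<sigma> *\<^sub>R (x - y))))) (at \<sigma> within U)"
    and e: "\<And>s. s \<in> U \<Longrightarrow> integral (cbox a b) (\<lambda>y. u y * ker s (x - y)) = conv u (ker s) x" by simp_all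
  have "((\<lambda>s. conv u (ker s) x) has_field_derivative
     (LINT y|lborel. u y * (inverse \<sigma> ^ Suc CARD('d) * lap pot (inverse \<sigma> *\<^sub>R (x - y))))) (at \<sigma> within U)"
    by (rule has_field_derivative_transform_within[OF d, of \<sigma>]) (use \<sigma> e in \<open>auto simp: U_def\<close>)
  moreover have "at \<sigma> within U = at \<sigma>" by (rule at_within_open) (use \<sigma> in \<open>auto simp: U_def\<close>)
  ultimately show ?thesis by simp
qed

text \<open>A constant that depends on the dimension alone; the argument of type
  \<open>itself\<close> carries that dimension.\<close>

definition pot_energy :: "'d::finite itself \<Rightarrow> real" where
  "pot_energy T = (LINT y|lborel. (norm (grad pot (y :: real^'d)))\<^sup>2)"

lemma pot_energy_nonneg: "pot_energy T \<ge> 0"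
  unfolding pot_energy_def by (intro integral_nonneg_AE) auto

text \<open>For a harmonic function the averages at all scales agree. Here their difference is s/2
  times the scale derivative at some intermediate \<sigma>, and that derivative pairs
  \<open>u\<close> with the Laplacian of the potential rescaled to radius \<sigma>, an admissible
  test function whose energy is of order \<sigma>^(d-2).\<close>

lemma mean_value_step:
  fixes u :: "real^'d \<Rightarrow> real"
  assumes w: "nearly_harmonic \<Lambda> x0 R u Z" and s: "s > 0" and sub: "cball x s \<subseteq> cball x0 R"
  shows "(conv u (ker (s/2)) x - conv u (ker s) x)\<^sup>2 \<le>
     2 ^ CARD('d) * pot_energy TYPE('d) * \<Lambda> * s\<^sup>2 * inverse s ^ CARD('d) * measure lborel (Z \<inter> cball x s)"
proof -
  define n where "n = CARD('d)"
  define F' where "F' \<sigma> = (LINT y|lborel. u y * (inverse \<sigma> ^ Suc n * lap pot (inverse \<sigma> *\<^sub>R (x - y))))" for \<sigma>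
  have "\<exists>\<sigma>>s/2. \<sigma> < s \<and> conv u (ker s) x - conv u (ker (s/2)) x = (s - s/2) * F' \<sigma>"
    unfolding F'_def n_def
  proof (rule MVT2)
    show "s/2 < s" using s by simp
    fix t assume "s/2 \<le> t" "t \<le> s"
    then have "t > 0" using s by linarith
    then show "((\<lambda>s. conv u (ker s) x) has_real_derivative
      (LINT y|lborel. u y * (inverse t ^ Suc CARD('d) * lap pot (inverse t *\<^sub>R (x - y))))) (at t)"
      by (rule conv_ker_has_derivative[OF nh_cont[OF w]])
  qed
  then obtain \<sigma> where \<sigma>: "s/2 < \<sigma>" "\<sigma> < s" "conv u (ker s) x - conv u (ker (s/2)) x = (s/2) * F' \<sigma>" by auto
  have \<sigma>0: "\<sigma> > 0" using \<sigma> s by linarith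
  define \<tau> where "\<tau> = inverse \<sigma>"
  have ts: "\<tau> * \<sigma> = 1" "\<tau> > 0" using \<sigma>0 by (auto simp: \<tau>_def)
  define \<phi> where "\<phi> y = pot ((- \<tau>) *\<^sub>R y + \<tau> *\<^sub>R x)" for y
  have \<phi>: "smooth \<phi>" unfolding \<phi>_def[abs_def] by (rule smooth_affine[OF smooth_pot])
  have arg: "(- \<tau>) *\<^sub>R y + \<tau> *\<^sub>R x = \<tau> *\<^sub>R (x - y)" for y by (simp add: algebra_simps)
  have l: "lap \<phi> y = \<tau>\<^sup>2 * lap pot (\<tau> *\<^sub>R (x - y))" for y
    using lap_affine[OF smooth_pot, of "- \<tau>" "\<tau> *\<^sub>R x" y] unfolding \<phi>_def[abs_def] by (simp only: arg power2_minus)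
  have g: "grad \<phi> y = (- \<tau>) *\<^sub>R grad pot (\<tau> *\<^sub>R (x - y))" for y
    using grad_affine[OF smooth_pot, of "- \<tau>" "\<tau> *\<^sub>R x" y] unfolding \<phi>_def[abs_def] by (simp only: arg)
  define I where "I = (LINT y|lborel. u y * lap \<phi> y)"
  define M where "M = measure lborel (Z \<inter> cball x s)"
  have F: "F' \<sigma> = \<tau> ^ n * \<sigma> * I"
  proof -
    have "u y * (\<tau> ^ Suc n * lap pot (\<tau> *\<^sub>R (x - y))) = \<tau> ^ n * \<sigma> * (u y * lap \<phi> y)" for y
    proof -
      have "\<tau> ^ n * \<sigma> * (u y * (\<tau>\<^sup>2 * L)) = (\<tau> * \<sigma>) * (u y * (\<tau> ^ Suc n * L))" for L
        by (simp add: power2_eq_square ac_simps)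
      then show ?thesis by (simp only: l ts mult_1_left)
    qed
    then have "F' \<sigma> = (LINT y|lborel. \<tau> ^ n * \<sigma> * (u y * lap \<phi> y))" by (simp only: F'_def \<tau>_def[symmetric])
    then show ?thesis by (simp add: I_def)
  qed
  have G: "(LINT y|lborel. (norm (grad \<phi> y))\<^sup>2) = \<sigma> ^ n * \<tau>\<^sup>2 * pot_energy TYPE('d)"
  proof -
    have "(LINT y|lborel. (norm (grad \<phi> y))\<^sup>2) =
       \<bar>- \<sigma>\<bar> ^ DIM(real^'d) * (LINT y|lborel. (norm (grad \<phi> (x + (- \<sigma>) *\<^sub>R y)))\<^sup>2)"
      using \<sigma>0 by (intro lborel_integral_affine borel_measurable_continuous_onI continuous_intros continuous_grad[OF \<phi>]) auto
    also have "(\<lambda>y. (norm (grad \<phi> (x + (- \<sigma>) *\<^sub>R y)))\<^sup>2) = (\<lambda>y. \<tau>\<^sup>2 * (norm (grad pot y))\<^sup>2)"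
      using ts by (auto simp: g power_mult_distrib)
    finally show ?thesis using \<sigma>0 by (simp add: pot_energy_def n_def)
  qed
  have "I\<^sup>2 \<le> \<Lambda> * measure lborel (Z \<inter> cball x \<sigma>) * (LINT y|lborel. (norm (grad \<phi> y))\<^sup>2)"
    unfolding I_def
  proof (rule nh_test[OF w \<phi>])
    show "\<phi> y = 0" if "y \<notin> cball x \<sigma>" for y
      unfolding \<phi>_def arg using that \<sigma>0 ts
      by (intro pot_outside) (simp add: dist_norm \<tau>_def divide_simps)
    show "cball x \<sigma> \<subseteq> cball x0 R" using sub \<sigma> by (meson less_imp_le order_trans subset_cball)
  qed
  also have "\<dots> \<le> \<Lambda> * M * (LINT y|lborel. (norm (grad \<phi> y))\<^sup>2)"
  proof (intro mult_right_mono mult_left_mono)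
    show "measure lborel (Z \<inter> cball x \<sigma>) \<le> M"
      unfolding M_def
    proof (rule measure_mono_fmeasurable)
      show "Z \<inter> cball x s \<in> fmeasurable lborel"
        by (intro fmeasurable_compact compact_Int_closed nh_compact[OF w] closed_cball)
    qed (use \<sigma> nh_compact[OF w] in \<open>auto intro!: borel_compact compact_Int_closed\<close>)
  qed (use nh_Lam[OF w] in \<open>auto intro!: integral_nonneg_AE\<close>)
  finally have I: "I\<^sup>2 \<le> \<Lambda> * M * (\<sigma> ^ n * \<tau>\<^sup>2 * pot_energy TYPE('d))" unfolding G .
  have "(F' \<sigma>)\<^sup>2 = (\<tau> ^ n * \<sigma>)\<^sup>2 * I\<^sup>2" by (simp add: F power_mult_distrib)
  also have "\<dots> \<le> (\<tau> ^ n * \<sigma>)\<^sup>2 * (\<Lambda> * M * (\<sigma> ^ n * \<tau>\<^sup>2 * pot_energy TYPE('d)))"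
    by (intro mult_left_mono I) auto
  also have "\<dots> = (\<tau> * \<sigma>) ^ n * (\<tau> * \<sigma>)\<^sup>2 * (\<tau> ^ n * (\<Lambda> * M * pot_energy TYPE('d)))"
    by (simp add: power_mult_distrib power2_eq_square ac_simps)
  also have "\<dots> = \<tau> ^ n * (\<Lambda> * M * pot_energy TYPE('d))" by (simp add: ts)
  \<comment> \<open>Here \<sigma> > s/2 is used; it produces the factor 2^d of the
    statement.\<close>
  also have "\<dots> \<le> (2 * inverse s) ^ n * (\<Lambda> * M * pot_energy TYPE('d))"
  proof (intro mult_right_mono power_mono)
    show "\<tau> \<le> 2 * inverse s" using \<sigma> \<sigma>0 s by (simp add: \<tau>_def field_simps)
  qed (use ts nh_Lam[OF w] pot_energy_nonneg in \<open>auto simp: M_def intro!: mult_nonneg_nonneg\<close>)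
  finally have F2: "(F' \<sigma>)\<^sup>2 \<le> (2 * inverse s) ^ n * (\<Lambda> * M * pot_energy TYPE('d))" .
  have "(conv u (ker (s/2)) x - conv u (ker s) x)\<^sup>2 = (s/2)\<^sup>2 * (F' \<sigma>)\<^sup>2"
    using \<sigma>(3) by (metis power2_commute power_mult_distrib)
  also have "\<dots> \<le> s\<^sup>2 * ((2 * inverse s) ^ n * (\<Lambda> * M * pot_energy TYPE('d)))"
    using F2 by (intro mult_mono) (auto simp: power_divide)
  finally show ?thesis by (simp add: n_def M_def power_mult_distrib ac_simps)
qed

text \<open>Repeated use of (a + b)^2 \<le> 2 a^2 + 2 b^2, splitting off the first term each time,
  so that later terms collect the larger weights. The weights 2^j are affordable because the bounds
  on the squared differences at the scales s / 2^j carry a factor 4^(-j).\<close>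

lemma sum_square_weighted:
  fixes b :: "nat \<Rightarrow> real"
  shows "(\<Sum>j<N. b j)\<^sup>2 \<le> 2 * (\<Sum>j<N. 2 ^ j * (b j)\<^sup>2)"
proof (induction N arbitrary: b)
  case (Suc N)
  have "(\<Sum>j<Suc N. b j) = b 0 + (\<Sum>j<N. b (Suc j))" by (rule sum.lessThan_Suc_shift)
  then have "(\<Sum>j<Suc N. b j)\<^sup>2 \<le> 2 * (b 0)\<^sup>2 + 2 * (\<Sum>j<N. b (Suc j))\<^sup>2"
    using zero_le_power2[of "b 0 - (\<Sum>j<N. b (Suc j))"] by (simp add: power2_sum power2_diff)
  also have "\<dots> \<le> 2 * (b 0)\<^sup>2 + 2 * (2 * (\<Sum>j<N. 2 ^ j * (b (Suc j))\<^sup>2))"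
    using Suc.IH[of "\<lambda>j. b (Suc j)"] by simp
  also have "\<dots> = 2 * (\<Sum>j<Suc N. 2 ^ j * (b j)\<^sup>2)"
    by (simp add: sum.lessThan_Suc_shift sum_distrib_left mult.assoc del: sum.lessThan_Suc)
  finally show ?case .
qed simp

lemma measure_cball_vec: "r \<ge> 0 \<Longrightarrow> measure lborel (cball (x::real^'d) r) = unit_ball_vol (real CARD('d)) * r ^ CARD('d)"
  using content_cball[of r x] by simp

text \<open>By Fubini each point of \<open>Z\<close> is counted once for every centre within
  distance \<open>s\<close>. At a single centre the density of \<open>Z\<close> in small balls may
  stay of order one; integrated over the centres it is controlled by the measure of
  \<open>Z\<close>, uniformly in the scale.\<close>

lemma ball_average:
  fixes Z :: "(real^'d) set"
  assumes Z: "compact Z" and s: "s \<ge> 0"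
  shows "integrable lborel (\<lambda>x. indicator (cball a \<rho>) x * measure lborel (Z \<inter> cball x s))" (is ?A)
    and "(LINT x|lborel. indicator (cball a \<rho>) x * measure lborel (Z \<inter> cball x s)) \<le>
       unit_ball_vol (real CARD('d)) * s ^ CARD('d) * measure lborel (Z \<inter> cball a (\<rho> + s))" (is ?B)
proof -
  define W where "W = {p :: (real^'d) \<times> (real^'d). fst p \<in> cball a \<rho> \<and> snd p \<in> Z \<and> dist (fst p) (snd p) \<le> s}"
  have "W = (cball a \<rho> \<times> Z) \<inter> {p. dist (fst p) (snd p) \<le> s}" by (auto simp: W_def)
  moreover have "closed {p :: (real^'d) \<times> (real^'d). dist (fst p) (snd p) \<le> s}"
    by (intro closed_Collect_le continuous_intros)
  ultimately have W: "compact W" using Z by (auto intro!: compact_Int_closed compact_Times)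
  have "integrable lborel (indicator W :: _ \<Rightarrow> real)"
    using borel_compact[OF W] emeasure_compact_finite[OF W] by (intro integrable_real_indicator) auto
  then have iW: "integrable (lborel \<Otimes>\<^sub>M lborel) (\<lambda>(x, y). indicator W (x, y) :: real)"
    unfolding lborel_prod by (simp add: case_prod_beta)
  have f1: "(LINT y|lborel. indicator W (x, y)) = indicator (cball a \<rho>) x * measure lborel (Z \<inter> cball x s)" for x
  proof -
    have "(\<lambda>y. indicator W (x, y) :: real) = (\<lambda>y. indicator (cball a \<rho>) x * indicator (Z \<inter> cball x s) y)"
      by (auto simp: W_def indicator_def)
    then show ?thesis by simp
  qed
  have mb: "measure lborel (cball a \<rho> \<inter> cball y s) \<le> unit_ball_vol (real CARD('d)) * s ^ CARD('d)" for y
  proof -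
    have "measure lborel (cball a \<rho> \<inter> cball y s) \<le> measure lborel (cball y s)"
      by (rule measure_mono_fmeasurable) (auto intro!: fmeasurable_compact)
    then show ?thesis using measure_cball_vec[OF s, of y] by simp
  qed
  have f2: "(LINT x|lborel. indicator W (x, y)) \<le>
      unit_ball_vol (real CARD('d)) * s ^ CARD('d) * indicator (Z \<inter> cball a (\<rho> + s)) y" for y
  proof -
    have "(\<lambda>x. indicator W (x, y) :: real) = (\<lambda>x. indicator Z y * indicator (cball a \<rho> \<inter> cball y s) x)"
      by (auto simp: W_def indicator_def dist_commute)
    then have e: "(LINT x|lborel. indicator W (x, y)) = indicator Z y * measure lborel (cball a \<rho> \<inter> cball y s)" by simp
    show ?thesis
    proof (cases "y \<in> cball a (\<rho> + s)")
      case True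
      then show ?thesis unfolding e using mb[of y] by (auto simp: indicator_def)
    next
      case False
      have "x \<notin> cball y s" if "x \<in> cball a \<rho>" for x
        using dist_triangle[of a y x] that False by (auto simp: dist_commute)
      then have "cball a \<rho> \<inter> cball y s = {}" by blast
      then show ?thesis unfolding e using False by simp
    qed
  qed
  show ?A using lborel_pair.integrable_fst[OF iW] by (simp add: f1)
  have "(LINT x|lborel. indicator (cball a \<rho>) x * measure lborel (Z \<inter> cball x s)) =
     (LINT x|lborel. LINT y|lborel. indicator W (x, y))" by (simp add: f1)
  also have "\<dots> = (LINT y|lborel. LINT x|lborel. indicator W (x, y))"
    using lborel_pair.Fubini_integral[OF iW] by simp
  also have "\<dots> \<le> (LINT y|lborel. unit_ball_vol (real CARD('d)) * s ^ CARD('d) * indicator (Z \<inter> cball a (\<rho> + s)) y)"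
  proof (rule integral_mono)
    show "integrable lborel (\<lambda>y. LINT x|lborel. indicator W (x, y) :: real)"
      using lborel_pair.integrable_snd[OF iW] by simp
    have "compact (Z \<inter> cball a (\<rho> + s))" by (intro compact_Int_closed Z closed_cball)
    then show "integrable lborel (\<lambda>y. unit_ball_vol (real CARD('d)) * s ^ CARD('d) * indicator (Z \<inter> cball a (\<rho> + s)) y)"
      using borel_compact emeasure_compact_finite by (intro integrable_mult_right integrable_real_indicator) auto
  qed (rule f2)
  finally show ?B by simp
qed

lemma measure_Int_compact_mono:
  fixes Z :: "(real^'d) set"
  assumes "compact Z" "cball a r \<subseteq> cball b t"
  shows "measure lborel (Z \<inter> cball a r) \<le> measure lborel (Z \<inter> cball b t)"
proof (rule measure_mono_fmeasurable)
  show "Z \<inter> cball b t \<in> fmeasurable lborel"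
    by (intro fmeasurable_compact compact_Int_closed assms closed_cball)
  show "Z \<inter> cball a r \<in> sets lborel"
    using borel_compact[OF compact_Int_closed[OF assms(1) closed_cball]] by simp
qed (use assms in auto)

lemma smooth_conv_ker: "continuous_on UNIV u \<Longrightarrow> s > 0 \<Longrightarrow> smooth (conv u (ker s))"
  by (rule smooth_conv[OF _ smooth_ker ker_outside])

lemma conv_continuous:
  assumes "continuous_on UNIV u" "s > 0"
  shows "continuous_on S (conv u (ker s))"
  by (rule continuous_on_subset[OF smooth_continuous[OF smooth_conv_ker[OF assms]]]) simp

lemma integrable_indicator_cball:
  fixes f :: "real^'d \<Rightarrow> real"
  assumes "continuous_on UNIV f"
  shows "integrable lborel (\<lambda>x. indicator (cball a r) x * f x)"
  using borel_integrable_compact[OF compact_cball continuous_on_subset[OF assms subset_UNIV], of a r] by simp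

text \<open>The difference between \<open>u\<close> and its average is telescoped over the scales s
  / 2^j. The errors are summed after integrating over the centre, because only then does
  \<open>ball_average\<close> replace the density of \<open>Z\<close> at each scale by its measure,
  leaving a geometric series.\<close>

lemma mean_value_L2:
  fixes u :: "real^'d \<Rightarrow> real"
  assumes w: "nearly_harmonic \<Lambda> x0 R u Z" and s: "s > 0" and sub: "cball a (\<rho> + s) \<subseteq> cball x0 R"
  shows "(LINT x|lborel. indicator (cball a \<rho>) x * (u x - conv u (ker s) x)\<^sup>2) \<le>
     8 * 2 ^ CARD('d) * pot_energy TYPE('d) * unit_ball_vol (real CARD('d)) * \<Lambda> * s\<^sup>2 *
       measure lborel (Z \<inter> cball a (\<rho> + s))"
proof -
  note uc = nh_cont[OF w]
  note Zc = nh_compact[OF w]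
  define n where "n = CARD('d)"
  define \<omega> where "\<omega> = unit_ball_vol (real n)"
  define c where "c = 2 ^ n * pot_energy TYPE('d) * \<Lambda>"
  define M where "M = measure lborel (Z \<inter> cball a (\<rho> + s))"
  have c0: "c \<ge> 0" using nh_Lam[OF w] by (simp add: c_def pot_energy_nonneg)
  have M0: "M \<ge> 0" by (simp add: M_def)
  have \<omega>0: "\<omega> \<ge> 0" by (simp add: \<omega>_def)
  define sj where "sj j = s / 2 ^ j" for j :: nat
  have sj: "sj j > 0" "sj j \<le> s" "sj (Suc j) = sj j / 2" "2 ^ j * (sj j)\<^sup>2 = s\<^sup>2 * (1/2) ^ j" for j
    using s by (auto simp: sj_def field_simps power2_eq_square)
  define F where "F j x = conv u (ker (sj j)) x" for j x
  define \<mu> where "\<mu> j x = measure lborel (Z \<inter> cball x (sj j))" for j x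
  have step: "(F (Suc j) x - F j x)\<^sup>2 \<le> c * (sj j)\<^sup>2 * inverse (sj j) ^ n * \<mu> j x" if x: "x \<in> cball a \<rho>" for j x
  proof -
    have "cball x (sj j) \<subseteq> cball a (\<rho> + s)"
    proof
      fix y assume "y \<in> cball x (sj j)"
      then show "y \<in> cball a (\<rho> + s)" using x sj(2)[of j] dist_triangle[of a y x] by auto
    qed
    then have "cball x (sj j) \<subseteq> cball x0 R" using sub by blast
    from mean_value_step[OF w sj(1) this] show ?thesis
      unfolding F_def sj(3) c_def n_def \<mu>_def by simp
  qed
  have bd: "(F N x - F 0 x)\<^sup>2 \<le> 2 * (\<Sum>j<N. c * s\<^sup>2 * (1/2) ^ j * inverse (sj j) ^ n * \<mu> j x)"
    if x: "x \<in> cball a \<rho>" for N x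
  proof -
    have "F N x - F 0 x = (\<Sum>j<N. F (Suc j) x - F j x)" by (rule sum_lessThan_telescope[symmetric])
    also have "\<dots>\<^sup>2 \<le> 2 * (\<Sum>j<N. 2 ^ j * (F (Suc j) x - F j x)\<^sup>2)" by (rule sum_square_weighted)
    also have "\<dots> \<le> 2 * (\<Sum>j<N. c * s\<^sup>2 * (1/2) ^ j * inverse (sj j) ^ n * \<mu> j x)"
    proof (intro mult_left_mono sum_mono)
      fix j
      have "2 ^ j * (F (Suc j) x - F j x)\<^sup>2 \<le> 2 ^ j * (c * (sj j)\<^sup>2 * inverse (sj j) ^ n * \<mu> j x)"
        by (intro mult_left_mono step x) auto
      also have "\<dots> = c * (2 ^ j * (sj j)\<^sup>2) * inverse (sj j) ^ n * \<mu> j x" by (simp add: ac_simps)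
      finally show "2 ^ j * (F (Suc j) x - F j x)\<^sup>2 \<le> c * s\<^sup>2 * (1/2) ^ j * inverse (sj j) ^ n * \<mu> j x"
        unfolding sj(4) by (simp add: ac_simps)
    qed simp
    finally show ?thesis .
  qed
  have cF: "continuous_on UNIV (F j)" for j unfolding F_def[abs_def] by (rule conv_continuous[OF uc sj(1)])
  have i\<mu>: "integrable lborel (\<lambda>x. indicator (cball a \<rho>) x * \<mu> j x)" for j
    unfolding \<mu>_def by (rule ball_average(1)[OF Zc less_imp_le[OF sj(1)]])
  have b\<mu>: "inverse (sj j) ^ n * (LINT x|lborel. indicator (cball a \<rho>) x * \<mu> j x) \<le> \<omega> * M" for j
  proof -
    have "(LINT x|lborel. indicator (cball a \<rho>) x * \<mu> j x) \<le> \<omega> * sj j ^ n * measure lborel (Z \<inter> cball a (\<rho> + sj j))"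
      unfolding \<mu>_def \<omega>_def n_def by (rule ball_average(2)[OF Zc less_imp_le[OF sj(1)]])
    also have "\<dots> \<le> \<omega> * sj j ^ n * M"
      unfolding M_def using sj[of j] \<omega>0
      by (intro mult_left_mono measure_Int_compact_mono Zc subset_cball) auto
    finally have "inverse (sj j) ^ n * (LINT x|lborel. indicator (cball a \<rho>) x * \<mu> j x) \<le> inverse (sj j) ^ n * (\<omega> * sj j ^ n * M)"
      using sj(1)[of j] by (intro mult_left_mono) auto
    also have "\<dots> = \<omega> * M" using sj(1)[of j] by (simp add: power_inverse)
    finally show ?thesis .
  qed
  have L: "(LINT x|lborel. indicator (cball a \<rho>) x * (F N x - F 0 x)\<^sup>2) \<le> 4 * c * s\<^sup>2 * \<omega> * M" for N
  proof -
    have "(LINT x|lborel. indicator (cball a \<rho>) x * (F N x - F 0 x)\<^sup>2) \<le>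
      (LINT x|lborel. 2 * (\<Sum>j<N. c * s\<^sup>2 * (1/2) ^ j * inverse (sj j) ^ n * (indicator (cball a \<rho>) x * \<mu> j x)))"
    proof (rule integral_mono)
      show "integrable lborel (\<lambda>x. indicator (cball a \<rho>) x * (F N x - F 0 x)\<^sup>2)"
        by (intro integrable_indicator_cball continuous_intros cF)
      show "integrable lborel (\<lambda>x. 2 * (\<Sum>j<N. c * s\<^sup>2 * (1/2) ^ j * inverse (sj j) ^ n * (indicator (cball a \<rho>) x * \<mu> j x)))"
        using i\<mu> by (intro integrable_mult_right integrable_sum) auto
      show "indicator (cball a \<rho>) x * (F N x - F 0 x)\<^sup>2 \<le>
        2 * (\<Sum>j<N. c * s\<^sup>2 * (1/2) ^ j * inverse (sj j) ^ n * (indicator (cball a \<rho>) x * \<mu> j x))" for x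
        using bd[of x N] by (cases "x \<in> cball a \<rho>") auto
    qed
    also have "\<dots> = 2 * (\<Sum>j<N. c * s\<^sup>2 * (1/2) ^ j * (inverse (sj j) ^ n * (LINT x|lborel. indicator (cball a \<rho>) x * \<mu> j x)))"
      using i\<mu> by (simp add: mult.assoc)
    also have "\<dots> \<le> 2 * (\<Sum>j<N. c * s\<^sup>2 * (1/2) ^ j * (\<omega> * M))"
      using c0 by (intro mult_left_mono sum_mono b\<mu>) auto
    also have "\<dots> = 2 * (c * s\<^sup>2 * (\<omega> * M)) * (\<Sum>j<N. (1/2) ^ j)"
      by (simp add: sum_distrib_left sum_distrib_right ac_simps)
    also have "\<dots> \<le> 2 * (c * s\<^sup>2 * (\<omega> * M)) * 2"
    proof (rule mult_left_mono)
      show "(\<Sum>j<N. (1/2) ^ j) \<le> (2::real)" by (simp add: sum_gp_strict)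
    qed (use c0 M0 \<omega>0 in simp)
    finally show ?thesis by (simp add: ac_simps)
  qed
  define I where "I = (LINT x|lborel. indicator (cball a \<rho>) x * (u x - F 0 x)\<^sup>2)"
  have iB: "integrable lborel (\<lambda>x. indicator (cball a \<rho>) x * (u x - F 0 x)\<^sup>2)"
    by (intro integrable_indicator_cball continuous_intros uc cF)
  define B where "B = measure lborel (cball a \<rho>)"
  \<comment> \<open>A sufficiently fine average replaces \<open>u\<close> up to an arbitrary error;
    splitting the square costs the factor two between the constants 4 and 8.\<close>
  have "I \<le> 8 * c * s\<^sup>2 * \<omega> * M + e" if e: "e > 0" for e
  proof -
    define e' where "e' = sqrt (e / (2 * (B + 1)))"
    have B0: "B \<ge> 0" by (simp add: B_def)
    have e': "e' > 0" "e'\<^sup>2 = e / (2 * (B + 1))" using e B0 by (auto simp: e'_def)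
    obtain s0 where s0: "s0 > 0" "\<And>s x. 0 < s \<Longrightarrow> s < s0 \<Longrightarrow> x \<in> cball a \<rho> \<Longrightarrow> \<bar>conv u (ker s) x - u x\<bar> \<le> e'"
      using conv_uniform[OF uc compact_cball e'(1)] by metis
    have "\<exists>N. inverse (2 ^ N) < s0 / s" using real_arch_pow_inv[of "s0 / s" "1/2"] s0(1) s
      by (auto simp: power_one_over inverse_eq_divide)
    then obtain N where "sj N < s0" using s by (auto simp: sj_def field_simps)
    then have N: "\<bar>F N x - u x\<bar> \<le> e'" if "x \<in> cball a \<rho>" for x unfolding F_def by (intro s0 sj that)
    have "I \<le> (LINT x|lborel. 2 * e'\<^sup>2 * indicator (cball a \<rho>) x + 2 * (indicator (cball a \<rho>) x * (F N x - F 0 x)\<^sup>2))"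
      unfolding I_def
    proof (rule integral_mono[OF iB])
      show "integrable lborel (\<lambda>x. 2 * e'\<^sup>2 * indicator (cball a \<rho>) x + 2 * (indicator (cball a \<rho>) x * (F N x - F 0 x)\<^sup>2))"
        using emeasure_lborel_cball_finite
        by (intro Bochner_Integration.integrable_add integrable_mult_right integrable_real_indicator
             integrable_indicator_cball continuous_intros cF) auto
      fix x
      show "indicator (cball a \<rho>) x * (u x - F 0 x)\<^sup>2 \<le>
         2 * e'\<^sup>2 * indicator (cball a \<rho>) x + 2 * (indicator (cball a \<rho>) x * (F N x - F 0 x)\<^sup>2)"
      proof (cases "x \<in> cball a \<rho>")
        case True
        have "(F N x - u x)\<^sup>2 \<le> e'\<^sup>2" using N[OF True] abs_le_square_iff[of "F N x - u x" e'] e'(1) by simp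
        moreover have "(u x - F 0 x)\<^sup>2 \<le> 2 * (F N x - u x)\<^sup>2 + 2 * (F N x - F 0 x)\<^sup>2"
          using zero_le_power2[of "(F N x - u x) + (F N x - F 0 x)"]
          by (simp add: power2_eq_square algebra_simps)
        ultimately show ?thesis using True by simp
      qed simp
    qed
    also have "\<dots> = 2 * e'\<^sup>2 * B + 2 * (LINT x|lborel. indicator (cball a \<rho>) x * (F N x - F 0 x)\<^sup>2)"
    proof -
      have 1: "integrable lborel (\<lambda>x. 2 * e'\<^sup>2 * indicator (cball a \<rho>) x)"
        using emeasure_lborel_cball_finite by (intro integrable_mult_right integrable_real_indicator) auto
      have 2: "integrable lborel (\<lambda>x. 2 * (indicator (cball a \<rho>) x * (F N x - F 0 x)\<^sup>2))"
        by (intro integrable_mult_right integrable_indicator_cball continuous_intros cF)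
      show ?thesis using Bochner_Integration.integral_add[OF 1 2] by (simp add: B_def)
    qed
    also have "\<dots> \<le> e + 2 * (4 * c * s\<^sup>2 * \<omega> * M)"
    proof (intro add_mono mult_left_mono L)
      show "2 * e'\<^sup>2 * B \<le> e" using e B0 unfolding e'(2) by (simp add: field_simps)
    qed simp
    finally show ?thesis by simp
  qed
  then have "I \<le> 8 * c * s\<^sup>2 * \<omega> * M" by (rule field_le_epsilon)
  then show ?thesis by (simp add: I_def F_def sj_def c_def n_def \<omega>_def M_def ac_simps)
qed

text \<open>By \<open>zero_set_energy\<close> a slope \<open>q\<close> forces the gradient to
  deviate from \<open>q\<close> by |q| on the zero set, and \<open>caccioppoli\<close> bounds this
  deviation by the L^2 distance to the affine function plus \<Lambda> times the measure of
  \<open>Z\<close>. Both are applied to a smooth approximation of \<open>u\<close>, and the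
  approximation is removed at the end.\<close>

lemma zero_set_density:
  "\<exists>C\<ge>0. \<forall>\<Lambda> (u :: real^'d \<Rightarrow> real) Z b q. nearly_harmonic \<Lambda> 0 1 u Z \<longrightarrow>
     (norm q)\<^sup>2 * measure lborel (Z \<inter> cball 0 (1/4)) \<le>
       C * ((LINT x|lborel. indicator (cball 0 1) x * (u x - (b + q \<bullet> x))\<^sup>2) + \<Lambda> * measure lborel (Z \<inter> cball 0 1))"
proof -
  \<comment> \<open>The dilation by 2 puts the support in the ball of radius 1/2, which leaves room
    for mollification at scales up to 1/2, and keeps \<eta> at least exp(-2) on the ball of radius
    1/4.\<close>
  define \<eta> where "\<eta> y = bump (2 *\<^sub>R y + 0)" for y :: "real^'d"
  have \<eta>: "smooth \<eta>" unfolding \<eta>_def[abs_def] by (rule smooth_affine[OF smooth_bump])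
  have \<eta>b: "0 \<le> \<eta> y" "\<eta> y \<le> 1" for y by (auto simp: \<eta>_def bump_bounds)
  have \<eta>0: "\<eta> y = 0" if "y \<notin> cball 0 (1/2)" for y using that by (auto simp: \<eta>_def intro!: bump_outside)
  have \<eta>l: "exp (-2) \<le> \<eta> y" if "y \<in> cball 0 (1/4)" for y using that by (auto simp: \<eta>_def intro!: bump_lower)
  have g0: "grad \<eta> y = 0" if "y \<notin> cball 0 (1/2)" for y by (rule grad_outside[OF closed_cball \<eta>0 that])
  obtain B where B: "B \<ge> 0" "\<And>y. norm (grad \<eta> y) \<le> B"
    using bounded_compact_support[OF continuous_grad[OF \<eta>] compact_cball g0] by metis
  define \<zeta> where "\<zeta> y = (\<eta> y)\<^sup>2" for y
  have \<zeta>: "smooth \<zeta>" unfolding \<zeta>_def[abs_def] by (rule smooth_power2[OF \<eta>])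
  have \<zeta>0: "\<zeta> y = 0" if "y \<notin> cball 0 (1/2)" for y using \<eta>0[OF that] by (simp add: \<zeta>_def)
  define N where "N = (LINT y|lborel. norm (grad \<zeta> y))"
  define \<omega> where "\<omega> = measure lborel (cball (0::real^'d) 1)"
  define e2 where "e2 = exp (-2 :: real)"
  define C where "C = max (24 * B\<^sup>2) 8 / e2\<^sup>2"
  have C0: "C \<ge> 0" by (simp add: C_def)
  have "(norm q)\<^sup>2 * measure lborel (Z \<inter> cball 0 (1/4)) \<le>
       C * ((LINT x|lborel. indicator (cball 0 1) x * (u x - (b + q \<bullet> x))\<^sup>2) + \<Lambda> * measure lborel (Z \<inter> cball 0 1))"
    if w: "nearly_harmonic \<Lambda> 0 1 u Z" for \<Lambda> b q and u :: "real^'d \<Rightarrow> real" and Z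
  proof -
    note uc = nh_cont[OF w]
    define m where "m = measure lborel (Z \<inter> cball 0 (1/4))"
    define A where "A = \<Lambda> * measure lborel (Z \<inter> cball 0 1)"
    have A0: "A \<ge> 0" using nh_Lam[OF w] by (simp add: A_def)
    define I where "I = (LINT x|lborel. indicator (cball 0 1) x * (u x - (b + q \<bullet> x))\<^sup>2)"
    have K: "compact (Z \<inter> cball 0 (1/4))" by (intro compact_Int_closed nh_compact[OF w] closed_cball)
    have est: "(norm q)\<^sup>2 * (e2\<^sup>2 * m / (1 + t\<^sup>2)) \<le> 24 * B\<^sup>2 * (I + (t\<^sup>2)\<^sup>2 * \<omega>) + 8 * A + 4 * t * norm q * N"
      if t: "t > 0" for t
    proof -
      \<comment> \<open>The accuracy is t^2 rather than t: on \<open>Z\<close>, where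
        \<open>u\<close> vanishes, f / t is then at most t in absolute value, and the weight 1 / (1
        + (f / t)^2) tends to one.\<close>
      obtain s0 where s0: "s0 > 0"
        "\<And>s x. 0 < s \<Longrightarrow> s < s0 \<Longrightarrow> x \<in> cball 0 1 \<Longrightarrow> \<bar>conv u (ker s) x - u x\<bar> \<le> t\<^sup>2"
        using conv_uniform[OF uc compact_cball, of "t\<^sup>2" 0 1] t by (metis zero_less_power)
      define s where "s = min (s0/2) (1/2)"
      have s: "s > 0" "s < s0" "s \<le> 1/2" using s0(1) by (auto simp: s_def)
      define f where "f = conv u (ker s)"
      have fu: "\<bar>f x - u x\<bar> \<le> t\<^sup>2" if "x \<in> cball 0 1" for x unfolding f_def by (intro s0 s that)
      have f: "smooth f" unfolding f_def by (rule smooth_conv[OF uc smooth_ker ker_outside[OF s(1)]])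
      have fc: "continuous_on S f" for S by (rule continuous_on_subset[OF smooth_continuous[OF f]]) simp
      have cc: "continuous_on S \<zeta>" "continuous_on S (grad \<eta>)" for S
        by (rule continuous_on_subset[OF smooth_continuous[OF \<zeta>]], simp,
            rule continuous_on_subset[OF continuous_grad[OF \<eta>]], simp)
      have den: "1 + (f y / t)\<^sup>2 \<noteq> 0" for y using sum_power2_gt_zero_iff[of 1 "f y / t"] by simp
      have test: "(LINT y|lborel. f y * lap \<phi> y)\<^sup>2 \<le> A * (LINT y|lborel. (norm (grad \<phi> y))\<^sup>2)"
        if \<phi>: "smooth \<phi>" "\<And>y. y \<notin> cball 0 (1/2) \<Longrightarrow> \<phi> y = 0" for \<phi>
      proof -
        have sub: "cball (0::real^'d) (1/2 + s) \<subseteq> cball 0 1" using s by (intro subset_cball) simp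
        have "(LINT y|lborel. f y * lap \<phi> y)\<^sup>2 \<le>
           \<Lambda> * measure lborel (Z \<inter> cball 0 (1/2 + s)) * (LINT y|lborel. (norm (grad \<phi> y))\<^sup>2)"
          unfolding f_def by (rule mollified_test[OF w s(1) \<phi>(1) _ sub]) (rule \<phi>(2))
        also have "\<dots> \<le> A * (LINT y|lborel. (norm (grad \<phi> y))\<^sup>2)"
          unfolding A_def
          by (intro mult_right_mono mult_left_mono measure_Int_compact_mono nh_compact[OF w] sub nh_Lam[OF w] integral_nonneg_AE) auto
        finally show ?thesis .
      qed
      have cacc: "(LINT y|lborel. \<zeta> y * (norm (grad f y - q))\<^sup>2) \<le>
          12 * (LINT y|lborel. (f y - (b + q \<bullet> y))\<^sup>2 * (norm (grad \<eta> y))\<^sup>2) + 8 * A"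
        unfolding \<zeta>_def by (rule caccioppoli[OF f \<eta> \<eta>b \<eta>0 test A0])
      have "(LINT y|lborel. (f y - (b + q \<bullet> y))\<^sup>2 * (norm (grad \<eta> y))\<^sup>2) \<le>
         (LINT y|lborel. 2 * B\<^sup>2 * (indicator (cball 0 1) y * (u y - (b + q \<bullet> y))\<^sup>2) + 2 * B\<^sup>2 * (t\<^sup>2)\<^sup>2 * indicator (cball 0 1) y)"
      proof (rule integral_mono)
        show "integrable lborel (\<lambda>y. (f y - (b + q \<bullet> y))\<^sup>2 * (norm (grad \<eta> y))\<^sup>2)"
          by (rule integrable_compact_support[OF _ compact_cball[of 0 "1/2"]])
             (auto intro!: continuous_intros fc cc simp: g0)
        show "integrable lborel (\<lambda>y. 2 * B\<^sup>2 * (indicator (cball 0 1) y * (u y - (b + q \<bullet> y))\<^sup>2) +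
            2 * B\<^sup>2 * (t\<^sup>2)\<^sup>2 * indicator (cball 0 1) y)"
          using emeasure_lborel_cball_finite
          by (intro Bochner_Integration.integrable_add integrable_mult_right integrable_real_indicator
             integrable_indicator_cball continuous_intros uc) auto
        fix y :: "real^'d"
        show "(f y - (b + q \<bullet> y))\<^sup>2 * (norm (grad \<eta> y))\<^sup>2 \<le>
           2 * B\<^sup>2 * (indicator (cball 0 1) y * (u y - (b + q \<bullet> y))\<^sup>2) + 2 * B\<^sup>2 * (t\<^sup>2)\<^sup>2 * indicator (cball 0 1) y"
        proof (cases "y \<in> cball 0 1")
          case True
          have "(f y - u y)\<^sup>2 \<le> (t\<^sup>2)\<^sup>2" using fu[OF True] by (metis abs_le_square_iff abs_power2)
          moreover have "(f y - (b + q \<bullet> y))\<^sup>2 \<le> 2 * (f y - u y)\<^sup>2 + 2 * (u y - (b + q \<bullet> y))\<^sup>2"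
            using zero_le_power2[of "(f y - u y) - (u y - (b + q \<bullet> y))"]
            by (simp add: power2_eq_square algebra_simps)
          ultimately have "(f y - (b + q \<bullet> y))\<^sup>2 \<le> 2 * (t\<^sup>2)\<^sup>2 + 2 * (u y - (b + q \<bullet> y))\<^sup>2" by linarith
          moreover have "(norm (grad \<eta> y))\<^sup>2 \<le> B\<^sup>2" using B(2)[of y] by (intro power_mono) auto
          ultimately have "(f y - (b + q \<bullet> y))\<^sup>2 * (norm (grad \<eta> y))\<^sup>2 \<le> (2 * (t\<^sup>2)\<^sup>2 + 2 * (u y - (b + q \<bullet> y))\<^sup>2) * B\<^sup>2"
            by (intro mult_mono) auto
          then show ?thesis using True by (simp add: algebra_simps)
        next
          case False
          then have "y \<notin> cball 0 (1/2)" by simp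
          from g0[OF this] show ?thesis using False by simp
        qed
      qed
      also have "\<dots> = 2 * B\<^sup>2 * I + 2 * B\<^sup>2 * (t\<^sup>2)\<^sup>2 * \<omega>"
      proof -
        have 1: "integrable lborel (\<lambda>y. 2 * B\<^sup>2 * (indicator (cball 0 1) y * (u y - (b + q \<bullet> y))\<^sup>2))"
          by (intro integrable_mult_right integrable_indicator_cball continuous_intros uc)
        have 2: "integrable lborel (\<lambda>y::real^'d. 2 * B\<^sup>2 * (t\<^sup>2)\<^sup>2 * indicator (cball 0 1) y)"
          using emeasure_lborel_cball_finite by (intro integrable_mult_right integrable_real_indicator) auto
        show ?thesis using Bochner_Integration.integral_add[OF 1 2] by (simp add: I_def \<omega>_def)
      qed
      finally have Y: "(LINT y|lborel. (f y - (b + q \<bullet> y))\<^sup>2 * (norm (grad \<eta> y))\<^sup>2) \<le> 2 * B\<^sup>2 * (I + (t\<^sup>2)\<^sup>2 * \<omega>)"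
        by (simp add: algebra_simps)
      have "e2\<^sup>2 * m / (1 + t\<^sup>2) = (LINT y|lborel. e2\<^sup>2 / (1 + t\<^sup>2) * indicator (Z \<inter> cball 0 (1/4)) y)"
        by (simp add: m_def)
      also have "\<dots> \<le> (LINT y|lborel. \<zeta> y / (1 + (f y / t)\<^sup>2))"
      proof (rule integral_mono)
        show "integrable lborel (\<lambda>y. e2\<^sup>2 / (1 + t\<^sup>2) * indicator (Z \<inter> cball 0 (1/4)) y)"
          using borel_compact[OF K] emeasure_compact_finite[OF K] by (intro integrable_mult_right integrable_real_indicator) auto
        show "integrable lborel (\<lambda>y. \<zeta> y / (1 + (f y / t)\<^sup>2))"
          by (rule integrable_compact_support[OF _ compact_cball[of 0 "1/2"]])
             (use t den in \<open>auto intro!: continuous_intros fc cc simp: \<zeta>0\<close>)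
        fix y :: "real^'d"
        show "e2\<^sup>2 / (1 + t\<^sup>2) * indicator (Z \<inter> cball 0 (1/4)) y \<le> \<zeta> y / (1 + (f y / t)\<^sup>2)"
        proof (cases "y \<in> Z \<inter> cball 0 (1/4)")
          case True
          then have "\<bar>f y\<bar> \<le> t\<^sup>2" using fu[of y] nh_zero[OF w, of y] by auto
          then have "\<bar>f y / t\<bar> \<le> \<bar>t\<bar>" using t by (simp add: field_simps power2_eq_square)
          then have "(f y / t)\<^sup>2 \<le> t\<^sup>2" by (simp only: abs_le_square_iff)
          moreover have "e2\<^sup>2 \<le> \<zeta> y" using \<eta>l[of y] True unfolding \<zeta>_def e2_def by (intro power_mono) auto
          ultimately have "e2\<^sup>2 / (1 + t\<^sup>2) \<le> \<zeta> y / (1 + (f y / t)\<^sup>2)"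
            using \<zeta>_def sum_power2_gt_zero_iff[of 1 "f y / t"] by (intro frac_le) auto
          then show ?thesis using True by simp
        next
          case False
          then show ?thesis by (simp add: \<zeta>_def)
        qed
      qed
      finally have "(norm q)\<^sup>2 * (e2\<^sup>2 * m / (1 + t\<^sup>2)) \<le> (norm q)\<^sup>2 * (LINT y|lborel. \<zeta> y / (1 + (f y / t)\<^sup>2))"
        by (intro mult_left_mono) auto
      also have "\<dots> \<le> (LINT y|lborel. \<zeta> y * (norm (grad f y - q))\<^sup>2) + 4 * t * norm q * N"
        unfolding N_def by (rule zero_set_energy[OF f \<zeta> _ \<zeta>0 t]) (simp add: \<zeta>_def)
      finally show ?thesis using cacc Y by linarith
    qed
    \<comment> \<open>As t tends to 0, both the mollification error and the term with
      \<open>N\<close> disappear.\<close>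
    have "((\<lambda>t. (norm q)\<^sup>2 * (e2\<^sup>2 * m / (1 + t\<^sup>2))) \<longlongrightarrow> (norm q)\<^sup>2 * (e2\<^sup>2 * m / (1 + 0\<^sup>2))) (at_right 0)"
      by (intro tendsto_intros) auto
    moreover have "((\<lambda>t. 24 * B\<^sup>2 * (I + (t\<^sup>2)\<^sup>2 * \<omega>) + 8 * A + 4 * t * norm q * N) \<longlongrightarrow>
       24 * B\<^sup>2 * (I + (0\<^sup>2)\<^sup>2 * \<omega>) + 8 * A + 4 * 0 * norm q * N) (at_right 0)"
      by (intro tendsto_intros)
    moreover have "\<forall>\<^sub>F t in at_right 0. (norm q)\<^sup>2 * (e2\<^sup>2 * m / (1 + t\<^sup>2)) \<le>
        24 * B\<^sup>2 * (I + (t\<^sup>2)\<^sup>2 * \<omega>) + 8 * A + 4 * t * norm q * N"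
      using eventually_at_right_less[of 0] by (rule eventually_mono) (rule est)
    ultimately have "(norm q)\<^sup>2 * (e2\<^sup>2 * m / (1 + 0\<^sup>2)) \<le> 24 * B\<^sup>2 * (I + (0\<^sup>2)\<^sup>2 * \<omega>) + 8 * A + 4 * 0 * norm q * N"
      by (intro tendsto_le[OF trivial_limit_at_right_real]) auto
    then have "e2\<^sup>2 * ((norm q)\<^sup>2 * m) \<le> 24 * B\<^sup>2 * I + 8 * A" by (simp add: ac_simps)
    also have "\<dots> \<le> max (24 * B\<^sup>2) 8 * I + max (24 * B\<^sup>2) 8 * A"
    proof -
      have "I \<ge> 0" unfolding I_def by (intro integral_nonneg_AE) auto
      then show ?thesis using A0 by (intro add_mono mult_right_mono) auto
    qed
    also have "\<dots> = e2\<^sup>2 * (C * (I + A))" by (simp add: C_def e2_def field_simps)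
    finally have "(norm q)\<^sup>2 * m \<le> C * (I + A)" by (simp add: e2_def)
    then show ?thesis by (simp add: m_def I_def A_def)
  qed
  with C0 show ?thesis by blast
qed

section \<open>Decay of the excess and Lipschitz continuity\<close>

text \<open>The constant part is reproduced because the kernel has mass one. The linear part centred
  at \<open>x\<close> is odd under the reflection of y into 2 x - y while the kernel is even, so its
  integral vanishes.\<close>

lemma conv_affine:
  fixes q :: "real^'d"
  assumes s: "s > 0"
  shows "conv (\<lambda>y. b + q \<bullet> y) (ker s) x = b + q \<bullet> x"
proof -
  define h where "h y = (q \<bullet> (y - x)) * ker s (x - y)" for y
  have hc: "continuous_on UNIV (\<lambda>y. q \<bullet> (y - x))" by (intro continuous_intros)
  have ih: "integrable lborel h" unfolding h_def[abs_def] by (rule conv_ker_integrable[OF hc s])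
  have ik: "integrable lborel (\<lambda>y. ker s (x - y))"
    using conv_ker_integrable[OF continuous_on_const s, of 1 x] by simp
  have "h \<in> borel_measurable borel" using ih by (simp add: borel_measurable_integrable)
  then have "integral\<^sup>L lborel h = \<bar>-1\<bar> ^ DIM(real^'d) * (LINT y|lborel. h (2 *\<^sub>R x + (-1) *\<^sub>R y))"
    by (intro lborel_integral_affine) auto
  also have "(\<lambda>y. h (2 *\<^sub>R x + (-1) *\<^sub>R y)) = (\<lambda>y. - h y)"
  proof
    fix y
    have "2 *\<^sub>R x + (-1) *\<^sub>R y - x = - (y - x)" "x - (2 *\<^sub>R x + (-1) *\<^sub>R y) = y - x"
      by (simp_all add: algebra_simps scaleR_2)
    then show "h (2 *\<^sub>R x + (-1) *\<^sub>R y) = - h y"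
      unfolding h_def using ker_even_diff[of s y x] by (simp only: inner_minus_right mult_minus_left)
  qed
  finally have h0: "integral\<^sup>L lborel h = 0" by simp
  have "conv (\<lambda>y. b + q \<bullet> y) (ker s) x = (LINT y|lborel. h y + (b + q \<bullet> x) * ker s (x - y))"
    by (simp add: conv_def h_def inner_diff_right algebra_simps)
  also have "\<dots> = b + q \<bullet> x" using ih ik h0 integral_ker'[OF s, of x] by simp
  finally show ?thesis .
qed

lemma conv_diff:
  assumes "continuous_on UNIV f" "continuous_on UNIV g" "s > 0"
  shows "conv (\<lambda>y. f y - g y) (ker s) x = conv f (ker s) x - conv g (ker s) x"
  using conv_ker_integrable[OF assms(1,3), of x] conv_ker_integrable[OF assms(2,3), of x]
  by (simp add: conv_def left_diff_distrib)

section \<open>Integral bounds on balls\<close>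

lemma integrable_cball_const: "integrable lborel (\<lambda>x::real^'d. c * indicator (cball a r) x :: real)"
  using emeasure_lborel_cball_finite by (intro integrable_mult_right integrable_real_indicator) auto

text \<open>The Cauchy-Schwarz inequality, obtained from the nonnegative variance of |w| around its
  mean D / B on the ball.\<close>

lemma L1_le_L2_cball:
  fixes w :: "real^'d \<Rightarrow> real"
  assumes w: "continuous_on UNIV w" and r: "r > 0"
  shows "(LINT y|lborel. indicator (cball a r) y * \<bar>w y\<bar>)\<^sup>2 \<le>
     measure lborel (cball a r) * (LINT y|lborel. indicator (cball a r) y * (w y)\<^sup>2)"
proof -
  define B where "B = measure lborel (cball a r)"
  have B: "B > 0" using content_cball_pos[OF r] by (simp add: B_def)
  define D where "D = (LINT y|lborel. indicator (cball a r) y * \<bar>w y\<bar>)"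
  define J where "J = (LINT y|lborel. indicator (cball a r) y * (w y)\<^sup>2)"
  have i: "integrable lborel (\<lambda>y. indicator (cball a r) y * \<bar>w y\<bar>)" "integrable lborel (\<lambda>y. indicator (cball a r) y * (w y)\<^sup>2)"
    by (intro integrable_indicator_cball continuous_intros w)+
  have "0 \<le> (LINT y|lborel. indicator (cball a r) y * (\<bar>w y\<bar> - D/B)\<^sup>2)"
    by (intro integral_nonneg_AE) auto
  also have "\<dots> = (LINT y|lborel. indicator (cball a r) y * (w y)\<^sup>2 - 2 * (D/B) * (indicator (cball a r) y * \<bar>w y\<bar>)
      + (D/B)\<^sup>2 * indicator (cball a r) y)"
    by (simp add: power2_diff algebra_simps)
  also have "\<dots> = J - 2 * (D/B) * D + (D/B)\<^sup>2 * B"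
    using i integrable_cball_const[of "(D/B)\<^sup>2" a r] by (simp add: J_def D_def B_def)
  also have "\<dots> = J - D\<^sup>2 / B" using B by (simp add: power2_eq_square field_simps)
  finally have "D\<^sup>2 / B \<le> J" by simp
  then have "D\<^sup>2 \<le> B * J" using B by (simp add: field_simps)
  then show ?thesis by (simp add: B_def D_def J_def)
qed

lemma conv_bound:
  fixes w \<rho> :: "real^'d \<Rightarrow> real"
  assumes w: "continuous_on UNIV w" and \<rho>: "continuous_on UNIV \<rho>" "\<And>z. z \<notin> cball 0 1 \<Longrightarrow> \<rho> z = 0" "\<And>z. \<bar>\<rho> z\<bar> \<le> B"
  shows "\<bar>conv w \<rho> 0\<bar> \<le> B * (LINT y|lborel. indicator (cball 0 1) y * \<bar>w y\<bar>)"
proof -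
  have i: "integrable lborel (\<lambda>y. indicator (cball 0 1) y * \<bar>w y\<bar>)"
    by (intro integrable_indicator_cball continuous_intros w)
  have "norm (LINT y|lborel. w y * \<rho> (0 - y)) \<le> (LINT y|lborel. B * (indicator (cball 0 1) y * \<bar>w y\<bar>))"
  proof (rule Bochner_Integration.integral_norm_bound_integral)
    show "integrable lborel (\<lambda>y. w y * \<rho> (0 - y))" by (rule conv_integrable[OF w \<rho>(1,2)])
    show "norm (w y * \<rho> (0 - y)) \<le> B * (indicator (cball 0 1) y * \<bar>w y\<bar>)" for y
    proof (cases "y \<in> cball 0 1")
      case True
      then show ?thesis using \<rho>(3)[of "- y"] by (simp add: abs_mult mult.commute[of "\<bar>w y\<bar>"] mult_right_mono)
    next
      case False
      then have "\<rho> (0 - y) = 0" by (intro \<rho>(2)) simp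
      then show ?thesis using False by simp
    qed
  qed (use i in simp)
  then show ?thesis by (simp add: conv_def)
qed

text \<open>There is no minimisation over \<open>b\<close> and \<open>q\<close>: the affine
  functions are carried along explicitly, since their slopes are what the iteration has to
  control.\<close>

definition excess :: "(real^'d \<Rightarrow> real) \<Rightarrow> real \<Rightarrow> real^'d \<Rightarrow> real" where
  "excess u b q = (LINT x|lborel. indicator (cball 0 1) x * (u x - (b + q \<bullet> x))\<^sup>2)"

lemma excess_nonneg: "excess u b q \<ge> 0"
  unfolding excess_def by (intro integral_nonneg_AE) auto

text \<open>The new affine function is the first-order Taylor polynomial at 0 of the average of
  \<open>u\<close> at scale 1/2. Averaging reproduces affine functions, so only the deviation of
  \<open>u\<close> from the old affine function enters the change of coefficients and the quadratic
  remainder, and both are bounded by its L^1 norm, hence by the excess. The distance from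
  \<open>u\<close> to its average gives the term with \<Lambda>.\<close>

lemma excess_decay:
  "\<exists>C\<ge>0. \<forall>\<Lambda> (u :: real^'d \<Rightarrow> real) Z b q \<theta>. nearly_harmonic \<Lambda> 0 1 u Z \<longrightarrow> 0 < \<theta> \<longrightarrow> \<theta> \<le> 1/2 \<longrightarrow>
     (\<exists>b' q'. (LINT x|lborel. indicator (cball 0 \<theta>) x * (u x - (b' + q' \<bullet> x))\<^sup>2) \<le>
         C * (\<theta> ^ (CARD('d) + 4) * excess u b q
            + \<Lambda> * measure lborel (Z \<inter> cball 0 1)) \<and>
       (b' - b)\<^sup>2 \<le> C * excess u b q \<and>
       (norm (q' - q))\<^sup>2 \<le> C * excess u b q)"
proof -
  define k where "k = (ker (1/2) :: real^'d \<Rightarrow> real)"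
  have k: "smooth k" "\<And>z. z \<notin> cball 0 (1/2) \<Longrightarrow> k z = 0"
    unfolding k_def by (rule smooth_ker, rule ker_outside) auto
  have kc: "continuous_on UNIV k" by (rule smooth_continuous[OF k(1)])
  have pk: "continuous_on UNIV (pd i k)" "\<And>z. z \<notin> cball 0 (1/2) \<Longrightarrow> pd i k z = 0" for i
    by (rule smooth_continuous[OF smooth_pd[OF k(1)]], rule pd_outside[OF closed_cball k(2)])
  obtain Ck where Ck: "Ck \<ge> 0" "\<And>x v. \<bar>k (x + v) - k x - grad k x \<bullet> v\<bar> \<le> Ck * (norm v)\<^sup>2"
    using smooth_taylor2[OF k(1) compact_cball k(2)] by metis
  obtain B0 where B0: "B0 \<ge> 0" "\<And>x. norm (k x) \<le> B0"
    using bounded_compact_support[OF kc compact_cball k(2)] by metis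
  have "\<exists>B\<ge>0. \<forall>x. \<bar>pd i k x\<bar> \<le> B" for i
    using bounded_compact_support[OF pk(1)[of i] compact_cball pk(2)] by (metis real_norm_def)
  then obtain B where B: "\<And>i. B i \<ge> 0" "\<And>i x. \<bar>pd i k x\<bar> \<le> B i" by metis
  define \<omega> where "\<omega> = unit_ball_vol (real CARD('d))"
  have \<omega>0: "\<omega> \<ge> 0" by (simp add: \<omega>_def)
  define C1 where "C1 = 8 * 2 ^ CARD('d) * pot_energy TYPE('d) * \<omega>"
  have C10: "C1 \<ge> 0" by (simp add: C1_def \<omega>0 pot_energy_nonneg)
  define C where "C = C1 + 2 * Ck\<^sup>2 * \<omega>\<^sup>2 + B0\<^sup>2 * \<omega> + (\<Sum>i\<in>UNIV. (B i)\<^sup>2) * \<omega>"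
  have Cs: "0 \<le> 2 * Ck\<^sup>2 * \<omega>\<^sup>2" "0 \<le> B0\<^sup>2 * \<omega>" "0 \<le> (\<Sum>i\<in>UNIV. (B i)\<^sup>2) * \<omega>"
    using \<omega>0 by (auto intro!: mult_nonneg_nonneg sum_nonneg)
  then have C: "C \<ge> 0" "C1 \<le> C" "2 * Ck\<^sup>2 * \<omega>\<^sup>2 \<le> C" "B0\<^sup>2 * \<omega> \<le> C" "(\<Sum>i\<in>UNIV. (B i)\<^sup>2) * \<omega> \<le> C"
    using C10 unfolding C_def by linarith+
  show ?thesis
  proof (rule exI[of _ C], intro conjI allI impI C)
    fix \<Lambda> and u :: "real^'d \<Rightarrow> real" and Z b q and \<theta> :: real
    assume w: "nearly_harmonic \<Lambda> 0 1 u Z" and \<theta>: "0 < \<theta>" "\<theta> \<le> 1/2"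
    note uc = nh_cont[OF w]
    define J where "J = (LINT x|lborel. indicator (cball 0 1) x * (u x - (b + q \<bullet> x))\<^sup>2)"
    define m where "m = measure lborel (Z \<inter> cball 0 1)"
    define v where "v x = u x - (b + q \<bullet> x)" for x
    have vc: "continuous_on UNIV v" unfolding v_def[abs_def] by (intro continuous_intros uc)
    have J0: "J \<ge> 0" unfolding J_def by (intro integral_nonneg_AE) auto
    define D where "D = (LINT y|lborel. indicator (cball 0 1) y * \<bar>v y\<bar>)"
    have D0: "D \<ge> 0" unfolding D_def by (intro integral_nonneg_AE) auto
    have D: "D\<^sup>2 \<le> \<omega> * J"
      using L1_le_L2_cball[OF vc, of 1 0] measure_cball_vec[of 1 "0::real^'d"]
      by (simp add: D_def J_def v_def \<omega>_def)
    \<comment> \<open>The gradient at 0 of the averaged deviation, with the derivatives put on the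
      kernel.\<close>
    define g where "g = (\<chi> i. conv v (pd i k) 0)"
    define b' where "b' = b + conv v k 0"
    define q' where "q' = q + g"
    have up: "(b' - b)\<^sup>2 \<le> C * J"
    proof -
      have "\<bar>conv v k 0\<bar> \<le> B0 * D" unfolding D_def
        by (rule conv_bound[OF vc kc]) (use k(2) B0 in auto)
      then have "(conv v k 0)\<^sup>2 \<le> (B0 * D)\<^sup>2" using B0 D0 by (metis abs_le_square_iff abs_of_nonneg mult_nonneg_nonneg)
      also have "\<dots> = B0\<^sup>2 * D\<^sup>2" by (rule power_mult_distrib)
      also have "\<dots> \<le> B0\<^sup>2 * (\<omega> * J)" by (intro mult_left_mono D) auto
      also have "\<dots> \<le> C * J" using mult_right_mono[OF C(4) J0] by (simp add: mult.assoc)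
      finally show ?thesis by (simp add: b'_def)
    qed
    have uq: "(norm (q' - q))\<^sup>2 \<le> C * J"
    proof -
      have "(conv v (pd i k) 0)\<^sup>2 \<le> (B i)\<^sup>2 * (\<omega> * J)" for i
      proof -
        have "\<bar>conv v (pd i k) 0\<bar> \<le> B i * D" unfolding D_def
          by (rule conv_bound[OF vc pk(1)]) (use pk(2) B in auto)
        then have "(conv v (pd i k) 0)\<^sup>2 \<le> (B i * D)\<^sup>2" using B(1)[of i] D0 by (metis abs_le_square_iff abs_of_nonneg mult_nonneg_nonneg)
        also have "\<dots> = (B i)\<^sup>2 * D\<^sup>2" by (rule power_mult_distrib)
        also have "\<dots> \<le> (B i)\<^sup>2 * (\<omega> * J)" by (intro mult_left_mono D) auto
        finally show ?thesis .
      qed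
      then have "(norm g)\<^sup>2 \<le> (\<Sum>i\<in>UNIV. (B i)\<^sup>2 * (\<omega> * J))"
        unfolding power2_norm_eq_inner inner_vec_def g_def
        by (intro sum_mono) (simp add: power2_eq_square)
      also have "\<dots> = (\<Sum>i\<in>UNIV. (B i)\<^sup>2) * \<omega> * J" by (simp add: sum_distrib_right mult.assoc)
      also have "\<dots> \<le> C * J" by (intro mult_right_mono C J0)
      finally show ?thesis by (simp add: q'_def)
    qed
    have P: "conv u k x = b + q \<bullet> x + conv v k x" for x
    proof -
      have lc: "continuous_on UNIV (\<lambda>y. b + q \<bullet> y)" by (intro continuous_intros)
      have "conv v k x = conv u k x - conv (\<lambda>y. b + q \<bullet> y) k x"
        unfolding v_def[abs_def] k_def by (rule conv_diff[OF uc lc]) simp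
      then show ?thesis unfolding k_def by (simp add: conv_affine)
    qed
    have taylor: "(conv u k x - (b' + q' \<bullet> x))\<^sup>2 \<le> Ck\<^sup>2 * \<theta> ^ 4 * (\<omega> * J)" if x: "x \<in> cball 0 \<theta>" for x
    proof -
      have nx: "norm x \<le> 1/2" using x \<theta> by simp
      have "\<bar>conv v k (0 + x) - conv v k 0 - (\<Sum>i\<in>UNIV. conv v (pd i k) 0 * x $ i)\<bar> \<le> Ck * (norm x)\<^sup>2 * D"
        using conv_taylor[where r = "1/2" and x = 0, OF vc k Ck nx] by (simp add: D_def)
      moreover have "conv u k x - (b' + q' \<bullet> x) = conv v k (0 + x) - conv v k 0 - (\<Sum>i\<in>UNIV. conv v (pd i k) 0 * x $ i)"
        by (simp add: P b'_def q'_def g_def inner_add_left inner_vec_def distrib_right sum.distrib)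
      ultimately have "\<bar>conv u k x - (b' + q' \<bullet> x)\<bar> \<le> Ck * (norm x)\<^sup>2 * D" by simp
      also have "\<dots> \<le> Ck * \<theta>\<^sup>2 * D" using x \<theta> Ck D0
        by (intro mult_right_mono mult_left_mono power_mono) auto
      finally have "(conv u k x - (b' + q' \<bullet> x))\<^sup>2 \<le> (Ck * \<theta>\<^sup>2 * D)\<^sup>2"
        using Ck D0 by (metis abs_le_square_iff abs_of_nonneg mult_nonneg_nonneg zero_le_power2)
      also have "\<dots> = Ck\<^sup>2 * \<theta> ^ 4 * D\<^sup>2" by (simp add: power_mult_distrib flip: power_mult)
      also have "\<dots> \<le> Ck\<^sup>2 * \<theta> ^ 4 * (\<omega> * J)" by (intro mult_left_mono D) auto
      finally show ?thesis .
    qed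
    have main: "(LINT x|lborel. indicator (cball 0 \<theta>) x * (u x - (b' + q' \<bullet> x))\<^sup>2) \<le> C * (\<theta> ^ (CARD('d) + 4) * J + \<Lambda> * m)"
    proof -
      have cu: "continuous_on UNIV (conv u k)" unfolding k_def by (rule conv_continuous[OF uc]) simp
      have i1: "integrable lborel (\<lambda>x. indicator (cball 0 \<theta>) x * (u x - conv u k x)\<^sup>2)"
        by (intro integrable_indicator_cball continuous_intros uc cu)
      have "(LINT x|lborel. indicator (cball 0 \<theta>) x * (u x - (b' + q' \<bullet> x))\<^sup>2) \<le>
        (LINT x|lborel. 2 * (indicator (cball 0 \<theta>) x * (u x - conv u k x)\<^sup>2)
            + 2 * (Ck\<^sup>2 * \<theta> ^ 4 * (\<omega> * J)) * indicator (cball 0 \<theta>) x)"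
      proof (rule integral_mono)
        show "integrable lborel (\<lambda>x. indicator (cball 0 \<theta>) x * (u x - (b' + q' \<bullet> x))\<^sup>2)"
          by (intro integrable_indicator_cball continuous_intros uc)
        show "integrable lborel (\<lambda>x. 2 * (indicator (cball 0 \<theta>) x * (u x - conv u k x)\<^sup>2)
            + 2 * (Ck\<^sup>2 * \<theta> ^ 4 * (\<omega> * J)) * indicator (cball 0 \<theta>) x)"
          by (intro Bochner_Integration.integrable_add integrable_mult_right[OF i1] integrable_cball_const)
        fix x
        show "indicator (cball 0 \<theta>) x * (u x - (b' + q' \<bullet> x))\<^sup>2 \<le> 2 * (indicator (cball 0 \<theta>) x * (u x - conv u k x)\<^sup>2)
            + 2 * (Ck\<^sup>2 * \<theta> ^ 4 * (\<omega> * J)) * indicator (cball 0 \<theta>) x"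
        proof (cases "x \<in> cball 0 \<theta>")
          case True
          have "(u x - (b' + q' \<bullet> x))\<^sup>2 \<le> 2 * (u x - conv u k x)\<^sup>2 + 2 * (conv u k x - (b' + q' \<bullet> x))\<^sup>2"
            using zero_le_power2[of "(u x - conv u k x) - (conv u k x - (b' + q' \<bullet> x))"]
            by (simp add: power2_eq_square algebra_simps)
          then show ?thesis using True taylor[OF True] by simp
        qed simp
      qed
      also have "\<dots> = 2 * (LINT x|lborel. indicator (cball 0 \<theta>) x * (u x - conv u k x)\<^sup>2)
          + 2 * (Ck\<^sup>2 * \<theta> ^ 4 * (\<omega> * J)) * measure lborel (cball (0::real^'d) \<theta>)"
        using Bochner_Integration.integral_add[OF integrable_mult_right[OF i1, of 2]
            integrable_cball_const[of "2 * (Ck\<^sup>2 * \<theta> ^ 4 * (\<omega> * J))" 0 \<theta>]] by simp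
      also have "\<dots> \<le> 2 * (C1 * \<Lambda> * (1/2)\<^sup>2 * m) + 2 * (Ck\<^sup>2 * \<theta> ^ 4 * (\<omega> * J)) * (\<omega> * \<theta> ^ CARD('d))"
      proof -
        \<comment> \<open>Averages at scale 1/2 around points of the \<theta>-ball reach distance
          \<theta> + 1/2 from the origin; here \<theta> \<le> 1/2 enters.\<close>
        have sub: "cball (0::real^'d) (\<theta> + 1/2) \<subseteq> cball 0 1" using \<theta> by (intro subset_cball) simp
        have "(LINT x|lborel. indicator (cball 0 \<theta>) x * (u x - conv u k x)\<^sup>2) \<le>
           C1 * \<Lambda> * (1/2)\<^sup>2 * measure lborel (Z \<inter> cball 0 (\<theta> + 1/2))"
          using mean_value_L2[OF w _ sub] by (simp add: k_def C1_def \<omega>_def)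
        also have "\<dots> \<le> C1 * \<Lambda> * (1/2)\<^sup>2 * m" unfolding m_def
          using C10 nh_Lam[OF w] by (intro mult_left_mono measure_Int_compact_mono nh_compact[OF w] sub) auto
        finally show ?thesis using \<theta> measure_cball_vec[of \<theta> "0::real^'d"] by (simp add: \<omega>_def)
      qed
      also have "\<dots> = C1 / 2 * (\<Lambda> * m) + 2 * Ck\<^sup>2 * \<omega>\<^sup>2 * (\<theta> ^ (CARD('d) + 4) * J)"
        by (simp add: power_add power2_eq_square ac_simps)
      also have "\<dots> \<le> C * (\<Lambda> * m) + C * (\<theta> ^ (CARD('d) + 4) * J)"
        using C C10 nh_Lam[OF w] \<theta> J0 by (intro add_mono mult_right_mono) (auto simp: m_def)
      finally show ?thesis by (simp add: algebra_simps)
    qed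
    show "\<exists>b' q'. (LINT x|lborel. indicator (cball 0 \<theta>) x * (u x - (b' + q' \<bullet> x))\<^sup>2) \<le>
         C * (\<theta> ^ (CARD('d) + 4) * excess u b q + \<Lambda> * measure lborel (Z \<inter> cball 0 1)) \<and>
       (b' - b)\<^sup>2 \<le> C * excess u b q \<and> (norm (q' - q))\<^sup>2 \<le> C * excess u b q"
      using main up uq unfolding J_def m_def excess_def by blast
  qed
qed

text \<open>The change of variables contributes r^d and the division of the values by r contributes
  r^2.\<close>

lemma excess_rescale:
  fixes u :: "real^'d \<Rightarrow> real"
  assumes u: "continuous_on UNIV u" and r: "r > 0"
  shows "excess (\<lambda>y. u (a + r *\<^sub>R y) / r) b q * r ^ (CARD('d) + 2) =
     (LINT x|lborel. indicator (cball a r) x * (u x - (r * b + q \<bullet> (x - a)))\<^sup>2)"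
proof -
  have "(LINT x|lborel. indicator (cball a r) x * (u x - (r * b + q \<bullet> (x - a)))\<^sup>2) =
     \<bar>r\<bar> ^ DIM(real^'d) * (LINT y|lborel. indicator (cball a r) (a + r *\<^sub>R y) * (u (a + r *\<^sub>R y) - (r * b + q \<bullet> (a + r *\<^sub>R y - a)))\<^sup>2)"
    using r by (intro lborel_integral_affine borel_measurable_times borel_measurable_indicator
        borel_measurable_continuous_onI continuous_intros u) auto
  also have "(\<lambda>y. indicator (cball a r) (a + r *\<^sub>R y) * (u (a + r *\<^sub>R y) - (r * b + q \<bullet> (a + r *\<^sub>R y - a)))\<^sup>2) =
    (\<lambda>y. r\<^sup>2 * (indicator (cball 0 1) y * (u (a + r *\<^sub>R y) / r - (b + q \<bullet> y))\<^sup>2))"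
  proof
    fix y
    have "indicator (cball a r) (a + r *\<^sub>R y) = (indicator (cball 0 1) y :: real)"
      using r by (auto simp: indicator_def dist_norm)
    moreover have "u (a + r *\<^sub>R y) - (r * b + q \<bullet> (a + r *\<^sub>R y - a)) = r * (u (a + r *\<^sub>R y) / r - (b + q \<bullet> y))"
      using r by (simp add: field_simps)
    ultimately show "indicator (cball a r) (a + r *\<^sub>R y) * (u (a + r *\<^sub>R y) - (r * b + q \<bullet> (a + r *\<^sub>R y - a)))\<^sup>2 =
      r\<^sup>2 * (indicator (cball 0 1) y * (u (a + r *\<^sub>R y) / r - (b + q \<bullet> y))\<^sup>2)"
      by (simp add: power_mult_distrib)
  qed
  also have "(LINT y|lborel. r\<^sup>2 * (indicator (cball 0 1) y * (u (a + r *\<^sub>R y) / r - (b + q \<bullet> y))\<^sup>2)) =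
      r\<^sup>2 * excess (\<lambda>y. u (a + r *\<^sub>R y) / r) b q"
    unfolding excess_def by (rule integral_mult_right_zero)
  finally show ?thesis using r by (simp add: power_add power2_eq_square ac_simps)
qed

text \<open>Decay on the \<theta>-ball is rewritten on the unit ball for the rescaled function, so
  that it can be iterated. Dividing by \<theta>^(d+2) leaves the gain \<theta>^2 on the excess and
  puts a large but fixed factor on the zero-set term. Slopes are invariant under the rescaling while
  constants are divided by \<theta>, whence \<open>\<theta> * b' - b\<close>. The condition \<theta>
  \<le> 1/4 fits the \<theta>-ball into the ball of \<open>zero_set_density\<close>.\<close>

lemma excess_step:
  "\<exists>C\<ge>0. \<forall>\<Lambda> (u :: real^'d \<Rightarrow> real) Z b q \<theta>. nearly_harmonic \<Lambda> 0 1 u Z \<longrightarrow> 0 < \<theta> \<longrightarrow> \<theta> \<le> 1/4 \<longrightarrow>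
     (\<exists>b' q'. excess (\<lambda>y. u (\<theta> *\<^sub>R y) / \<theta>) b' q' \<le>
          C * (\<theta>\<^sup>2 * excess u b q + inverse \<theta> ^ (CARD('d) + 2) * (\<Lambda> * measure lborel (Z \<inter> cball 0 1))) \<and>
        (\<theta> * b' - b)\<^sup>2 \<le> C * excess u b q \<and> (norm (q' - q))\<^sup>2 \<le> C * excess u b q \<and>
        (norm q)\<^sup>2 * measure lborel ({y. \<theta> *\<^sub>R y \<in> Z} \<inter> cball 0 1) \<le>
          C * inverse \<theta> ^ CARD('d) * (excess u b q + \<Lambda> * measure lborel (Z \<inter> cball 0 1)))"
proof -
  obtain C1 where C1: "C1 \<ge> 0" and D: "\<forall>\<Lambda> (u :: real^'d \<Rightarrow> real) Z b q \<theta>. nearly_harmonic \<Lambda> 0 1 u Z \<longrightarrow> 0 < \<theta> \<longrightarrow> \<theta> \<le> 1/2 \<longrightarrow>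
     (\<exists>b' q'. (LINT x|lborel. indicator (cball 0 \<theta>) x * (u x - (b' + q' \<bullet> x))\<^sup>2) \<le>
         C1 * (\<theta> ^ (CARD('d) + 4) * excess u b q + \<Lambda> * measure lborel (Z \<inter> cball 0 1)) \<and>
       (b' - b)\<^sup>2 \<le> C1 * excess u b q \<and> (norm (q' - q))\<^sup>2 \<le> C1 * excess u b q)"
    using excess_decay[where 'd = 'd] by blast
  obtain C2 where C2: "C2 \<ge> 0" and Zd: "\<forall>\<Lambda> (u :: real^'d \<Rightarrow> real) Z b q. nearly_harmonic \<Lambda> 0 1 u Z \<longrightarrow>
     (norm q)\<^sup>2 * measure lborel (Z \<inter> cball 0 (1/4)) \<le> C2 * (excess u b q + \<Lambda> * measure lborel (Z \<inter> cball 0 1))"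
    using zero_set_density[where 'd = 'd] unfolding excess_def by blast
  define C where "C = max C1 C2"
  have C: "C \<ge> 0" "C1 \<le> C" "C2 \<le> C" using C1 by (auto simp: C_def)
  show ?thesis
  proof (rule exI[of _ C], intro conjI allI impI C)
    fix \<Lambda> and u :: "real^'d \<Rightarrow> real" and Z b q and \<theta> :: real
    assume w: "nearly_harmonic \<Lambda> 0 1 u Z" and \<theta>: "0 < \<theta>" "\<theta> \<le> 1/4"
    define J where "J = excess u b q"
    define m where "m = \<Lambda> * measure lborel (Z \<inter> cball 0 1)"
    have J0: "J \<ge> 0" by (simp add: J_def excess_nonneg)
    have m0: "m \<ge> 0" using nh_Lam[OF w] by (simp add: m_def)
    obtain b' q' where 1: "(LINT x|lborel. indicator (cball 0 \<theta>) x * (u x - (b' + q' \<bullet> x))\<^sup>2) \<le> C1 * (\<theta> ^ (CARD('d) + 4) * J + m)"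
      and 2: "(b' - b)\<^sup>2 \<le> C1 * J" "(norm (q' - q))\<^sup>2 \<le> C1 * J"
      using D[rule_format, OF w \<theta>(1), of b q] \<theta>(2) unfolding J_def m_def by fastforce
    have "excess (\<lambda>y. u (\<theta> *\<^sub>R y) / \<theta>) (b' / \<theta>) q' * \<theta> ^ (CARD('d) + 2) \<le> C1 * (\<theta> ^ (CARD('d) + 4) * J + m)"
      using excess_rescale[OF nh_cont[OF w] \<theta>(1), of 0 "b' / \<theta>" q'] 1 \<theta> by simp
    also have "\<dots> = C1 * (\<theta>\<^sup>2 * J + inverse \<theta> ^ (CARD('d) + 2) * m) * \<theta> ^ (CARD('d) + 2)"
    proof -
      have "\<theta> ^ (CARD('d) + 4) = \<theta>\<^sup>2 * \<theta> ^ (CARD('d) + 2)" by (simp only: power_add[symmetric]) (rule arg_cong[where f = "power \<theta>"], simp)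
      moreover have "inverse \<theta> ^ (CARD('d) + 2) * \<theta> ^ (CARD('d) + 2) = 1"
      proof -
        have "inverse \<theta> * \<theta> = 1" using \<theta> by simp
        then show ?thesis by (simp only: power_mult_distrib[symmetric] power_one)
      qed
      ultimately show ?thesis by (simp only: distrib_left distrib_right ac_simps)
    qed
    finally have "excess (\<lambda>y. u (\<theta> *\<^sub>R y) / \<theta>) (b' / \<theta>) q' \<le> C1 * (\<theta>\<^sup>2 * J + inverse \<theta> ^ (CARD('d) + 2) * m)"
      using \<theta> by simp
    also have "\<dots> \<le> C * (\<theta>\<^sup>2 * J + inverse \<theta> ^ (CARD('d) + 2) * m)"
      using C \<theta> J0 m0 by (intro mult_right_mono) auto
    finally have 3: "excess (\<lambda>y. u (\<theta> *\<^sub>R y) / \<theta>) (b' / \<theta>) q' \<le> C * (\<theta>\<^sup>2 * J + inverse \<theta> ^ (CARD('d) + 2) * m)" .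
    have 4: "C1 * J \<le> C * J" by (intro mult_right_mono C J0)
    have "measure lborel ({y. \<theta> *\<^sub>R y \<in> Z} \<inter> cball 0 1) = inverse \<theta> ^ CARD('d) * measure lborel (Z \<inter> cball 0 \<theta>)"
    proof -
      have "{y. 0 + \<theta> *\<^sub>R y \<in> Z \<inter> cball 0 \<theta>} = {y. \<theta> *\<^sub>R y \<in> Z} \<inter> cball 0 1" using \<theta> by auto
      then have "measure lborel (Z \<inter> cball 0 \<theta>) = \<theta> ^ CARD('d) * measure lborel ({y. \<theta> *\<^sub>R y \<in> Z} \<inter> cball 0 1)"
        using measure_affine_vimage[of "Z \<inter> cball 0 \<theta>" \<theta> 0] \<theta> borel_compact[OF compact_Int_closed[OF nh_compact[OF w] closed_cball]]
        by simp
      then show ?thesis using \<theta> by (simp add: power_inverse)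
    qed
    also have "\<dots> \<le> inverse \<theta> ^ CARD('d) * measure lborel (Z \<inter> cball 0 (1/4))"
      using \<theta> by (intro mult_left_mono measure_Int_compact_mono nh_compact[OF w] subset_cball) auto
    finally have "(norm q)\<^sup>2 * measure lborel ({y. \<theta> *\<^sub>R y \<in> Z} \<inter> cball 0 1) \<le>
       (norm q)\<^sup>2 * (inverse \<theta> ^ CARD('d) * measure lborel (Z \<inter> cball 0 (1/4)))" by (intro mult_left_mono) auto
    also have "\<dots> = inverse \<theta> ^ CARD('d) * ((norm q)\<^sup>2 * measure lborel (Z \<inter> cball 0 (1/4)))" by simp
    also have "\<dots> \<le> inverse \<theta> ^ CARD('d) * (C2 * (J + m))"
      using Zd[rule_format, OF w, of q b] \<theta> unfolding J_def m_def by (intro mult_left_mono) auto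
    also have "\<dots> \<le> inverse \<theta> ^ CARD('d) * (C * (J + m))"
      using C J0 m0 \<theta> by (intro mult_left_mono mult_right_mono) auto
    finally have 5: "(norm q)\<^sup>2 * measure lborel ({y. \<theta> *\<^sub>R y \<in> Z} \<inter> cball 0 1) \<le> C * inverse \<theta> ^ CARD('d) * (J + m)"
      by (simp add: ac_simps)
    have 6: "(\<theta> * (b' / \<theta>) - b)\<^sup>2 \<le> C * J" "(norm (q' - q))\<^sup>2 \<le> C * J" using 2 4 \<theta> by auto
    show "\<exists>b' q'. excess (\<lambda>y. u (\<theta> *\<^sub>R y) / \<theta>) b' q' \<le>
          C * (\<theta>\<^sup>2 * excess u b q + inverse \<theta> ^ (CARD('d) + 2) * (\<Lambda> * measure lborel (Z \<inter> cball 0 1))) \<and>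
        (\<theta> * b' - b)\<^sup>2 \<le> C * excess u b q \<and> (norm (q' - q))\<^sup>2 \<le> C * excess u b q \<and>
        (norm q)\<^sup>2 * measure lborel ({y. \<theta> *\<^sub>R y \<in> Z} \<inter> cball 0 1) \<le>
          C * inverse \<theta> ^ CARD('d) * (excess u b q + \<Lambda> * measure lborel (Z \<inter> cball 0 1))"
      using 3 5 6 unfolding J_def m_def by blast
  qed
qed

text \<open>
  When the slope is large, \<open>sqrt (J + K \<mu>)\<close> halves at each scale, so that the quantity
  \<open>norm q + 2 sqrt (C (J + K \<mu>))\<close> does not increase; otherwise it is bounded.
\<close>

lemma slope_iteration:
  fixes C \<alpha> \<beta> \<gamma> N E :: real
  assumes pos: "C \<ge> 0" "\<beta> \<ge> 0" "\<gamma> \<ge> 0" "N \<ge> 0" "E \<ge> 0" and \<alpha>: "C * \<alpha> \<le> 1/8"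
  shows "\<exists>Q\<ge>0. \<forall>J \<mu> (q :: nat \<Rightarrow> 'a::real_normed_vector).
     (\<forall>k. J k \<ge> 0 \<and> 0 \<le> \<mu> k \<and> \<mu> k \<le> N) \<longrightarrow> J 0 \<le> E \<longrightarrow> q 0 = 0 \<longrightarrow>
     (\<forall>k. J (Suc k) \<le> C * (\<alpha> * J k + \<beta> * \<mu> k) \<and> (norm (q (Suc k) - q k))\<^sup>2 \<le> C * J k \<and>
        (norm (q k))\<^sup>2 * \<mu> (Suc k) \<le> C * \<gamma> * (J k + \<mu> k)) \<longrightarrow>
     (\<forall>k. J k \<le> Q \<and> norm (q k) \<le> Q)"
proof -
  \<comment> \<open>The weight is large enough that the forcing term C \<beta> \<mu> is at most an
    eighth of K \<mu>.\<close>
  define K where "K = 8 * C * \<beta> + 1"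
  have K: "K \<ge> 1" "C * \<beta> \<le> K / 8" using pos by (auto simp: K_def)
  \<comment> \<open>Threshold slope: from it on, the third inequality gives 8 K \<mu>(k+1) \<le>
    J(k) + \<mu>(k). Adding one keeps \<open>M\<close> positive.\<close>
  define M where "M = sqrt (8 * K * C * \<gamma>) + 1"
  have M: "M > 0" "8 * K * C * \<gamma> \<le> M\<^sup>2"
  proof -
    have nn: "0 \<le> 8 * K * C * \<gamma>" using K pos by (intro mult_nonneg_nonneg) auto
    then show "M > 0" unfolding M_def by (smt (verit) real_sqrt_ge_zero)
    have "8 * K * C * \<gamma> = (sqrt (8 * K * C * \<gamma>))\<^sup>2" using nn by simp
    also have "\<dots> \<le> M\<^sup>2" unfolding M_def using nn by (intro power_mono) auto
    finally show "8 * K * C * \<gamma> \<le> M\<^sup>2" .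
  qed
  \<comment> \<open>A bound preserved by the recursion: an eighth of it plus C \<beta> N is again at
    most \<open>Jm\<close>.\<close>
  define Jm where "Jm = E + 2 * (C * \<beta> * N)"
  define Fm where "Fm = Jm + K * N"
  define c where "c = sqrt C"
  have c: "c \<ge> 0" using pos by (simp add: c_def)
  have Jm0: "Jm \<ge> 0" "Fm \<ge> 0" using pos K by (auto simp: Jm_def Fm_def)
  \<comment> \<open>Covers the worst step from below the threshold: slope at most \<open>M\<close>,
    one increment of at most \<open>c * sqrt Fm\<close>, and twice that amount for the remaining
    potential.\<close>
  define P where "P = M + 3 * (c * sqrt Fm)"
  have P0: "P \<ge> 0" using M c Jm0 by (auto simp: P_def intro!: add_nonneg_nonneg)
  show ?thesis
  proof (rule exI[of _ "Jm + P"], intro conjI allI impI)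
    show "Jm + P \<ge> 0" using Jm0 P0 by simp
    fix J \<mu> :: "nat \<Rightarrow> real" and q :: "nat \<Rightarrow> 'a" and k :: nat
    assume nn: "\<forall>k. J k \<ge> 0 \<and> 0 \<le> \<mu> k \<and> \<mu> k \<le> N" and init: "J 0 \<le> E" "q 0 = 0"
      and step: "\<forall>k. J (Suc k) \<le> C * (\<alpha> * J k + \<beta> * \<mu> k) \<and> (norm (q (Suc k) - q k))\<^sup>2 \<le> C * J k \<and>
        (norm (q k))\<^sup>2 * \<mu> (Suc k) \<le> C * \<gamma> * (J k + \<mu> k)"
    have J1: "J (Suc k) \<le> J k / 8 + C * \<beta> * \<mu> k" for k
    proof -
      have "C * \<alpha> * J k \<le> 1/8 * J k" using nn by (intro mult_right_mono \<alpha>) auto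
      then show ?thesis using step[rule_format, of k] by (simp add: algebra_simps)
    qed
    have Jb: "J k \<le> Jm" for k
    proof (induction k)
      case 0
      have "0 \<le> C * \<beta> * N" using pos by (intro mult_nonneg_nonneg) auto
      then show ?case using init by (simp add: Jm_def)
    next
      case (Suc k)
      have "C * \<beta> * \<mu> k \<le> C * \<beta> * N" using nn pos by (intro mult_left_mono) auto
      moreover have "0 \<le> C * \<beta> * N" using pos by (intro mult_nonneg_nonneg) auto
      ultimately show ?case using J1[of k] Suc pos unfolding Jm_def by linarith
    qed
    define F where "F k = J k + K * \<mu> k" for k
    have F0: "F k \<ge> 0" for k using nn K by (simp add: F_def)
    have FJ: "J k \<le> F k" for k using nn K by (simp add: F_def)
    have Fb: "F k \<le> Fm" for k unfolding F_def Fm_def using nn K by (intro add_mono Jb mult_left_mono) auto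
    have sF: "sqrt (F k) \<le> sqrt Fm" for k using Fb by simp
    have qs: "norm (q (Suc k)) \<le> norm (q k) + c * sqrt (F k)" for k
    proof -
      have "(norm (q (Suc k) - q k))\<^sup>2 \<le> C * J k" using step by blast
      also have "\<dots> \<le> C * F k" by (intro mult_left_mono FJ pos)
      finally have "norm (q (Suc k) - q k) \<le> sqrt (C * F k)" by (simp add: real_le_rsqrt)
      then have "norm (q (Suc k) - q k) \<le> c * sqrt (F k)" by (simp add: c_def real_sqrt_mult)
      then show ?thesis using norm_triangle_ineq[of "q k" "q (Suc k) - q k"] by simp
    qed
    have dec: "sqrt (F (Suc k)) \<le> sqrt (F k) / 2" if big: "norm (q k) \<ge> M" for k
    proof -
      have "M\<^sup>2 \<le> (norm (q k))\<^sup>2" using big M by (intro power_mono) auto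
      then have "M\<^sup>2 * \<mu> (Suc k) \<le> (norm (q k))\<^sup>2 * \<mu> (Suc k)" using nn by (intro mult_right_mono) auto
      also have "\<dots> \<le> C * \<gamma> * (J k + \<mu> k)" using step by blast
      finally have "(8 * K) * (M\<^sup>2 * \<mu> (Suc k)) \<le> (8 * K) * (C * \<gamma> * (J k + \<mu> k))" using K by (intro mult_left_mono) auto
      also have "\<dots> = (8 * K * C * \<gamma>) * (J k + \<mu> k)" by simp
      also have "\<dots> \<le> M\<^sup>2 * (J k + \<mu> k)" using nn by (intro mult_right_mono M) auto
      finally have "M\<^sup>2 * (8 * K * \<mu> (Suc k)) \<le> M\<^sup>2 * (J k + \<mu> k)" by (simp add: ac_simps)
      then have 1: "8 * K * \<mu> (Suc k) \<le> J k + \<mu> k" using M by simp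
      have 2: "C * \<beta> * \<mu> k \<le> K / 8 * \<mu> k" using nn K by (intro mult_right_mono) auto
      have 3: "\<mu> k \<le> K * \<mu> k" using nn K mult_right_mono[of 1 K "\<mu> k"] by simp
      have 1: "K * \<mu> (Suc k) \<le> (J k + \<mu> k) / 8" and 2: "C * \<beta> * \<mu> k \<le> K * \<mu> k / 8" using 1 2 by simp_all
      \<comment> \<open>J(k+1) is at most J/8 + K \<mu>/8 and K \<mu>(k+1) at most (J + \<mu>)/8,
        together at most a quarter of F(k); hence the factor one half for the square root.\<close>
      have "j' + y' \<le> (j + y) / 4" if "y' \<le> (j + m) / 8" "x \<le> y / 8" "m \<le> y" "j' \<le> j / 8 + x"
        for j j' x y y' m :: real using that by (simp add: field_simps)
      from this[OF 1 2 3 J1] have "F (Suc k) \<le> F k / 4" unfolding F_def .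
      then have "sqrt (F (Suc k)) \<le> sqrt (F k / 4)" by simp
      then show ?thesis by (simp add: real_sqrt_divide)
    qed
    have "norm (q k) + 2 * (c * sqrt (F k)) \<le> P" for k
    proof (induction k)
      case 0
      have "c * sqrt (F 0) \<le> c * sqrt Fm" by (intro mult_left_mono sF c)
      moreover have "0 \<le> c * sqrt Fm" using c Jm0 by simp
      ultimately show ?case using init M unfolding P_def by simp
    next
      case (Suc k)
      show ?case
      proof (cases "norm (q k) \<ge> M")
        case True
        have "c * sqrt (F (Suc k)) \<le> c * (sqrt (F k) / 2)" by (intro mult_left_mono dec True c)
        then show ?thesis using qs[of k] Suc by simp
      next
        case False
        have "c * sqrt (F k) \<le> c * sqrt Fm" "c * sqrt (F (Suc k)) \<le> c * sqrt Fm" by (intro mult_left_mono sF c)+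
        then show ?thesis using qs[of k] False unfolding P_def by linarith
      qed
    qed
    moreover have "0 \<le> c * sqrt (F k)" using c F0 by simp
    ultimately have "norm (q k) \<le> P" using order_trans[of "norm (q k)" "norm (q k) + 2 * (c * sqrt (F k))" P] by simp
    then show "J k \<le> Jm + P" "norm (q k) \<le> Jm + P" using Jb[of k] Jm0 P0 by linarith+
  qed
qed

section \<open>From bounded slopes to Lipschitz continuity\<close>

lemma geometric_scale:
  fixes \<theta> \<rho> r0 :: real
  assumes "0 < \<theta>" "\<theta> < 1" "0 < \<rho>" "\<rho> \<le> r0"
  obtains k where "\<theta> ^ Suc k * r0 < \<rho>" "\<rho> \<le> \<theta> ^ k * r0"
proof -
  have "\<exists>n. \<theta> ^ n * r0 < \<rho>"
    using real_arch_pow_inv[of "\<rho> / r0" \<theta>] assms by (auto simp: field_simps)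
  then obtain n where n: "\<theta> ^ n * r0 < \<rho>" "\<And>m. m < n \<Longrightarrow> \<not> \<theta> ^ m * r0 < \<rho>"
    using exists_least_iff[of "\<lambda>n. \<theta> ^ n * r0 < \<rho>"] by blast
  have "n \<noteq> 0" using n(1) assms by (intro notI) simp
  then obtain k where "n = Suc k" using not0_implies_Suc by blast
  then show ?thesis using n that[of k] by force
qed

text \<open>At each centre the one-step estimate is iterated along the radii \<theta>^k R/2,
  starting from the zero affine function. Bounded excess and bounded slope keep \<open>u\<close>
  within a multiple of the radius of a constant, in mean square, and these constants converge to the
  value of \<open>u\<close> at the centre.\<close>

lemma nearly_harmonic_campanato:
  fixes u :: "real^'d \<Rightarrow> real"
  assumes w: "nearly_harmonic \<Lambda> x0 R u Z" and R: "R > 0"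
  shows "\<exists>L\<ge>0. \<forall>a \<rho>. a \<in> cball x0 (R/2) \<longrightarrow> 0 < \<rho> \<longrightarrow> \<rho> \<le> R/2 \<longrightarrow>
     (LINT x|lborel. indicator (cball a \<rho>) x * (u x - u a)\<^sup>2) \<le> L * \<rho> ^ (CARD('d) + 2)"
proof -
  note uc = nh_cont[OF w]
  define n where "n = CARD('d)"
  define \<omega> where "\<omega> = unit_ball_vol (real n)"
  have \<omega>: "\<omega> > 0" by (simp add: \<omega>_def)
  have m1: "measure lborel (cball (0::real^'d) 1) = \<omega>" using measure_cball_vec[of 1 "0::real^'d"] by (simp add: \<omega>_def n_def)
  obtain C0 where C0: "C0 \<ge> 0" and step0: "\<forall>\<Lambda> (u :: real^'d \<Rightarrow> real) Z b q \<theta>. nearly_harmonic \<Lambda> 0 1 u Z \<longrightarrow> 0 < \<theta> \<longrightarrow> \<theta> \<le> 1/4 \<longrightarrow>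
     (\<exists>b' q'. excess (\<lambda>y. u (\<theta> *\<^sub>R y) / \<theta>) b' q' \<le>
          C0 * (\<theta>\<^sup>2 * excess u b q + inverse \<theta> ^ (CARD('d) + 2) * (\<Lambda> * measure lborel (Z \<inter> cball 0 1))) \<and>
        (\<theta> * b' - b)\<^sup>2 \<le> C0 * excess u b q \<and> (norm (q' - q))\<^sup>2 \<le> C0 * excess u b q \<and>
        (norm q)\<^sup>2 * measure lborel ({y. \<theta> *\<^sub>R y \<in> Z} \<inter> cball 0 1) \<le>
          C0 * inverse \<theta> ^ CARD('d) * (excess u b q + \<Lambda> * measure lborel (Z \<inter> cball 0 1)))"
    using excess_step[where 'd = 'd] by blast
  \<comment> \<open>The iteration tracks \<Lambda> times the measure of \<open>Z\<close>, so the
    zero-set inequality gets multiplied by \<Lambda>; the factor \<open>max 1 \<Lambda>\<close> lets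
    one constant serve all inequalities.\<close>
  define C where "C = C0 * max 1 \<Lambda>"
  have C: "C \<ge> 0" "C0 \<le> C" "\<Lambda> * C0 \<le> C" using C0 mult_left_mono[of 1 "max 1 \<Lambda>" C0] mult_left_mono[of \<Lambda> "max 1 \<Lambda>" C0]
    by (auto simp: C_def mult.commute)
  \<comment> \<open>Small enough that C \<theta>^2 \<le> 1/8, the contraction asked for by
    \<open>slope_iteration\<close>.\<close>
  define \<theta> where "\<theta> = min (1/4) (inverse (8 * (C + 1)))"
  have \<theta>: "0 < \<theta>" "\<theta> \<le> 1/4" "\<theta> < 1" using C by (auto simp: \<theta>_def)
  have \<theta>C: "C * \<theta>\<^sup>2 \<le> 1/8"
  proof -
    have "C * \<theta>\<^sup>2 \<le> (C + 1) * \<theta>\<^sup>2" by (intro mult_right_mono) auto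
    also have "\<dots> = ((C + 1) * \<theta>) * \<theta>" by (simp add: power2_eq_square)
    also have "\<dots> \<le> ((C + 1) * inverse (8 * (C + 1))) * 1"
      using \<theta> C by (intro mult_mono) (auto simp: \<theta>_def)
    also have "\<dots> = 1/8" using C by (simp add: field_simps)
    finally show ?thesis .
  qed
  define r0 where "r0 = R / 2"
  have r0: "r0 > 0" using R by (simp add: r0_def)
  obtain U where U: "\<And>x. x \<in> cball x0 R \<Longrightarrow> \<bar>u x\<bar> \<le> U"
  proof -
    have "compact (u ` cball x0 R)" by (intro compact_continuous_image continuous_on_subset[OF uc]) auto
    then have "bounded (u ` cball x0 R)" by (rule compact_imp_bounded)
    then obtain B where "\<forall>x\<in>u ` cball x0 R. norm x \<le> B" using bounded_iff by blast
    then show ?thesis by (intro that[of B]) auto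
  qed
  have U0: "U \<ge> 0"
  proof -
    have "\<bar>u x0\<bar> \<le> U" using R by (intro U) simp
    then show ?thesis using abs_ge_zero order_trans by blast
  qed
  define J0 where "J0 = (U / r0)\<^sup>2 * \<omega>"
  have J00: "J0 \<ge> 0" using \<omega> by (simp add: J0_def)
  have L0: "\<Lambda> \<ge> 0" by (rule nh_Lam[OF w])
  \<comment> \<open>\<open>Q\<close> is fixed before the centre \<open>a\<close>: it depends on the
    sequences only through their common bounds, which makes the final constant uniform in
    \<open>a\<close>.\<close>
  obtain Q where Q: "Q \<ge> 0" and Qb: "\<forall>J \<mu> (q :: nat \<Rightarrow> real^'d).
     (\<forall>k. J k \<ge> 0 \<and> 0 \<le> \<mu> k \<and> \<mu> k \<le> \<Lambda> * \<omega>) \<longrightarrow> J 0 \<le> J0 \<longrightarrow> q 0 = 0 \<longrightarrow>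
     (\<forall>k. J (Suc k) \<le> C * (\<theta>\<^sup>2 * J k + inverse \<theta> ^ (n + 2) * \<mu> k) \<and> (norm (q (Suc k) - q k))\<^sup>2 \<le> C * J k \<and>
        (norm (q k))\<^sup>2 * \<mu> (Suc k) \<le> C * inverse \<theta> ^ n * (J k + \<mu> k)) \<longrightarrow>
     (\<forall>k. J k \<le> Q \<and> norm (q k) \<le> Q)"
    using slope_iteration[where 'a = "real^'d" and C = C and \<alpha> = "\<theta>\<^sup>2" and \<beta> = "inverse \<theta> ^ (n + 2)"
        and \<gamma> = "inverse \<theta> ^ n" and N = "\<Lambda> * \<omega>" and E = J0] C \<theta> \<theta>C J00 L0 \<omega> by auto
  define L1 where "L1 = 3 * (Q + 4 * (C * Q) * \<omega> + Q\<^sup>2 * \<omega>)"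
  have L10: "L1 \<ge> 0" using Q C \<omega> by (auto simp: L1_def intro!: add_nonneg_nonneg mult_nonneg_nonneg)
  define L where "L = L1 * inverse \<theta> ^ (n + 2)"
  have main: "(LINT x|lborel. indicator (cball a (\<theta> ^ k * r0)) x * (u x - u a)\<^sup>2) \<le> L1 * (\<theta> ^ k * r0) ^ (n + 2)"
    if a: "a \<in> cball x0 (R/2)" for a k
  proof -
    define r where "r k = \<theta> ^ k * r0" for k
    have r: "r k > 0" "r (Suc k) = \<theta> * r k" "r k \<le> r0" for k
      using \<theta> r0 by (auto simp: r_def mult_left_le_one_le power_le_one)
    define v where "v k y = u (a + r k *\<^sub>R y) / r k" for k y
    define Zk where "Zk k = {y. a + r k *\<^sub>R y \<in> Z}" for k
    have sub: "cball a (r k) \<subseteq> cball x0 R" for k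
    proof
      fix x assume "x \<in> cball a (r k)"
      then show "x \<in> cball x0 R" using a r(3)[of k] dist_triangle[of x0 x a] by (auto simp: r0_def)
    qed
    have nh: "nearly_harmonic \<Lambda> 0 1 (v k) (Zk k)" for k
      unfolding v_def[abs_def] Zk_def by (rule nearly_harmonic_rescale[OF w r(1) sub])
    have vs: "(\<lambda>y. v k (\<theta> *\<^sub>R y) / \<theta>) = v (Suc k)" for k by (auto simp: v_def r ac_simps)
    have Zs: "{y. \<theta> *\<^sub>R y \<in> Zk k} = Zk (Suc k)" for k by (auto simp: Zk_def r ac_simps)
    define \<mu> where "\<mu> k = \<Lambda> * measure lborel (Zk k \<inter> cball 0 1)" for k
    have \<mu>: "0 \<le> \<mu> k" "\<mu> k \<le> \<Lambda> * \<omega>" for k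
    proof -
      show "0 \<le> \<mu> k" using L0 by (simp add: \<mu>_def)
      have "measure lborel (Zk k \<inter> cball 0 1) \<le> measure lborel (cball (0::real^'d) 1)"
        by (rule measure_mono_fmeasurable)
           (auto intro!: fmeasurable_compact borel_compact compact_Int_closed nh_compact[OF nh])
      then show "\<mu> k \<le> \<Lambda> * \<omega>" unfolding \<mu>_def m1 using L0 by (rule mult_left_mono)
    qed
    define Stp where "Stp k p p' \<longleftrightarrow>
        excess (v (Suc k)) (fst p') (snd p') \<le> C0 * (\<theta>\<^sup>2 * excess (v k) (fst p) (snd p) + inverse \<theta> ^ (n + 2) * \<mu> k) \<and>
        (\<theta> * fst p' - fst p)\<^sup>2 \<le> C0 * excess (v k) (fst p) (snd p) \<and>
        (norm (snd p' - snd p))\<^sup>2 \<le> C0 * excess (v k) (fst p) (snd p) \<and>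
        (norm (snd p))\<^sup>2 * measure lborel (Zk (Suc k) \<inter> cball 0 1) \<le>
          C0 * inverse \<theta> ^ n * (excess (v k) (fst p) (snd p) + \<mu> k)" for k and p p' :: "real \<times> (real^'d)"
    have ex: "\<exists>p'. Stp k p p'" for p k
    proof -
      obtain b' q' where "Stp k p (b', q')"
        using step0[rule_format, OF nh \<theta>(1,2), of k "fst p" "snd p"]
        unfolding vs Zs \<mu>_def[symmetric] n_def[symmetric] Stp_def fst_conv snd_conv by blast
      then show ?thesis by blast
    qed
    \<comment> \<open>Each affine function is only known to exist once the previous one is given, so
      the sequence comes from dependent choice.\<close>
    obtain p where p: "\<And>k. (k = 0 \<longrightarrow> p k = (0, 0)) \<and> Stp k (p k) (p (Suc k))"
    proof -
      have "\<exists>p. \<forall>k. (k = 0 \<longrightarrow> p k = (0, 0)) \<and> Stp k (p k) (p (Suc k))"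
        by (rule dependent_nat_choice) (use ex in auto)
      then show ?thesis using that by blast
    qed
    have p0: "p 0 = (0, 0)" and ps: "\<And>k. Stp k (p k) (p (Suc k))" using p by auto
    define b where "b k = fst (p k)" for k
    define q where "q k = snd (p k)" for k
    define J where "J k = excess (v k) (b k) (q k)" for k
    have J0': "J k \<ge> 0" for k by (simp add: J_def excess_nonneg)
    have s: "J (Suc k) \<le> C0 * (\<theta>\<^sup>2 * J k + inverse \<theta> ^ (n + 2) * \<mu> k)" "(\<theta> * b (Suc k) - b k)\<^sup>2 \<le> C0 * J k"
      "(norm (q (Suc k) - q k))\<^sup>2 \<le> C0 * J k"
      "(norm (q k))\<^sup>2 * measure lborel (Zk (Suc k) \<inter> cball 0 1) \<le> C0 * inverse \<theta> ^ n * (J k + \<mu> k)" for k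
      using ps[of k] by (simp_all add: Stp_def b_def q_def J_def)
    have s1: "J (Suc k) \<le> C * (\<theta>\<^sup>2 * J k + inverse \<theta> ^ (n + 2) * \<mu> k)" for k
    proof -
      have "C0 * (\<theta>\<^sup>2 * J k + inverse \<theta> ^ (n + 2) * \<mu> k) \<le> C * (\<theta>\<^sup>2 * J k + inverse \<theta> ^ (n + 2) * \<mu> k)"
        using J0' \<mu> \<theta> by (intro mult_right_mono C) auto
      then show ?thesis using s(1)[of k] by linarith
    qed
    have CJ: "C0 * J k \<le> C * J k" for k by (intro mult_right_mono C J0')
    have s4: "(norm (q k))\<^sup>2 * \<mu> (Suc k) \<le> C * inverse \<theta> ^ n * (J k + \<mu> k)" for k
    proof -
      have "(norm (q k))\<^sup>2 * \<mu> (Suc k) = \<Lambda> * ((norm (q k))\<^sup>2 * measure lborel (Zk (Suc k) \<inter> cball 0 1))"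
        by (simp add: \<mu>_def)
      also have "\<dots> \<le> \<Lambda> * (C0 * inverse \<theta> ^ n * (J k + \<mu> k))" by (intro mult_left_mono s L0)
      also have "\<dots> = (\<Lambda> * C0) * (inverse \<theta> ^ n * (J k + \<mu> k))" by simp
      also have "\<dots> \<le> C * (inverse \<theta> ^ n * (J k + \<mu> k))" using J0' \<mu> \<theta> by (intro mult_right_mono C) auto
      finally show ?thesis by simp
    qed
    have iv: "integrable lborel (\<lambda>y. indicator (cball 0 1) y * (f y)\<^sup>2)" if "continuous_on UNIV f" for f :: "real^'d \<Rightarrow> real"
      by (intro integrable_indicator_cball continuous_intros that)
    have J0b: "J 0 \<le> J0"
    proof -
      have "J 0 = (LINT y|lborel. indicator (cball 0 1) y * (v 0 y)\<^sup>2)"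
        by (simp add: J_def b_def q_def p0 excess_def)
      also have "\<dots> \<le> (LINT y|lborel. (U / r0)\<^sup>2 * indicator (cball (0::real^'d) 1) y)"
      proof (rule integral_mono[OF iv integrable_cball_const])
        show "continuous_on UNIV (v 0)" by (rule nh_cont[OF nh])
        fix y :: "real^'d"
        show "indicator (cball 0 1) y * (v 0 y)\<^sup>2 \<le> (U / r0)\<^sup>2 * indicator (cball 0 1) y"
        proof (cases "y \<in> cball 0 1")
          case True
          then have "a + r 0 *\<^sub>R y \<in> cball a (r 0)" using r(1)[of 0] by (simp add: dist_norm)
          then have "\<bar>u (a + r 0 *\<^sub>R y)\<bar> \<le> U" using sub U by blast
          then have "\<bar>v 0 y\<bar> \<le> \<bar>U / r0\<bar>" using r0 U0 by (simp add: v_def r_def divide_right_mono)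
          then have "(v 0 y)\<^sup>2 \<le> (U / r0)\<^sup>2" by (simp only: abs_le_square_iff)
          then show ?thesis using True by simp
        qed simp
      qed
      also have "\<dots> = J0" by (simp add: J0_def m1)
      finally show ?thesis .
    qed
    have bds: "J k \<le> Q" "norm (q k) \<le> Q" for k
    proof -
      have "\<forall>k. J k \<ge> 0 \<and> 0 \<le> \<mu> k \<and> \<mu> k \<le> \<Lambda> * \<omega>" using J0' \<mu> by blast
      moreover have "q 0 = 0" by (simp add: q_def p0)
      moreover have "\<forall>k. J (Suc k) \<le> C * (\<theta>\<^sup>2 * J k + inverse \<theta> ^ (n + 2) * \<mu> k) \<and> (norm (q (Suc k) - q k))\<^sup>2 \<le> C * J k \<and>
        (norm (q k))\<^sup>2 * \<mu> (Suc k) \<le> C * inverse \<theta> ^ n * (J k + \<mu> k)"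
        using s1 s4 order_trans[OF s(3) CJ] by blast
      ultimately show "J k \<le> Q" "norm (q k) \<le> Q" using Qb J0b by blast+
    qed
    define c where "c = sqrt (C * Q)"
    have c: "c \<ge> 0" "c\<^sup>2 = C * Q" using C Q by (auto simp: c_def)
    define A where "A k = r k * b k" for k
    \<comment> \<open>Writing the bound as a difference of radii makes it telescope; since \<theta>
      \<le> 1/4, each radius is at most twice its difference from the next.\<close>
    have Astep: "\<bar>A (Suc k) - A k\<bar> \<le> 2 * c * (r k - r (Suc k))" for k
    proof -
      have "(\<theta> * b (Suc k) - b k)\<^sup>2 \<le> C * Q"
        using s(2)[of k] CJ[of k] mult_left_mono[OF bds(1)[of k] C(1)] by linarith
      then have "\<bar>\<theta> * b (Suc k) - b k\<bar> \<le> c" using c by (metis abs_le_square_iff abs_of_nonneg)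
      then have "r k * \<bar>\<theta> * b (Suc k) - b k\<bar> \<le> r k * c" using r(1)[of k] by (intro mult_left_mono) auto
      moreover have "A (Suc k) - A k = r k * (\<theta> * b (Suc k) - b k)" by (simp add: A_def r algebra_simps)
      then have "\<bar>A (Suc k) - A k\<bar> = r k * \<bar>\<theta> * b (Suc k) - b k\<bar>" using r(1)[of k] by (simp add: abs_mult)
      moreover have "r k * c \<le> 2 * c * (r k - r (Suc k))"
      proof -
        have "r (Suc k) \<le> r k / 2" using mult_right_mono[OF \<theta>(2), of "r k"] r(1)[of k] by (simp add: r)
        then have "c * r k \<le> c * (2 * (r k - r (Suc k)))" using c by (intro mult_left_mono) auto
        then show ?thesis by (simp add: ac_simps)
      qed
      ultimately show ?thesis by linarith
    qed
    have Adiff: "\<bar>A (k + m) - A k\<bar> \<le> 2 * c * (r k - r (k + m))" for k m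
    proof (induction m)
      case (Suc m)
      then show ?case using Astep[of "k + m"] by (simp add: algebra_simps)
    qed simp
    have cv: "continuous_on UNIV (\<lambda>y. u (a + r k *\<^sub>R y))" for k
      by (intro continuous_on_compose2[OF uc] continuous_intros) auto
    have three: "(x + y + z)\<^sup>2 \<le> 3 * x\<^sup>2 + 3 * y\<^sup>2 + 3 * z\<^sup>2" for x y z :: real
      using zero_le_power2[of "x - y"] zero_le_power2[of "y - z"] zero_le_power2[of "x - z"]
      by (simp add: power2_eq_square algebra_simps)
    have Jsc: "(LINT y|lborel. indicator (cball 0 1) y * (u (a + r k *\<^sub>R y) - A k - r k * (q k \<bullet> y))\<^sup>2) \<le> (r k)\<^sup>2 * Q" for k
    proof -
      have "(\<lambda>y. indicator (cball 0 1) y * (u (a + r k *\<^sub>R y) - A k - r k * (q k \<bullet> y))\<^sup>2) =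
        (\<lambda>y. (r k)\<^sup>2 * (indicator (cball 0 1) y * (v k y - (b k + q k \<bullet> y))\<^sup>2))"
      proof
        fix y
        have "u (a + r k *\<^sub>R y) - A k - r k * (q k \<bullet> y) = r k * (v k y - (b k + q k \<bullet> y))"
          using r(1)[of k] by (simp add: v_def A_def field_simps)
        then show "indicator (cball 0 1) y * (u (a + r k *\<^sub>R y) - A k - r k * (q k \<bullet> y))\<^sup>2 =
          (r k)\<^sup>2 * (indicator (cball 0 1) y * (v k y - (b k + q k \<bullet> y))\<^sup>2)"
          by (simp add: power_mult_distrib)
      qed
      then have "(LINT y|lborel. indicator (cball 0 1) y * (u (a + r k *\<^sub>R y) - A k - r k * (q k \<bullet> y))\<^sup>2) = (r k)\<^sup>2 * J k"
        by (simp add: J_def excess_def)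
      also have "\<dots> \<le> (r k)\<^sup>2 * Q" by (intro mult_left_mono bds) auto
      finally show ?thesis .
    qed
    have qy: "(r k * (q k \<bullet> y))\<^sup>2 \<le> (r k)\<^sup>2 * Q\<^sup>2" if "y \<in> cball 0 1" for k y
    proof -
      have "\<bar>q k \<bullet> y\<bar> \<le> norm (q k) * norm y" by (rule Cauchy_Schwarz_ineq2)
      also have "\<dots> \<le> Q * 1" using bds(2)[of k] that Q by (intro mult_mono) auto
      finally have "(q k \<bullet> y)\<^sup>2 \<le> Q\<^sup>2" using Q by (metis abs_le_square_iff abs_of_nonneg mult_1_right)
      then show ?thesis by (simp add: power_mult_distrib mult_left_mono)
    qed
    have r_lim: "r \<longlonglongrightarrow> 0"
      unfolding r_def[abs_def] using \<theta> by (intro tendsto_mult_left_zero LIMSEQ_power_zero) auto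
    \<comment> \<open>Near the centre \<open>u\<close> is close to \<open>u a\<close> by continuity,
      and in mean square it is close to \<open>A k\<close> up to terms of order \<open>r k\<close>.
      Averaging the sum of both estimates over the unit ball compares the two constants.\<close>
    have A_lim: "A \<longlonglongrightarrow> u a"
    proof (rule LIMSEQ_I)
      fix e :: real assume e: "e > 0"
      have "isCont u a" using uc by (simp add: continuous_on_eq_continuous_at)
      then obtain d where d: "d > 0" "\<And>x. dist x a < d \<Longrightarrow> dist (u x) (u a) < e / 4"
        using e unfolding continuous_at_eps_delta by (metis dist_norm divide_pos_pos zero_less_numeral)
      define K where "K = 3 * (Q / \<omega> + Q\<^sup>2)"
      have "(\<lambda>k. K * (r k)\<^sup>2) \<longlonglongrightarrow> K * 0\<^sup>2" by (intro tendsto_intros r_lim)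
      then have "\<forall>\<^sub>F k in sequentially. K * (r k)\<^sup>2 < e\<^sup>2 / 4"
        by (rule order_tendstoD(2)) (use e in simp)
      moreover have "\<forall>\<^sub>F k in sequentially. r k < d" by (rule order_tendstoD(2)[OF r_lim d(1)])
      ultimately have "\<forall>\<^sub>F k in sequentially. norm (A k - u a) < e"
      proof eventually_elim
        case (elim k)
        have near: "(u (a + r k *\<^sub>R y) - u a)\<^sup>2 \<le> (e/4)\<^sup>2" if "y \<in> cball 0 1" for y
        proof -
          have "norm (r k *\<^sub>R y) \<le> r k * 1" using that r(1)[of k] by (simp add: mult_left_le)
          then have "dist (a + r k *\<^sub>R y) a < d" using elim(2) by (simp add: dist_norm)
          then have "dist (u (a + r k *\<^sub>R y)) (u a) < e / 4" by (rule d(2))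
          then have "\<bar>u (a + r k *\<^sub>R y) - u a\<bar> \<le> \<bar>e/4\<bar>" using e by (simp add: dist_norm)
          then show ?thesis by (simp only: abs_le_square_iff)
        qed
        have "(A k - u a)\<^sup>2 * \<omega> = (LINT y|lborel. (A k - u a)\<^sup>2 * indicator (cball (0::real^'d) 1) y)" by (simp add: m1)
        also have "\<dots> \<le> (LINT y|lborel. 3 * (indicator (cball 0 1) y * (u (a + r k *\<^sub>R y) - A k - r k * (q k \<bullet> y))\<^sup>2)
             + (3 * (e/4)\<^sup>2 + 3 * ((r k)\<^sup>2 * Q\<^sup>2)) * indicator (cball (0::real^'d) 1) y)"
        proof (rule integral_mono[OF integrable_cball_const])
          show "integrable lborel (\<lambda>y. 3 * (indicator (cball 0 1) y * (u (a + r k *\<^sub>R y) - A k - r k * (q k \<bullet> y))\<^sup>2)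
             + (3 * (e/4)\<^sup>2 + 3 * ((r k)\<^sup>2 * Q\<^sup>2)) * indicator (cball (0::real^'d) 1) y)"
            by (intro Bochner_Integration.integrable_add integrable_mult_right iv integrable_cball_const continuous_intros cv)
          fix y :: "real^'d"
          show "(A k - u a)\<^sup>2 * indicator (cball 0 1) y \<le> 3 * (indicator (cball 0 1) y * (u (a + r k *\<^sub>R y) - A k - r k * (q k \<bullet> y))\<^sup>2)
             + (3 * (e/4)\<^sup>2 + 3 * ((r k)\<^sup>2 * Q\<^sup>2)) * indicator (cball (0::real^'d) 1) y"
          proof (cases "y \<in> cball 0 1")
            case True
            have "(A k - u a)\<^sup>2 = ((u (a + r k *\<^sub>R y) - u a) + (- (u (a + r k *\<^sub>R y) - A k - r k * (q k \<bullet> y))) + (- (r k * (q k \<bullet> y))))\<^sup>2"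
              by simp
            also have "\<dots> \<le> 3 * (u (a + r k *\<^sub>R y) - u a)\<^sup>2 + 3 * (- (u (a + r k *\<^sub>R y) - A k - r k * (q k \<bullet> y)))\<^sup>2 + 3 * (- (r k * (q k \<bullet> y)))\<^sup>2"
              by (rule three)
            finally have "(A k - u a)\<^sup>2 \<le> 3 * (u (a + r k *\<^sub>R y) - u a)\<^sup>2 + 3 * (u (a + r k *\<^sub>R y) - A k - r k * (q k \<bullet> y))\<^sup>2 + 3 * (r k * (q k \<bullet> y))\<^sup>2"
              by (simp only: power2_minus)
            then have "(A k - u a)\<^sup>2 \<le> 3 * (u (a + r k *\<^sub>R y) - A k - r k * (q k \<bullet> y))\<^sup>2 + (3 * (e/4)\<^sup>2 + 3 * ((r k)\<^sup>2 * Q\<^sup>2))"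
              using near[OF True] qy[OF True, of k] by linarith
            moreover have "indicator (cball 0 1) y = (1::real)" using True by simp
            ultimately show ?thesis by (simp only: mult_1_left mult_1_right)
          qed simp
        qed
        also have "\<dots> = 3 * (LINT y|lborel. indicator (cball 0 1) y * (u (a + r k *\<^sub>R y) - A k - r k * (q k \<bullet> y))\<^sup>2)
             + (3 * (e/4)\<^sup>2 + 3 * ((r k)\<^sup>2 * Q\<^sup>2)) * \<omega>"
        proof -
          have 1: "integrable lborel (\<lambda>y. 3 * (indicator (cball 0 1) y * (u (a + r k *\<^sub>R y) - A k - r k * (q k \<bullet> y))\<^sup>2))"
            by (intro integrable_mult_right iv continuous_intros cv)
          show ?thesis using Bochner_Integration.integral_add[OF 1 integrable_cball_const] by (simp add: m1)
        qed
        also have "\<dots> \<le> 3 * ((r k)\<^sup>2 * Q) + (3 * (e/4)\<^sup>2 + 3 * ((r k)\<^sup>2 * Q\<^sup>2)) * \<omega>"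
          using Jsc[of k] by simp
        also have "\<dots> = (K * (r k)\<^sup>2 + 3 * (e/4)\<^sup>2) * \<omega>" using \<omega> by (simp add: K_def field_simps)
        finally have "(A k - u a)\<^sup>2 \<le> K * (r k)\<^sup>2 + 3 * (e/4)\<^sup>2" using \<omega> by simp
        also have "\<dots> < e\<^sup>2"
        proof -
          have "3 * (e/4)\<^sup>2 = 3/16 * e\<^sup>2" by (simp add: power_divide)
          moreover have "e\<^sup>2 > 0" using e by simp
          ultimately show ?thesis using elim(1) by linarith
        qed
        finally have "\<bar>A k - u a\<bar> < e" using e by (intro power2_less_imp_less[of "\<bar>A k - u a\<bar>" e]) auto
        then show ?case by simp
      qed
      then show "\<exists>no. \<forall>k\<ge>no. norm (A k - u a) < e" by (simp add: eventually_sequentially)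
    qed
    \<comment> \<open>Letting m tend to infinity in the telescoped bound turns convergence into a
      rate: \<open>A k\<close> is within \<open>2 * c * r k\<close> of \<open>u a\<close>.\<close>
    have Ab: "(A k - u a)\<^sup>2 \<le> (r k)\<^sup>2 * (4 * (C * Q))" for k
    proof -
      have "(\<lambda>m. \<bar>A (k + m) - A k\<bar>) \<longlonglongrightarrow> \<bar>u a - A k\<bar>"
        by (intro tendsto_intros LIMSEQ_ignore_initial_segment[OF A_lim, of k, unfolded add.commute[of _ k]])
      moreover have "\<bar>A (k + m) - A k\<bar> \<le> 2 * c * r k" for m
      proof -
        have "2 * c * (r k - r (k + m)) \<le> 2 * c * r k" using c r(1)[of "k + m"] by (intro mult_left_mono) auto
        then show ?thesis using Adiff[of k m] by linarith
      qed
      ultimately have "\<bar>u a - A k\<bar> \<le> 2 * c * r k" by (intro LIMSEQ_le_const2) auto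
      then have "(u a - A k)\<^sup>2 \<le> (2 * c * r k)\<^sup>2" using c r(1)[of k]
        by (metis abs_le_square_iff abs_of_nonneg less_imp_le mult_nonneg_nonneg zero_le_numeral)
      also have "\<dots> = (r k)\<^sup>2 * (4 * (C * Q))" by (simp add: power_mult_distrib c)
      finally show ?thesis by (simp add: power2_commute)
    qed
    have "(LINT y|lborel. indicator (cball 0 1) y * (u (a + r k *\<^sub>R y) - u a)\<^sup>2) \<le>
      (LINT y|lborel. 3 * (indicator (cball 0 1) y * (u (a + r k *\<^sub>R y) - A k - r k * (q k \<bullet> y))\<^sup>2)
             + (3 * ((r k)\<^sup>2 * (4 * (C * Q))) + 3 * ((r k)\<^sup>2 * Q\<^sup>2)) * indicator (cball (0::real^'d) 1) y)"
    proof (rule integral_mono)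
      show "integrable lborel (\<lambda>y. indicator (cball 0 1) y * (u (a + r k *\<^sub>R y) - u a)\<^sup>2)"
        by (intro iv continuous_intros cv)
      show "integrable lborel (\<lambda>y. 3 * (indicator (cball 0 1) y * (u (a + r k *\<^sub>R y) - A k - r k * (q k \<bullet> y))\<^sup>2)
             + (3 * ((r k)\<^sup>2 * (4 * (C * Q))) + 3 * ((r k)\<^sup>2 * Q\<^sup>2)) * indicator (cball (0::real^'d) 1) y)"
        by (intro Bochner_Integration.integrable_add integrable_mult_right iv integrable_cball_const continuous_intros cv)
      fix y :: "real^'d"
      show "indicator (cball 0 1) y * (u (a + r k *\<^sub>R y) - u a)\<^sup>2 \<le>
         3 * (indicator (cball 0 1) y * (u (a + r k *\<^sub>R y) - A k - r k * (q k \<bullet> y))\<^sup>2)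
             + (3 * ((r k)\<^sup>2 * (4 * (C * Q))) + 3 * ((r k)\<^sup>2 * Q\<^sup>2)) * indicator (cball (0::real^'d) 1) y"
      proof (cases "y \<in> cball 0 1")
        case True
        have "(u (a + r k *\<^sub>R y) - u a)\<^sup>2 = ((u (a + r k *\<^sub>R y) - A k - r k * (q k \<bullet> y)) + (A k - u a) + r k * (q k \<bullet> y))\<^sup>2"
          by simp
        also have "\<dots> \<le> 3 * (u (a + r k *\<^sub>R y) - A k - r k * (q k \<bullet> y))\<^sup>2 + 3 * (A k - u a)\<^sup>2 + 3 * (r k * (q k \<bullet> y))\<^sup>2"
          by (rule three)
        finally have "(u (a + r k *\<^sub>R y) - u a)\<^sup>2 \<le> 3 * (u (a + r k *\<^sub>R y) - A k - r k * (q k \<bullet> y))\<^sup>2 +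
            (3 * ((r k)\<^sup>2 * (4 * (C * Q))) + 3 * ((r k)\<^sup>2 * Q\<^sup>2))"
          using Ab[of k] qy[OF True, of k] by linarith
        moreover have "indicator (cball 0 1) y = (1::real)" using True by simp
        ultimately show ?thesis by (simp only: mult_1_left mult_1_right)
      qed simp
    qed
    also have "\<dots> = 3 * (LINT y|lborel. indicator (cball 0 1) y * (u (a + r k *\<^sub>R y) - A k - r k * (q k \<bullet> y))\<^sup>2)
             + (3 * ((r k)\<^sup>2 * (4 * (C * Q))) + 3 * ((r k)\<^sup>2 * Q\<^sup>2)) * \<omega>"
    proof -
      have 1: "integrable lborel (\<lambda>y. 3 * (indicator (cball 0 1) y * (u (a + r k *\<^sub>R y) - A k - r k * (q k \<bullet> y))\<^sup>2))"
        by (intro integrable_mult_right iv continuous_intros cv)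
      show ?thesis using Bochner_Integration.integral_add[OF 1 integrable_cball_const] by (simp add: m1)
    qed
    also have "\<dots> \<le> 3 * ((r k)\<^sup>2 * Q) + (3 * ((r k)\<^sup>2 * (4 * (C * Q))) + 3 * ((r k)\<^sup>2 * Q\<^sup>2)) * \<omega>"
      using Jsc[of k] by simp
    also have "\<dots> = L1 * (r k)\<^sup>2" by (simp add: L1_def algebra_simps)
    finally have fin: "(LINT y|lborel. indicator (cball 0 1) y * (u (a + r k *\<^sub>R y) - u a)\<^sup>2) \<le> L1 * (r k)\<^sup>2" .
    have "(LINT x|lborel. indicator (cball a (r k)) x * (u x - u a)\<^sup>2) =
       \<bar>r k\<bar> ^ DIM(real^'d) * (LINT y|lborel. indicator (cball a (r k)) (a + r k *\<^sub>R y) * (u (a + r k *\<^sub>R y) - u a)\<^sup>2)"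
      using r(1)[of k] by (intro lborel_integral_affine borel_measurable_times borel_measurable_indicator
          borel_measurable_continuous_onI continuous_intros uc) auto
    also have "(\<lambda>y. indicator (cball a (r k)) (a + r k *\<^sub>R y) * (u (a + r k *\<^sub>R y) - u a)\<^sup>2) =
      (\<lambda>y. indicator (cball 0 1) y * (u (a + r k *\<^sub>R y) - u a)\<^sup>2)"
      using r(1)[of k] by (auto simp: indicator_def dist_norm fun_eq_iff)
    also have "\<bar>r k\<bar> ^ DIM(real^'d) * (LINT y|lborel. indicator (cball 0 1) y * (u (a + r k *\<^sub>R y) - u a)\<^sup>2) \<le> r k ^ n * (L1 * (r k)\<^sup>2)"
      using fin r(1)[of k] by (simp add: n_def mult_left_mono)
    also have "r k ^ n * (L1 * (r k)\<^sup>2) = L1 * r k ^ (n + 2)" by (simp only: power_add ac_simps)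
    finally show ?thesis by (simp only: r_def)
  qed
  show ?thesis
  proof (rule exI[of _ L], intro conjI allI impI)
    show "L \<ge> 0" using L10 \<theta> by (simp add: L_def)
    fix a :: "real^'d" and \<rho> :: real
    assume a: "a \<in> cball x0 (R/2)" and \<rho>: "0 < \<rho>" "\<rho> \<le> R/2"
    obtain k where k: "\<theta> ^ Suc k * r0 < \<rho>" "\<rho> \<le> \<theta> ^ k * r0"
      using geometric_scale[OF \<theta>(1,3) \<rho>(1), of r0] \<rho>(2) unfolding r0_def by metis
    have ic: "integrable lborel (\<lambda>x. indicator (cball a t) x * (u x - u a)\<^sup>2)" for t
      by (intro integrable_indicator_cball continuous_intros uc)
    have "(LINT x|lborel. indicator (cball a \<rho>) x * (u x - u a)\<^sup>2) \<le> (LINT x|lborel. indicator (cball a (\<theta> ^ k * r0)) x * (u x - u a)\<^sup>2)"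
    proof (rule integral_mono[OF ic ic])
      show "indicator (cball a \<rho>) x * (u x - u a)\<^sup>2 \<le> indicator (cball a (\<theta> ^ k * r0)) x * (u x - u a)\<^sup>2" for x
        using k(2) by (auto simp: indicator_def)
    qed
    also have "\<dots> \<le> L1 * (\<theta> ^ k * r0) ^ (n + 2)" by (rule main[OF a])
    also have "\<dots> \<le> L1 * (inverse \<theta> * \<rho>) ^ (n + 2)"
    proof (intro mult_left_mono power_mono L10)
      show "\<theta> ^ k * r0 \<le> inverse \<theta> * \<rho>" using k(1) \<theta> by (simp add: field_simps)
    qed (use \<theta> r0 in auto)
    also have "\<dots> = L * \<rho> ^ (n + 2)" by (simp add: L_def power_mult_distrib)
    finally show "(LINT x|lborel. indicator (cball a \<rho>) x * (u x - u a)\<^sup>2) \<le> L * \<rho> ^ (CARD('d) + 2)" by (simp add: n_def)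
  qed
qed

text \<open>Campanato's argument for two points: the ball about their midpoint with radius half
  their distance lies in both balls centred at the points whose radius is the full distance.
  Integrating the squared difference of the two values over it brings in the mean square estimates
  at both points.\<close>

theorem nearly_harmonic_lipschitz:
  fixes u :: "real^'d \<Rightarrow> real"
  assumes w: "nearly_harmonic \<Lambda> x0 R u Z" and R: "R > 0"
  shows "\<exists>L\<ge>0. \<forall>x\<in>cball x0 (R/4). \<forall>y\<in>cball x0 (R/4). \<bar>u x - u y\<bar> \<le> L * norm (x - y)"
proof -
  note uc = nh_cont[OF w]
  obtain L where L: "L \<ge> 0" and Lb: "\<forall>a \<rho>. a \<in> cball x0 (R/2) \<longrightarrow> 0 < \<rho> \<longrightarrow> \<rho> \<le> R/2 \<longrightarrow>
     (LINT x|lborel. indicator (cball a \<rho>) x * (u x - u a)\<^sup>2) \<le> L * \<rho> ^ (CARD('d) + 2)"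
    using nearly_harmonic_campanato[OF w R] by blast
  define \<omega> where "\<omega> = unit_ball_vol (real CARD('d))"
  have \<omega>: "\<omega> > 0" by (simp add: \<omega>_def)
  define K where "K = 4 * L * 2 ^ CARD('d) / \<omega>"
  have K: "K \<ge> 0" using L \<omega> by (simp add: K_def)
  show ?thesis
  proof (rule exI[of _ "sqrt K"], intro conjI ballI)
    show "sqrt K \<ge> 0" using K by simp
    fix x y assume x: "x \<in> cball x0 (R/4)" and y: "y \<in> cball x0 (R/4)"
    show "\<bar>u x - u y\<bar> \<le> sqrt K * norm (x - y)"
    proof (cases "x = y")
      case False
      define \<rho> where "\<rho> = norm (x - y)"
      have \<rho>: "\<rho> > 0" "\<rho> \<le> R/2" using False x y dist_triangle[of x y x0]
        by (auto simp: \<rho>_def dist_norm norm_minus_commute)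
      define z where "z = (1/2) *\<^sub>R (x + y)"
      have zx: "cball z (\<rho>/2) \<subseteq> cball x \<rho>"
      proof
        fix t assume t: "t \<in> cball z (\<rho>/2)"
        have "x - z = (1/2) *\<^sub>R (x - y)" by (simp add: z_def vec_eq_iff field_simps)
        then have "norm (x - z) = \<rho>/2" by (simp add: \<rho>_def)
        then show "t \<in> cball x \<rho>" using t dist_triangle[of x t z] by (simp add: dist_norm)
      qed
      have zy: "cball z (\<rho>/2) \<subseteq> cball y \<rho>"
      proof
        fix t assume t: "t \<in> cball z (\<rho>/2)"
        have "y - z = (1/2) *\<^sub>R (y - x)" by (simp add: z_def vec_eq_iff field_simps)
        then have "norm (y - z) = \<rho>/2" by (simp add: \<rho>_def norm_minus_commute)
        then show "t \<in> cball y \<rho>" using t dist_triangle[of y t z] by (simp add: dist_norm)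
      qed
      have ic: "integrable lborel (\<lambda>t. indicator (cball a \<rho>) t * (u t - u a)\<^sup>2)" for a
        by (intro integrable_indicator_cball continuous_intros uc)
      have "(u x - u y)\<^sup>2 * (\<omega> * (\<rho>/2) ^ CARD('d)) = (LINT t|lborel. (u x - u y)\<^sup>2 * indicator (cball z (\<rho>/2)) t)"
        using measure_cball_vec[of "\<rho>/2" z] \<rho> by (simp add: \<omega>_def)
      also have "\<dots> \<le> (LINT t|lborel. 2 * (indicator (cball x \<rho>) t * (u t - u x)\<^sup>2) + 2 * (indicator (cball y \<rho>) t * (u t - u y)\<^sup>2))"
      proof (rule integral_mono[OF integrable_cball_const])
        show "integrable lborel (\<lambda>t. 2 * (indicator (cball x \<rho>) t * (u t - u x)\<^sup>2) + 2 * (indicator (cball y \<rho>) t * (u t - u y)\<^sup>2))"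
          using ic by simp
        fix t
        show "(u x - u y)\<^sup>2 * indicator (cball z (\<rho>/2)) t \<le>
          2 * (indicator (cball x \<rho>) t * (u t - u x)\<^sup>2) + 2 * (indicator (cball y \<rho>) t * (u t - u y)\<^sup>2)"
        proof (cases "t \<in> cball z (\<rho>/2)")
          case True
          then have "t \<in> cball x \<rho>" "t \<in> cball y \<rho>" using zx zy by blast+
          moreover have "(u x - u y)\<^sup>2 \<le> 2 * (u t - u x)\<^sup>2 + 2 * (u t - u y)\<^sup>2"
            using zero_le_power2[of "(u t - u x) + (u t - u y)"]
            by (simp add: power2_eq_square algebra_simps)
          ultimately show ?thesis using True by simp
        qed simp
      qed
      also have "\<dots> = 2 * (LINT t|lborel. indicator (cball x \<rho>) t * (u t - u x)\<^sup>2) + 2 * (LINT t|lborel. indicator (cball y \<rho>) t * (u t - u y)\<^sup>2)"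
        using ic by simp
      also have "\<dots> \<le> 2 * (L * \<rho> ^ (CARD('d) + 2)) + 2 * (L * \<rho> ^ (CARD('d) + 2))"
        using x y R \<rho> by (intro add_mono mult_left_mono Lb[rule_format]) auto
      also have "\<dots> = K * \<rho>\<^sup>2 * (\<omega> * (\<rho>/2) ^ CARD('d))"
        using \<omega> by (simp add: K_def power_add power2_eq_square power_divide)
      finally have "(u x - u y)\<^sup>2 \<le> K * \<rho>\<^sup>2"
        using \<omega> \<rho> by (simp add: mult_le_cancel_right)
      then have "sqrt ((u x - u y)\<^sup>2) \<le> sqrt (K * \<rho>\<^sup>2)" by (rule real_sqrt_le_mono)
      then show ?thesis using \<rho> by (simp add: real_sqrt_mult \<rho>_def)
    qed simp
  qed
qed

section \<open>Weak gradients and the variational inequality\<close>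

lemma test_functionI:
  assumes "smooth \<phi>" "compact K" "K \<subseteq> D" "\<And>y. y \<notin> K \<Longrightarrow> \<phi> y = 0"
  shows "\<phi> \<in> test_functions D"
proof -
  have "closure {x. \<phi> x \<noteq> 0} \<subseteq> K"
    using assms(4) by (intro closure_minimal compact_imp_closed assms(2)) auto
  moreover from this have "compact (closure {x. \<phi> x \<noteq> 0})"
    using compact_Int_closed[OF assms(2) closed_closure, of "{x. \<phi> x \<noteq> 0}"] by (simp add: inf_absorb2)
  ultimately show ?thesis using assms unfolding test_functions_def by auto
qed

lemma test_function_support:
  assumes "\<phi> \<in> test_functions D"
  obtains K where "smooth \<phi>" "compact K" "K \<subseteq> D" "\<And>y. y \<notin> K \<Longrightarrow> \<phi> y = 0"
proof (rule that[of "closure {x. \<phi> x \<noteq> 0}"])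
  show "smooth \<phi>" "compact (closure {x. \<phi> x \<noteq> 0})" "closure {x. \<phi> x \<noteq> 0} \<subseteq> D"
    using assms unfolding test_functions_def by blast+
  show "\<phi> y = 0" if "y \<notin> closure {x. \<phi> x \<noteq> 0}" for y
    using that closure_subset[of "{x. \<phi> x \<noteq> 0}"] by blast
qed

text \<open>The Sobolev notions use the completed measure restricted to the domain, while
  integration by parts was done over \<open>lborel\<close>; this is the passage between
  them.\<close>

lemma integral_lebesgue_on_eq_lborel:
  fixes f :: "'a::euclidean_space \<Rightarrow> real"
  assumes f: "f \<in> borel_measurable borel" and 0: "\<And>x. x \<notin> D \<Longrightarrow> f x = 0" and D: "D \<in> sets lebesgue"
  shows "integral\<^sup>L (lebesgue_on D) f = integral\<^sup>L lborel f"
    and "integrable (lebesgue_on D) f \<longleftrightarrow> integrable lborel f"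
proof -
  have e: "(\<lambda>x. indicator D x *\<^sub>R f x) = f" 
  proof
    fix x show "indicator D x *\<^sub>R f x = f x" by (cases "x \<in> D") (simp_all add: 0)
  qed
  show "integral\<^sup>L (lebesgue_on D) f = integral\<^sup>L lborel f"
    using D f by (simp add: integral_restrict_space e[unfolded real_scaleR_def] integral_completion)
  show "integrable (lebesgue_on D) f \<longleftrightarrow> integrable lborel f"
    using D f by (simp add: integrable_restrict_space e[unfolded real_scaleR_def] integrable_completion)
qed

lemma integrable_mult_compact_support:
  fixes u f :: "'a::euclidean_space \<Rightarrow> real"
  assumes u: "set_integrable lebesgue K u" and K: "compact K" "K \<subseteq> D" and D: "D \<in> sets lebesgue"
    and f: "continuous_on UNIV f" "\<And>x. x \<notin> K \<Longrightarrow> f x = 0"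
  shows "integrable (lebesgue_on D) (\<lambda>x. u x * f x)"
proof -
  obtain B where B: "B \<ge> 0" "\<And>x. norm (f x) \<le> B" using bounded_compact_support[OF f(1) K(1) f(2)] by metis
  have iu: "integrable lebesgue (\<lambda>x. indicator K x *\<^sub>R u x)" using u unfolding set_integrable_def .
  have fm: "f \<in> borel_measurable lebesgue" using borel_measurable_continuous_onI[OF f(1)] by (simp add: measurable_completion)
  have "integrable lebesgue (\<lambda>x. (indicator K x *\<^sub>R u x) * f x)"
  proof (rule Bochner_Integration.integrable_bound)
    show "integrable lebesgue (\<lambda>x. B * (indicator K x *\<^sub>R u x))" using iu by (rule integrable_mult_right)
    show "(\<lambda>x. (indicator K x *\<^sub>R u x) * f x) \<in> borel_measurable lebesgue"
      using iu fm by (intro borel_measurable_times) auto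
    show "AE x in lebesgue. norm ((indicator K x *\<^sub>R u x) * f x) \<le> norm (B * (indicator K x *\<^sub>R u x))"
      using B by (intro AE_I2) (auto simp: abs_mult indicator_def mult.commute[of B] intro!: mult_left_mono)
  qed
  moreover have "(\<lambda>x. (indicator K x *\<^sub>R u x) * f x) = (\<lambda>x. indicator D x *\<^sub>R (u x * f x))"
  proof
    fix x show "(indicator K x *\<^sub>R u x) * f x = indicator D x *\<^sub>R (u x * f x)"
      using K(2) f(2)[of x] by (cases "x \<in> K"; cases "x \<in> D") auto
  qed
  ultimately show ?thesis using D by (simp add: integrable_restrict_space)
qed

lemma set_integrable_continuous_compact:
  fixes f :: "'a::euclidean_space \<Rightarrow> 'b::euclidean_space"
  assumes "compact K" "continuous_on UNIV f"
  shows "set_integrable lebesgue K f"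
proof -
  have m: "f \<in> borel_measurable borel" using assms(2) by (rule borel_measurable_continuous_onI)
  have "integrable lborel (\<lambda>x. indicator K x *\<^sub>R f x)"
    by (rule borel_integrable_compact[OF assms(1) continuous_on_subset[OF assms(2) subset_UNIV]])
  moreover have "(\<lambda>x. indicator K x *\<^sub>R f x) \<in> borel_measurable lborel"
    using m borel_compact[OF assms(1)] by simp
  ultimately show ?thesis unfolding set_integrable_def by (simp add: integrable_completion)
qed

text \<open>A clipped linear function of the distance to \<open>K\<close> is mollified at its own
  length scale \<open>s n\<close>. It equals one within distance \<open>s n\<close> of
  \<open>K\<close> and zero beyond twice that distance, so its mollification is one on
  \<open>K\<close> and zero from distance \<open>3 * s n\<close> on. All approximants live in one
  compact neighbourhood, as dominated convergence later requires.\<close>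

lemma compact_test_approximation:
  fixes K :: "(real^'d) set"
  assumes K: "compact K" "K \<noteq> {}" and D: "open D" "K \<subseteq> D"
  obtains \<phi> :: "nat \<Rightarrow> real^'d \<Rightarrow> real" and K' where "compact K'" "K' \<subseteq> D" "K \<subseteq> K'"
    "\<And>n. smooth (\<phi> n)" "\<And>n x. x \<notin> K' \<Longrightarrow> \<phi> n x = 0" "\<And>n x. \<bar>\<phi> n x\<bar> \<le> 1" "\<And>x. (\<lambda>n. \<phi> n x) \<longlonglongrightarrow> indicator K x"
proof -
  obtain e where e: "e > 0" "(\<Union>x\<in>K. cball x e) \<subseteq> D"
    using compact_subset_open_imp_cball_epsilon_subset[OF K(1) D] by metis
  define K' where "K' = (\<Union>x\<in>K. cball x e)"
  have K'c: "compact K'" 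
  proof -
    have "K' = {x + y | x y. x \<in> K \<and> y \<in> cball 0 e}"
    proof (intro equalityI subsetI)
      fix z assume "z \<in> K'"
      then obtain x where "x \<in> K" "z \<in> cball x e" by (auto simp: K'_def)
      then have "z = x + (z - x) \<and> x \<in> K \<and> z - x \<in> cball 0 e" by (simp add: dist_norm norm_minus_commute)
      then show "z \<in> {x + y | x y. x \<in> K \<and> y \<in> cball 0 e}" by blast
    next
      fix z assume "z \<in> {x + y | x y. x \<in> K \<and> y \<in> cball 0 e}"
      then obtain x y where "z = x + y" "x \<in> K" "y \<in> cball 0 e" by blast
      then have "z \<in> cball x e" by (simp add: dist_norm)
      then show "z \<in> K'" using \<open>x \<in> K\<close> unfolding K'_def by blast
    qed
    then show ?thesis using compact_sums[OF K(1) compact_cball[of 0 e]] by simp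
  qed
  have far: "infdist x K > e" if "x \<notin> K'" for x
  proof (rule ccontr)
    assume "\<not> infdist x K > e"
    moreover obtain y where "y \<in> K" "infdist x K = dist x y"
      using infdist_attains_inf[OF compact_imp_closed[OF K(1)] K(2)] by metis
    ultimately show False using that by (auto simp: K'_def dist_commute)
  qed
  define s where "s n = e / (3 * real (Suc n))" for n
  have s: "s n > 0" "3 * s n \<le> e" for n using e by (auto simp: s_def field_simps)
  define v where "v n y = max 0 (min 1 (2 - infdist y K / s n))" for n y
  have vc: "continuous_on UNIV (v n)" for n unfolding v_def[abs_def] using s(1)[of n] by (intro continuous_intros) auto
  have vb: "0 \<le> v n y" "v n y \<le> 1" for n y by (auto simp: v_def)
  define \<phi> where "\<phi> n = conv (v n) (ker (s n))" for n
  have ik: "integrable lborel (\<lambda>y. ker (s n) (x - y))" for n and x :: "real^'d"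
    using conv_ker_integrable[OF continuous_on_const s(1), of 1 n x] by simp
  have iv: "integrable lborel (\<lambda>y. v n y * ker (s n) (x - y))" for n x by (rule conv_ker_integrable[OF vc s(1)])
  have b: "\<bar>\<phi> n x\<bar> \<le> 1" for n x
  proof -
    have "0 \<le> \<phi> n x" unfolding \<phi>_def conv_def using vb ker_nonneg[OF s(1)] by (intro integral_nonneg_AE AE_I2 mult_nonneg_nonneg) auto
    moreover have "\<phi> n x \<le> (LINT y|lborel. ker (s n) (x - y))" unfolding \<phi>_def conv_def
      using vb ker_nonneg[OF s(1)] by (intro integral_mono iv ik mult_left_le_one_le) auto
    ultimately show ?thesis using integral_ker'[OF s(1)[of n], of x] by simp
  qed
  have z: "\<phi> n x = 0" if "infdist x K \<ge> 3 * s n" for n x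
  proof -
    have "v n y * ker (s n) (x - y) = 0" for y
    proof (cases "y \<in> cball x (s n)")
      case True
      then have "infdist y K \<ge> 2 * s n" using that infdist_triangle[of x K y] by (simp add: dist_commute)
      then have "infdist y K / s n \<ge> 2" using s(1)[of n] by (simp add: field_simps)
      then show ?thesis by (simp add: v_def)
    next
      case False
      then have "ker (s n) (x - y) = 0" by (rule ker_outside_diff[OF s(1)])
      then show ?thesis by simp
    qed
    then have "(\<lambda>y. v n y * ker (s n) (x - y)) = (\<lambda>y. 0)" by (rule ext)
    then show ?thesis unfolding \<phi>_def conv_def by (simp only:) simp
  qed
  have one: "\<phi> n x = 1" if "x \<in> K" for n x
  proof -
    have "v n y * ker (s n) (x - y) = ker (s n) (x - y)" for y
    proof (cases "y \<in> cball x (s n)")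
      case True
      then have "infdist y K \<le> s n" using infdist_le[OF that, of y] by (simp add: dist_commute)
      then have "infdist y K / s n \<le> 1" using s(1)[of n] by simp
      then show ?thesis by (simp add: v_def)
    next
      case False
      then have "ker (s n) (x - y) = 0" by (rule ker_outside_diff[OF s(1)])
      then show ?thesis by simp
    qed
    then have "(\<lambda>y. v n y * ker (s n) (x - y)) = (\<lambda>y. ker (s n) (x - y))" by (rule ext)
    then show ?thesis unfolding \<phi>_def conv_def using integral_ker'[OF s(1)[of n], of x] by (simp only:)
  qed
  show ?thesis
  proof (rule that[of K' \<phi>])
    show "compact K'" "K' \<subseteq> D" using K'c e by (auto simp: K'_def)
    show "K \<subseteq> K'" unfolding K'_def using e(1) by force
    show "smooth (\<phi> n)" for n unfolding \<phi>_def by (rule smooth_conv_ker[OF vc s(1)])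
    show "\<phi> n x = 0" if "x \<notin> K'" for n x using far[OF that] s(2)[of n] by (intro z) simp
    show "\<bar>\<phi> n x\<bar> \<le> 1" for n x by (rule b)
    show "(\<lambda>n. \<phi> n x) \<longlonglongrightarrow> indicator K x" for x
    proof (cases "x \<in> K")
      case False
      then have "infdist x K > 0"
        using K in_closed_iff_infdist_zero[OF compact_imp_closed[OF K(1)]] infdist_nonneg[of x K] by force
      moreover have "(\<lambda>n. 3 * s n) \<longlonglongrightarrow> 0"
      proof -
        have "(\<lambda>n. e * inverse (real (Suc n))) \<longlonglongrightarrow> e * 0" by (intro tendsto_intros LIMSEQ_inverse_real_of_nat)
        moreover have "3 * (e / (3 * x)) = e * inverse x" for x :: real by (cases "x = 0") (simp_all add: field_simps)
        ultimately show ?thesis by (simp only: s_def mult_zero_right)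
      qed
      ultimately have "\<forall>\<^sub>F n in sequentially. 3 * s n < infdist x K" by (intro order_tendstoD(2)) auto
      then have "\<forall>\<^sub>F n in sequentially. \<phi> n x = 0" by eventually_elim (rule z, simp)
      then show ?thesis using False by (simp add: tendsto_eventually)
    qed (simp add: one)
  qed
qed

lemma sigma_finite_lebesgue: "sigma_finite_measure (lebesgue :: 'a::euclidean_space measure)"
proof
  let ?A = "range (\<lambda>n::nat. cball (0::'a) (real n))"
  have "emeasure lebesgue (cball (0::'a) (real n)) \<noteq> \<infinity>" for n
    using emeasure_lborel_cball_finite[of "0::'a" "real n"] by simp
  moreover have "x \<in> \<Union>?A" for x using real_arch_simple[of "norm x"] by auto
  ultimately show "\<exists>A::'a set set. countable A \<and> A \<subseteq> sets lebesgue \<and> \<Union>A = space lebesgue \<and> (\<forall>a\<in>A. emeasure lebesgue a \<noteq> \<infinity>)"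
    by (intro exI[of _ ?A]) auto
qed

text \<open>The integral of \<open>g\<close> is shown to vanish over compact subsets, by
  approximating their indicators with test functions, and then over measurable subsets of a compact
  set, which up to null sets are countable unions of closed sets. An integrable function whose
  integral over every measurable set is zero vanishes almost everywhere.\<close>

lemma fundamental_lemma:
  fixes g :: "real^'d \<Rightarrow> real"
  assumes D: "open D" and int: "\<And>K. compact K \<Longrightarrow> K \<subseteq> D \<Longrightarrow> set_integrable lebesgue K g"
    and 0: "\<And>\<phi>. \<phi> \<in> test_functions D \<Longrightarrow> (\<integral>x. g x * \<phi> x \<partial>lebesgue_on D) = 0"
  shows "AE x in lebesgue_on D. g x = 0"
proof -
  have Dl: "D \<in> sets lebesgue" using D by simp
  have a: "set_lebesgue_integral lebesgue K g = 0" if K: "compact K" "K \<subseteq> D" for K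
  proof (cases "K = {}")
    case False
    from compact_test_approximation[OF K(1) False D K(2)]
    obtain \<phi> K' where K': "compact K'" "K' \<subseteq> D" "K \<subseteq> K'" and \<phi>: "\<And>n. smooth (\<phi> n)"
      "\<And>n x. x \<notin> K' \<Longrightarrow> \<phi> n x = 0" "\<And>n x. \<bar>\<phi> n x\<bar> \<le> 1" "\<And>x. (\<lambda>n. \<phi> n x) \<longlonglongrightarrow> indicator K x" by metis
    have ig: "integrable lebesgue (\<lambda>x. indicator K' x *\<^sub>R g x)" using int[OF K'(1,2)] unfolding set_integrable_def .
    have \<phi>m: "\<phi> n \<in> borel_measurable lebesgue" for n
      using borel_measurable_continuous_onI[OF smooth_continuous[OF \<phi>(1)]] by (simp add: measurable_completion)
    have "(\<lambda>n. LINT x|lebesgue. (indicator K' x *\<^sub>R g x) * \<phi> n x) \<longlonglongrightarrow> (LINT x|lebesgue. (indicator K' x *\<^sub>R g x) * indicator K x)"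
    proof (rule integral_dominated_convergence[where w = "\<lambda>x. norm (indicator K' x *\<^sub>R g x)"])
      show "(\<lambda>x. (indicator K' x *\<^sub>R g x) * indicator K x) \<in> borel_measurable lebesgue"
        using ig borel_compact[OF K(1)] by (intro borel_measurable_times borel_measurable_indicator) auto
      show "(\<lambda>x. (indicator K' x *\<^sub>R g x) * \<phi> n x) \<in> borel_measurable lebesgue" for n
        using ig \<phi>m by (intro borel_measurable_times) auto
      show "integrable lebesgue (\<lambda>x. norm (indicator K' x *\<^sub>R g x))" using ig by (rule integrable_norm)
      show "AE x in lebesgue. (\<lambda>n. (indicator K' x *\<^sub>R g x) * \<phi> n x) \<longlonglongrightarrow> (indicator K' x *\<^sub>R g x) * indicator K x"
        by (intro AE_I2 tendsto_intros \<phi>)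
      show "AE x in lebesgue. norm ((indicator K' x *\<^sub>R g x) * \<phi> n x) \<le> norm (indicator K' x *\<^sub>R g x)" for n
        using \<phi>(3)[of n] by (intro AE_I2) (auto simp: abs_mult intro!: mult_left_le)
    qed
    moreover have "(LINT x|lebesgue. (indicator K' x *\<^sub>R g x) * \<phi> n x) = 0" for n
    proof -
      have "(\<lambda>x. (indicator K' x *\<^sub>R g x) * \<phi> n x) = (\<lambda>x. indicator D x *\<^sub>R (g x * \<phi> n x))"
      proof
        fix x show "(indicator K' x *\<^sub>R g x) * \<phi> n x = indicator D x *\<^sub>R (g x * \<phi> n x)"
          using K'(2) \<phi>(2)[of x n] by (cases "x \<in> K'"; cases "x \<in> D") auto
      qed
      then have "(LINT x|lebesgue. (indicator K' x *\<^sub>R g x) * \<phi> n x) = (\<integral>x. g x * \<phi> n x \<partial>lebesgue_on D)"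
        using Dl by (simp add: integral_restrict_space)
      then show ?thesis using 0[OF test_functionI[OF \<phi>(1) K'(1,2) \<phi>(2)]] by simp
    qed
    ultimately have "(LINT x|lebesgue. (indicator K' x *\<^sub>R g x) * indicator K x) = 0"
      using LIMSEQ_unique[of "\<lambda>n. 0"] by auto
    moreover have "(\<lambda>x. (indicator K' x *\<^sub>R g x) * indicator K x) = (\<lambda>x. indicator K x *\<^sub>R g x)"
    proof
      fix x show "(indicator K' x *\<^sub>R g x) * indicator K x = indicator K x *\<^sub>R g x"
        using K'(3) by (cases "x \<in> K") auto
    qed
    ultimately show ?thesis by (simp add: set_lebesgue_integral_def)
  qed (simp add: set_lebesgue_integral_def)
  have b: "AE x in lebesgue. indicator K x *\<^sub>R g x = 0" if K: "compact K" "K \<subseteq> D" for K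
  proof (rule sigma_finite_measure.density_zero[OF sigma_finite_lebesgue])
    show iK: "integrable lebesgue (\<lambda>x. indicator K x *\<^sub>R g x)" using int[OF K] unfolding set_integrable_def .
    have hm: "(\<lambda>x. indicator K x *\<^sub>R g x) \<in> borel_measurable lebesgue" by (rule borel_measurable_integrable[OF iK])
    fix A :: "(real^'d) set" assume A: "A \<in> sets lebesgue"
    have "A \<inter> K \<in> sets lebesgue" using A borel_compact[OF K(1)] by auto
    from lebesgue_set_almost_fsigma[OF this]
    obtain C T where CT: "fsigma C" "T \<in> null_sets lebesgue" "C \<union> T = A \<inter> K" "disjnt C T" by metis
    from CT(1) obtain F where F: "\<And>i::nat. closed (F i)" "C = \<Union>(F ` UNIV)" by (auto elim!: fsigma.cases)
    \<comment> \<open>Finite unions of the closed sets increase to \<open>C\<close> and are compact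
      subsets of \<open>K\<close>, so the compact case applies to each of them.\<close>
    define Cn where "Cn n = (\<Union>i<n. F i)" for n :: nat
    have CK: "C \<subseteq> K" using CT(3) by auto
    have Cn: "compact (Cn n)" "Cn n \<subseteq> D" for n
    proof -
      have "closed (Cn n)" unfolding Cn_def using F(1) by (intro closed_UN) auto
      moreover have sub: "Cn n \<subseteq> K" using CK F(2) by (auto simp: Cn_def)
      ultimately show "compact (Cn n)" using compact_Int_closed[OF K(1), of "Cn n"] by (simp add: inf_absorb2)
      show "Cn n \<subseteq> D" using sub K(2) by blast
    qed
    have "(\<lambda>n. LINT x|lebesgue. indicator (Cn n) x *\<^sub>R (indicator K x *\<^sub>R g x)) \<longlonglongrightarrow>
        (LINT x|lebesgue. indicator C x *\<^sub>R (indicator K x *\<^sub>R g x))"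
    proof (rule integral_dominated_convergence[where w = "\<lambda>x. norm (indicator K x *\<^sub>R g x)"])
      have "C \<in> sets borel" unfolding F(2) using F(1) by auto
      then show "(\<lambda>x. indicator C x *\<^sub>R (indicator K x *\<^sub>R g x)) \<in> borel_measurable lebesgue"
        by (intro borel_measurable_scaleR[OF borel_measurable_indicator hm]) auto
      show "(\<lambda>x. indicator (Cn n) x *\<^sub>R (indicator K x *\<^sub>R g x)) \<in> borel_measurable lebesgue" for n
        using borel_compact[OF Cn(1)] by (intro borel_measurable_scaleR[OF borel_measurable_indicator hm]) auto
      show "integrable lebesgue (\<lambda>x. norm (indicator K x *\<^sub>R g x))" using iK by (rule integrable_norm)
      show "AE x in lebesgue. (\<lambda>n. indicator (Cn n) x *\<^sub>R (indicator K x *\<^sub>R g x)) \<longlonglongrightarrow> indicator C x *\<^sub>R (indicator K x *\<^sub>R g x)"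
      proof (intro AE_I2 tendsto_scaleR tendsto_const)
        fix x
        show "(\<lambda>n. indicator (Cn n) x) \<longlonglongrightarrow> (indicator C x :: real)"
          unfolding F(2) Cn_def by (rule LIMSEQ_indicator_UN)
      qed
    qed (auto simp: indicator_def)
    moreover have "(LINT x|lebesgue. indicator (Cn n) x *\<^sub>R (indicator K x *\<^sub>R g x)) = 0" for n
    proof -
      have "(\<lambda>x. indicator (Cn n) x *\<^sub>R (indicator K x *\<^sub>R g x)) = (\<lambda>x. indicator (Cn n) x *\<^sub>R g x)"
      proof
        fix x have "Cn n \<subseteq> K" using CK F(2) by (auto simp: Cn_def)
        then show "indicator (Cn n) x *\<^sub>R (indicator K x *\<^sub>R g x) = indicator (Cn n) x *\<^sub>R g x"
          by (cases "x \<in> Cn n") auto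
      qed
      then show ?thesis using a[OF Cn, of n] by (simp add: set_lebesgue_integral_def)
    qed
    ultimately have z: "(LINT x|lebesgue. indicator C x *\<^sub>R (indicator K x *\<^sub>R g x)) = 0"
      using LIMSEQ_unique[of "\<lambda>n. 0"] by auto
    have "(LINT x|lebesgue. indicator A x *\<^sub>R (indicator K x *\<^sub>R g x)) = (LINT x|lebesgue. indicator C x *\<^sub>R (indicator K x *\<^sub>R g x))"
    proof (rule integral_cong_AE)
      show "(\<lambda>x. indicator A x *\<^sub>R (indicator K x *\<^sub>R g x)) \<in> borel_measurable lebesgue"
        by (intro borel_measurable_scaleR[OF borel_measurable_indicator hm] A)
      have "C \<in> sets borel" unfolding F(2) using F(1) by auto
      then show "(\<lambda>x. indicator C x *\<^sub>R (indicator K x *\<^sub>R g x)) \<in> borel_measurable lebesgue"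
        by (intro borel_measurable_scaleR[OF borel_measurable_indicator hm]) auto
      have "AE x in lebesgue. x \<notin> T" using CT(2) by (rule AE_not_in)
      then show "AE x in lebesgue. indicator A x *\<^sub>R (indicator K x *\<^sub>R g x) = indicator C x *\<^sub>R (indicator K x *\<^sub>R g x)"
      proof eventually_elim
        case (elim x)
        then show ?case using CT(3) by (auto simp: indicator_def)
      qed
    qed
    then show "set_lebesgue_integral lebesgue A (\<lambda>x. indicator K x *\<^sub>R g x) = 0"
      using z by (simp add: set_lebesgue_integral_def)
  qed
  obtain C where C: "\<And>n::nat. compact (C n)" "\<And>n. C n \<subseteq> D" "\<Union>(range C) = D"
    using open_Union_compact_subsets[OF D] by metis
  have "AE x in lebesgue. \<forall>n. indicator (C n) x *\<^sub>R g x = 0" unfolding AE_all_countable using b C by blast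
  then have "AE x in lebesgue. x \<in> D \<longrightarrow> g x = 0"
  proof eventually_elim
    case (elim x)
    show ?case
    proof
      assume "x \<in> D"
      then obtain n where "x \<in> C n" using C(3) by blast
      then show "g x = 0" using elim[rule_format, of n] by simp
    qed
  qed
  then show ?thesis using Dl by (simp add: AE_restrict_space_iff)
qed

section \<open>Weak gradients up to null sets\<close>

lemma set_integrable_nth:
  fixes G :: "'a \<Rightarrow> real^'d"
  shows "set_integrable M K G \<Longrightarrow> set_integrable M K (\<lambda>x. G x $ i)"
  unfolding set_integrable_def
  using integrable_bounded_linear[OF bounded_linear_vec_nth, of M "\<lambda>x. indicator K x *\<^sub>R G x" i] by simp

lemma
  assumes "is_weak_gradient D u G"
  shows weak_gradient_integrable: "compact K \<Longrightarrow> K \<subseteq> D \<Longrightarrow> set_integrable lebesgue K u"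
      "compact K \<Longrightarrow> K \<subseteq> D \<Longrightarrow> set_integrable lebesgue K G"
    and weak_gradient_parts: "\<phi> \<in> test_functions D \<Longrightarrow>
      (\<integral>x. u x * pd i \<phi> x \<partial>lebesgue_on D) = - (\<integral>x. G x $ i * \<phi> x \<partial>lebesgue_on D)"
  using assms unfolding is_weak_gradient_def by simp_all

text \<open>\<open>weak_grad\<close> is an arbitrary choice among weak gradients. Uniqueness up to
  null sets makes integrals of it meaningful and allows it to be replaced by an explicitly computed
  weak gradient.\<close>

lemma weak_gradient_unique:
  fixes u :: "real^'d \<Rightarrow> real"
  assumes D: "open D" and G: "is_weak_gradient D u G" and H: "is_weak_gradient D u H"
  shows "AE x in lebesgue_on D. G x = H x"
proof -
  have Dl: "D \<in> sets lebesgue" using D by simp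
  have gi: "set_integrable lebesgue K G" "set_integrable lebesgue K H" if "compact K" "K \<subseteq> D" for K
    by (rule weak_gradient_integrable(2)[OF G that], rule weak_gradient_integrable(2)[OF H that])
  have "AE x in lebesgue_on D. G x $ i - H x $ i = 0" for i
  proof (rule fundamental_lemma[OF D])
    show "set_integrable lebesgue K (\<lambda>x. G x $ i - H x $ i)" if "compact K" "K \<subseteq> D" for K
      using gi[OF that] by (intro set_integral_diff set_integrable_nth)
    fix \<phi> assume \<phi>: "\<phi> \<in> test_functions D"
    obtain K where K: "smooth \<phi>" "compact K" "K \<subseteq> D" "\<And>y. y \<notin> K \<Longrightarrow> \<phi> y = 0"
      using test_function_support[OF \<phi>] by metis
    have i: "integrable (lebesgue_on D) (\<lambda>x. G x $ i * \<phi> x)" "integrable (lebesgue_on D) (\<lambda>x. H x $ i * \<phi> x)"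
      using gi[OF K(2,3)]
      by (auto intro!: integrable_mult_compact_support[OF _ K(2,3) Dl smooth_continuous[OF K(1)] K(4)] set_integrable_nth)
    have "(\<integral>x. u x * pd i \<phi> x \<partial>lebesgue_on D) = - (\<integral>x. G x $ i * \<phi> x \<partial>lebesgue_on D)"
      "(\<integral>x. u x * pd i \<phi> x \<partial>lebesgue_on D) = - (\<integral>x. H x $ i * \<phi> x \<partial>lebesgue_on D)"
      by (rule weak_gradient_parts[OF G \<phi>], rule weak_gradient_parts[OF H \<phi>])
    then show "(\<integral>x. (G x $ i - H x $ i) * \<phi> x \<partial>lebesgue_on D) = 0"
      using i by (simp add: left_diff_distrib)
  qed
  then have "AE x in lebesgue_on D. \<forall>i\<in>UNIV. G x $ i - H x $ i = 0" by (intro AE_finite_allI) auto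
  then show ?thesis by eventually_elim (simp add: vec_eq_iff)
qed

text \<open>The definition gives integrability, hence measurability, on compact subsets only; an
  increasing exhaustion by compact sets exhibits the gradient as a pointwise limit.\<close>

lemma weak_gradient_measurable:
  fixes u :: "real^'d \<Rightarrow> real"
  assumes D: "open D" and G: "is_weak_gradient D u G"
  shows "G \<in> borel_measurable (lebesgue_on D)"
proof -
  have Dl: "D \<in> sets lebesgue" using D by simp
  obtain C where C: "\<forall>n::nat. compact (C n)" "\<forall>n. C n \<subseteq> D" "\<forall>n. C n \<subseteq> interior (C (Suc n))" "\<Union>(range C) = D"
  proof (rule open_Union_compact_subsets[OF D])
    fix C :: "nat \<Rightarrow> (real^'d) set"
    assume "\<And>n. compact (C n)" "\<And>n. C n \<subseteq> D" "\<And>n. C n \<subseteq> interior (C (Suc n))" "\<Union>(range C) = D"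
    then show thesis by (intro that[of C]) auto
  qed
  show ?thesis
  proof (rule borel_measurable_LIMSEQ_metric)
    show "(\<lambda>x. indicator (C n) x *\<^sub>R G x) \<in> borel_measurable (lebesgue_on D)" for n
    proof -
      have "set_integrable lebesgue (C n) G" using C by (intro weak_gradient_integrable(2)[OF G]) auto
      then have "(\<lambda>x. indicator (C n) x *\<^sub>R G x) \<in> borel_measurable lebesgue" unfolding set_integrable_def by auto
      then show ?thesis by (rule measurable_restrict_space1)
    qed
    fix x assume "x \<in> space (lebesgue_on D)"
    then have "x \<in> D" by (simp add: space_restrict_space)
    then obtain n where n: "x \<in> C n" using C(4) by blast
    have "C n \<subseteq> C m" if "n \<le> m" for m using that
      by (induction rule: dec_induct) (use C(3) interior_subset in blast)+
    then have "\<forall>\<^sub>F m in sequentially. indicator (C m) x *\<^sub>R G x = G x"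
      using n unfolding eventually_sequentially by (intro exI[of _ n]) (auto simp: indicator_def)
    then show "(\<lambda>m. indicator (C m) x *\<^sub>R G x) \<longlonglongrightarrow> G x" by (rule tendsto_eventually)
  qed
qed

lemma weak_grad_is_weak_gradient: "is_weak_gradient D u G \<Longrightarrow> is_weak_gradient D u (weak_grad D u)"
  unfolding weak_grad_def by (rule someI[where P = "is_weak_gradient D u"])

section \<open>Perturbation by test functions\<close>

lemma weak_gradient_add_smooth:
  fixes u \<phi> :: "real^'d \<Rightarrow> real"
  assumes D: "open D" and G: "is_weak_gradient D u G"
    and \<phi>: "smooth \<phi>" and K: "compact K" "K \<subseteq> D" "\<And>y. y \<notin> K \<Longrightarrow> \<phi> y = 0"
  shows "is_weak_gradient D (\<lambda>x. u x + t * \<phi> x) (\<lambda>x. G x + t *\<^sub>R grad \<phi> x)"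
  unfolding is_weak_gradient_def
proof (intro conjI allI impI ballI)
  have Dl: "D \<in> sets lebesgue" using D by simp
  have gi: "set_integrable lebesgue K' u" "set_integrable lebesgue K' G" if "compact K'" "K' \<subseteq> D" for K'
    by (rule weak_gradient_integrable(1)[OF G that], rule weak_gradient_integrable(2)[OF G that])
  fix K' assume K': "compact K' \<and> K' \<subseteq> D"
  show "(\<lambda>x. u x + t * \<phi> x) absolutely_integrable_on K'"
    using gi K' set_integrable_continuous_compact[OF _ continuous_on_mult_left[OF smooth_continuous[OF \<phi>], of t]]
    by (intro set_integral_add) auto
  show "(\<lambda>x. G x + t *\<^sub>R grad \<phi> x) absolutely_integrable_on K'"
    using gi K' set_integrable_continuous_compact[OF _ continuous_on_scaleR[OF continuous_on_const continuous_grad[OF \<phi>], of t]]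
    by (intro set_integral_add) auto
next
  have Dl: "D \<in> sets lebesgue" using D by simp
  have gi: "set_integrable lebesgue K' u" "set_integrable lebesgue K' (\<lambda>x. G x $ i)" if "compact K'" "K' \<subseteq> D" for K' i
    by (rule weak_gradient_integrable(1)[OF G that],
        rule set_integrable_nth, rule weak_gradient_integrable(2)[OF G that])
  fix \<psi> i assume \<psi>: "\<psi> \<in> test_functions D"
  obtain L where L: "smooth \<psi>" "compact L" "L \<subseteq> D" "\<And>y. y \<notin> L \<Longrightarrow> \<psi> y = 0"
    using test_function_support[OF \<psi>] by metis
  have pL: "pd i \<psi> y = 0" if "y \<notin> L" for y by (rule pd_outside[OF compact_imp_closed[OF L(2)] L(4) that])
  note cs = smooth_continuous
  have i: "integrable (lebesgue_on D) (\<lambda>x. u x * pd i \<psi> x)" "integrable (lebesgue_on D) (\<lambda>x. G x $ i * \<psi> x)"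
    by (rule integrable_mult_compact_support[OF gi(1)[OF L(2,3)] L(2,3) Dl cs[OF smooth_pd[OF L(1)]] pL],
        assumption, rule integrable_mult_compact_support[OF gi(2)[OF L(2,3)] L(2,3) Dl cs[OF L(1)] L(4)], assumption)
  have m: "(\<lambda>x. \<phi> x * pd i \<psi> x) \<in> borel_measurable borel" "(\<lambda>x. pd i \<phi> x * \<psi> x) \<in> borel_measurable borel"
    by (intro borel_measurable_continuous_onI cs smooth_mult smooth_pd \<phi> L)+
  have z: "\<phi> x * pd i \<psi> x = 0" "pd i \<phi> x * \<psi> x = 0" if "x \<notin> D" for x
    using that L(3,4) pL[of x] by auto
  have "integrable lborel (\<lambda>x. \<phi> x * pd i \<psi> x)" "integrable lborel (\<lambda>x. pd i \<phi> x * \<psi> x)"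
    by (rule integrable_compact_support[OF continuous_on_subset[OF cs] L(2)];
        auto intro!: smooth_mult smooth_pd \<phi> L simp: pL L(4))+
  then have j: "integrable (lebesgue_on D) (\<lambda>x. \<phi> x * pd i \<psi> x)" "integrable (lebesgue_on D) (\<lambda>x. pd i \<phi> x * \<psi> x)"
    using integral_lebesgue_on_eq_lborel(2)[OF m(1) z(1) Dl] integral_lebesgue_on_eq_lborel(2)[OF m(2) z(2) Dl] by blast+
  have "(LINT x|lborel. \<phi> x * pd i \<psi> x) = - (LINT x|lborel. pd i \<phi> x * \<psi> x)"
    by (rule integral_by_parts[OF smooth_differentiable[OF \<phi>] cs[OF smooth_pd[OF \<phi>]]
          smooth_differentiable[OF L(1)] cs[OF smooth_pd[OF L(1)]] L(2) L(4)])
  then have "(\<integral>x. \<phi> x * pd i \<psi> x \<partial>lebesgue_on D) = - (\<integral>x. pd i \<phi> x * \<psi> x \<partial>lebesgue_on D)"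
    using integral_lebesgue_on_eq_lborel(1)[OF m(1) z(1) Dl] integral_lebesgue_on_eq_lborel(1)[OF m(2) z(2) Dl] by simp
  moreover have "(\<integral>x. u x * pd i \<psi> x \<partial>lebesgue_on D) = - (\<integral>x. G x $ i * \<psi> x \<partial>lebesgue_on D)"
    by (rule weak_gradient_parts[OF G \<psi>])
  ultimately show "(\<integral>x. (u x + t * \<phi> x) * pd i \<psi> x \<partial>lebesgue_on D) = - (\<integral>x. (G x + t *\<^sub>R grad \<phi> x) $ i * \<psi> x \<partial>lebesgue_on D)"
    using i j by (simp add: distrib_right mult.assoc)
qed

lemma L2_add_compact_support:
  fixes f g :: "'a::euclidean_space \<Rightarrow> 'b::euclidean_space"
  assumes f: "f \<in> L2 (lebesgue_on D)" and D: "D \<in> sets lebesgue"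
    and g: "continuous_on UNIV g" "compact K" "K \<subseteq> D" "\<And>x. x \<notin> K \<Longrightarrow> g x = 0"
  shows "(\<lambda>x. f x + g x) \<in> L2 (lebesgue_on D)"
  unfolding L2_def
proof (intro CollectI conjI)
  have fm: "f \<in> borel_measurable (lebesgue_on D)" and fi: "integrable (lebesgue_on D) (\<lambda>x. (norm (f x))\<^sup>2)"
    using f unfolding L2_def by auto
  have gm: "g \<in> borel_measurable (lebesgue_on D)"
    using borel_measurable_continuous_onI[OF g(1)] by (intro measurable_restrict_space1) (simp add: measurable_completion)
  show m: "(\<lambda>x. f x + g x) \<in> borel_measurable (lebesgue_on D)" using fm gm by simp
  have "(\<lambda>x. (norm (g x))\<^sup>2) \<in> borel_measurable borel"
    by (intro borel_measurable_continuous_onI continuous_intros g)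
  then have gi: "integrable (lebesgue_on D) (\<lambda>x. (norm (g x))\<^sup>2)"
    using g D by (subst integral_lebesgue_on_eq_lborel(2))
      (auto intro!: integrable_compact_support[OF _ g(2)] continuous_intros continuous_on_subset[OF g(1)])
  show "integrable (lebesgue_on D) (\<lambda>x. (norm (f x + g x))\<^sup>2)"
  proof (rule Bochner_Integration.integrable_bound)
    show "integrable (lebesgue_on D) (\<lambda>x. 2 * (norm (f x))\<^sup>2 + 2 * (norm (g x))\<^sup>2)" using fi gi by simp
    show "(\<lambda>x. (norm (f x + g x))\<^sup>2) \<in> borel_measurable (lebesgue_on D)" using m by simp
    show "AE x in lebesgue_on D. norm ((norm (f x + g x))\<^sup>2) \<le> norm (2 * (norm (f x))\<^sup>2 + 2 * (norm (g x))\<^sup>2)"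
    proof (rule AE_I2)
      fix x
      have "0 \<le> (norm (f x - g x))\<^sup>2" by simp
      then have "(norm (f x + g x))\<^sup>2 \<le> 2 * (norm (f x))\<^sup>2 + 2 * (norm (g x))\<^sup>2"
        by (simp add: power2_norm_eq_inner inner_add inner_diff inner_commute)
      then show "norm ((norm (f x + g x))\<^sup>2) \<le> norm (2 * (norm (f x))\<^sup>2 + 2 * (norm (g x))\<^sup>2)" by simp
    qed
  qed
qed

text \<open>The square integrable gradient provided by \<open>H1\<close> need not be the one that
  \<open>weak_grad\<close> selects; equality almost everywhere transfers the integrability.\<close>

lemma weak_grad_L2:
  fixes u :: "real^'d \<Rightarrow> real"
  assumes D: "open D" and u: "u \<in> H1 D"
  shows "is_weak_gradient D u (weak_grad D u)" "weak_grad D u \<in> L2 (lebesgue_on D)"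
proof -
  obtain G where G: "is_weak_gradient D u G" "G \<in> L2 (lebesgue_on D)" using u unfolding H1_def by blast
  show w: "is_weak_gradient D u (weak_grad D u)" by (rule weak_grad_is_weak_gradient[OF G(1)])
  have m: "weak_grad D u \<in> borel_measurable (lebesgue_on D)" by (rule weak_gradient_measurable[OF D w])
  have Gm: "G \<in> borel_measurable (lebesgue_on D)" "integrable (lebesgue_on D) (\<lambda>x. (norm (G x))\<^sup>2)"
    using G(2) unfolding L2_def by auto
  have "AE x in lebesgue_on D. (norm (G x))\<^sup>2 = (norm (weak_grad D u x))\<^sup>2"
    using weak_gradient_unique[OF D G(1) w] by eventually_elim simp
  then have "integrable (lebesgue_on D) (\<lambda>x. (norm (weak_grad D u x))\<^sup>2)"
    by (rule integrable_cong_AE[THEN iffD1, rotated 2]) (use m Gm in auto)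
  with m show "weak_grad D u \<in> L2 (lebesgue_on D)" unfolding L2_def by simp
qed

lemma H1_add_smooth:
  fixes u \<phi> :: "real^'d \<Rightarrow> real"
  assumes D: "open D" and u: "u \<in> H1 D"
    and \<phi>: "smooth \<phi>" and K: "compact K" "K \<subseteq> D" "\<And>y. y \<notin> K \<Longrightarrow> \<phi> y = 0"
  shows "(\<lambda>x. u x + t * \<phi> x) \<in> H1 D"
proof -
  have Dl: "D \<in> sets lebesgue" using D by simp
  have "(\<lambda>x. u x + t * \<phi> x) \<in> L2 (lebesgue_on D)"
    using u unfolding H1_def
    by (intro L2_add_compact_support[OF _ Dl _ K(1,2)] continuous_intros smooth_continuous[OF \<phi>]) (auto simp: K(3))
  moreover have "(\<lambda>x. weak_grad D u x + t *\<^sub>R grad \<phi> x) \<in> L2 (lebesgue_on D)"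
    using grad_outside[OF compact_imp_closed[OF K(1)] K(3)]
    by (intro L2_add_compact_support[OF weak_grad_L2(2)[OF D u] Dl _ K(1,2)] continuous_intros continuous_grad[OF \<phi>]) auto
  ultimately show ?thesis
    using weak_gradient_add_smooth[OF D weak_grad_L2(1)[OF D u] \<phi> K] unfolding H1_def by blast
qed

text \<open>The same perturbation is added to the approximating sequence. The differences measured
  in H^1 do not change, and neither do the boundary integrals, because the support lies in an open
  set and so misses its frontier.\<close>

lemma has_trace_add_smooth:
  fixes u \<phi> :: "real^'d \<Rightarrow> real"
  assumes D: "open D" and u: "has_trace D u \<Phi>"
    and \<phi>: "smooth \<phi>" and K: "compact K" "K \<subseteq> D" "\<And>y. y \<notin> K \<Longrightarrow> \<phi> y = 0"
  shows "has_trace D (\<lambda>x. u x + t * \<phi> x) \<Phi>"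
proof -
  obtain f where f: "\<forall>n::nat. f n \<in> test_functions UNIV" "(\<lambda>n. H1_norm_sq D (\<lambda>x. f n x - u x)) \<longlonglongrightarrow> 0"
    "\<forall>K. compact K \<longrightarrow> (\<lambda>n. \<integral>\<^sup>+x. ennreal ((f n x - \<Phi> x)\<^sup>2) * indicator K x \<partial>surface_measure D) \<longlonglongrightarrow> 0"
    and u': "u \<in> H1 D" "\<Phi> \<in> borel_measurable (surface_measure D)"
    using u unfolding has_trace_def by blast
  define g where "g n x = f n x + t * \<phi> x" for n x
  have "g n \<in> test_functions UNIV" for n
  proof -
    obtain L where L: "smooth (f n)" "compact L" "\<And>y. y \<notin> L \<Longrightarrow> f n y = 0" using test_function_support[OF f(1)[rule_format, of n]] by metis
    show ?thesis unfolding g_def[abs_def]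
      by (rule test_functionI[of _ "L \<union> K"]) (use L K \<phi> in \<open>auto intro!: smooth_add smooth_cmult\<close>)
  qed
  moreover have "(\<lambda>x. g n x - (u x + t * \<phi> x)) = (\<lambda>x. f n x - u x)" for n by (auto simp: g_def)
  then have "(\<lambda>n. H1_norm_sq D (\<lambda>x. g n x - (u x + t * \<phi> x))) \<longlonglongrightarrow> 0" using f(2) by simp
  moreover have "(\<integral>\<^sup>+x. ennreal ((g n x - \<Phi> x)\<^sup>2) * indicator C x \<partial>surface_measure D) =
      (\<integral>\<^sup>+x. ennreal ((f n x - \<Phi> x)\<^sup>2) * indicator C x \<partial>surface_measure D)" for n C
  proof (rule nn_integral_cong)
    fix x assume "x \<in> space (surface_measure D)"
    then have "x \<in> frontier D" by (auto simp: surface_measure_def space_restrict_space)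
    then have "x \<notin> K" using D K(2) by (auto simp: frontier_def interior_open)
    then show "ennreal ((g n x - \<Phi> x)\<^sup>2) * indicator C x = ennreal ((f n x - \<Phi> x)\<^sup>2) * indicator C x"
      by (simp add: g_def K(3))
  qed
  ultimately show ?thesis
    unfolding has_trace_def using f(3) u'(2) H1_add_smooth[OF D u'(1) \<phi> K]
    by (intro conjI exI[of _ g]) auto
qed

text \<open>Let I be the pairing of the weak gradient of the component with the gradient of \<phi>,
  P the energy of \<phi> and M the measure of the zeros in \<open>K\<close>. Minimality makes 2 t I
  + t^2 P + \<Lambda> M nonnegative for every real t, and the claim is the discriminant
  condition.\<close>

lemma solution_test:
  fixes U :: "real^'d \<Rightarrow> real^'k"
  assumes D: "open D" and fin: "emeasure lebesgue D < \<infinity>" and \<Lambda>: "\<Lambda> > 0" and sol: "bernoulli_solution D \<Lambda> \<Phi> U"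
    and \<phi>: "smooth \<phi>" and K: "compact K" "K \<subseteq> D" "\<And>y. y \<notin> K \<Longrightarrow> \<phi> y = 0"
  shows "(\<integral>y. U y $ i * lap \<phi> y \<partial>lebesgue_on D)\<^sup>2 \<le>
     \<Lambda> * measure lebesgue ({y\<in>D. U y = 0} \<inter> K) * (LINT y|lborel. (norm (grad \<phi> y))\<^sup>2)"
proof -
  have Dl: "D \<in> sets lebesgue" using D by simp
  have UH: "(\<lambda>y. U y $ j) \<in> H1 D" for j using sol unfolding bernoulli_solution_def H1_vec_def by blast
  have Ut: "has_trace D (\<lambda>y. U y $ j) (\<lambda>y. \<Phi> y $ j)" for j
    using sol unfolding bernoulli_solution_def has_trace_vec_def by blast
  have Uc: "continuous_on D U" using sol unfolding bernoulli_solution_def by blast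
  have min: "bernoulli_energy D \<Lambda> U \<le> bernoulli_energy D \<Lambda> V" if "V \<in> H1_vec D" "has_trace_vec D V \<Phi>" for V
    using sol that unfolding bernoulli_solution_def by blast
  define G where "G = (\<lambda>j. weak_grad D (\<lambda>y. U y $ j))"
  have G: "is_weak_gradient D (\<lambda>y. U y $ j) (G j)" "G j \<in> L2 (lebesgue_on D)" for j
    unfolding G_def by (rule weak_grad_L2[OF D UH])+
  have Gm: "G j \<in> borel_measurable (lebesgue_on D)" "integrable (lebesgue_on D) (\<lambda>x. (norm (G j x))\<^sup>2)" for j
    using G(2)[of j] unfolding L2_def by auto
  have g0: "grad \<phi> y = 0" if "y \<notin> K" for y by (rule grad_outside[OF compact_imp_closed[OF K(1)] K(3) that])
  have gD: "grad \<phi> y = 0" "pd m \<phi> y = 0" if "y \<notin> D" for y m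
    using g0[of y] that K(2) by (auto simp: vec_eq_iff)
  define P where "P = (LINT y|lborel. (norm (grad \<phi> y))\<^sup>2)"
  define I where "I = (\<integral>x. G i x \<bullet> grad \<phi> x \<partial>lebesgue_on D)"
  define M where "M = measure lebesgue ({y\<in>D. U y = 0} \<inter> K)"
  have P0: "P \<ge> 0" unfolding P_def by (intro integral_nonneg_AE) auto
  have M0: "M \<ge> 0" by (simp add: M_def)
  have bm: "(\<lambda>y. (norm (grad \<phi> y))\<^sup>2) \<in> borel_measurable borel"
    by (intro borel_measurable_continuous_onI continuous_intros continuous_grad[OF \<phi>])
  have iP: "integrable lborel (\<lambda>y. (norm (grad \<phi> y))\<^sup>2)"
    by (rule integrable_compact_support[OF _ K(1)])
       (auto intro!: continuous_intros continuous_on_subset[OF continuous_grad[OF \<phi>]] simp: g0)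
  have P: "integrable (lebesgue_on D) (\<lambda>y. (norm (grad \<phi> y))\<^sup>2)" "(\<integral>y. (norm (grad \<phi> y))\<^sup>2 \<partial>lebesgue_on D) = P"
    using integral_lebesgue_on_eq_lborel[OF bm _ Dl] iP by (auto simp: gD P_def)
  have iGc: "integrable (lebesgue_on D) (\<lambda>x. G i x $ m * pd m \<phi> x)" for m
    by (rule integrable_mult_compact_support[OF set_integrable_nth[OF weak_gradient_integrable(2)[OF G(1) K(1,2)]] K(1,2) Dl
          smooth_continuous[OF smooth_pd[OF \<phi>]]], rule pd_outside[OF compact_imp_closed[OF K(1)] K(3)])
  have iI: "integrable (lebesgue_on D) (\<lambda>x. G i x \<bullet> grad \<phi> x)"
    unfolding inner_vec_def using iGc by simp
  have I: "I = - (\<integral>y. U y $ i * lap \<phi> y \<partial>lebesgue_on D)"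
  proof -
    have p: "(\<integral>y. U y $ i * pd m (pd m \<phi>) y \<partial>lebesgue_on D) = - (\<integral>x. G i x $ m * pd m \<phi> x \<partial>lebesgue_on D)" for m
      by (rule weak_gradient_parts[OF G(1)], rule test_functionI[OF smooth_pd[OF \<phi>] K(1,2)],
          rule pd_outside[OF compact_imp_closed[OF K(1)] K(3)])
    have q: "pd m (pd m \<phi>) y = 0" if "y \<notin> K" for m y
      by (rule pd_outside[OF compact_imp_closed[OF K(1)] pd_outside[OF compact_imp_closed[OF K(1)] K(3)] that])
    have j: "integrable (lebesgue_on D) (\<lambda>y. U y $ i * pd m (pd m \<phi>) y)" for m
      by (rule integrable_mult_compact_support[OF weak_gradient_integrable(1)[OF G(1) K(1,2)] K(1,2) Dl
          smooth_continuous[OF smooth_pd[OF smooth_pd[OF \<phi>]]] q])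
    have "I = (\<Sum>m\<in>UNIV. \<integral>x. G i x $ m * pd m \<phi> x \<partial>lebesgue_on D)"
      unfolding I_def inner_vec_def using iGc by simp
    also have "\<dots> = - (\<Sum>m\<in>UNIV. \<integral>y. U y $ i * pd m (pd m \<phi>) y \<partial>lebesgue_on D)"
      unfolding p by (simp add: sum_negf)
    also have "\<dots> = - (\<integral>y. U y $ i * lap \<phi> y \<partial>lebesgue_on D)"
      unfolding lap_def using j by (simp add: sum_distrib_left)
    finally show ?thesis .
  qed
  have quad: "0 \<le> 2 * t * I + t\<^sup>2 * P + \<Lambda> * M" for t
  proof -
    define V where "V y = U y + (t * \<phi> y) *\<^sub>R axis i 1" for y
    have Vi: "(\<lambda>y. V y $ i) = (\<lambda>y. U y $ i + t * \<phi> y)" by (simp add: V_def)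
    have Vj: "(\<lambda>y. V y $ j) = (\<lambda>y. U y $ j)" if "j \<noteq> i" for j using that by (simp add: V_def axis_def)
    have VH: "V \<in> H1_vec D"
      unfolding H1_vec_def
    proof (intro CollectI allI)
      show "(\<lambda>y. V y $ j) \<in> H1 D" for j
        by (cases "j = i") (simp_all only: Vi Vj UH H1_add_smooth[OF D UH \<phi> K] not_False_eq_True)
    qed
    have Vt: "has_trace_vec D V \<Phi>"
      unfolding has_trace_vec_def
    proof
      show "has_trace D (\<lambda>y. V y $ j) (\<lambda>y. \<Phi> y $ j)" for j
        by (cases "j = i") (simp_all only: Vi Vj Ut has_trace_add_smooth[OF D Ut \<phi> K] not_False_eq_True)
    qed
    define H where "H j = weak_grad D (\<lambda>y. V y $ j)" for j
    have Hj: "H j = G j" if "j \<noteq> i" for j unfolding H_def G_def Vj[OF that] ..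
    have VHj: "(\<lambda>y. V y $ j) \<in> H1 D" for j using VH unfolding H1_vec_def by blast
    have Hm: "H j \<in> borel_measurable (lebesgue_on D)" "integrable (lebesgue_on D) (\<lambda>x. (norm (H j x))\<^sup>2)" for j
      using weak_grad_L2(2)[OF D VHj[of j]] unfolding L2_def H_def by auto
    have Hi: "(\<integral>x. (norm (H i x))\<^sup>2 \<partial>lebesgue_on D) = (\<integral>x. (norm (G i x))\<^sup>2 \<partial>lebesgue_on D) + 2 * t * I + t\<^sup>2 * P"
    proof -
      have "is_weak_gradient D (\<lambda>y. V y $ i) (\<lambda>x. G i x + t *\<^sub>R grad \<phi> x)"
        unfolding Vi by (rule weak_gradient_add_smooth[OF D G(1) \<phi> K])
      then have "AE x in lebesgue_on D. H i x = G i x + t *\<^sub>R grad \<phi> x"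
        unfolding H_def by (intro weak_gradient_unique[OF D weak_grad_L2(1)[OF D VHj]])
      then have ae: "AE x in lebesgue_on D. (norm (H i x))\<^sup>2 = (norm (G i x))\<^sup>2 + 2 * t * (G i x \<bullet> grad \<phi> x) + t\<^sup>2 * (norm (grad \<phi> x))\<^sup>2"
      proof eventually_elim
        case (elim x)
        show ?case unfolding elim power2_norm_eq_inner
          by (simp add: inner_add inner_commute power2_eq_square algebra_simps)
      qed
      have "(\<integral>x. (norm (H i x))\<^sup>2 \<partial>lebesgue_on D) =
          (\<integral>x. (norm (G i x))\<^sup>2 + 2 * t * (G i x \<bullet> grad \<phi> x) + t\<^sup>2 * (norm (grad \<phi> x))\<^sup>2 \<partial>lebesgue_on D)"
        by (rule integral_cong_AE[OF _ _ ae])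
           (use Hm(2)[of i] Gm(2)[of i] iI P(1) in \<open>auto intro!: borel_measurable_integrable\<close>)
      also have "\<dots> = (\<integral>x. (norm (G i x))\<^sup>2 \<partial>lebesgue_on D) + 2 * t * I + t\<^sup>2 * P"
        using Gm(2)[of i] iI P by (simp add: I_def)
      finally show ?thesis .
    qed
    have e1: "(\<integral>x. (\<Sum>j\<in>UNIV. (norm (H j x))\<^sup>2) \<partial>lebesgue_on D) =
        (\<integral>x. (\<Sum>j\<in>UNIV. (norm (G j x))\<^sup>2) \<partial>lebesgue_on D) + (2 * t * I + t\<^sup>2 * P)"
    proof -
      have "(\<integral>x. (\<Sum>j\<in>UNIV. (norm (H j x))\<^sup>2) \<partial>lebesgue_on D) = (\<Sum>j\<in>UNIV. \<integral>x. (norm (H j x))\<^sup>2 \<partial>lebesgue_on D)"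
        using Hm(2) by simp
      also have "\<dots> = (\<integral>x. (norm (H i x))\<^sup>2 \<partial>lebesgue_on D) + (\<Sum>j\<in>UNIV - {i}. \<integral>x. (norm (H j x))\<^sup>2 \<partial>lebesgue_on D)"
        by (intro sum.remove) auto
      also have "(\<Sum>j\<in>UNIV - {i}. \<integral>x. (norm (H j x))\<^sup>2 \<partial>lebesgue_on D) = (\<Sum>j\<in>UNIV - {i}. \<integral>x. (norm (G j x))\<^sup>2 \<partial>lebesgue_on D)"
        by (intro sum.cong refl) (simp add: Hj)
      also have "(\<integral>x. (norm (H i x))\<^sup>2 \<partial>lebesgue_on D) + (\<Sum>j\<in>UNIV - {i}. \<integral>x. (norm (G j x))\<^sup>2 \<partial>lebesgue_on D) =
          ((\<integral>x. (norm (G i x))\<^sup>2 \<partial>lebesgue_on D) + (\<Sum>j\<in>UNIV - {i}. \<integral>x. (norm (G j x))\<^sup>2 \<partial>lebesgue_on D)) + (2 * t * I + t\<^sup>2 * P)"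
        unfolding Hi by simp
      also have "(\<integral>x. (norm (G i x))\<^sup>2 \<partial>lebesgue_on D) + (\<Sum>j\<in>UNIV - {i}. \<integral>x. (norm (G j x))\<^sup>2 \<partial>lebesgue_on D) =
          (\<Sum>j\<in>UNIV. \<integral>x. (norm (G j x))\<^sup>2 \<partial>lebesgue_on D)"
        by (intro sum.remove[symmetric]) auto
      also have "\<dots> = (\<integral>x. (\<Sum>j\<in>UNIV. (norm (G j x))\<^sup>2) \<partial>lebesgue_on D)" using Gm(2) by simp
      finally show ?thesis .
    qed
    have Vc: "continuous_on D V" unfolding V_def[abs_def]
      by (intro continuous_intros Uc continuous_on_subset[OF smooth_continuous[OF \<phi>]]) auto
    have op: "open (pos_set D W)" if "continuous_on D W" for W :: "real^'d \<Rightarrow> real^'k"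
    proof -
      have "pos_set D W = D \<inter> W -` (- {0})" by (auto simp: pos_set_def)
      then show ?thesis using continuous_open_preimage[OF that D, of "- {0}"] by (simp add: open_Compl)
    qed
    define Z where "Z = {y\<in>D. U y = 0} \<inter> K"
    have ZK: "Z \<in> sets lebesgue"
    proof -
      have "Z = K - pos_set D U" using K(2) by (auto simp: Z_def pos_set_def)
      then show ?thesis using op[OF Uc] borel_compact[OF K(1)] by simp
    qed
    \<comment> \<open>Finite measure of \<open>D\<close> enters here: \<open>measure\<close> assigns
      0 to sets of infinite measure, which would spoil monotonicity.\<close>
    have fm: "A \<in> fmeasurable lebesgue" if "A \<in> sets lebesgue" "A \<subseteq> D" for A
      by (rule fmeasurableI2[OF fmeasurableI[OF Dl fin] that(2,1)])
    have "measure lebesgue (pos_set D V) \<le> measure lebesgue (pos_set D U \<union> Z)"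
    proof (rule measure_mono_fmeasurable)
      show "pos_set D V \<subseteq> pos_set D U \<union> Z"
        using K(3) by (auto simp: pos_set_def Z_def V_def)
      show "pos_set D U \<union> Z \<in> fmeasurable lebesgue"
        by (rule fm) (use op[OF Uc] ZK in \<open>auto simp: pos_set_def Z_def\<close>)
    qed (use op[OF Vc] in simp)
    also have "\<dots> \<le> measure lebesgue (pos_set D U) + measure lebesgue Z"
      by (rule measure_Un_le) (use op[OF Uc] ZK in auto)
    finally have "\<Lambda> * measure lebesgue (pos_set D V) \<le> \<Lambda> * (measure lebesgue (pos_set D U) + M)"
      using \<Lambda> unfolding M_def Z_def by (intro mult_left_mono) auto
    moreover have "bernoulli_energy D \<Lambda> U \<le> bernoulli_energy D \<Lambda> V" by (rule min[OF VH Vt])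
    ultimately show ?thesis
      using e1 unfolding bernoulli_energy_def H_def G_def by (simp add: algebra_simps)
  qed
  \<comment> \<open>The minimiser t = - I / P exists only for P > 0; for P = 0 the polynomial is
    affine in t, and nonnegativity forces I = 0.\<close>
  have "I\<^sup>2 \<le> \<Lambda> * M * P"
  proof (cases "P = 0")
    case True
    have "I = 0"
    proof (rule ccontr)
      assume "I \<noteq> 0"
      define t where "t = - (\<Lambda> * M + 1) / (2 * I)"
      have "2 * t * I = - (\<Lambda> * M + 1)" using \<open>I \<noteq> 0\<close> by (simp add: t_def)
      then show False using quad[of t] True by simp
    qed
    then show ?thesis using True by simp
  next
    case False
    then have P: "P > 0" using P0 by simp
    have "0 \<le> 2 * (- I / P) * I + (- I / P)\<^sup>2 * P + \<Lambda> * M" by (rule quad)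
    also have "\<dots> = \<Lambda> * M - I\<^sup>2 / P" using P by (simp add: power2_eq_square field_simps)
    finally show ?thesis using P by (simp add: field_simps)
  qed
  then show ?thesis by (simp add: I M_def P_def)
qed

text \<open>\<open>nearly_harmonic\<close> speaks of functions continuous on the whole space and of
  a compact set, so each component is restricted to a closed ball in \<open>D\<close> and extended
  by Tietze's theorem, and \<open>Z\<close> is the zero set of the whole vector in that ball. Test
  functions are supported in the ball, so the extension does not affect the inequality.\<close>

lemma solution_lipschitz:
  fixes U :: "real^'d \<Rightarrow> real^'k"
  assumes D: "open D" and fin: "emeasure lebesgue D < \<infinity>" and \<Lambda>: "\<Lambda> > 0" and sol: "bernoulli_solution D \<Lambda> \<Phi> U"
    and x0: "x0 \<in> D"
  obtains R L where "R > 0" "L \<ge> 0" "cball x0 R \<subseteq> D"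
    "\<And>x y. x \<in> cball x0 R \<Longrightarrow> y \<in> cball x0 R \<Longrightarrow> norm (U x - U y) \<le> L * norm (x - y)"
proof -
  have Dl: "D \<in> sets lebesgue" using D by simp
  have Uc: "continuous_on D U" using sol unfolding bernoulli_solution_def by blast
  obtain R where R: "R > 0" "cball x0 R \<subseteq> D" using D x0 open_contains_cball by blast
  have Uc': "continuous_on (cball x0 R) U" using continuous_on_subset[OF Uc R(2)] .
  define Z where "Z = {y\<in>D. U y = 0} \<inter> cball x0 R"
  have Z: "compact Z"
  proof -
    have "Z = cball x0 R \<inter> U -` {0}" using R(2) by (auto simp: Z_def)
    moreover have "closed (cball x0 R \<inter> U -` {0})"
      by (rule continuous_closed_preimage[OF Uc' closed_cball closed_singleton])
    ultimately show ?thesis using compact_Int_closed[OF compact_cball, of Z x0 R] by (simp add: Z_def inf.absorb2)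
  qed
  have "\<exists>L\<ge>0. \<forall>x\<in>cball x0 (R/4). \<forall>y\<in>cball x0 (R/4). \<bar>U x $ i - U y $ i\<bar> \<le> L * norm (x - y)" for i
  proof -
    have "continuous_on (cball x0 R) (\<lambda>y. U y $ i)" by (intro continuous_intros Uc')
    then obtain u where u: "continuous_on UNIV u" "\<And>x. x \<in> cball x0 R \<Longrightarrow> u x = U x $ i"
      using Tietze_unbounded[of "cball x0 R" "\<lambda>y. U y $ i" UNIV] by auto
    have "nearly_harmonic \<Lambda> x0 R u Z"
      unfolding nearly_harmonic_def
    proof (intro conjI allI impI ballI)
      show "\<Lambda> \<ge> 0" using \<Lambda> by simp
      show "u x = 0" if "x \<in> Z" for x using that u(2) by (auto simp: Z_def)
      fix \<phi> :: "real^'d \<Rightarrow> real" and x r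
      assume \<phi>: "smooth \<phi>" "\<forall>y. y \<notin> cball x r \<longrightarrow> \<phi> y = 0" and sub: "cball x r \<subseteq> cball x0 R"
      have subD: "cball x r \<subseteq> D" using sub R(2) by blast
      have \<phi>0: "\<phi> y = 0" if "y \<notin> cball x r" for y using \<phi>(2) that by blast
      have l0: "lap \<phi> y = 0" if "y \<notin> cball x r" for y by (rule lap_outside[OF closed_cball \<phi>0 that])
      have lD: "lap \<phi> y = 0" if "y \<notin> D" for y using l0 subD that by blast
      have "(\<integral>y. U y $ i * lap \<phi> y \<partial>lebesgue_on D) = (\<integral>y. u y * lap \<phi> y \<partial>lebesgue_on D)"
      proof (rule Bochner_Integration.integral_cong[OF refl])
        show "U y $ i * lap \<phi> y = u y * lap \<phi> y" for y
          using u(2)[of y] l0[of y] sub by (cases "y \<in> cball x r") auto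
      qed
      also have "\<dots> = (LINT y|lborel. u y * lap \<phi> y)"
        by (rule integral_lebesgue_on_eq_lborel(1)[OF _ _ Dl])
           (use lD in \<open>auto intro!: borel_measurable_continuous_onI continuous_intros u(1) smooth_continuous[OF smooth_lap[OF \<phi>(1)]]\<close>)
      finally have "(LINT y|lborel. u y * lap \<phi> y)\<^sup>2 \<le>
         \<Lambda> * measure lebesgue ({y\<in>D. U y = 0} \<inter> cball x r) * (LINT y|lborel. (norm (grad \<phi> y))\<^sup>2)"
        using solution_test[OF D fin \<Lambda> sol \<phi>(1) compact_cball subD \<phi>0, of i] by simp
      moreover have "{y\<in>D. U y = 0} \<inter> cball x r = Z \<inter> cball x r" using sub by (auto simp: Z_def)
      moreover have "measure lebesgue (Z \<inter> cball x r) = measure lborel (Z \<inter> cball x r)"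
        using borel_compact[OF compact_Int_closed[OF Z closed_cball]] by simp
      ultimately show "(LINT y|lborel. u y * lap \<phi> y)\<^sup>2 \<le>
         \<Lambda> * measure lborel (Z \<inter> cball x r) * (LINT y|lborel. (norm (grad \<phi> y))\<^sup>2)" by simp
    qed (use u Z in auto)
    from nearly_harmonic_lipschitz[OF this R(1)] obtain L where "L \<ge> 0"
      "\<forall>x\<in>cball x0 (R/4). \<forall>y\<in>cball x0 (R/4). \<bar>u x - u y\<bar> \<le> L * norm (x - y)" by blast
    moreover have "u x = U x $ i" if "x \<in> cball x0 (R/4)" for x using that R(1) by (intro u(2)) auto
    ultimately show ?thesis by (intro exI[of _ L]) auto
  qed
  then obtain L where L: "\<And>i. L i \<ge> 0"
    "\<And>i x y. x \<in> cball x0 (R/4) \<Longrightarrow> y \<in> cball x0 (R/4) \<Longrightarrow> \<bar>U x $ i - U y $ i\<bar> \<le> L i * norm (x - y)"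
    by metis
  show ?thesis
  proof (rule that[of "R/4" "\<Sum>i\<in>UNIV. L i"])
    show "R/4 > 0" using R by simp
    show "(\<Sum>i\<in>UNIV. L i) \<ge> 0" using L by (intro sum_nonneg) auto
    show "cball x0 (R/4) \<subseteq> D" using R by (auto intro: subsetD[OF R(2)])
    fix x y assume xy: "x \<in> cball x0 (R/4)" "y \<in> cball x0 (R/4)"
    have "norm (U x - U y) \<le> (\<Sum>i\<in>UNIV. \<bar>(U x - U y) $ i\<bar>)" by (rule norm_le_l1_cart)
    also have "\<dots> \<le> (\<Sum>i\<in>UNIV. L i * norm (x - y))" using L(2)[OF xy] by (intro sum_mono) simp
    finally show "norm (U x - U y) \<le> (\<Sum>i\<in>UNIV. L i) * norm (x - y)" by (simp add: sum_distrib_right)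
  qed
qed

section \<open>Compactness of blow-ups\<close>

text \<open>The Arzela-Ascoli theorem gives uniform convergence on each ball of integer radius, and
  a diagonal sequence serves all of them at once.\<close>

lemma locally_uniform_subsequence:
  fixes W :: "nat \<Rightarrow> 'a::euclidean_space \<Rightarrow> 'b::euclidean_space"
  assumes L: "\<And>n x y. norm (W n x - W n y) \<le> L * norm (x - y)" "L \<ge> 0" and 0: "\<And>n. W n 0 = 0"
  shows "\<exists>s g. strict_mono (s :: nat \<Rightarrow> nat) \<and> (\<forall>K. compact K \<longrightarrow> uniform_limit K (\<lambda>n. W (s n)) g sequentially)"
proof -
  define P where "P m s \<longleftrightarrow> (\<exists>g. uniform_limit (cball 0 (real m)) (\<lambda>n. W (s n)) g sequentially)" for m and s :: "nat \<Rightarrow> nat"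
  interpret subseqs P
  proof
    fix m and s :: "nat \<Rightarrow> nat" assume "strict_mono s"
    have "\<exists>g k. continuous_on (cball 0 (real m)) g \<and> strict_mono (k :: nat \<Rightarrow> nat) \<and>
       (\<forall>e>0. \<exists>N. \<forall>n x. n \<ge> N \<and> x \<in> cball 0 (real m) \<longrightarrow> norm (W (s (k n)) x - g x) < e)"
    proof (rule Arzela_Ascoli[of "cball 0 (real m)" "\<lambda>n. W (s n)" "L * real m"])
      show "compact (cball (0::'a) (real m))" by simp
      show "norm (W (s n) x) \<le> L * real m" if "x \<in> cball 0 (real m)" for n x
        using L(1)[of "s n" x 0] 0 mult_left_mono[of "norm x" "real m" L] L(2) that by simp
      fix x :: 'a and e :: real assume e: "0 < e"
      show "\<exists>d>0. \<forall>n y. y \<in> cball 0 (real m) \<and> norm (x - y) < d \<longrightarrow> norm (W (s n) x - W (s n) y) < e"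
      proof (intro exI[of _ "e / (L + 1)"] conjI allI impI)
        show "e / (L + 1) > 0" using e L(2) by simp
        fix n y assume "y \<in> cball 0 (real m) \<and> norm (x - y) < e / (L + 1)"
        then have "(L + 1) * norm (x - y) < e" using L(2) by (simp add: field_simps)
        moreover have "L * norm (x - y) \<le> (L + 1) * norm (x - y)" by (intro mult_right_mono) auto
        ultimately show "norm (W (s n) x - W (s n) y) < e" using L(1)[of "s n" x y] by linarith
      qed
    next
      fix g k
      assume "continuous_on (cball 0 (real m)) g" "strict_mono (k :: nat \<Rightarrow> nat)"
        "\<And>e. 0 < e \<Longrightarrow> \<exists>N. \<forall>n x. N \<le> n \<and> x \<in> cball 0 (real m) \<longrightarrow> norm (W (s (k n)) x - g x) < e"
      then show "\<exists>g k. continuous_on (cball 0 (real m)) g \<and> strict_mono (k :: nat \<Rightarrow> nat) \<and>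
       (\<forall>e>0. \<exists>N. \<forall>n x. n \<ge> N \<and> x \<in> cball 0 (real m) \<longrightarrow> norm (W (s (k n)) x - g x) < e)"
        by (intro exI[of _ g] exI[of _ k]) simp
    qed
    then obtain g k where k: "strict_mono (k :: nat \<Rightarrow> nat)"
      "\<forall>e>0. \<exists>N. \<forall>n x. n \<ge> N \<and> x \<in> cball 0 (real m) \<longrightarrow> norm (W (s (k n)) x - g x) < e" by blast
    have "uniform_limit (cball 0 (real m)) (\<lambda>n. W (s (k n))) g sequentially"
      unfolding uniform_limit_iff eventually_sequentially dist_norm using k(2) by blast
    then show "\<exists>r'. strict_mono r' \<and> P m (s \<circ> r')" using k(1) unfolding P_def by (auto simp: o_def)
  qed
  define s where "s = diagseq"
  have s: "strict_mono s" unfolding s_def by (rule subseq_diagseq)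
  have "\<exists>g. uniform_limit (cball 0 (real m)) (\<lambda>n. W (s n)) g sequentially" for m
  proof -
    \<comment> \<open>\<open>P m\<close> is available for the diagonal sequence only after its first
      m + 1 terms are dropped; the shift is removed again below.\<close>
    have "P m (diagseq \<circ> ((+) (Suc m)))"
    proof (rule diagseq_holds)
      fix r t :: "nat \<Rightarrow> nat" and n assume r: "strict_mono r" and "P n t"
      then obtain g where "uniform_limit (cball 0 (real n)) (\<lambda>n. W (t n)) g sequentially" unfolding P_def by blast
      then have "uniform_limit (cball 0 (real n)) (\<lambda>k. W (t (r k))) g sequentially"
        unfolding uniform_limit_iff using eventually_subseq[OF r] by blast
      then show "P n (t \<circ> r)" unfolding P_def by auto
    qed
    then obtain g where g: "uniform_limit (cball 0 (real m)) (\<lambda>n. W (s (n + Suc m))) g sequentially"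
      unfolding P_def s_def by (auto simp: add.commute)
    have "uniform_limit (cball 0 (real m)) (\<lambda>n. W (s n)) g sequentially"
      unfolding uniform_limit_iff
    proof (intro allI impI)
      fix e :: real assume "e > 0"
      then have "\<forall>\<^sub>F n in sequentially. \<forall>x\<in>cball 0 (real m). dist (W (s (n + Suc m)) x) (g x) < e"
        using g unfolding uniform_limit_iff by blast
      then show "\<forall>\<^sub>F n in sequentially. \<forall>x\<in>cball 0 (real m). dist (W (s n) x) (g x) < e"
        using eventually_sequentially_seg[of "\<lambda>n. \<forall>x\<in>cball 0 (real m). dist (W (s n) x) (g x) < e" "Suc m"] by blast
    qed
    then show ?thesis by blast
  qed
  then obtain G where G: "\<And>m. uniform_limit (cball 0 (real m)) (\<lambda>n. W (s n)) (G m) sequentially" by metis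
  \<comment> \<open>The limits on different balls agree because each is the pointwise limit of the
    same sequence.\<close>
  define g where "g y = lim (\<lambda>n. W (s n) y)" for y
  have Gg: "G m y = g y" if "y \<in> cball 0 (real m)" for m y
    unfolding g_def using tendsto_uniform_limitI[OF G that] by (simp add: limI)
  show ?thesis
  proof (intro exI[of _ s] exI[of _ g] conjI allI impI s)
    fix K :: "'a set" assume "compact K"
    then obtain M where M: "\<And>x. x \<in> K \<Longrightarrow> norm x \<le> M" using compact_imp_bounded bounded_iff by metis
    obtain m :: nat where "M \<le> real m" using real_arch_simple by blast
    then have sub: "K \<subseteq> cball 0 (real m)" using M by force
    have "uniform_limit K (\<lambda>n. W (s n)) (G m) sequentially" by (rule uniform_limit_on_subset[OF G sub])
    then show "uniform_limit K (\<lambda>n. W (s n)) g sequentially"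
      using sub Gg by (subst (asm) uniform_limit_cong'[where g = "\<lambda>n. W (s n)" and i = g]) auto
  qed
qed

text \<open>The conclusion retains the convergence along the prescribed radii and not just the
  existence of a blow-up limit: the compactness argument below compares the limit with
  \<open>U\<close> at these very scales.\<close>

lemma blowup_subsequence:
  fixes U :: "real^'d \<Rightarrow> real^'k"
  assumes R: "R > 0" "L \<ge> 0"
    and Lip: "\<And>x y. x \<in> cball x0 R \<Longrightarrow> y \<in> cball x0 R \<Longrightarrow> norm (U x - U y) \<le> L * norm (x - y)"
    and U0: "U x0 = 0" and r: "\<And>n. r n > 0" "r \<longlonglongrightarrow> 0"
  shows "\<exists>s g. strict_mono (s :: nat \<Rightarrow> nat) \<and> is_blowup_limit U x0 g \<and>
    (\<forall>K. compact K \<longrightarrow> uniform_limit K (\<lambda>n y. (1 / r (s n)) *\<^sub>R U (x0 + r (s n) *\<^sub>R y)) g sequentially)"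
proof -
  text \<open>Composing with the projection onto the ball makes the rescalings globally Lipschitz.\<close>
  define p where "p = closest_point (cball x0 R)"
  have p_in: "p x \<in> cball x0 R" for x
    unfolding p_def using R by (intro closest_point_in_set) auto
  have p_lip: "norm (p x - p y) \<le> norm (x - y)" for x y
    using closest_point_lipschitz[of "cball x0 R" x y] R unfolding p_def dist_norm by auto
  have p_self: "p x = x" if "x \<in> cball x0 R" for x unfolding p_def by (rule closest_point_self[OF that])
  define W where "W n y = (1 / r n) *\<^sub>R U (p (x0 + r n *\<^sub>R y))" for n y
  have WL: "norm (W n x - W n y) \<le> L * norm (x - y)" for n x y
  proof -
    have "norm (W n x - W n y) = (1 / r n) * norm (U (p (x0 + r n *\<^sub>R x)) - U (p (x0 + r n *\<^sub>R y)))"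
      using r(1)[of n] by (simp add: W_def flip: scaleR_diff_right)
    also have "\<dots> \<le> (1 / r n) * (L * norm (p (x0 + r n *\<^sub>R x) - p (x0 + r n *\<^sub>R y)))"
      using r(1)[of n] by (intro mult_left_mono Lip p_in) auto
    also have "\<dots> \<le> (1 / r n) * (L * norm ((x0 + r n *\<^sub>R x) - (x0 + r n *\<^sub>R y)))"
      using r(1)[of n] R by (intro mult_left_mono p_lip) auto
    also have "\<dots> = L * norm (x - y)"
      using r(1)[of n] by (simp flip: scaleR_diff_right)
    finally show ?thesis .
  qed
  have W0: "W n 0 = 0" for n using U0 R by (simp add: W_def p_self)
  have "\<exists>s g. strict_mono (s :: nat \<Rightarrow> nat) \<and> (\<forall>K. compact K \<longrightarrow> uniform_limit K (\<lambda>n. W (s n)) g sequentially)"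
    by (rule locally_uniform_subsequence[where W = W, OF WL R(2) W0])
  then obtain s g where s: "strict_mono (s :: nat \<Rightarrow> nat)"
    and g: "\<forall>K. compact K \<longrightarrow> uniform_limit K (\<lambda>n. W (s n)) g sequentially" by blast
  have rs: "(\<lambda>n. r (s n)) \<longlonglongrightarrow> 0" using LIMSEQ_subseq_LIMSEQ[OF r(2) s] by (simp add: o_def)
  have lim: "uniform_limit K (\<lambda>n y. (1 / r (s n)) *\<^sub>R U (x0 + r (s n) *\<^sub>R y)) g sequentially" if K: "compact K" for K
  proof -
    obtain M where M: "\<And>x. x \<in> K \<Longrightarrow> norm x \<le> M" using compact_imp_bounded[OF K] bounded_iff by metis
    have "(\<lambda>n. r (s n) * (\<bar>M\<bar> + 1)) \<longlonglongrightarrow> 0 * (\<bar>M\<bar> + 1)" by (intro tendsto_intros rs)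
    then have "\<forall>\<^sub>F n in sequentially. r (s n) * (\<bar>M\<bar> + 1) < R"
      by (intro order_tendstoD(2)[where y = "0 * (\<bar>M\<bar> + 1)"]) (use R in auto)
    then have "\<forall>\<^sub>F n in sequentially. \<forall>y\<in>K. W (s n) y = (1 / r (s n)) *\<^sub>R U (x0 + r (s n) *\<^sub>R y)"
    proof eventually_elim
      case (elim n)
      show ?case
      proof
        fix y assume "y \<in> K"
        then have "norm y \<le> \<bar>M\<bar> + 1" using M by fastforce
        then have "r (s n) * norm y \<le> r (s n) * (\<bar>M\<bar> + 1)" using r(1)[of "s n"] by (intro mult_left_mono) auto
        then have "r (s n) * norm y \<le> R" using elim by linarith
        then have "x0 + r (s n) *\<^sub>R y \<in> cball x0 R" using r(1)[of "s n"] by (simp add: dist_norm)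
        then show "W (s n) y = (1 / r (s n)) *\<^sub>R U (x0 + r (s n) *\<^sub>R y)" by (simp add: W_def p_self)
      qed
    qed
    then show ?thesis using g[rule_format, OF K] by (subst (asm) uniform_limit_cong) auto
  qed
  have "is_blowup_limit U x0 g"
    unfolding is_blowup_limit_def using r(1) rs lim by (intro exI[of _ "\<lambda>n. r (s n)"]) auto
  with s lim show ?thesis by blast
qed

section \<open>The zero set at small scales\<close>

lemma frontier_pos_set_zero:
  fixes U :: "real^'d \<Rightarrow> real^'k"
  assumes D: "open D" and U: "continuous_on D U" and x: "x \<in> frontier (pos_set D U)" "x \<in> D"
  shows "U x = 0"
proof (rule ccontr)
  assume "U x \<noteq> 0"
  then have "x \<in> pos_set D U" using x by (simp add: pos_set_def)
  moreover have "pos_set D U = D \<inter> U -` (- {0})" by (auto simp: pos_set_def)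
  then have "open (pos_set D U)" using continuous_open_preimage[OF U D, of "- {0}"] by (simp add: open_Compl)
  ultimately show False using x(1) by (simp add: frontier_def interior_open)
qed

text \<open>Suppose it fails along radii tending to 0. A subsequence of the rescalings converges
  uniformly on the unit ball to a linear map of rank \<open>j\<close>. The offending zeros, seen at
  unit scale, accumulate at a point of its kernel, so some of them lie within \<epsilon> of that
  kernel, a contradiction.\<close>

lemma zero_set_near_kernel:
  fixes U :: "real^'d \<Rightarrow> real^'k"
  assumes R: "R > 0" "L \<ge> 0"
    and Lip: "\<And>x y. x \<in> cball x0 R \<Longrightarrow> y \<in> cball x0 R \<Longrightarrow> norm (U x - U y) \<le> L * norm (x - y)"
    and U0: "U x0 = 0" and bl: "\<And>g. is_blowup_limit U x0 g \<Longrightarrow> linear_of_rank j g" and \<epsilon>: "\<epsilon> > 0"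
  shows "\<exists>\<rho>>0. \<forall>r. 0 < r \<longrightarrow> r < \<rho> \<longrightarrow> (\<exists>A :: real^'d^'k. rank A = j \<and>
     (\<forall>y\<in>cball x0 r. U y = 0 \<longrightarrow> (\<exists>z. A *v z = 0 \<and> norm (y - x0 - r *\<^sub>R z) \<le> \<epsilon> * r)))"
proof (rule ccontr)
  assume neg: "\<not> ?thesis"
  \<comment> \<open>The failure is recorded for all maps of rank \<open>j\<close> at once, since the
    map to be contradicted is known only after the limit has been taken.\<close>
  have "\<exists>r. 0 < r \<and> r < inverse (real (Suc n)) \<and> (\<forall>A :: real^'d^'k. rank A = j \<longrightarrow>
     (\<exists>y\<in>cball x0 r. U y = 0 \<and> (\<forall>z. A *v z = 0 \<longrightarrow> norm (y - x0 - r *\<^sub>R z) > \<epsilon> * r)))" for n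
  proof -
    have pos: "inverse (real (Suc n)) > 0" by simp
    obtain r where "0 < r" "r < inverse (real (Suc n))" and A: "\<not> (\<exists>A :: real^'d^'k. rank A = j \<and>
      (\<forall>y\<in>cball x0 r. U y = 0 \<longrightarrow> (\<exists>z. A *v z = 0 \<and> norm (y - x0 - r *\<^sub>R z) \<le> \<epsilon> * r)))"
      using neg pos by blast
    moreover have "\<exists>y\<in>cball x0 r. U y = 0 \<and> (\<forall>z. A *v z = 0 \<longrightarrow> norm (y - x0 - r *\<^sub>R z) > \<epsilon> * r)"
      if "rank A = j" for A :: "real^'d^'k"
    proof (rule ccontr)
      assume "\<not> ?thesis"
      then have "\<forall>y\<in>cball x0 r. U y = 0 \<longrightarrow> (\<exists>z. A *v z = 0 \<and> norm (y - x0 - r *\<^sub>R z) \<le> \<epsilon> * r)"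
        by (metis not_le)
      then show False using A that by blast
    qed
    ultimately show ?thesis by blast
  qed
  then obtain r where r: "\<And>n. 0 < r n" "\<And>n. r n < inverse (real (Suc n))"
    "\<And>n. \<forall>A :: real^'d^'k. rank A = j \<longrightarrow>
     (\<exists>y\<in>cball x0 (r n). U y = 0 \<and> (\<forall>z. A *v z = 0 \<longrightarrow> norm (y - x0 - r n *\<^sub>R z) > \<epsilon> * r n))"
    by metis
  have r0: "r \<longlonglongrightarrow> 0"
    by (rule tendsto_sandwich[OF _ _ tendsto_const LIMSEQ_inverse_real_of_nat])
       (use r(1,2) in \<open>auto intro!: always_eventually less_imp_le\<close>)
  obtain s g where s: "strict_mono (s :: nat \<Rightarrow> nat)" and g: "is_blowup_limit U x0 g"
    and lim: "\<forall>K. compact K \<longrightarrow> uniform_limit K (\<lambda>n y. (1 / r (s n)) *\<^sub>R U (x0 + r (s n) *\<^sub>R y)) g sequentially"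
    using blowup_subsequence[where U = U and r = r, OF R Lip U0 r(1) r0] by blast
  obtain A :: "real^'d^'k" where A: "\<And>x. g x = A *v x" "rank A = j" using bl[OF g] unfolding linear_of_rank_def by blast
  have "\<exists>y\<in>cball x0 (r n). U y = 0 \<and> (\<forall>z. A *v z = 0 \<longrightarrow> norm (y - x0 - r n *\<^sub>R z) > \<epsilon> * r n)" for n
    using r(3) A(2) by blast
  then obtain y where y: "\<And>n. y n \<in> cball x0 (r n)" "\<And>n. U (y n) = 0"
    "\<And>n z. A *v z = 0 \<Longrightarrow> norm (y n - x0 - r n *\<^sub>R z) > \<epsilon> * r n" by metis
  \<comment> \<open>The offending zeros in blow-up coordinates; they stay in the closed unit ball,
    where uniform convergence and compactness are available.\<close>
  define \<xi> where "\<xi> n = (1 / r (s n)) *\<^sub>R (y (s n) - x0)" for n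
  have y\<xi>: "y (s n) - x0 = r (s n) *\<^sub>R \<xi> n" for n using r(1)[of "s n"] by (simp add: \<xi>_def)
  have \<xi>1: "\<xi> n \<in> cball 0 1" for n
    using y(1)[of "s n"] r(1)[of "s n"] by (simp add: \<xi>_def dist_norm norm_minus_commute)
  have Ulim: "(\<lambda>n. g (\<xi> n)) \<longlonglongrightarrow> 0"
  proof (rule tendstoI)
    fix e :: real assume "e > 0"
    then have "\<forall>\<^sub>F n in sequentially. \<forall>y\<in>cball 0 1. dist ((1 / r (s n)) *\<^sub>R U (x0 + r (s n) *\<^sub>R y)) (g y) < e"
      using lim[rule_format, of "cball 0 1"] unfolding uniform_limit_iff by simp
    then show "\<forall>\<^sub>F n in sequentially. dist (g (\<xi> n)) 0 < e"
    proof eventually_elim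
      case (elim n)
      have "x0 + r (s n) *\<^sub>R \<xi> n = y (s n)" using y\<xi>[of n] by (simp add: algebra_simps)
      then show ?case using elim \<xi>1[of n] y(2)[of "s n"] by (metis dist_commute scaleR_zero_right)
    qed
  qed
  obtain \<xi>0 t where t: "strict_mono (t :: nat \<Rightarrow> nat)" "(\<xi> \<circ> t) \<longlonglongrightarrow> \<xi>0"
    using \<xi>1 compact_cball[of "0 :: real^'d" 1] unfolding compact_def by metis
  have "(\<lambda>n. A *v (\<xi> \<circ> t) n) \<longlonglongrightarrow> A *v \<xi>0"
    by (intro bounded_linear.tendsto[OF matrix_vector_mul_bounded_linear] t)
  moreover have "(\<lambda>n. A *v (\<xi> \<circ> t) n) \<longlonglongrightarrow> 0"
    using LIMSEQ_subseq_LIMSEQ[OF Ulim t(1)] by (simp add: A(1) o_def)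
  ultimately have ker: "A *v \<xi>0 = 0" using LIMSEQ_unique by blast
  have "\<forall>\<^sub>F n in sequentially. dist ((\<xi> \<circ> t) n) \<xi>0 < \<epsilon>" using t(2) \<epsilon> by (rule tendstoD)
  then obtain n where n: "dist (\<xi> (t n)) \<xi>0 < \<epsilon>" by (auto simp: eventually_sequentially)
  have "\<epsilon> * r (s (t n)) < norm (y (s (t n)) - x0 - r (s (t n)) *\<^sub>R \<xi>0)" by (rule y(3)[OF ker])
  also have "\<dots> = r (s (t n)) * dist (\<xi> (t n)) \<xi>0"
    unfolding y\<xi> using r(1)[of "s (t n)"] by (simp add: dist_norm flip: scaleR_diff_right)
  also have "\<dots> < r (s (t n)) * \<epsilon>" using n r(1) by (intro mult_strict_left_mono) auto
  finally show False by simp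
qed

text \<open>The kernel is the orthogonal complement of the row space, whose dimension is the
  rank.\<close>

lemma dim_kernel:
  fixes A :: "real^'d^'k"
  shows "subspace {z. A *v z = 0}" "dim {z. A *v z = 0} = CARD('d) - rank A"
proof -
  show "subspace {z. A *v z = 0}"
    by (auto simp: subspace_def matrix_vector_right_distrib matrix_vector_mult_scaleR)
  have "{z. A *v z = 0} = {y \<in> UNIV. \<forall>x \<in> span (rows A). orthogonal x y}"
  proof (intro equalityI subsetI)
    fix z assume z: "z \<in> {z. A *v z = 0}"
    have "orthogonal z x" if "x \<in> span (rows A)" for x
    proof (rule orthogonal_to_span[OF that])
      fix y assume "y \<in> rows A"
      then obtain i where "y = row i A" unfolding rows_def by blast
      moreover have "(A *v z) $ i = row i A \<bullet> z" by (simp add: matrix_mult_dot row_def)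
      ultimately show "orthogonal z y" using z by (simp add: orthogonal_def inner_commute)
    qed
    then show "z \<in> {y \<in> UNIV. \<forall>x \<in> span (rows A). orthogonal x y}" by (simp add: orthogonal_commute)
  next
    fix z assume z: "z \<in> {y \<in> UNIV. \<forall>x \<in> span (rows A). orthogonal x y}"
    have "(A *v z) $ i = 0" for i
    proof -
      have "row i A \<in> span (rows A)" by (intro span_base) (auto simp: rows_def)
      then have "row i A \<bullet> z = 0" using z by (simp add: orthogonal_def)
      then show ?thesis by (simp add: matrix_mult_dot row_def)
    qed
    then show "z \<in> {z. A *v z = 0}" by (simp add: vec_eq_iff)
  qed
  moreover have "dim {y \<in> UNIV. \<forall>x \<in> span (rows A). orthogonal x y} + dim (span (rows A)) = dim (UNIV :: (real^'d) set)"
    by (rule dim_subspace_orthogonal_to_vectors) auto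
  moreover have "dim (span (rows A)) = rank A" by (simp add: row_rank_def dim_vec_eq)
  ultimately show "dim {z. A *v z = 0} = CARD('d) - rank A" by simp
qed

section \<open>Coverings and Hausdorff dimension\<close>

lemma hausdorff_outer_zeroI:
  fixes A :: "'a::metric_space set"
  assumes "\<And>\<delta> e. \<delta> > 0 \<Longrightarrow> e > 0 \<Longrightarrow> \<exists>E :: nat \<Rightarrow> 'a set. A \<subseteq> (\<Union>i. E i) \<and>
     (\<forall>i. bounded (E i) \<and> diameter (E i) \<le> \<delta>) \<and> (\<Sum>i. diam_pow s (E i)) \<le> ennreal e"
  shows "hausdorff_outer s A = 0"
proof -
  have "(INF E \<in> {E :: nat \<Rightarrow> 'a set. A \<subseteq> (\<Union>i. E i) \<and> (\<forall>i. bounded (E i) \<and> diameter (E i) \<le> \<delta>)}.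
      (\<Sum>i. diam_pow s (E i))) \<le> 0" if "\<delta> > 0" for \<delta>
  proof (rule ennreal_le_epsilon)
    fix e :: real assume "e > 0"
    from assms[OF that this] obtain E :: "nat \<Rightarrow> 'a set" where E: "A \<subseteq> (\<Union>i. E i)"
      "\<forall>i. bounded (E i) \<and> diameter (E i) \<le> \<delta>" "(\<Sum>i. diam_pow s (E i)) \<le> ennreal e" by blast
    then show "(INF E \<in> {E :: nat \<Rightarrow> 'a set. A \<subseteq> (\<Union>i. E i) \<and> (\<forall>i. bounded (E i) \<and> diameter (E i) \<le> \<delta>)}.
      (\<Sum>i. diam_pow s (E i))) \<le> 0 + ennreal e"
      by (intro INF_lower2[of E]) auto
  qed
  then have "hausdorff_outer s A \<le> 0" unfolding hausdorff_outer_def by (intro SUP_least) auto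
  then show ?thesis by simp
qed

lemma hausdorff_outer_zeroD:
  fixes A :: "'a::metric_space set"
  assumes "hausdorff_outer s A = 0" "\<delta> > 0" "e > 0"
  obtains E :: "nat \<Rightarrow> 'a set" where "A \<subseteq> (\<Union>i. E i)" "\<And>i. bounded (E i)" "\<And>i. diameter (E i) \<le> \<delta>"
    "(\<Sum>i. diam_pow s (E i)) \<le> ennreal e"
proof -
  have "(INF E \<in> {E :: nat \<Rightarrow> 'a set. A \<subseteq> (\<Union>i. E i) \<and> (\<forall>i. bounded (E i) \<and> diameter (E i) \<le> \<delta>)}.
      (\<Sum>i. diam_pow s (E i))) \<le> hausdorff_outer s A"
    unfolding hausdorff_outer_def using assms(2) by (intro SUP_upper) auto
  also have "\<dots> < ennreal e" using assms by simp
  finally obtain E :: "nat \<Rightarrow> 'a set" where "A \<subseteq> (\<Union>i. E i)"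
    "\<forall>i. bounded (E i) \<and> diameter (E i) \<le> \<delta>" "(\<Sum>i. diam_pow s (E i)) < ennreal e"
    unfolding INF_less_iff by blast
  then show ?thesis using that[of E] by (simp add: less_imp_le)
qed

text \<open>The n-th set receives the budget e / 2^(n+1), and the resulting double family of
  covering sets is enumerated by \<open>prod_decode\<close>.\<close>

lemma hausdorff_outer_zero_UN:
  fixes A :: "nat \<Rightarrow> 'a::metric_space set"
  assumes "\<And>n. hausdorff_outer s (A n) = 0"
  shows "hausdorff_outer s (\<Union>n. A n) = 0"
proof (rule hausdorff_outer_zeroI)
  fix \<delta> e :: real assume \<delta>: "\<delta> > 0" and e: "e > 0"
  have "\<exists>E :: nat \<Rightarrow> 'a set. A n \<subseteq> (\<Union>i. E i) \<and> (\<forall>i. bounded (E i) \<and> diameter (E i) \<le> \<delta>) \<and>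
     (\<Sum>i. diam_pow s (E i)) \<le> ennreal (e * (1/2) ^ Suc n)" for n
  proof -
    have "e * (1/2) ^ Suc n > 0" using e by simp
    from hausdorff_outer_zeroD[OF assms \<delta> this, of n] show ?thesis by metis
  qed
  then obtain E :: "nat \<Rightarrow> nat \<Rightarrow> 'a set" where E: "\<And>n. A n \<subseteq> (\<Union>i. E n i)"
    "\<And>n i. bounded (E n i) \<and> diameter (E n i) \<le> \<delta>" "\<And>n. (\<Sum>i. diam_pow s (E n i)) \<le> ennreal (e * (1/2) ^ Suc n)"
    by metis
  define F where "F i = (case prod_decode i of (n, m) \<Rightarrow> E n m)" for i
  show "\<exists>E :: nat \<Rightarrow> 'a set. (\<Union>n. A n) \<subseteq> (\<Union>i. E i) \<and>
     (\<forall>i. bounded (E i) \<and> diameter (E i) \<le> \<delta>) \<and> (\<Sum>i. diam_pow s (E i)) \<le> ennreal e"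
  proof (intro exI[of _ F] conjI allI)
    show "(\<Union>n. A n) \<subseteq> (\<Union>i. F i)"
    proof
      fix x assume "x \<in> (\<Union>n. A n)"
      then obtain n m where "x \<in> E n m" using E(1) by blast
      then have "x \<in> F (prod_encode (n, m))" by (simp add: F_def)
      then show "x \<in> (\<Union>i. F i)" by blast
    qed
    show "bounded (F i)" "diameter (F i) \<le> \<delta>" for i using E(2) by (auto simp: F_def split: prod.split)
    have "(\<Sum>i. diam_pow s (F i)) = (\<Sum>i. (\<lambda>(n, m). diam_pow s (E n m)) (prod_decode i))"
      by (rule suminf_cong) (simp add: F_def case_prod_beta)
    also have "\<dots> = (\<Sum>n. \<Sum>m. diam_pow s (E n m))" by (rule suminf_ennreal_2dimen) simp
    also have "\<dots> \<le> (\<Sum>n. ennreal (e * (1/2) ^ Suc n))" by (intro suminf_le E) auto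
    also have "\<dots> = ennreal (\<Sum>n. e * (1/2) ^ Suc n)"
      using e by (intro suminf_ennreal2) (auto intro!: summable_mult simp: summable_geometric_iff)
    also have "(\<Sum>n. e * (1/2) ^ Suc n) = e"
      using sums_unique[OF sums_mult[OF power_half_series, of e]] by simp
    finally show "(\<Sum>i. diam_pow s (F i)) \<le> ennreal e" .
  qed
qed

text \<open>A finite family of equal balls is padded with empty sets, which cost nothing by the
  definition of \<open>diam_pow\<close>.\<close>

lemma hausdorff_outer_zero_balls:
  fixes A :: "'a::euclidean_space set"
  assumes s: "s > 0" and cov: "\<And>\<delta> e. \<delta> > 0 \<Longrightarrow> e > 0 \<Longrightarrow>
     \<exists>F \<rho>. finite F \<and> 0 < \<rho> \<and> 2 * \<rho> \<le> \<delta> \<and> real (card F) * (2 * \<rho>) powr s \<le> e \<and> A \<subseteq> (\<Union>f\<in>F. cball f \<rho>)"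
  shows "hausdorff_outer s A = 0"
proof (rule hausdorff_outer_zeroI)
  fix \<delta> e :: real assume \<delta>: "\<delta> > 0" and e: "e > 0"
  obtain F \<rho> where F: "finite F" "0 < \<rho>" "2 * \<rho> \<le> \<delta>" "real (card F) * (2 * \<rho>) powr s \<le> e" "A \<subseteq> (\<Union>f\<in>F. cball f \<rho>)"
    using cov[OF \<delta> e] by blast
  obtain f where f: "bij_betw f {..<card F} F" using ex_bij_betw_nat_finite[OF F(1)] by (auto simp: atLeast0LessThan)
  define E where "E i = (if i < card F then cball (f i) \<rho> else {})" for i
  show "\<exists>E :: nat \<Rightarrow> 'a set. A \<subseteq> (\<Union>i. E i) \<and>
     (\<forall>i. bounded (E i) \<and> diameter (E i) \<le> \<delta>) \<and> (\<Sum>i. diam_pow s (E i)) \<le> ennreal e"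
  proof (intro exI[of _ E] conjI allI)
    show "A \<subseteq> (\<Union>i. E i)"
    proof
      fix x assume "x \<in> A"
      then obtain y where y: "y \<in> F" "x \<in> cball y \<rho>" using F(5) by blast
      then obtain i where "i < card F" "y = f i" using f unfolding bij_betw_def by (auto simp: image_iff)
      then have "x \<in> E i" using y by (simp add: E_def)
      then show "x \<in> (\<Union>i. E i)" by blast
    qed
    show "bounded (E i)" "diameter (E i) \<le> \<delta>" for i using F(2,3) \<delta> by (auto simp: E_def)
    have "(\<Sum>i. diam_pow s (E i)) = (\<Sum>i<card F. diam_pow s (E i))"
      by (rule suminf_finite) (auto simp: E_def diam_pow_def)
    also have "\<dots> = (\<Sum>i<card F. ennreal ((2 * \<rho>) powr s))"
      using F(2) s by (intro sum.cong refl) (auto simp: E_def diam_pow_def)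
    also have "\<dots> = ennreal (real (card F) * (2 * \<rho>) powr s)"
      by (simp add: ennreal_mult' ennreal_of_nat_eq_real_of_nat)
    also have "\<dots> \<le> ennreal e" using F(4) by (rule ennreal_leI)
    finally show "(\<Sum>i. diam_pow s (E i)) \<le> ennreal e" .
  qed
qed

text \<open>Iterating the covering k times inside one ball produces at most N^k balls of radius
  \<kappa>^k t, of total cost (N \<kappa>^s)^k (2 t)^s, which tends to 0. The new centres have to
  lie in \<open>S\<close> again, since otherwise the hypothesis could not be reapplied to the
  smaller balls.\<close>

lemma hausdorff_outer_zero_self_covering:
  fixes S :: "'a::euclidean_space set"
  assumes s: "s > 0" and \<kappa>: "0 < \<kappa>" "\<kappa> < 1" and N: "real N * \<kappa> powr s < 1" and t: "t > 0"
    and cov: "\<And>x r. x \<in> S \<Longrightarrow> 0 < r \<Longrightarrow> r \<le> t \<Longrightarrow>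
      \<exists>F\<subseteq>S. finite F \<and> card F \<le> N \<and> S \<inter> cball x r \<subseteq> (\<Union>f\<in>F. cball f (\<kappa> * r))"
  shows "hausdorff_outer s S = 0"
proof -
  have local: "hausdorff_outer s (S \<inter> cball x t) = 0" if x: "x \<in> S" for x
  proof -
    have cover: "\<exists>F\<subseteq>S. finite F \<and> card F \<le> N ^ k \<and> S \<inter> cball x t \<subseteq> (\<Union>f\<in>F. cball f (\<kappa> ^ k * t))" for k
    proof (induction k)
      case 0
      show ?case using x by (intro exI[of _ "{x}"]) auto
    next
      case (Suc k)
      then obtain F where F: "F \<subseteq> S" "finite F" "card F \<le> N ^ k" "S \<inter> cball x t \<subseteq> (\<Union>f\<in>F. cball f (\<kappa> ^ k * t))" by blast
      have rk: "0 < \<kappa> ^ k * t" "\<kappa> ^ k * t \<le> t" using \<kappa> t by (auto simp: mult_left_le_one_le power_le_one)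
      have "\<exists>G\<subseteq>S. finite G \<and> card G \<le> N \<and> S \<inter> cball f (\<kappa> ^ k * t) \<subseteq> (\<Union>g\<in>G. cball g (\<kappa> * (\<kappa> ^ k * t)))" if "f \<in> F" for f
        using cov[OF _ rk, of f] F(1) that by blast
      then obtain G where G: "\<And>f. f \<in> F \<Longrightarrow> G f \<subseteq> S \<and> finite (G f) \<and> card (G f) \<le> N \<and>
          S \<inter> cball f (\<kappa> ^ k * t) \<subseteq> (\<Union>g\<in>G f. cball g (\<kappa> * (\<kappa> ^ k * t)))" by metis
      show ?case
      proof (intro exI[of _ "\<Union>f\<in>F. G f"] conjI)
        show "(\<Union>f\<in>F. G f) \<subseteq> S" "finite (\<Union>f\<in>F. G f)" using G F(2) by auto
        have "card (\<Union>f\<in>F. G f) \<le> (\<Sum>f\<in>F. card (G f))" by (rule card_UN_le[OF F(2)])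
        also have "\<dots> \<le> (\<Sum>f\<in>F. N)" using G by (intro sum_mono) auto
        also have "\<dots> \<le> N ^ Suc k" using F(3) by simp
        finally show "card (\<Union>f\<in>F. G f) \<le> N ^ Suc k" .
        show "S \<inter> cball x t \<subseteq> (\<Union>f\<in>\<Union>f\<in>F. G f. cball f (\<kappa> ^ Suc k * t))"
        proof
          fix z assume z: "z \<in> S \<inter> cball x t"
          then obtain f where f: "f \<in> F" "z \<in> cball f (\<kappa> ^ k * t)" using F(4) by blast
          then obtain g where "g \<in> G f" "z \<in> cball g (\<kappa> * (\<kappa> ^ k * t))" using G[OF f(1)] z by blast
          then show "z \<in> (\<Union>f\<in>\<Union>f\<in>F. G f. cball f (\<kappa> ^ Suc k * t))" using f(1) by (auto simp: mult.assoc)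
        qed
      qed
    qed
    show ?thesis
    proof (rule hausdorff_outer_zero_balls[OF s])
      fix \<delta> e :: real assume \<delta>: "\<delta> > 0" and e: "e > 0"
      have "(\<lambda>k. 2 * (\<kappa> ^ k * t)) \<longlonglongrightarrow> 2 * (0 * t)" using \<kappa> by (intro tendsto_intros LIMSEQ_power_zero) auto
      then have 1: "\<forall>\<^sub>F k in sequentially. 2 * (\<kappa> ^ k * t) < \<delta>" using \<delta> by (intro order_tendstoD(2)) auto
      have "(\<lambda>k. (real N * \<kappa> powr s) ^ k * (2 * t) powr s) \<longlonglongrightarrow> 0 * (2 * t) powr s"
        using N by (intro tendsto_intros LIMSEQ_power_zero) auto
      then have 2: "\<forall>\<^sub>F k in sequentially. (real N * \<kappa> powr s) ^ k * (2 * t) powr s < e" using e by (intro order_tendstoD(2)) auto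
      obtain k where k: "2 * (\<kappa> ^ k * t) < \<delta>" "(real N * \<kappa> powr s) ^ k * (2 * t) powr s < e"
        using eventually_conj[OF 1 2] by (auto simp: eventually_sequentially)
      obtain F where F: "finite F" "card F \<le> N ^ k" "S \<inter> cball x t \<subseteq> (\<Union>f\<in>F. cball f (\<kappa> ^ k * t))"
        using cover[of k] by blast
      have pw: "(2 * (\<kappa> ^ k * t)) powr s = (\<kappa> powr s) ^ k * (2 * t) powr s"
      proof -
        have "(2 * (\<kappa> ^ k * t)) powr s = (\<kappa> ^ k) powr s * (2 * t) powr s"
          using \<kappa> t by (simp add: powr_mult)
        also have "(\<kappa> ^ k) powr s = (\<kappa> powr s) ^ k"
          using \<kappa> by (simp add: powr_powr mult.commute flip: powr_realpow)
        finally show ?thesis .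
      qed
      have "real (card F) * (2 * (\<kappa> ^ k * t)) powr s \<le> real (N ^ k) * (2 * (\<kappa> ^ k * t)) powr s"
        using F(2) by (intro mult_right_mono) (simp_all only: of_nat_le_iff powr_ge_zero)
      also have "real (N ^ k) * (2 * (\<kappa> ^ k * t)) powr s = (real N * \<kappa> powr s) ^ k * (2 * t) powr s"
        unfolding pw by (simp add: power_mult_distrib)
      finally have "real (card F) * (2 * (\<kappa> ^ k * t)) powr s \<le> e" using k(2) by linarith
      moreover have "0 < \<kappa> ^ k * t" using \<kappa> t by simp
      ultimately show "\<exists>F \<rho>. finite F \<and> 0 < \<rho> \<and> 2 * \<rho> \<le> \<delta> \<and> real (card F) * (2 * \<rho>) powr s \<le> e \<and>
          S \<inter> cball x t \<subseteq> (\<Union>f\<in>F. cball f \<rho>)"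
        using k(1) F(1,3) less_imp_le by blast
    qed
  qed
  \<comment> \<open>Lindelof's theorem reduces \<open>S\<close> to countably many of the balls just
    treated.\<close>
  obtain C where C: "C \<subseteq> (\<lambda>x. ball x t) ` S" "countable C" "\<Union>C = (\<Union>x\<in>S. ball x t)"
    using Lindelof[of "(\<lambda>x. ball x t) ` S"] by blast
  then obtain T where T: "T \<subseteq> S" "countable T" "C = (\<lambda>x. ball x t) ` T"
    by (meson countable_subset_image)
  have ST: "S \<subseteq> (\<Union>x\<in>T. S \<inter> cball x t)"
  proof
    fix x assume "x \<in> S"
    then have "x \<in> (\<Union>x\<in>S. ball x t)" using t by (intro UN_I[of x]) auto
    then have "x \<in> \<Union>C" unfolding C(3) .
    then obtain y where "y \<in> T" "x \<in> ball y t" using T(3) by blast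
    then show "x \<in> (\<Union>x\<in>T. S \<inter> cball x t)" using \<open>x \<in> S\<close> ball_subset_cball by blast
  qed
  show ?thesis
  proof (cases "T = {}")
    case True
    then have "S = {}" using ST by auto
    show ?thesis
    proof (rule hausdorff_outer_zero_balls[OF s])
      fix \<delta> e :: real assume "\<delta> > 0" "e > 0"
      with \<open>S = {}\<close> show "\<exists>F \<rho>. finite F \<and> 0 < \<rho> \<and> 2 * \<rho> \<le> \<delta> \<and> real (card F) * (2 * \<rho>) powr s \<le> e \<and>
          S \<subseteq> (\<Union>f\<in>F. cball f \<rho>)"
        by (intro exI[of _ "{}"] exI[of _ "\<delta> / 2"]) auto
    qed
  next
    case False
    have "hausdorff_outer s (\<Union>n. S \<inter> cball (from_nat_into T n) t) = 0"
      by (intro hausdorff_outer_zero_UN local subsetD[OF T(1)] from_nat_into False)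
    moreover have "(\<Union>n. S \<inter> cball (from_nat_into T n) t) = S"
    proof -
      have "(\<Union>n. S \<inter> cball (from_nat_into T n) t) = (\<Union>x\<in>range (from_nat_into T). S \<inter> cball x t)"
        by (simp only: image_image)
      also have "\<dots> = (\<Union>x\<in>T. S \<inter> cball x t)" by (simp only: range_from_nat_into[OF False T(2)])
      also have "\<dots> = S" using ST by (intro equalityI UN_least Int_lower1)
      finally show ?thesis .
    qed
    ultimately show ?thesis by simp
  qed
qed

text \<open>A cubic grid of mesh h = \<delta>/n with respect to an orthonormal basis: rounding each
  of the n coordinates down moves a point by at most n h = \<delta>. Coordinates are bounded by 2,
  so 2 M + 1 \<le> 4/h + 3 values per axis suffice, and 4 + 3 gives the constant 7. The radius 2
  leaves room for points of the subspace that approximate points of the unit ball.\<close>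

lemma subspace_ball_cover:
  fixes W :: "'a::euclidean_space set"
  assumes W: "subspace W" "dim W = n" "n > 0" and \<delta>: "0 < \<delta>" "\<delta> \<le> 1"
  shows "\<exists>F. finite F \<and> real (card F) \<le> (7 * real n / \<delta>) ^ n \<and> W \<inter> cball 0 2 \<subseteq> (\<Union>f\<in>F. cball f \<delta>)"
proof -
  obtain B where B: "B \<subseteq> W" "pairwise orthogonal B" "\<And>x. x \<in> B \<Longrightarrow> norm x = 1" "independent B" "card B = n" "span B = W"
    using orthonormal_basis_subspace[OF W(1)] W(2) by metis
  have fB: "finite B" using B(5) W(3) card_ge_0_finite by blast
  define h where "h = \<delta> / real n"
  have h: "h > 0" using \<delta> W by (simp add: h_def)
  define M where "M = \<lceil>2 / h\<rceil>"
  have "0 \<le> 2 / h" using h by simp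
  then have M0: "M \<ge> 0" unfolding M_def by linarith
  define P where "P = (PiE B (\<lambda>_. {-M..M}))"
  define pt where "pt k = (\<Sum>b\<in>B. (of_int (k b) * h) *\<^sub>R b)" for k :: "'a \<Rightarrow> int"
  have fP: "finite P" unfolding P_def using fB by (intro finite_PiE) auto
  show ?thesis
  proof (intro exI[of _ "pt ` P"] conjI)
    show "finite (pt ` P)" using fP by simp
    have "card (pt ` P) \<le> card P" by (rule card_image_le[OF fP])
    also have "card P = nat (2 * M + 1) ^ n" unfolding P_def using fB by (simp add: card_PiE B(5) algebra_simps)
    finally have "real (card (pt ` P)) \<le> real (nat (2 * M + 1) ^ n)" by (simp only: of_nat_le_iff)
    also have "\<dots> = of_int (2 * M + 1) ^ n" using M0 by (simp add: of_nat_nat)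
    also have "\<dots> \<le> (7 * real n / \<delta>) ^ n"
    proof (rule power_mono)
      have "of_int M \<le> 2 / h + 1" unfolding M_def by linarith
      then have "of_int (2 * M + 1) \<le> 4 / h + 3" by simp
      also have "\<dots> = 4 * real n / \<delta> + 3" by (simp add: h_def)
      also have "\<dots> \<le> 4 * real n / \<delta> + 3 * real n / \<delta>"
      proof -
        have "3 * \<delta> \<le> 3 * real n * 1" using \<delta> W(3) by (intro mult_mono) auto
        then have "3 \<le> 3 * real n / \<delta>" using \<delta> by (simp add: field_simps)
        then show ?thesis by simp
      qed
      also have "\<dots> = 7 * real n / \<delta>" by (simp add: add_divide_distrib[symmetric])
      finally show "of_int (2 * M + 1) \<le> 7 * real n / \<delta>" .
    qed (use M0 in simp)
    finally show "real (card (pt ` P)) \<le> (7 * real n / \<delta>) ^ n" .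
    show "W \<inter> cball 0 2 \<subseteq> (\<Union>f\<in>pt ` P. cball f \<delta>)"
    proof
      fix z assume z: "z \<in> W \<inter> cball 0 2"
      define k where "k = restrict (\<lambda>b. \<lfloor>(z \<bullet> b) / h\<rfloor>) B"
      have zb: "\<bar>z \<bullet> b\<bar> \<le> 2" if "b \<in> B" for b
        using Cauchy_Schwarz_ineq2[of z b] B(3)[OF that] z by simp
      have "k \<in> P" unfolding P_def
      proof
        fix b assume b: "b \<in> B"
        have "\<bar>(z \<bullet> b) / h\<bar> \<le> 2 / h" using zb[OF b] h by (simp add: divide_right_mono)
        then have "- of_int M \<le> (z \<bullet> b) / h" "(z \<bullet> b) / h \<le> of_int M" unfolding M_def by linarith+
        then have "- M \<le> \<lfloor>(z \<bullet> b) / h\<rfloor>" "\<lfloor>(z \<bullet> b) / h\<rfloor> \<le> M" by (simp_all add: le_floor_iff floor_le_iff)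
        then show "k b \<in> {-M..M}" using b by (simp add: k_def)
      qed (simp add: k_def)
      moreover have "z \<in> cball (pt k) \<delta>"
      proof -
        have "z = (\<Sum>b\<in>B. (z \<bullet> b) *\<^sub>R b)"
          using orthonormal_basis_expand[OF B(2,3) _ fB, of z] z B(6) by simp
        then have "z - pt k = (\<Sum>b\<in>B. (z \<bullet> b - of_int (k b) * h) *\<^sub>R b)"
          unfolding pt_def by (simp add: sum_subtractf scaleR_diff_left)
        also have "norm \<dots> \<le> (\<Sum>b\<in>B. h)"
        proof (rule sum_norm_le)
          fix b assume b: "b \<in> B"
          have "\<bar>(z \<bullet> b) / h - of_int \<lfloor>(z \<bullet> b) / h\<rfloor>\<bar> \<le> 1" by linarith
          then have "\<bar>(z \<bullet> b) / h - of_int \<lfloor>(z \<bullet> b) / h\<rfloor>\<bar> * h \<le> 1 * h" using h by (intro mult_right_mono) auto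
          moreover have "z \<bullet> b - of_int (k b) * h = ((z \<bullet> b) / h - of_int \<lfloor>(z \<bullet> b) / h\<rfloor>) * h"
            using h b by (simp add: k_def left_diff_distrib)
          ultimately show "norm ((z \<bullet> b - of_int (k b) * h) *\<^sub>R b) \<le> h" using h B(3)[OF b] by (simp add: abs_mult)
        qed
        also have "\<dots> = \<delta>" using B(5) W(3) by (simp add: h_def)
        finally show ?thesis by (simp add: dist_norm norm_minus_commute)
      qed
      ultimately show "z \<in> (\<Union>f\<in>pt ` P. cball f \<delta>)" by blast
    qed
  qed
qed

lemma hausdorff_dim_le:
  assumes "\<And>s. s > t \<Longrightarrow> hausdorff_outer s A = 0" "t \<ge> 0"
  shows "hausdorff_dim A \<le> ereal t"
proof (rule ereal_le_epsilon2)
  fix e :: real assume e: "0 < e"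
  have "hausdorff_dim A \<le> ereal (t + e)"
    unfolding hausdorff_dim_def by (rule Inf_lower) (use assms e in auto)
  then show "hausdorff_dim A \<le> ereal t + ereal e" by simp
qed

text \<open>As s - n is positive, \<epsilon> can be fixed so small that one covering step has
  relative cost below one. The threshold \<rho> varies with the point, so \<open>S\<close> is split
  into countably many pieces \<open>T m\<close> on each of which one threshold works, and the
  covering is iterated within a piece.\<close>

lemma hausdorff_null_near_subspaces:
  fixes S :: "'a::euclidean_space set"
  assumes n: "n > 0" and s: "s > real n"
    and flat: "\<And>\<epsilon> x. 0 < \<epsilon> \<Longrightarrow> x \<in> S \<Longrightarrow> \<exists>\<rho>>0. \<forall>r. 0 < r \<longrightarrow> r < \<rho> \<longrightarrow> (\<exists>W. subspace W \<and> dim W = n \<and>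
       (\<forall>y\<in>S \<inter> cball x r. \<exists>z\<in>W. norm (y - x - r *\<^sub>R z) \<le> \<epsilon> * r))"
  shows "hausdorff_outer s S = 0"
proof -
  \<comment> \<open>Collects the constants of N (4 \<epsilon>)^s with N \<le> (7 n / \<epsilon>)^n,
    leaving the power \<epsilon>^(s-n).\<close>
  define c where "c = (7 * real n) ^ n * 4 powr s"
  have "((\<lambda>\<epsilon>. c * \<epsilon> powr (s - real n)) \<longlongrightarrow> c * 0 powr (s - real n)) (at_right 0)"
    using s by (intro tendsto_intros tendsto_powr') (auto simp: eventually_at_right_less intro: eventually_mono[OF eventually_at_right_less[of 0]])
  then have "\<forall>\<^sub>F \<epsilon> in at_right 0. c * \<epsilon> powr (s - real n) < 1"
    using s by (intro order_tendstoD(2)) auto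
  moreover have "\<forall>\<^sub>F \<epsilon> in at_right 0. 0 < \<epsilon> \<and> \<epsilon> < (1/8::real)"
    using eventually_at_right_real[of 0 "1/8::real"] by simp
  ultimately have "\<forall>\<^sub>F \<epsilon> in at_right 0. c * \<epsilon> powr (s - real n) < 1 \<and> 0 < \<epsilon> \<and> \<epsilon> < (1/8::real)"
    by (rule eventually_conj)
  then obtain \<epsilon> :: real where \<epsilon>: "c * \<epsilon> powr (s - real n) < 1" "0 < \<epsilon>" "\<epsilon> < 1/8"
    using eventually_happens'[OF trivial_limit_at_right_real] by blast
  define N where "N = nat \<lfloor>(7 * real n / \<epsilon>) ^ n\<rfloor>"
  define T where "T m = {x \<in> S. \<forall>r. 0 < r \<longrightarrow> r \<le> inverse (real (Suc m)) \<longrightarrow> (\<exists>W. subspace W \<and> dim W = n \<and>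
       (\<forall>y\<in>S \<inter> cball x r. \<exists>z\<in>W. norm (y - x - r *\<^sub>R z) \<le> \<epsilon> * r))}" for m
  have "hausdorff_outer s (T m) = 0" for m
  proof (rule hausdorff_outer_zero_self_covering[where \<kappa> = "4 * \<epsilon>" and N = N and t = "inverse (real (Suc m))"])
    show "s > 0" "0 < 4 * \<epsilon>" "4 * \<epsilon> < 1" "inverse (real (Suc m)) > 0" using s n \<epsilon> by auto
    have "real N \<le> (7 * real n / \<epsilon>) ^ n" unfolding N_def using \<epsilon> by (simp add: of_nat_nat)
    then have "real N * (4 * \<epsilon>) powr s \<le> (7 * real n / \<epsilon>) ^ n * (4 * \<epsilon>) powr s" by (intro mult_right_mono) auto
    also have "\<dots> = c * \<epsilon> powr (s - real n)"
      using \<epsilon> by (simp add: c_def powr_mult powr_diff powr_realpow power_divide)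
    finally show "real N * (4 * \<epsilon>) powr s < 1" using \<epsilon> by linarith
    fix x r assume x: "x \<in> T m" and r: "0 < r" "r \<le> inverse (real (Suc m))"
    then obtain W where W: "subspace W" "dim W = n"
      "\<forall>y\<in>S \<inter> cball x r. \<exists>z\<in>W. norm (y - x - r *\<^sub>R z) \<le> \<epsilon> * r" unfolding T_def by blast
    obtain F where F: "finite F" "real (card F) \<le> (7 * real n / \<epsilon>) ^ n" "W \<inter> cball 0 2 \<subseteq> (\<Union>f\<in>F. cball f \<epsilon>)"
      using subspace_ball_cover[OF W(1,2) n \<epsilon>(2)] \<epsilon>(3) by auto
    \<comment> \<open>Grid points need not correspond to points of \<open>T m\<close>. Each useful
      one is replaced by a point of \<open>T m\<close> within \<open>2 * \<epsilon> * r\<close> of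
      its position, and two points near the same grid point are at distance at most
      \<open>4 * \<epsilon> * r\<close>; this is the origin of the factor 4.\<close>
    define near where "near f = {y \<in> T m \<inter> cball x r. norm (y - x - r *\<^sub>R f) \<le> 2 * \<epsilon> * r}" for f
    define F' where "F' = {f \<in> F. near f \<noteq> {}}"
    define sel where "sel f = (SOME y. y \<in> near f)" for f
    have sel: "sel f \<in> near f" if "f \<in> F'" for f
      using that unfolding F'_def sel_def by (auto intro: someI)
    show "\<exists>F\<subseteq>T m. finite F \<and> card F \<le> N \<and> T m \<inter> cball x r \<subseteq> (\<Union>f\<in>F. cball f (4 * \<epsilon> * r))"
    proof (intro exI[of _ "sel ` F'"] conjI)
      show "sel ` F' \<subseteq> T m" using sel by (auto simp: near_def)
      show "finite (sel ` F')" using F(1) by (simp add: F'_def)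
      have "card (sel ` F') \<le> card F'" using F(1) by (intro card_image_le) (simp add: F'_def)
      also have "\<dots> \<le> card F" using F(1) by (intro card_mono) (auto simp: F'_def)
      also have "\<dots> \<le> N" unfolding N_def using F(2) by (simp add: le_nat_iff le_floor_iff)
      finally show "card (sel ` F') \<le> N" .
      show "T m \<inter> cball x r \<subseteq> (\<Union>f\<in>sel ` F'. cball f (4 * \<epsilon> * r))"
      proof
        fix y assume y: "y \<in> T m \<inter> cball x r"
        then have "y \<in> S \<inter> cball x r" by (auto simp: T_def)
        then obtain z where z: "z \<in> W" "norm (y - x - r *\<^sub>R z) \<le> \<epsilon> * r" using W(3) by blast
        \<comment> \<open>The approximating vector has norm at most 1 + \<epsilon>, which is why the
          subspace was covered up to radius 2.\<close>
        have "norm (r *\<^sub>R z) \<le> norm (y - x) + norm (y - x - r *\<^sub>R z)"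
          using norm_triangle_ineq4[of "y - x" "y - x - r *\<^sub>R z"] by simp
        also have "\<dots> \<le> r + 1 * r"
        proof (rule add_mono)
          show "norm (y - x) \<le> r" using y by (simp add: dist_norm norm_minus_commute)
          have "\<epsilon> * r \<le> 1 * r" using \<epsilon> r(1) by (intro mult_right_mono) auto
          with z(2) show "norm (y - x - r *\<^sub>R z) \<le> 1 * r" by linarith
        qed
        finally have "r * norm z \<le> r * 2" using r(1) by simp
        then have "z \<in> W \<inter> cball 0 2" using z(1) r(1) by simp
        then obtain f where f: "f \<in> F" "z \<in> cball f \<epsilon>" using F(3) by blast
        have "norm (y - x - r *\<^sub>R f) = norm ((y - x - r *\<^sub>R z) + r *\<^sub>R (z - f))"
          by (simp add: scaleR_diff_right)
        also have "\<dots> \<le> \<epsilon> * r + r * \<epsilon>"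
          using z(2) f(2) r(1) by (intro norm_triangle_mono) (simp_all add: dist_norm norm_minus_commute)
        finally have yn: "y \<in> near f" using y by (simp add: near_def)
        then have f': "f \<in> F'" using f(1) by (auto simp: F'_def)
        have "norm (sel f - y) = norm ((sel f - x - r *\<^sub>R f) - (y - x - r *\<^sub>R f))" by simp
        also have "\<dots> \<le> 2 * \<epsilon> * r + 2 * \<epsilon> * r"
          using sel[OF f'] yn norm_triangle_ineq4[of "sel f - x - r *\<^sub>R f" "y - x - r *\<^sub>R f"] by (simp add: near_def)
        finally have "y \<in> cball (sel f) (4 * \<epsilon> * r)" by (simp add: dist_norm)
        then show "y \<in> (\<Union>f\<in>sel ` F'. cball f (4 * \<epsilon> * r))" using f' by blast
      qed
    qed
  qed
  then have "hausdorff_outer s (\<Union>m. T m) = 0" by (rule hausdorff_outer_zero_UN)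
  moreover have "(\<Union>m. T m) = S"
  proof
    show "S \<subseteq> (\<Union>m. T m)"
    proof
      fix x assume x: "x \<in> S"
      obtain \<rho> where \<rho>: "\<rho> > 0" "\<forall>r. 0 < r \<longrightarrow> r < \<rho> \<longrightarrow> (\<exists>W. subspace W \<and> dim W = n \<and>
         (\<forall>y\<in>S \<inter> cball x r. \<exists>z\<in>W. norm (y - x - r *\<^sub>R z) \<le> \<epsilon> * r))" using flat[OF \<epsilon>(2) x] by blast
      obtain m where m: "inverse (real (Suc m)) < \<rho>" using reals_Archimedean[OF \<rho>(1)] by blast
      have "x \<in> T m" unfolding T_def using x \<rho>(2) m by (auto intro: le_less_trans)
      then show "x \<in> (\<Union>m. T m)" by blast
    qed
  qed (auto simp: T_def)
  ultimately show ?thesis by simp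
qed

theorem theorem4p3:
  fixes D :: "(real^'d) set" and \<Lambda> :: real and \<Phi> U :: "real^'d \<Rightarrow> real^'k" and j :: nat
  assumes "smooth_open_set D" and "emeasure lebesgue D < \<infinity>"
    and "\<Lambda> > 0"
    and "\<Phi> \<in> H_half_vec D"
    and "bernoulli_solution D \<Lambda> \<Phi> U"
    and "1 \<le> j" and "j \<le> CARD('d)"
  shows "(j = CARD('d) \<longrightarrow>
            stratum D U j \<subseteq> D \<and> discrete (stratum D U j) \<and>
            (\<forall>x \<in> stratum D U j. x isolated_in frontier (pos_set D U))) \<and>
         (j < CARD('d) \<longrightarrow>
            hausdorff_dim (stratum D U j) \<le> ereal (real CARD('d) - real j))"
proof -
  have D: "open D" using assms(1) unfolding smooth_open_set_def by blast
  have Uc: "continuous_on D U" using assms(5) unfolding bernoulli_solution_def by blast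
  let ?S = "stratum D U j"
  have S: "x \<in> D" "x \<in> frontier (pos_set D U)" "\<And>g. is_blowup_limit U x g \<Longrightarrow> linear_of_rank j g"
    if "x \<in> ?S" for x using that unfolding stratum_def by auto
  have zero: "U x = 0" if "x \<in> frontier (pos_set D U)" "x \<in> D" for x
    by (rule frontier_pos_set_zero[OF D Uc that])
  have flat: "\<exists>\<rho>>0. \<forall>r. 0 < r \<longrightarrow> r < \<rho> \<longrightarrow> (\<exists>A :: real^'d^'k. rank A = j \<and>
     (\<forall>y\<in>cball x r. U y = 0 \<longrightarrow> (\<exists>z. A *v z = 0 \<and> norm (y - x - r *\<^sub>R z) \<le> \<epsilon> * r)))"
    if x: "x \<in> ?S" and \<epsilon>: "\<epsilon> > 0" for x \<epsilon>
  proof (rule solution_lipschitz[OF D assms(2,3,5) S(1)[OF x]])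
    fix R L assume R: "R > 0" "L \<ge> 0"
      and Lip: "\<And>v y. v \<in> cball x R \<Longrightarrow> y \<in> cball x R \<Longrightarrow> norm (U v - U y) \<le> L * norm (v - y)"
    show ?thesis
      by (rule zero_set_near_kernel[OF R Lip zero[OF S(2,1)[OF x]] S(3)[OF x] \<epsilon>])
  qed
  show ?thesis
  proof (intro conjI impI)
    show "?S \<subseteq> D" using S(1) by blast
    assume j: "j = CARD('d)"
    show iso: "\<forall>x \<in> ?S. x isolated_in frontier (pos_set D U)"
    proof
      fix x assume x: "x \<in> ?S"
      obtain \<rho> where \<rho>: "\<rho> > 0" "\<forall>r. 0 < r \<longrightarrow> r < \<rho> \<longrightarrow> (\<exists>A :: real^'d^'k. rank A = j \<and>
         (\<forall>y\<in>cball x r. U y = 0 \<longrightarrow> (\<exists>z. A *v z = 0 \<and> norm (y - x - r *\<^sub>R z) \<le> 1/2 * r)))"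
        using flat[OF x, of "1/2"] by auto
      \<comment> \<open>Points of the frontier are known to be zeros of \<open>U\<close> only inside
        \<open>D\<close>, so the neighbourhood is also kept within \<open>D\<close>.\<close>
      obtain e where e: "e > 0" "ball x e \<subseteq> D" using D S(1)[OF x] open_contains_ball by blast
      have "y = x" if y: "y \<in> ball x (min \<rho> e)" "y \<in> frontier (pos_set D U)" for y
      proof (rule ccontr)
        assume "y \<noteq> x"
        \<comment> \<open>The nearness to the kernel is applied at the radius equal to the distance
          from \<open>x\<close> to \<open>y\<close>, with \<epsilon> = 1/2. Full rank makes
          \<open>A\<close> injective, so the kernel vector is 0 and r \<le> r/2 follows.\<close>
        define r where "r = norm (y - x)"
        have r: "0 < r" "r < \<rho>" "y \<in> cball x r"
          using \<open>y \<noteq> x\<close> y(1) by (auto simp: r_def dist_norm norm_minus_commute)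
        have "U y = 0" using y e(2) by (intro zero) auto
        then obtain A :: "real^'d^'k" and z where A: "rank A = j" "A *v z = 0" "norm (y - x - r *\<^sub>R z) \<le> 1/2 * r"
          using \<rho>(2) r by blast
        have "inj ((*v) A)" using A(1) j by (simp add: full_rank_injective)
        then have "z = 0" using A(2) by (metis injD matrix_vector_mult_0_right)
        then show False using A(3) r(1) by (simp add: r_def)
      qed
      moreover have "x \<in> ball x (min \<rho> e)" using \<rho>(1) e(1) by simp
      ultimately show "x isolated_in frontier (pos_set D U)"
        unfolding isolated_in_def using S(2)[OF x] by (intro conjI exI[of _ "ball x (min \<rho> e)"]) auto
    qed
    show "discrete ?S"
    proof (rule discreteI)
      fix x assume x: "x \<in> ?S"
      then obtain T where "open T" "T \<inter> frontier (pos_set D U) = {x}"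
        using iso unfolding isolated_in_def by blast
      then show "x isolated_in ?S" unfolding isolated_in_def using x S(2) by (intro conjI exI[of _ T]) auto
    qed
  next
    assume j: "j < CARD('d)"
    define n where "n = CARD('d) - j"
    have n: "n > 0" "real n = real CARD('d) - real j" using j by (auto simp: n_def of_nat_diff)
    show "hausdorff_dim ?S \<le> ereal (real CARD('d) - real j)"
      unfolding n(2)[symmetric]
    proof (rule hausdorff_dim_le)
      fix s assume s: "s > real n"
      show "hausdorff_outer s ?S = 0"
      proof (rule hausdorff_null_near_subspaces[OF n(1) s])
        fix \<epsilon> :: real and x assume \<epsilon>: "0 < \<epsilon>" and x: "x \<in> ?S"
        obtain \<rho> where \<rho>: "\<rho> > 0" "\<forall>r. 0 < r \<longrightarrow> r < \<rho> \<longrightarrow> (\<exists>A :: real^'d^'k. rank A = j \<and>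
           (\<forall>y\<in>cball x r. U y = 0 \<longrightarrow> (\<exists>z. A *v z = 0 \<and> norm (y - x - r *\<^sub>R z) \<le> \<epsilon> * r)))"
          using flat[OF x \<epsilon>] by blast
        show "\<exists>\<rho>>0. \<forall>r. 0 < r \<longrightarrow> r < \<rho> \<longrightarrow> (\<exists>W. subspace W \<and> dim W = n \<and>
            (\<forall>y\<in>?S \<inter> cball x r. \<exists>z\<in>W. norm (y - x - r *\<^sub>R z) \<le> \<epsilon> * r))"
        proof (intro exI[of _ \<rho>] conjI allI impI \<rho>(1))
          fix r assume "0 < r" "r < \<rho>"
          then obtain A :: "real^'d^'k" where A: "rank A = j"
            "\<forall>y\<in>cball x r. U y = 0 \<longrightarrow> (\<exists>z. A *v z = 0 \<and> norm (y - x - r *\<^sub>R z) \<le> \<epsilon> * r)"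
            using \<rho>(2) by blast
          \<comment> \<open>Points of the stratum lie in \<open>D\<close> and on the frontier, hence
            are zeros of \<open>U\<close>, and the kernel of the map belonging to this radius serves
            as the subspace.\<close>
          show "\<exists>W. subspace W \<and> dim W = n \<and> (\<forall>y\<in>?S \<inter> cball x r. \<exists>z\<in>W. norm (y - x - r *\<^sub>R z) \<le> \<epsilon> * r)"
            using dim_kernel[of A] A zero S(1,2)
            by (intro exI[of _ "{z. A *v z = 0}"]) (auto simp: n_def)
        qed
      qed
    qed simp
  qed
qed

end
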